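(* Let $G$ be a compact topological group. Then $G\text{-Mod}^{\mathrm{iso}}$ is equivalent to the category of comodules in $\mathrm{IndBan}_k$ over the bialgebra $C_b^{\mathrm{lu}}(G,k)$, where the multiplication is pointwise and the comultiplication is the composition $$C_b^{\mathrm{lu}}(G,k)\xrightarrow{\Delta}C_b^{\mathrm{lu}}(G,C_b^{\mathrm{lu}}(G,k))\cong C_b^{\mathrm{lu}}(G,k)\hat\otimes C_b^{\mathrm{lu}}(G,k),$$ with $\Delta(f)(g)(g')=f(gg')$.
   Context: $k$ is a field complete with respect to a non-trivial valuation. $\mathrm{Ban}_k$ is the category of $k$-Banach spaces and bounded linear maps (for non-Archimedean $k$ one may use either the usual or the strong triangle inequality; both conventions are allowed). $\mathrm{IndBan}_k$ is its Ind-completion: objects are formal filtered colimits $\text{"colim"}_{i\in I}V_i$ of Banach spaces, with $\mathrm{Hom}(\text{"colim"}_iX_i,\text{"colim"}_jY_j)=\lim_i\mathrm{colim}_j\mathrm{Hom}(X_i,Y_j)$; it is monoidal under the completed projective tensor product $\hat\otimes$ (norm $\inf\sum_i\|x_i\|\|y_i\|$ with the usual triangle inequality, $\inf\max_i\|x_i\|\|y_i\|$ with the strong one), extended by $(\text{"colim"}_iX_i)\hat\otimes(\text{"colim"}_jY_j)=\text{"colim"}_{i,j}X_i\hat\otimes Y_j$. $G\text{-Mod}^{\mathrm{iso}}$ is the category of strongly continuous IndBanach $G$-modules for which $G$ acts by isometries: the action of $G$ on $V=\text{"colim"}_{i\in I}V_i$ is determined by continuous maps $G\to\mathrm{Hom}(V_i,V_{i'})$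 for each $i\in I$ and for some $i'\in I$ depending on $i$, where $\mathrm{Hom}(V_i,V_{i'})$ has the strong operator topology, with images in the subspace of isometries. Morphisms are $G$-equivariant morphisms in $\mathrm{IndBan}_k$. For a Banach space $V$, $C_b^{\mathrm{lu}}(G,V)$ is the Banach space (sup norm) of bounded continuous functions $f:G\to V$ that are left uniformly continuous: for every net $(h_\lambda)$ in $G$ converging to the identity, $\sup_{x\in G}\|f(h_\lambda x)-f(x)\|\to0$. (For $G$ compact this is all continuous functions.)
   Formalization: For norms with the usual triangle inequality it is assumed that the canonical map from C(G,k)⊗̂V to C(G,V) is an isomorphism for every Banach space V; without this the displayed isomorphism can fail, e.g. for k=ℝ and G the circle. Nothing is added for the strong inequality. *)

theory Defs
  imports
    "HOL-Analysis.Analysis"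
    "HOL-Library.Equipollence"
    "HOL-Algebra.Algebraic_Closure_Type"
begin

(* the library's notation for polynomial variables would capture the name X *)
no_notation var (\<open>X\<index>\<close>)

section \<open>Categories\<close>

text \<open>Arrows need not carry their endpoints (a morphism of ind-objects is a compatible family of
  germs), so the objects are arguments: \<open>Cmp C a b c g f\<close> is \<open>g \<circ> f\<close> for
  \<open>f : a \<rightarrow> b\<close> and \<open>g : b \<rightarrow> c\<close>.\<close>

record ('o, 'm) cat =
  Ob :: "'o set"
  Ar :: "'o \<Rightarrow> 'o \<Rightarrow> 'm set"
  Idm :: "'o \<Rightarrow> 'm"
  Cmp :: "'o \<Rightarrow> 'o \<Rightarrow> 'o \<Rightarrow> 'm \<Rightarrow> 'm \<Rightarrow> 'm"

definition is_category :: "('o, 'm) cat \<Rightarrow> bool" where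
  "is_category C \<longleftrightarrow>
     (\<forall>a\<in>Ob C. Idm C a \<in> Ar C a a) \<and>
     (\<forall>a\<in>Ob C. \<forall>b\<in>Ob C. \<forall>c\<in>Ob C. \<forall>f\<in>Ar C a b. \<forall>g\<in>Ar C b c. Cmp C a b c g f \<in> Ar C a c) \<and>
     (\<forall>a\<in>Ob C. \<forall>b\<in>Ob C. \<forall>f\<in>Ar C a b.
        Cmp C a a b f (Idm C a) = f \<and> Cmp C a b b (Idm C b) f = f) \<and>
     (\<forall>a\<in>Ob C. \<forall>b\<in>Ob C. \<forall>c\<in>Ob C. \<forall>d\<in>Ob C. \<forall>f\<in>Ar C a b. \<forall>g\<in>Ar C b c. \<forall>h\<in>Ar C c d.
        Cmp C a c d h (Cmp C a b c g f) = Cmp C a b d (Cmp C b c d h g) f)"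

definition is_iso :: "('o, 'm) cat \<Rightarrow> 'o \<Rightarrow> 'o \<Rightarrow> 'm \<Rightarrow> bool" where
  "is_iso C a b f \<longleftrightarrow> f \<in> Ar C a b \<and>
     (\<exists>g\<in>Ar C b a. Cmp C a b a g f = Idm C a \<and> Cmp C b a b f g = Idm C b)"

record ('o, 'm, 'p, 'n) fctor =
  fob :: "'o \<Rightarrow> 'p"
  far :: "'o \<Rightarrow> 'o \<Rightarrow> 'm \<Rightarrow> 'n"

definition is_functor :: "('o, 'm) cat \<Rightarrow> ('p, 'n) cat \<Rightarrow> ('o, 'm, 'p, 'n) fctor \<Rightarrow> bool" where
  "is_functor C D F \<longleftrightarrow>
     (\<forall>a\<in>Ob C. fob F a \<in> Ob D) \<and>
     (\<forall>a\<in>Ob C. \<forall>b\<in>Ob C. \<forall>f\<in>Ar C a b. far F a b f \<in> Ar D (fob F a) (fob F b)) \<and>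
     (\<forall>a\<in>Ob C. far F a a (Idm C a) = Idm D (fob F a)) \<and>
     (\<forall>a\<in>Ob C. \<forall>b\<in>Ob C. \<forall>c\<in>Ob C. \<forall>f\<in>Ar C a b. \<forall>g\<in>Ar C b c.
        far F a c (Cmp C a b c g f) = Cmp D (fob F a) (fob F b) (fob F c) (far F b c g) (far F a b f))"

definition id_functor :: "('o, 'm, 'o, 'm) fctor" where
  "id_functor = \<lparr>fob = (\<lambda>a. a), far = (\<lambda>a b f. f)\<rparr>"

definition comp_functor ::
  "('p, 'n, 'q, 'l) fctor \<Rightarrow> ('o, 'm, 'p, 'n) fctor \<Rightarrow> ('o, 'm, 'q, 'l) fctor" where
  "comp_functor G F =
     \<lparr>fob = (\<lambda>a. fob G (fob F a)), far = (\<lambda>a b f. far G (fob F a) (fob F b) (far F a b f))\<rparr>"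

definition naturally_isomorphic ::
  "('o, 'm) cat \<Rightarrow> ('p, 'n) cat \<Rightarrow> ('o, 'm, 'p, 'n) fctor \<Rightarrow> ('o, 'm, 'p, 'n) fctor \<Rightarrow> bool" where
  "naturally_isomorphic C D F F' \<longleftrightarrow>
     (\<exists>\<eta>. (\<forall>a\<in>Ob C. is_iso D (fob F a) (fob F' a) (\<eta> a)) \<and>
        (\<forall>a\<in>Ob C. \<forall>b\<in>Ob C. \<forall>f\<in>Ar C a b.
           Cmp D (fob F a) (fob F b) (fob F' b) (\<eta> b) (far F a b f)
           = Cmp D (fob F a) (fob F' a) (fob F' b) (far F' a b f) (\<eta> a)))"

definition equivalent_categories :: "('o, 'm) cat \<Rightarrow> ('p, 'n) cat \<Rightarrow> bool" where
  "equivalent_categories C D \<longleftrightarrow> is_category C \<and> is_category D \<and>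
     (\<exists>F G. is_functor C D F \<and> is_functor D C G \<and>
        naturally_isomorphic C C (comp_functor G F) id_functor \<and>
        naturally_isomorphic D D (comp_functor F G) id_functor)"

definition filtered :: "('o, 'm) cat \<Rightarrow> bool" where
  "filtered C \<longleftrightarrow> is_category C \<and> Ob C \<noteq> {} \<and>
     (\<forall>i\<in>Ob C. \<forall>j\<in>Ob C. \<exists>l\<in>Ob C. Ar C i l \<noteq> {} \<and> Ar C j l \<noteq> {}) \<and>
     (\<forall>i\<in>Ob C. \<forall>j\<in>Ob C. \<forall>f\<in>Ar C i j. \<forall>g\<in>Ar C i j.
        \<exists>l\<in>Ob C. \<exists>h\<in>Ar C j l. Cmp C i j l h f = Cmp C i j l h g)"

definition prod_cat :: "('o, 'm) cat \<Rightarrow> ('p, 'n) cat \<Rightarrow> ('o \<times> 'p, 'm \<times> 'n) cat" where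
  "prod_cat C D =
     \<lparr>Ob = Ob C \<times> Ob D,
      Ar = (\<lambda>a b. Ar C (fst a) (fst b) \<times> Ar D (snd a) (snd b)),
      Idm = (\<lambda>a. (Idm C (fst a), Idm D (snd a))),
      Cmp = (\<lambda>a b c g f. (Cmp C (fst a) (fst b) (fst c) (fst g) (fst f),
                            Cmp D (snd a) (snd b) (snd c) (snd g) (snd f)))\<rparr>"

definition unit_cat :: "(unit, unit) cat" where
  "unit_cat = \<lparr>Ob = UNIV, Ar = (\<lambda>_ _. UNIV), Idm = (\<lambda>_. ()), Cmp = (\<lambda>_ _ _ _ _. ())\<rparr>"

section \<open>Banach spaces over a complete valued field\<close>

definition complete_valued_field :: "('k::field \<Rightarrow> real) \<Rightarrow> bool" where
  "complete_valued_field v \<longleftrightarrow>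
     (\<forall>x. 0 \<le> v x) \<and> (\<forall>x. v x = 0 \<longleftrightarrow> x = 0) \<and> (\<forall>x y. v (x * y) = v x * v y) \<and>
     (\<forall>x y. v (x + y) \<le> v x + v y) \<and> (\<exists>x. x \<noteq> 0 \<and> v x \<noteq> 1) \<and>
     (\<forall>s::nat \<Rightarrow> 'k. (\<forall>e>0. \<exists>N. \<forall>m\<ge>N. \<forall>n\<ge>N. v (s m - s n) < e) \<longrightarrow>
        (\<exists>l. (\<lambda>n. v (s n - l)) \<longlonglongrightarrow> 0))"

definition nonarchimedean :: "('k::field \<Rightarrow> real) \<Rightarrow> bool" where
  "nonarchimedean v \<longleftrightarrow> (\<forall>x y. v (x + y) \<le> max (v x) (v y))"

text \<open>The form of the triangle inequality imposed on norms; it also determines the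
  projective tensor norm.\<close>

datatype convention = Usual | Strong

text \<open>The fields \<open>mult\<close> and \<open>one\<close> inherited from the library's module record play no role and
  are left undefined.\<close>

record ('k, 'a) nspace = "('k, 'a) module" +
  nrm :: "'a \<Rightarrow> real"

definition banach_space :: "('k::field \<Rightarrow> real) \<Rightarrow> convention \<Rightarrow> ('k, 'a) nspace \<Rightarrow> bool" where
  "banach_space v c V \<longleftrightarrow>
     Module.module (ring_of_type_algebra :: 'k ring) V \<and>
     (\<forall>x\<in>carrier V. 0 \<le> nrm V x \<and> (nrm V x = 0 \<longleftrightarrow> x = \<zero>\<^bsub>V\<^esub>)) \<and>
     (\<forall>a. \<forall>x\<in>carrier V. nrm V (a \<odot>\<^bsub>V\<^esub> x) = v a * nrm V x) \<and>
     (\<forall>x\<in>carrier V. \<forall>y\<in>carrier V. nrm V (x \<oplus>\<^bsub>V\<^esub> y) \<le>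
        (case c of Usual \<Rightarrow> nrm V x + nrm V y | Strong \<Rightarrow> max (nrm V x) (nrm V y))) \<and>
     (\<forall>s::nat \<Rightarrow> 'a. (\<forall>n. s n \<in> carrier V) \<and>
          (\<forall>e>0. \<exists>N. \<forall>m\<ge>N. \<forall>n\<ge>N. nrm V (s m \<ominus>\<^bsub>V\<^esub> s n) < e) \<longrightarrow>
        (\<exists>l\<in>carrier V. (\<lambda>n. nrm V (s n \<ominus>\<^bsub>V\<^esub> l)) \<longlonglongrightarrow> 0))"

text \<open>Maps are extensional, so that equality of functions is equality of morphisms.\<close>

definition bl_hom :: "('k, 'a) nspace \<Rightarrow> ('k, 'b) nspace \<Rightarrow> ('a \<Rightarrow> 'b) set" where
  "bl_hom V W = {f \<in> carrier V \<rightarrow>\<^sub>E carrier W.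
     (\<forall>x\<in>carrier V. \<forall>y\<in>carrier V. f (x \<oplus>\<^bsub>V\<^esub> y) = f x \<oplus>\<^bsub>W\<^esub> f y) \<and>
     (\<forall>a. \<forall>x\<in>carrier V. f (a \<odot>\<^bsub>V\<^esub> x) = a \<odot>\<^bsub>W\<^esub> f x) \<and>
     (\<exists>B. \<forall>x\<in>carrier V. nrm W (f x) \<le> B * nrm V x)}"

definition ban_id :: "('k, 'a) nspace \<Rightarrow> 'a \<Rightarrow> 'a" where
  "ban_id V = (\<lambda>x\<in>carrier V. x)"

definition ban_cat :: "('k::field \<Rightarrow> real) \<Rightarrow> convention \<Rightarrow> (('k, 'a) nspace, 'a \<Rightarrow> 'a) cat" where
  "ban_cat v c = \<lparr>Ob = {V. banach_space v c V}, Ar = bl_hom, Idm = ban_id,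
     Cmp = (\<lambda>A B C g f. compose (carrier A) g f)\<rparr>"

text \<open>Isomorphism of Banach spaces whose carriers may live in different types.\<close>

definition ban_iso :: "('k, 'a) nspace \<Rightarrow> ('k, 'b) nspace \<Rightarrow> ('a \<Rightarrow> 'b) \<Rightarrow> bool" where
  "ban_iso A B f \<longleftrightarrow> f \<in> bl_hom A B \<and>
     (\<exists>g\<in>bl_hom B A. compose (carrier A) g f = ban_id A \<and> compose (carrier B) f g = ban_id B)"

definition base_field :: "('k::field \<Rightarrow> real) \<Rightarrow> ('k, 'k) nspace" where
  "base_field v = \<lparr>carrier = UNIV, mult = undefined, one = undefined, zero = 0, add = (+),
     smult = (*), nrm = v\<rparr>"

section \<open>The completed projective tensor product\<close>

text \<open>A list of pairs \<open>[(x\<^sub>1, y\<^sub>1), \<dots>, (x\<^sub>n, y\<^sub>n)]\<close> stands for the finite sum of the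
  \<open>x\<^sub>i \<otimes> y\<^sub>i\<close>; the algebraic tensor product consists of such lists modulo \<open>tens_eq\<close>.\<close>

inductive tens_eq :: "('k, 'a) nspace \<Rightarrow> ('k, 'b) nspace \<Rightarrow> ('a \<times> 'b) list \<Rightarrow> ('a \<times> 'b) list \<Rightarrow> bool"
  for V W where
  refl: "set l \<subseteq> carrier V \<times> carrier W \<Longrightarrow> tens_eq V W l l"
| sym: "tens_eq V W l l' \<Longrightarrow> tens_eq V W l' l"
| trans: "tens_eq V W l l' \<Longrightarrow> tens_eq V W l' l'' \<Longrightarrow> tens_eq V W l l''"
| append: "tens_eq V W l m \<Longrightarrow> tens_eq V W l' m' \<Longrightarrow> tens_eq V W (l @ l') (m @ m')"
| commute: "set l \<subseteq> carrier V \<times> carrier W \<Longrightarrow> set l' \<subseteq> carrier V \<times> carrier W \<Longrightarrow>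
    tens_eq V W (l @ l') (l' @ l)"
| zero: "y \<in> carrier W \<Longrightarrow> tens_eq V W [(\<zero>\<^bsub>V\<^esub>, y)] []"
| add_left: "x \<in> carrier V \<Longrightarrow> x' \<in> carrier V \<Longrightarrow> y \<in> carrier W \<Longrightarrow>
    tens_eq V W [(x \<oplus>\<^bsub>V\<^esub> x', y)] [(x, y), (x', y)]"
| add_right: "x \<in> carrier V \<Longrightarrow> y \<in> carrier W \<Longrightarrow> y' \<in> carrier W \<Longrightarrow>
    tens_eq V W [(x, y \<oplus>\<^bsub>W\<^esub> y')] [(x, y), (x, y')]"
| balanced: "x \<in> carrier V \<Longrightarrow> y \<in> carrier W \<Longrightarrow>
    tens_eq V W [(a \<odot>\<^bsub>V\<^esub> x, y)] [(x, a \<odot>\<^bsub>W\<^esub> y)]"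

definition tens_cost ::
  "convention \<Rightarrow> ('k, 'a) nspace \<Rightarrow> ('k, 'b) nspace \<Rightarrow> ('a \<times> 'b) list \<Rightarrow> real" where
  "tens_cost c V W l =
     (let ns = map (\<lambda>(x, y). nrm V x * nrm W y) l
      in case c of Usual \<Rightarrow> sum_list ns | Strong \<Rightarrow> foldr max ns 0)"

definition tens_snrm ::
  "convention \<Rightarrow> ('k, 'a) nspace \<Rightarrow> ('k, 'b) nspace \<Rightarrow> ('a \<times> 'b) list \<Rightarrow> real" where
  "tens_snrm c V W l = Inf {tens_cost c V W l' | l'. tens_eq V W l l'}"

definition tens_dist ::
  "convention \<Rightarrow> ('k, 'a) nspace \<Rightarrow> ('k, 'b) nspace \<Rightarrow> ('a \<times> 'b) list \<Rightarrow> ('a \<times> 'b) list \<Rightarrow> real" where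
  "tens_dist c V W l l' = tens_snrm c V W (l @ map (\<lambda>(x, y). (\<ominus>\<^bsub>V\<^esub> x, y)) l')"

definition tens_cauchy ::
  "convention \<Rightarrow> ('k, 'a) nspace \<Rightarrow> ('k, 'b) nspace \<Rightarrow> (nat \<Rightarrow> ('a \<times> 'b) list) \<Rightarrow> bool" where
  "tens_cauchy c V W s \<longleftrightarrow> (\<forall>n. set (s n) \<subseteq> carrier V \<times> carrier W) \<and>
     (\<forall>e>0. \<exists>N. \<forall>m\<ge>N. \<forall>n\<ge>N. tens_dist c V W (s m) (s n) < e)"

text \<open>An element of the completion is a class of Cauchy sequences with vanishing distance.\<close>

type_synonym ('a, 'b) tens = "(nat \<Rightarrow> ('a \<times> 'b) list) set"

definition tens_class ::
  "convention \<Rightarrow> ('k, 'a) nspace \<Rightarrow> ('k, 'b) nspace \<Rightarrow> (nat \<Rightarrow> ('a \<times> 'b) list) \<Rightarrow> ('a, 'b) tens" where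
  "tens_class c V W s = {t. tens_cauchy c V W t \<and> (\<lambda>n. tens_dist c V W (s n) (t n)) \<longlonglongrightarrow> 0}"

definition tensor ::
  "convention \<Rightarrow> ('k, 'a) nspace \<Rightarrow> ('k, 'b) nspace \<Rightarrow> ('k, ('a, 'b) tens) nspace" where
  "tensor c V W =
     \<lparr>carrier = {tens_class c V W s | s. tens_cauchy c V W s},
      mult = undefined, one = undefined,
      zero = tens_class c V W (\<lambda>n. []),
      add = (\<lambda>A B. \<Union>s\<in>A. \<Union>t\<in>B. tens_class c V W (\<lambda>n. s n @ t n)),
      smult = (\<lambda>a A. \<Union>s\<in>A. tens_class c V W (\<lambda>n. map (\<lambda>(x, y). (a \<odot>\<^bsub>V\<^esub> x, y)) (s n))),
      nrm = (\<lambda>A. lim (\<lambda>n. tens_snrm c V W ((SOME s. s \<in> A) n)))\<rparr>"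

definition elt :: "convention \<Rightarrow> ('k, 'a) nspace \<Rightarrow> ('k, 'b) nspace \<Rightarrow> 'a \<Rightarrow> 'b \<Rightarrow> ('a, 'b) tens" where
  "elt c V W x y = tens_class c V W (\<lambda>n. [(x, y)])"

text \<open>The bounded linear map out of the tensor product induced by a bounded bilinear map.\<close>

definition tens_lift ::
  "convention \<Rightarrow> ('k, 'a) nspace \<Rightarrow> ('k, 'b) nspace \<Rightarrow> ('k, 'd) nspace \<Rightarrow> ('a \<Rightarrow> 'b \<Rightarrow> 'd) \<Rightarrow>
     ('a, 'b) tens \<Rightarrow> 'd" where
  "tens_lift c V W Z \<beta> = (THE \<phi>. \<phi> \<in> bl_hom (tensor c V W) Z \<and>
     (\<forall>x\<in>carrier V. \<forall>y\<in>carrier W. \<phi> (elt c V W x y) = \<beta> x y))"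

definition tens_map ::
  "convention \<Rightarrow> ('k, 'a) nspace \<Rightarrow> ('k, 'd) nspace \<Rightarrow> ('k, 'b) nspace \<Rightarrow> ('k, 'e) nspace \<Rightarrow>
     ('a \<Rightarrow> 'd) \<Rightarrow> ('b \<Rightarrow> 'e) \<Rightarrow> ('a, 'b) tens \<Rightarrow> ('d, 'e) tens" where
  "tens_map c V V' W W' f g =
     tens_lift c V W (tensor c V' W') (\<lambda>x y. elt c V' W' (f x) (g y))"

definition tens_assoc ::
  "convention \<Rightarrow> ('k, 'a) nspace \<Rightarrow> ('k, 'b) nspace \<Rightarrow> ('k, 'd) nspace \<Rightarrow>
     (('a, 'b) tens, 'd) tens \<Rightarrow> ('a, ('b, 'd) tens) tens" where
  "tens_assoc c U V W =
     (let Z = tensor c U (tensor c V W)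
      in tens_lift c (tensor c U V) W Z
           (\<lambda>t z. tens_lift c U V Z (\<lambda>x y. elt c U (tensor c V W) x (elt c V W y z)) t))"

definition tens_lunit ::
  "('k::field \<Rightarrow> real) \<Rightarrow> convention \<Rightarrow> ('k, 'a) nspace \<Rightarrow> ('k, 'a) tens \<Rightarrow> 'a" where
  "tens_lunit v c V = tens_lift c (base_field v) V V (\<lambda>a x. a \<odot>\<^bsub>V\<^esub> x)"

definition tens_runit ::
  "('k::field \<Rightarrow> real) \<Rightarrow> convention \<Rightarrow> ('k, 'a) nspace \<Rightarrow> ('a, 'k) tens \<Rightarrow> 'a" where
  "tens_runit v c V = tens_lift c V (base_field v) V (\<lambda>x a. a \<odot>\<^bsub>V\<^esub> x)"

text \<open>\<open>(x \<otimes> y) \<otimes> (x' \<otimes> y') \<mapsto> (x \<otimes> x') \<otimes> (y \<otimes> y')\<close>\<close>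

definition tens_swap_mid ::
  "convention \<Rightarrow> ('k, 'a) nspace \<Rightarrow>
     (('a, 'a) tens, ('a, 'a) tens) tens \<Rightarrow> (('a, 'a) tens, ('a, 'a) tens) tens" where
  "tens_swap_mid c V =
     (let T = tensor c V V; Z = tensor c T T
      in tens_lift c T T Z (\<lambda>s t. tens_lift c V V Z (\<lambda>x y. tens_lift c V V Z
           (\<lambda>x' y'. elt c T T (elt c V V x x') (elt c V V y y')) t) s))"

section \<open>Bialgebras\<close>

record ('k, 'a) bialg =
  space :: "('k, 'a) nspace"
  mu :: "('a, 'a) tens \<Rightarrow> 'a"
  unt :: "'k \<Rightarrow> 'a"
  comul :: "'a \<Rightarrow> ('a, 'a) tens"
  counit :: "'a \<Rightarrow> 'k"

definition is_bialgebra :: "('k::field \<Rightarrow> real) \<Rightarrow> convention \<Rightarrow> ('k, 'a) bialg \<Rightarrow> bool" where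
  "is_bialgebra v c B \<longleftrightarrow>
     (let A = space B; k = base_field v; T = tensor c A A; m = mu B; u = unt B;
          \<Delta> = comul B; \<epsilon> = counit B; i = ban_id A
      in banach_space v c A \<and>
         m \<in> bl_hom T A \<and> u \<in> bl_hom k A \<and> \<Delta> \<in> bl_hom A T \<and> \<epsilon> \<in> bl_hom A k \<and>
         \<comment> \<open>algebra\<close>
         compose (carrier (tensor c T A)) m (tens_map c T A A A m i)
           = compose (carrier (tensor c T A)) m
               (compose (carrier (tensor c T A)) (tens_map c A A T A i m) (tens_assoc c A A A)) \<and>
         compose (carrier (tensor c k A)) m (tens_map c k A A A u i) = tens_lunit v c A \<and>
         compose (carrier (tensor c A k)) m (tens_map c A A k A i u) = tens_runit v c A \<and>
         \<comment> \<open>coalgebra\<close>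
         compose (carrier A) (tens_map c A A A T i \<Delta>) \<Delta>
           = compose (carrier A) (tens_assoc c A A A) (compose (carrier A) (tens_map c A T A A \<Delta> i) \<Delta>) \<and>
         compose (carrier A) (tens_lunit v c A) (compose (carrier A) (tens_map c A k A A \<epsilon> i) \<Delta>) = i \<and>
         compose (carrier A) (tens_runit v c A) (compose (carrier A) (tens_map c A A A k i \<epsilon>) \<Delta>) = i \<and>
         \<comment> \<open>comultiplication and counit are algebra homomorphisms\<close>
         compose (carrier T) \<Delta> m
           = compose (carrier T) (tens_map c T A T A m m)
               (compose (carrier T) (tens_swap_mid c A) (tens_map c A T A T \<Delta> \<Delta>)) \<and>
         (\<forall>a. \<Delta> (u a) = elt c A A (u a) (u 1)) \<and>
         compose (carrier T) \<epsilon> m = compose (carrier T) (tens_lunit v c k) (tens_map c A k A k \<epsilon> \<epsilon>) \<and>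
         compose UNIV \<epsilon> u = ban_id k)"

section \<open>Ind-Banach spaces\<close>

record ('i, 'm, 'k, 'a) ind =
  shape :: "('i, 'm) cat"
  diag :: "('i, 'm, ('k, 'a) nspace, 'a \<Rightarrow> 'a) fctor"

abbreviation idx :: "('i, 'm, 'k, 'a) ind \<Rightarrow> 'i set" where
  "idx X \<equiv> Ob (shape X)"

abbreviation arr :: "('i, 'm, 'k, 'a) ind \<Rightarrow> 'i \<Rightarrow> 'i \<Rightarrow> 'm set" where
  "arr X \<equiv> Ar (shape X)"

abbreviation at_idx :: "('i, 'm, 'k, 'a) ind \<Rightarrow> 'i \<Rightarrow> ('k, 'a) nspace" where
  "at_idx X \<equiv> fob (diag X)"

abbreviation trn :: "('i, 'm, 'k, 'a) ind \<Rightarrow> 'i \<Rightarrow> 'i \<Rightarrow> 'm \<Rightarrow> 'a \<Rightarrow> 'a" where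
  "trn X \<equiv> far (diag X)"

definition is_ind :: "('k::field \<Rightarrow> real) \<Rightarrow> convention \<Rightarrow> ('i, 'm, 'k, 'a) ind \<Rightarrow> bool" where
  "is_ind v c X \<longleftrightarrow> filtered (shape X) \<and> is_functor (shape X) (ban_cat v c) (diag X)"

text \<open>For a Banach space \<open>A\<close> and an ind-object \<open>Y\<close>, \<open>germ A Y j f\<close> is the class of
  \<open>f : A \<rightarrow> Y\<^sub>j\<close> in the filtered colimit of the sets \<open>Hom(A, Y\<^sub>j)\<close>.\<close>

definition germ ::
  "('k, 'a) nspace \<Rightarrow> ('j, 'n, 'k, 'b) ind \<Rightarrow> 'j \<Rightarrow> ('a \<Rightarrow> 'b) \<Rightarrow> ('j \<times> ('a \<Rightarrow> 'b)) set" where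
  "germ A Y j f = {(j', f'). j' \<in> idx Y \<and> f' \<in> bl_hom A (at_idx Y j') \<and>
     (\<exists>l\<in>idx Y. \<exists>a\<in>arr Y j l. \<exists>b\<in>arr Y j' l.
        compose (carrier A) (trn Y j l a) f = compose (carrier A) (trn Y j' l b) f')}"

text \<open>\<open>lim\<^sub>i colim\<^sub>j Hom(X\<^sub>i, Y\<^sub>j)\<close>\<close>

definition ind_hom ::
  "('i, 'm, 'k, 'a) ind \<Rightarrow> ('j, 'n, 'k, 'b) ind \<Rightarrow> ('i \<Rightarrow> ('j \<times> ('a \<Rightarrow> 'b)) set) set" where
  "ind_hom X Y = {\<phi> \<in> extensional (idx X).
     (\<forall>i\<in>idx X. \<exists>j\<in>idx Y. \<exists>f\<in>bl_hom (at_idx X i) (at_idx Y j). \<phi> i = germ (at_idx X i) Y j f) \<and>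
     (\<forall>i\<in>idx X. \<forall>i'\<in>idx X. \<forall>a\<in>arr X i i'. \<forall>(j, f)\<in>\<phi> i'.
        \<phi> i = germ (at_idx X i) Y j (compose (carrier (at_idx X i)) f (trn X i i' a)))}"

definition ind_id :: "('i, 'm, 'k, 'a) ind \<Rightarrow> 'i \<Rightarrow> ('i \<times> ('a \<Rightarrow> 'a)) set" where
  "ind_id X = (\<lambda>i\<in>idx X. germ (at_idx X i) X i (ban_id (at_idx X i)))"

text \<open>The unions below run over representatives; all the germs involved coincide.\<close>

definition ind_comp ::
  "('i, 'm, 'k, 'a) ind \<Rightarrow> ('j, 'n, 'k, 'b) ind \<Rightarrow> ('l, 'p, 'k, 'd) ind \<Rightarrow>
     ('j \<Rightarrow> ('l \<times> ('b \<Rightarrow> 'd)) set) \<Rightarrow> ('i \<Rightarrow> ('j \<times> ('a \<Rightarrow> 'b)) set) \<Rightarrow>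
     'i \<Rightarrow> ('l \<times> ('a \<Rightarrow> 'd)) set" where
  "ind_comp X Y Z \<psi> \<phi> = (\<lambda>i\<in>idx X. \<Union>(j, f)\<in>\<phi> i. \<Union>(l, h)\<in>\<psi> j.
     germ (at_idx X i) Z l (compose (carrier (at_idx X i)) h f))"

definition ind_const :: "('k, 'a) nspace \<Rightarrow> (unit, unit, 'k, 'a) ind" where
  "ind_const A = \<lparr>shape = unit_cat, diag = \<lparr>fob = (\<lambda>_. A), far = (\<lambda>_ _ _. ban_id A)\<rparr>\<rparr>"

definition ind_const_map ::
  "('k, 'a) nspace \<Rightarrow> ('k, 'b) nspace \<Rightarrow> ('a \<Rightarrow> 'b) \<Rightarrow> unit \<Rightarrow> (unit \<times> ('a \<Rightarrow> 'b)) set" where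
  "ind_const_map A B f = (\<lambda>_. germ A (ind_const B) () f)"

definition ind_tensor ::
  "convention \<Rightarrow> ('i, 'm, 'k, 'a) ind \<Rightarrow> ('j, 'n, 'k, 'b) ind \<Rightarrow>
     ('i \<times> 'j, 'm \<times> 'n, 'k, ('a, 'b) tens) ind" where
  "ind_tensor c X Y =
     \<lparr>shape = prod_cat (shape X) (shape Y),
      diag = \<lparr>fob = (\<lambda>p. tensor c (at_idx X (fst p)) (at_idx Y (snd p))),
              far = (\<lambda>p q a. tens_map c (at_idx X (fst p)) (at_idx X (fst q))
                                 (at_idx Y (snd p)) (at_idx Y (snd q))
                                 (trn X (fst p) (fst q) (fst a)) (trn Y (snd p) (snd q) (snd a)))\<rparr>\<rparr>"

definition ind_tensor_map ::
  "convention \<Rightarrow> ('i, 'm, 'k, 'a) ind \<Rightarrow> ('i', 'm', 'k, 'a') ind \<Rightarrow>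
     ('j, 'n, 'k, 'b) ind \<Rightarrow> ('j', 'n', 'k, 'b') ind \<Rightarrow>
     ('i \<Rightarrow> ('i' \<times> ('a \<Rightarrow> 'a')) set) \<Rightarrow> ('j \<Rightarrow> ('j' \<times> ('b \<Rightarrow> 'b')) set) \<Rightarrow>
     'i \<times> 'j \<Rightarrow> (('i' \<times> 'j') \<times> (('a, 'b) tens \<Rightarrow> ('a', 'b') tens)) set" where
  "ind_tensor_map c X X' Y Y' \<phi> \<psi> =
     (\<lambda>p\<in>idx (ind_tensor c X Y). \<Union>(i', f)\<in>\<phi> (fst p). \<Union>(j', h)\<in>\<psi> (snd p).
        germ (at_idx (ind_tensor c X Y) p) (ind_tensor c X' Y') (i', j')
          (tens_map c (at_idx X (fst p)) (at_idx X' i') (at_idx Y (snd p)) (at_idx Y' j') f h))"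

definition ind_assoc ::
  "convention \<Rightarrow> ('i, 'm, 'k, 'a) ind \<Rightarrow> ('j, 'n, 'k, 'b) ind \<Rightarrow> ('l, 'p, 'k, 'd) ind \<Rightarrow>
     ('i \<times> 'j) \<times> 'l \<Rightarrow>
     (('i \<times> 'j \<times> 'l) \<times> ((('a, 'b) tens, 'd) tens \<Rightarrow> ('a, ('b, 'd) tens) tens)) set" where
  "ind_assoc c X Y Z =
     (\<lambda>((i, j), l)\<in>idx (ind_tensor c (ind_tensor c X Y) Z).
        germ (at_idx (ind_tensor c (ind_tensor c X Y) Z) ((i, j), l))
          (ind_tensor c X (ind_tensor c Y Z)) (i, (j, l))
          (tens_assoc c (at_idx X i) (at_idx Y j) (at_idx Z l)))"

definition ind_lunit ::
  "('k::field \<Rightarrow> real) \<Rightarrow> convention \<Rightarrow> ('i, 'm, 'k, 'a) ind \<Rightarrow>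
     unit \<times> 'i \<Rightarrow> ('i \<times> (('k, 'a) tens \<Rightarrow> 'a)) set" where
  "ind_lunit v c X =
     (\<lambda>p\<in>idx (ind_tensor c (ind_const (base_field v)) X).
        germ (tensor c (base_field v) (at_idx X (snd p))) X (snd p)
          (tens_lunit v c (at_idx X (snd p))))"

section \<open>Comodules\<close>

text \<open>Left comodules, matching the order of the factors in \<open>C(G,k) \<otimes> V \<cong> C(G,V)\<close> (a left \<open>G\<close>-module
  gives one by \<open>w \<mapsto> (g \<mapsto> g\<^sup>-\<^sup>1w)\<close>): ind-objects \<open>X\<close> with a coaction \<open>\<rho> : X \<rightarrow> A \<otimes> X\<close>. The type \<open>'u\<close> is the
  universe: index categories and carriers of Banach spaces are subsets of it.\<close>

type_synonym ('k, 'u) uind = "('u, 'u, 'k, 'u) ind"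

type_synonym ('k, 'a, 'u) comodule =
  "('k, 'u) uind \<times> ('u \<Rightarrow> ((unit \<times> 'u) \<times> ('u \<Rightarrow> ('a, 'u) tens)) set)"

definition is_comodule ::
  "('k::field \<Rightarrow> real) \<Rightarrow> convention \<Rightarrow> ('k, 'a) bialg \<Rightarrow> ('k, 'a, 'u) comodule \<Rightarrow> bool" where
  "is_comodule v c B M \<longleftrightarrow>
     (let X = fst M; \<rho> = snd M; A = ind_const (space B); k = ind_const (base_field v);
          AX = ind_tensor c A X; AAX = ind_tensor c A AX; AA = ind_tensor c A A;
          \<Delta> = (\<lambda>_. germ (space B) AA ((), ()) (comul B));
          \<epsilon> = ind_const_map (space B) (base_field v) (counit B)
      in is_ind v c X \<and> \<rho> \<in> ind_hom X AX \<and>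
         ind_comp X AX AAX (ind_tensor_map c A A X AX (ind_id A) \<rho>) \<rho>
           = ind_comp X (ind_tensor c AA X) AAX (ind_assoc c A A X)
               (ind_comp X AX (ind_tensor c AA X) (ind_tensor_map c A AA X X \<Delta> (ind_id X)) \<rho>) \<and>
         ind_comp X (ind_tensor c k X) X (ind_lunit v c X)
             (ind_comp X AX (ind_tensor c k X) (ind_tensor_map c A k X X \<epsilon> (ind_id X)) \<rho>)
           = ind_id X)"

definition comodule_hom ::
  "convention \<Rightarrow> ('k, 'a) bialg \<Rightarrow> ('k, 'a, 'u) comodule \<Rightarrow> ('k, 'a, 'u) comodule \<Rightarrow>
     ('u \<Rightarrow> ('u \<times> ('u \<Rightarrow> 'u)) set) set" where
  "comodule_hom c B M N =
     (let X = fst M; Y = fst N; A = ind_const (space B); AX = ind_tensor c A X; AY = ind_tensor c A Y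
      in {\<phi> \<in> ind_hom X Y.
           ind_comp X AX AY (ind_tensor_map c A A X Y (ind_id A) \<phi>) (snd M)
             = ind_comp X Y AY (snd N) \<phi>})"

definition comodule_cat ::
  "('k::field \<Rightarrow> real) \<Rightarrow> convention \<Rightarrow> ('k, 'a) bialg \<Rightarrow>
     (('k, 'a, 'u) comodule, 'u \<Rightarrow> ('u \<times> ('u \<Rightarrow> 'u)) set) cat" where
  "comodule_cat v c B = \<lparr>Ob = {M. is_comodule v c B M}, Ar = comodule_hom c B,
     Idm = (\<lambda>M. ind_id (fst M)), Cmp = (\<lambda>M N P \<psi> \<phi>. ind_comp (fst M) (fst N) (fst P) \<psi> \<phi>)\<rparr>"

section \<open>Function spaces on a topological group\<close>

text \<open>Topological groups are the types of class \<open>topological_group_add\<close>. The library writes the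
  group operation as \<open>+\<close>, but does not assume that it is commutative; the identity is \<open>0\<close>.\<close>

definition cont_into :: "('k, 'a) nspace \<Rightarrow> ('p::topological_space \<Rightarrow> 'a) \<Rightarrow> bool" where
  "cont_into V f \<longleftrightarrow> (\<forall>x. f x \<in> carrier V) \<and>
     (\<forall>x. \<forall>e>0. eventually (\<lambda>y. nrm V (f y \<ominus>\<^bsub>V\<^esub> f x) < e) (nhds x))"

text \<open>Convergence of the supremum to 0 along every net converging to the identity is
  convergence along the neighbourhood filter of the identity.\<close>

definition left_unif_cont :: "('k, 'a) nspace \<Rightarrow> ('g::topological_group_add \<Rightarrow> 'a) \<Rightarrow> bool" where
  "left_unif_cont V f \<longleftrightarrow>
     (\<forall>e>0. eventually (\<lambda>h. \<forall>x. nrm V (f (h + x) \<ominus>\<^bsub>V\<^esub> f x) < e) (nhds 0))"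

definition Cblu :: "('k, 'a) nspace \<Rightarrow> ('k, 'g::topological_group_add \<Rightarrow> 'a) nspace" where
  "Cblu V =
     \<lparr>carrier = {f. cont_into V f \<and> bdd_above (range (\<lambda>x. nrm V (f x))) \<and> left_unif_cont V f},
      mult = undefined, one = undefined,
      zero = (\<lambda>_. \<zero>\<^bsub>V\<^esub>),
      add = (\<lambda>f f' x. f x \<oplus>\<^bsub>V\<^esub> f' x),
      smult = (\<lambda>a f x. a \<odot>\<^bsub>V\<^esub> f x),
      nrm = (\<lambda>f. SUP x. nrm V (f x))\<rparr>"

text \<open>The canonical map from \<open>C(G,k) \<otimes> V\<close> to \<open>C(G,V)\<close>, sending \<open>f \<otimes> w\<close> to
  \<open>g \<mapsto> f(g) w\<close>.\<close>

definition can ::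
  "('k::field \<Rightarrow> real) \<Rightarrow> convention \<Rightarrow> ('k, 'a) nspace \<Rightarrow>
     ('g::topological_group_add \<Rightarrow> 'k, 'a) tens \<Rightarrow> 'g \<Rightarrow> 'a" where
  "can v c V = tens_lift c (Cblu (base_field v)) V (Cblu V) (\<lambda>f w g. f g \<odot>\<^bsub>V\<^esub> w)"

definition group_bialg ::
  "('k::field \<Rightarrow> real) \<Rightarrow> convention \<Rightarrow> ('k, 'g::topological_group_add \<Rightarrow> 'k) bialg" where
  "group_bialg v c =
     (let C = Cblu (base_field v)
      in \<lparr>space = C,
          mu = tens_lift c C C C (\<lambda>f f' g. f g * f' g),
          unt = (\<lambda>a g. a),
          comul = (\<lambda>f\<in>carrier C. inv_into (carrier (tensor c C C)) (can v c C) (\<lambda>g g'. f (g + g'))),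
          counit = (\<lambda>f\<in>carrier C. f 0)\<rparr>)"

section \<open>Strongly continuous isometric ind-Banach modules\<close>

text \<open>Continuous maps from \<open>G\<close> to \<open>Hom(A, W)\<close> with the strong operator topology.\<close>

definition sot_maps ::
  "('k, 'a) nspace \<Rightarrow> ('k, 'b) nspace \<Rightarrow> ('g::topological_space \<Rightarrow> 'a \<Rightarrow> 'b) set" where
  "sot_maps A W = {\<sigma>. (\<forall>g. \<sigma> g \<in> bl_hom A W) \<and> (\<forall>x\<in>carrier A. cont_into W (\<lambda>g. \<sigma> g x))}"

text \<open>The class of \<open>\<sigma> : G \<rightarrow> Hom(A, Y\<^sub>j)\<close> in the colimit over \<open>j\<close> of the sets of such maps.
  Families are identified when they agree at a common stage, uniformly in \<open>g\<close>.\<close>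

definition fam_germ ::
  "('k, 'a) nspace \<Rightarrow> ('j, 'n, 'k, 'b) ind \<Rightarrow> 'j \<Rightarrow> ('g::topological_space \<Rightarrow> 'a \<Rightarrow> 'b) \<Rightarrow>
     ('j \<times> ('g \<Rightarrow> 'a \<Rightarrow> 'b)) set" where
  "fam_germ A Y j \<sigma> = {(j', \<sigma>'). j' \<in> idx Y \<and> \<sigma>' \<in> sot_maps A (at_idx Y j') \<and>
     (\<exists>l\<in>idx Y. \<exists>a\<in>arr Y j l. \<exists>b\<in>arr Y j' l. \<forall>g.
        compose (carrier A) (trn Y j l a) (\<sigma> g) = compose (carrier A) (trn Y j' l b) (\<sigma>' g))}"

type_synonym ('k, 'g, 'u) gmod =
  "('k, 'u) uind \<times> ('u \<Rightarrow> ('u \<times> ('g \<Rightarrow> 'u \<Rightarrow> 'u)) set)"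

text \<open>The conjuncts on \<open>\<alpha>\<close>: each germ is represented by a strongly continuous family of
  isometries; compatibility with the transition maps; the identity acts as the identity; and
  the action is multiplicative. Here \<open>g + h\<close> is the product \<open>gh\<close>.\<close>

definition is_gmod_iso ::
  "('k::field \<Rightarrow> real) \<Rightarrow> convention \<Rightarrow> ('k, 'g::topological_group_add, 'u) gmod \<Rightarrow> bool" where
  "is_gmod_iso v c M \<longleftrightarrow>
     (let X = fst M; \<alpha> = snd M
      in is_ind v c X \<and> \<alpha> \<in> extensional (idx X) \<and>
         (\<forall>i\<in>idx X. \<exists>i'\<in>idx X. \<exists>\<sigma>\<in>sot_maps (at_idx X i) (at_idx X i').
            (\<forall>g. \<forall>x\<in>carrier (at_idx X i). nrm (at_idx X i') (\<sigma> g x) = nrm (at_idx X i) x) \<and>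
            \<alpha> i = fam_germ (at_idx X i) X i' \<sigma>) \<and>
         (\<forall>i\<in>idx X. \<forall>l\<in>idx X. \<forall>a\<in>arr X i l. \<forall>(j, \<tau>)\<in>\<alpha> l.
            \<alpha> i = fam_germ (at_idx X i) X j
                     (\<lambda>g. compose (carrier (at_idx X i)) (\<tau> g) (trn X i l a))) \<and>
         (\<forall>i\<in>idx X. \<forall>(i', \<sigma>)\<in>\<alpha> i. (i', \<sigma> 0) \<in> ind_id X i) \<and>
         (\<forall>i\<in>idx X. \<forall>(i', \<sigma>)\<in>\<alpha> i. \<forall>(i'', \<tau>)\<in>\<alpha> i'.
            \<exists>l\<in>idx X. \<exists>a\<in>arr X i'' l. \<exists>b\<in>arr X i' l. \<forall>g h.
              compose (carrier (at_idx X i)) (trn X i'' l a)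
                  (compose (carrier (at_idx X i)) (\<tau> g) (\<sigma> h))
                = compose (carrier (at_idx X i)) (trn X i' l b) (\<sigma> (g + h))))"

definition gmod_hom ::
  "('k, 'g, 'u) gmod \<Rightarrow> ('k, 'g, 'u) gmod \<Rightarrow> ('u \<Rightarrow> ('u \<times> ('u \<Rightarrow> 'u)) set) set" where
  "gmod_hom M N =
     (let X = fst M; \<alpha> = snd M; Y = fst N; \<beta> = snd N
      in {\<phi> \<in> ind_hom X Y.
           \<forall>i\<in>idx X. \<forall>(i', \<sigma>)\<in>\<alpha> i. \<forall>(j', f')\<in>\<phi> i'. \<forall>(j, f)\<in>\<phi> i. \<forall>(m, \<tau>)\<in>\<beta> j.
             \<exists>l\<in>idx Y. \<exists>a\<in>arr Y j' l. \<exists>b\<in>arr Y m l. \<forall>g.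
               compose (carrier (at_idx X i)) (trn Y j' l a)
                   (compose (carrier (at_idx X i)) f' (\<sigma> g))
                 = compose (carrier (at_idx X i)) (trn Y m l b)
                     (compose (carrier (at_idx X i)) (\<tau> g) f)})"

definition gmod_iso_cat ::
  "('k::field \<Rightarrow> real) \<Rightarrow> convention \<Rightarrow>
     (('k, 'g::topological_group_add, 'u) gmod, 'u \<Rightarrow> ('u \<times> ('u \<Rightarrow> 'u)) set) cat" where
  "gmod_iso_cat v c = \<lparr>Ob = {M. is_gmod_iso v c M}, Ar = gmod_hom,
     Idm = (\<lambda>M. ind_id (fst M)), Cmp = (\<lambda>M N P \<psi> \<phi>. ind_comp (fst M) (fst N) (fst P) \<psi> \<phi>)\<rparr>"

end

theory Submission
  imports Defs
begin

text \<open>Write \<open>C = C(G,k)\<close> and let \<open>ev\<^sub>g : C \<otimes> V \<rightarrow> V\<close> be the map \<open>f \<otimes> w \<mapsto> f(g) w\<close>. For the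
  Banach spaces \<open>V\<close> that occur, \<open>C \<otimes> V \<cong> C(G,V)\<close>: under the strong triangle inequality a continuous
  function on the compact group is a uniform limit of locally constant functions, on which the map is
  isometric. Hence elements of iterated tensor products are determined by their evaluations. In these
  terms coassociativity and counitality of \<open>\<rho> : X \<rightarrow> C \<otimes> X\<close> say that
  \<open>ev\<^sub>h(\<rho>(ev\<^sub>g(\<rho> x))) = ev\<^bsub>gh\<^esub>(\<rho> x)\<close> and \<open>ev\<^sub>1(\<rho> x) = x\<close>, each at some common stage of \<open>X\<close>, uniformly
  in \<open>g\<close>, \<open>h\<close>, \<open>x\<close>. So a \<open>G\<close>-module becomes a comodule by \<open>x \<mapsto> (g \<mapsto> g\<^sup>-\<^sup>1x)\<close>, with the same morphisms.

  A comodule is in general only bounded, not isometric, under the action it defines. It is replaced by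
  an isomorphic one: the functions \<open>f : G \<rightarrow> X\<^sub>j\<close> with \<open>f(gh) = ev\<^sub>h(\<rho>(f(g)))\<close> at a given stage form a
  Banach space on which \<open>G\<close> acts by left translation, hence isometrically; these spaces form an ind-object,
  and \<open>f \<mapsto> f(1)\<close> is an isomorphism from it to \<open>X\<close> with inverse \<open>x \<mapsto> (g \<mapsto> ev\<^sub>g(\<rho> x))\<close>.\<close>

text \<open>With the usual triangle inequality the projective norm need not be comparable to the
  supremum norm, so there the isomorphism C \<otimes> V \<cong> C(G,V) is the hypothesis
  \<open>usual\<close>. It is assumed for spaces carried by \<open>'u\<close> only; iterated tensor
  products live in other types and are reached by transport along isomorphisms with spaces in
  \<open>'u\<close> (\<open>small\<close>).

  Ind-objects give equalities only at unspecified later stages. An equality that must hold for all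
  group elements has to find one stage for all of them, which pointwise arguments do not give;
  evaluation therefore turns group elements into parameters of \<open>geq\<close>. For the same
  reason a function on G cannot simply be called an orbit map: the stage l and the two arrows along
  which its equation is tested belong to the index. The new spaces are thus indexed by quadruples
  (j, l, a, b), and both these and the functions on G must be coded in \<open>'u\<close>, whence the
  closure of the universe under families over \<nat> \<times> G.

  Since the hom-sets agree literally, this essential surjectivity is all that the equivalence asks
  for beyond the functor itself.\<close>

abbreviation dst :: "('k, 'a) nspace => 'a => 'a => real" where
  "dst V x y == nrm V (x \<ominus>\<^bsub>V\<^esub> y)"

abbreviation elts :: "('i, 'm, 'k, 'a) ind => 'i => 'a set" where
  "elts X i == carrier (at_idx X i)"

section \<open>Complete valued fields and the two triangle inequalities\<close>

locale valued =
  fixes v :: "'k::field => real" and c :: convention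
  assumes cvf: "complete_valued_field v" and conv: "c = Strong ==> nonarchimedean v"
begin

abbreviation bs :: "('k, 'a) nspace => bool" where "bs \<equiv> banach_space v c"

lemma v_nonneg [simp]: "0 \<le> v x" and v_eq_0 [simp]: "v x = 0 \<longleftrightarrow> x = 0"
  and v_mult [simp]: "v (x * y) = v x * v y" and v_add: "v (x + y) \<le> v x + v y"
  using cvf unfolding complete_valued_field_def by auto

lemma v_0 [simp]: "v 0 = 0" by simp

lemma v_1 [simp]: "v 1 = 1"
proof -
  have "v 1 = v 1 * v 1" using v_mult[of 1 1] by simp
  moreover have "v 1 \<noteq> 0" by (subst v_eq_0) simp
  ultimately show ?thesis by simp
qed

lemma v_m1 [simp]: "v (- 1) = 1"
proof -
  have "v (-1) * v (-1) = 1" using v_mult[of "-1" "-1"] by simp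
  hence "(v (-1))^2 = 1" by (simp add: power2_eq_square)
  thus ?thesis using v_nonneg[of "-1"] by (simp add: power2_eq_1_iff)
qed

lemma v_minus [simp]: "v (- x) = v x"
  using v_mult[of "-1" x] by simp

end

text \<open>One operation for both conventions. On nonnegative reals it is associative, monotone and
  homogeneous, has unit 0 and never exceeds the sum, which lets most estimates be made once.\<close>

definition tri :: "convention => real => real => real" where
  "tri c a b = (case c of Usual => a + b | Strong => max a b)"

lemma tri_le: "0 \<le> a ==> 0 \<le> b ==> tri c a b \<le> a + b"
  by (simp add: tri_def split: convention.split)

lemma tri_mono: "a \<le> a' ==> b \<le> b' ==> tri c a b \<le> tri c a' b'"
  by (auto simp: tri_def split: convention.split)

lemma tri_mult: "0 \<le> t ==> tri c (t * a) (t * b) = t * tri c a b"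
  by (cases c) (simp_all add: tri_def algebra_simps max_mult_distrib_left)

lemma tri_nonneg: "0 \<le> a ==> 0 \<le> b ==> 0 \<le> tri c a b"
  by (auto simp: tri_def split: convention.split)

lemma tri_0 [simp]: "0 \<le> a ==> tri c a 0 = a" "0 \<le> a ==> tri c 0 a = a"
  by (auto simp: tri_def split: convention.split)

lemma tri_assoc: "tri c (tri c x y) z = tri c x (tri c y z)"
  by (auto simp: tri_def split: convention.split)

lemma tri_tendsto: "(a \<longlongrightarrow> A) F ==> (b \<longlongrightarrow> B) F ==> ((%n. tri c (a n) (b n)) \<longlongrightarrow> tri c A B) F"
  by (cases c) (auto simp: tri_def intro: tendsto_intros)

section \<open>Modules over the field of scalars\<close>

lemma module_typeI:
  fixes V :: "('k::field, 'a, 'z) module_scheme" (structure)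
  assumes "abelian_group V"
    and "!!a x. x \<in> carrier V ==> a \<odot> x \<in> carrier V"
    and "!!a b x. x \<in> carrier V ==> (a + b) \<odot> x = a \<odot> x \<oplus> b \<odot> x"
    and "!!a x y. x \<in> carrier V ==> y \<in> carrier V ==> a \<odot> (x \<oplus> y) = a \<odot> x \<oplus> a \<odot> y"
    and "!!a b x. x \<in> carrier V ==> (a * b) \<odot> x = a \<odot> (b \<odot> x)"
    and "!!x. x \<in> carrier V ==> 1 \<odot> x = x"
  shows "Module.module (ring_of_type_algebra :: 'k ring) V"
proof (rule moduleI)
  show "cring (ring_of_type_algebra :: 'k ring)" by (rule cring_from_type_algebra)
qed (use assms in \<open>auto simp: ring_of_type_algebra_def\<close>)

lemma module_typeD:
  fixes V :: "('k::field, 'a, 'z) module_scheme" (structure)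
  assumes "Module.module (ring_of_type_algebra :: 'k ring) V"
  shows "abelian_group V"
    and "!!a x. x \<in> carrier V ==> a \<odot> x \<in> carrier V"
    and "!!a b x. x \<in> carrier V ==> (a + b) \<odot> x = a \<odot> x \<oplus> b \<odot> x"
    and "!!a x y. x \<in> carrier V ==> y \<in> carrier V ==> a \<odot> (x \<oplus> y) = a \<odot> x \<oplus> a \<odot> y"
    and "!!a b x. x \<in> carrier V ==> (a * b) \<odot> x = a \<odot> (b \<odot> x)"
    and "!!x. x \<in> carrier V ==> 1 \<odot> x = x"
    and "!!x. x \<in> carrier V ==> 0 \<odot> x = \<zero>"
    and "!!a. a \<odot> \<zero> = \<zero>"
    and "!!a x. x \<in> carrier V ==> a \<odot> (\<ominus> x) = \<ominus> (a \<odot> x)"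
    and "!!a x. x \<in> carrier V ==> (- a) \<odot> x = \<ominus> (a \<odot> x)"
proof -
  interpret module "ring_of_type_algebra :: 'k ring" V by fact
  show "abelian_group V" by (rule abelian_group_axioms)
  show 1: "a \<odot> x \<in> carrier V" if "x \<in> carrier V" for a x
    using that smult_closed[of a x] by (simp add: ring_of_type_algebra_def)
  show 2: "(a + b) \<odot> x = a \<odot> x \<oplus> b \<odot> x" if "x \<in> carrier V" for a b x
    using that smult_l_distr[of a b x] by (simp add: ring_of_type_algebra_def)
  show 3: "a \<odot> (x \<oplus> y) = a \<odot> x \<oplus> a \<odot> y" if "x \<in> carrier V" "y \<in> carrier V" for a x y
    using that smult_r_distr[of a x y] by (simp add: ring_of_type_algebra_def)
  show "(a * b) \<odot> x = a \<odot> (b \<odot> x)" if "x \<in> carrier V" for a b x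
    using that smult_assoc1[of a b x] by (simp add: ring_of_type_algebra_def)
  show "1 \<odot> x = x" if "x \<in> carrier V" for x
    using that smult_one[of x] by (simp add: ring_of_type_algebra_def)
  show 4: "0 \<odot> x = \<zero>" if "x \<in> carrier V" for x
    using that smult_l_null[of x] by (simp add: ring_of_type_algebra_def)
  show 5: "a \<odot> \<zero> = \<zero>" for a
    using smult_r_null[of a] by (simp add: ring_of_type_algebra_def)
  show "a \<odot> (\<ominus> x) = \<ominus> (a \<odot> x)" if x: "x \<in> carrier V" for a x
  proof -
    have "a \<odot> (\<ominus> x) \<oplus> a \<odot> x = \<zero>"
      using 3[of "\<ominus> x" x a] x 5 by (simp add: M.l_neg)
    thus ?thesis using x 1 M.minus_equality by (metis M.a_inv_closed)
  qed
  show "(- a) \<odot> x = \<ominus> (a \<odot> x)" if x: "x \<in> carrier V" for a x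
  proof -
    have "(- a) \<odot> x \<oplus> a \<odot> x = \<zero>"
      using 2[of x "-a" a] x 4 by simp
    thus ?thesis using x 1 M.minus_equality by metis
  qed
qed

section \<open>Banach spaces: arithmetic, norms and limits\<close>

definition vlim :: "('k, 'a) nspace => (nat => 'a) => 'a => bool" where
  "vlim V s l \<longleftrightarrow> (\<forall>n. s n \<in> carrier V) \<and> l \<in> carrier V \<and> (%n. dst V (s n) l) \<longlonglongrightarrow> 0"

definition vcauchy :: "('k, 'a) nspace => (nat => 'a) => bool" where
  "vcauchy V s \<longleftrightarrow> (\<forall>n. s n \<in> carrier V) \<and>
     (\<forall>e>0. \<exists>N. \<forall>m\<ge>N. \<forall>n\<ge>N. dst V (s m) (s n) < e)"

context valued
begin

text \<open>Subtraction on a record goes through inverses in its additive group, which make sense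
  only once that group is known. Differences are written here as x + (-1)y instead, so that all
  conditions speak of the given operations alone.\<close>

lemma bsI:
  fixes V :: "('k, 'a) nspace" (structure)
  assumes add: "!!x y. x \<in> carrier V ==> y \<in> carrier V ==> x \<oplus> y \<in> carrier V"
    and zero: "\<zero> \<in> carrier V"
    and smult: "!!a x. x \<in> carrier V ==> a \<odot> x \<in> carrier V"
    and assoc: "!!x y z. x \<in> carrier V ==> y \<in> carrier V ==> z \<in> carrier V ==>
      (x \<oplus> y) \<oplus> z = x \<oplus> (y \<oplus> z)"
    and comm: "!!x y. x \<in> carrier V ==> y \<in> carrier V ==> x \<oplus> y = y \<oplus> x"
    and lzero: "!!x. x \<in> carrier V ==> \<zero> \<oplus> x = x"
    and neg: "!!x. x \<in> carrier V ==> (- 1) \<odot> x \<oplus> x = \<zero>"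
    and ld: "!!a b x. x \<in> carrier V ==> (a + b) \<odot> x = a \<odot> x \<oplus> b \<odot> x"
    and rd: "!!a x y. x \<in> carrier V ==> y \<in> carrier V ==> a \<odot> (x \<oplus> y) = a \<odot> x \<oplus> a \<odot> y"
    and sa: "!!a b x. x \<in> carrier V ==> (a * b) \<odot> x = a \<odot> (b \<odot> x)"
    and one: "!!x. x \<in> carrier V ==> 1 \<odot> x = x"
    and nn: "!!x. x \<in> carrier V ==> 0 \<le> nrm V x"
    and n0: "!!x. x \<in> carrier V ==> nrm V x = 0 ==> x = \<zero>"
    and nz: "nrm V \<zero> = 0"
    and ns: "!!a x. x \<in> carrier V ==> nrm V (a \<odot> x) = v a * nrm V x"
    and nt: "!!x y. x \<in> carrier V ==> y \<in> carrier V ==> nrm V (x \<oplus> y) \<le> tri c (nrm V x) (nrm V y)"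
    and complete: "!!s :: nat => 'a. (\<forall>n. s n \<in> carrier V) ==>
        (\<forall>e>0. \<exists>N. \<forall>m\<ge>N. \<forall>n\<ge>N. nrm V (s m \<oplus> (- 1) \<odot> s n) < e) ==>
        (\<exists>l\<in>carrier V. (%n. nrm V (s n \<oplus> (- 1) \<odot> l)) \<longlonglongrightarrow> 0)"
  shows "bs V"
proof -
  have "abelian_group V"
  proof (rule abelian_groupI)
    fix x assume "x \<in> carrier V"
    thus "\<exists>y\<in>carrier V. y \<oplus> x = \<zero>"
      using neg[of x] smult[of x "-1"] by blast
  qed (use add zero assoc comm lzero in auto)
  hence M: "Module.module (ring_of_type_algebra :: 'k ring) V"
    by (rule module_typeI) (use smult ld rd sa one in auto)
  note D = module_typeD[OF M]
  interpret abelian_group V by (rule D)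
  have dif: "x \<ominus> y = x \<oplus> (- 1) \<odot> y" if "x \<in> carrier V" "y \<in> carrier V" for x y
    using that D(10)[of y 1] one by (simp add: minus_eq)
  show ?thesis
    unfolding banach_space_def
  proof (intro conjI allI ballI impI M)
    fix s :: "nat => 'a" assume s: "(\<forall>n. s n \<in> carrier V) \<and>
          (\<forall>e>0. \<exists>N. \<forall>m\<ge>N. \<forall>n\<ge>N. dst V (s m) (s n) < e)"
    have "\<exists>l\<in>carrier V. (%n. nrm V (s n \<oplus> (- 1) \<odot> l)) \<longlonglongrightarrow> 0"
      by (rule complete) (use s dif in auto)
    thus "\<exists>l\<in>carrier V. (%n. dst V (s n) l) \<longlonglongrightarrow> 0"
      using dif s by auto
  qed (use nn n0 nz ns nt in \<open>auto simp: tri_def\<close>)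
qed

lemma bs_module: "bs V ==> Module.module (ring_of_type_algebra :: 'k ring) V"
  unfolding banach_space_def by blast

lemma bs_ag: "bs V ==> abelian_group V"
  using bs_module module_typeD(1) by blast

lemma bs_closed [simp]:
  fixes V (structure) assumes "bs V"
  shows "\<zero> \<in> carrier V"
    "x \<in> carrier V ==> y \<in> carrier V ==> x \<oplus> y \<in> carrier V"
    "x \<in> carrier V ==> \<ominus> x \<in> carrier V"
    "x \<in> carrier V ==> y \<in> carrier V ==> x \<ominus> y \<in> carrier V"
    "x \<in> carrier V ==> a \<odot> x \<in> carrier V"
proof -
  interpret abelian_group V by (rule bs_ag[OF assms])
  show "\<zero> \<in> carrier V"
    "x \<in> carrier V ==> y \<in> carrier V ==> x \<oplus> y \<in> carrier V"
    "x \<in> carrier V ==> \<ominus> x \<in> carrier V"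
    "x \<in> carrier V ==> y \<in> carrier V ==> x \<ominus> y \<in> carrier V" by auto
  show "x \<in> carrier V ==> a \<odot> x \<in> carrier V"
    by (rule module_typeD(2)[OF bs_module[OF assms]])
qed

lemma bs_ac:
  fixes V (structure) assumes "bs V"
  shows "x \<in> carrier V ==> y \<in> carrier V ==> z \<in> carrier V ==> x \<oplus> y \<oplus> z = x \<oplus> (y \<oplus> z)"
    "x \<in> carrier V ==> y \<in> carrier V ==> x \<oplus> y = y \<oplus> x"
    "x \<in> carrier V ==> y \<in> carrier V ==> z \<in> carrier V ==> x \<oplus> (y \<oplus> z) = y \<oplus> (x \<oplus> z)"
proof -
  interpret abelian_group V by (rule bs_ag[OF assms])
  show "x \<in> carrier V ==> y \<in> carrier V ==> z \<in> carrier V ==> x \<oplus> y \<oplus> z = x \<oplus> (y \<oplus> z)"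
    "x \<in> carrier V ==> y \<in> carrier V ==> x \<oplus> y = y \<oplus> x"
    "x \<in> carrier V ==> y \<in> carrier V ==> z \<in> carrier V ==> x \<oplus> (y \<oplus> z) = y \<oplus> (x \<oplus> z)"
    by (auto simp: a_ac)
qed

lemma bs_simps [simp]:
  fixes V (structure) assumes "bs V"
  shows "x \<in> carrier V ==> \<zero> \<oplus> x = x" "x \<in> carrier V ==> x \<oplus> \<zero> = x"
    "x \<in> carrier V ==> \<ominus> x \<oplus> x = \<zero>" "x \<in> carrier V ==> x \<oplus> \<ominus> x = \<zero>"
    "x \<in> carrier V ==> x \<ominus> x = \<zero>" "x \<in> carrier V ==> x \<ominus> \<zero> = x"
    "x \<in> carrier V ==> \<ominus> (\<ominus> x) = x" "\<ominus> \<zero> = \<zero>"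
    "x \<in> carrier V ==> y \<in> carrier V ==> \<ominus> (x \<ominus> y) = y \<ominus> x"
    "x \<in> carrier V ==> y \<in> carrier V ==> (x \<ominus> y) \<oplus> y = x"
    "x \<in> carrier V ==> 1 \<odot> x = x" "x \<in> carrier V ==> 0 \<odot> x = \<zero>" "a \<odot> \<zero> = \<zero>"
proof -
  interpret abelian_group V by (rule bs_ag[OF assms])
  show *: "x \<in> carrier V ==> \<zero> \<oplus> x = x" "x \<in> carrier V ==> x \<oplus> \<zero> = x"
    "x \<in> carrier V ==> \<ominus> x \<oplus> x = \<zero>" "x \<in> carrier V ==> x \<oplus> \<ominus> x = \<zero>"
    "x \<in> carrier V ==> x \<ominus> x = \<zero>"
    "x \<in> carrier V ==> \<ominus> (\<ominus> x) = x" by (auto simp: minus_eq r_neg l_neg)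
  show m0: "\<ominus> \<zero> = \<zero>" by (metis minus_equality r_zero zero_closed)
  show "x \<in> carrier V ==> x \<ominus> \<zero> = x" by (simp add: minus_eq m0)
  show "x \<in> carrier V ==> y \<in> carrier V ==> \<ominus> (x \<ominus> y) = y \<ominus> x"
    by (simp add: minus_eq minus_add a_ac)
  show "x \<in> carrier V ==> y \<in> carrier V ==> (x \<ominus> y) \<oplus> y = x"
    by (simp add: minus_eq a_assoc l_neg)
  show "x \<in> carrier V ==> 1 \<odot> x = x" "x \<in> carrier V ==> 0 \<odot> x = \<zero>" "a \<odot> \<zero> = \<zero>"
    by (rule module_typeD[OF bs_module[OF assms]] | assumption)+
qed

lemma bs_smult:
  fixes V (structure) assumes "bs V"
  shows "x \<in> carrier V ==> (a + b) \<odot> x = a \<odot> x \<oplus> b \<odot> x"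
    "x \<in> carrier V ==> y \<in> carrier V ==> a \<odot> (x \<oplus> y) = a \<odot> x \<oplus> a \<odot> y"
    "x \<in> carrier V ==> a \<odot> (b \<odot> x) = (a * b) \<odot> x"
    "x \<in> carrier V ==> a \<odot> (\<ominus> x) = \<ominus> (a \<odot> x)"
    "x \<in> carrier V ==> (- a) \<odot> x = \<ominus> (a \<odot> x)"
    "x \<in> carrier V ==> (a - b) \<odot> x = a \<odot> x \<ominus> b \<odot> x"
    "x \<in> carrier V ==> y \<in> carrier V ==> a \<odot> (x \<ominus> y) = a \<odot> x \<ominus> a \<odot> y"
proof -
  note D = module_typeD[OF bs_module[OF assms]]
  show "x \<in> carrier V ==> (a + b) \<odot> x = a \<odot> x \<oplus> b \<odot> x"
    "x \<in> carrier V ==> y \<in> carrier V ==> a \<odot> (x \<oplus> y) = a \<odot> x \<oplus> a \<odot> y"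
    "x \<in> carrier V ==> a \<odot> (b \<odot> x) = (a * b) \<odot> x"
    "x \<in> carrier V ==> a \<odot> (\<ominus> x) = \<ominus> (a \<odot> x)"
    "x \<in> carrier V ==> (- a) \<odot> x = \<ominus> (a \<odot> x)"
    using D by auto
  show "x \<in> carrier V ==> (a - b) \<odot> x = a \<odot> x \<ominus> b \<odot> x"
    using D(3)[of x a "-b"] D(10)[of x b] by (simp add: a_minus_def)
  show "x \<in> carrier V ==> y \<in> carrier V ==> a \<odot> (x \<ominus> y) = a \<odot> x \<ominus> a \<odot> y"
    using D(4)[of x "\<ominus> y" a] D(9)[of y a] assms by (simp add: a_minus_def)
qed

lemma bs_neg_conv: "bs V ==> x \<in> carrier V ==> \<ominus>\<^bsub>V\<^esub> x = (- 1) \<odot>\<^bsub>V\<^esub> x"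
  using bs_smult(5)[of V x 1] by simp

lemma bs_dif_conv: fixes V (structure) shows "bs V ==> x \<in> carrier V ==> y \<in> carrier V ==> x \<ominus> y = x \<oplus> (- 1) \<odot> y"
  by (simp add: a_minus_def bs_neg_conv)

lemma bs_diff_add:
  fixes V (structure) assumes "bs V" "x \<in> carrier V" "y \<in> carrier V" "x' \<in> carrier V" "y' \<in> carrier V"
  shows "(x \<oplus> y) \<ominus> (x' \<oplus> y') = (x \<ominus> x') \<oplus> (y \<ominus> y')"
proof -
  interpret abelian_group V by (rule bs_ag[OF assms(1)])
  show ?thesis using assms by (simp add: minus_eq minus_add a_ac)
qed

lemma bs_diff_trans:
  fixes V (structure) assumes "bs V" "x \<in> carrier V" "y \<in> carrier V" "z \<in> carrier V"
  shows "x \<ominus> z = (x \<ominus> y) \<oplus> (y \<ominus> z)"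
proof -
  interpret abelian_group V by (rule bs_ag[OF assms(1)])
  have "(x \<ominus> y) \<oplus> (y \<ominus> z) = ((x \<ominus> y) \<oplus> y) \<oplus> \<ominus> z"
    unfolding a_minus_def[of V y z] using assms by (subst a_assoc) auto
  thus ?thesis using assms by (simp add: a_minus_def[of V x z])
qed

lemma bs_diff_zero: "bs V ==> x \<in> carrier V ==> y \<in> carrier V ==> x \<ominus>\<^bsub>V\<^esub> y = \<zero>\<^bsub>V\<^esub> ==> x = y"
  by (metis bs_simps(1,10))

lemma nrm_nonneg [simp]: "bs V ==> x \<in> carrier V ==> 0 \<le> nrm V x"
  and nrm_eq_0: "bs V ==> x \<in> carrier V ==> nrm V x = 0 \<longleftrightarrow> x = \<zero>\<^bsub>V\<^esub>"
  and nrm_smult [simp]: "bs V ==> x \<in> carrier V ==> nrm V (a \<odot>\<^bsub>V\<^esub> x) = v a * nrm V x"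
  and nrm_tri: "bs V ==> x \<in> carrier V ==> y \<in> carrier V ==>
    nrm V (x \<oplus>\<^bsub>V\<^esub> y) \<le> tri c (nrm V x) (nrm V y)"
  unfolding banach_space_def tri_def by auto

lemma nrm_zero [simp]: "bs V ==> nrm V \<zero>\<^bsub>V\<^esub> = 0"
  by (subst nrm_eq_0) auto

lemma nrm_add: "bs V ==> x \<in> carrier V ==> y \<in> carrier V ==> nrm V (x \<oplus>\<^bsub>V\<^esub> y) \<le> nrm V x + nrm V y"
  by (rule order_trans[OF nrm_tri tri_le]) auto

lemma nrm_neg [simp]: "bs V ==> x \<in> carrier V ==> nrm V (\<ominus>\<^bsub>V\<^esub> x) = nrm V x"
  by (simp add: bs_neg_conv)

lemma nrm_commute: "bs V ==> x \<in> carrier V ==> y \<in> carrier V ==> dst V x y = dst V y x"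
  by (metis bs_closed(4) bs_simps(9) nrm_neg)

lemma nrm_dist_trans: "bs V ==> x \<in> carrier V ==> y \<in> carrier V ==> z \<in> carrier V ==>
    dst V x z \<le> dst V x y + dst V y z"
  using nrm_add[of V "x \<ominus>\<^bsub>V\<^esub> y" "y \<ominus>\<^bsub>V\<^esub> z"] by (simp add: bs_diff_trans[of V x y z])

lemma nrm_dist_tri: "bs V ==> x \<in> carrier V ==> y \<in> carrier V ==> z \<in> carrier V ==>
    dst V x z \<le> tri c (dst V x y) (dst V y z)"
  using nrm_tri[of V "x \<ominus>\<^bsub>V\<^esub> y" "y \<ominus>\<^bsub>V\<^esub> z"] by (simp add: bs_diff_trans[of V x y z])

lemma nrm_le_diff: "bs V ==> x \<in> carrier V ==> y \<in> carrier V ==> nrm V x \<le> dst V x y + nrm V y"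
  using nrm_add[of V "x \<ominus>\<^bsub>V\<^esub> y" y] by simp

lemma nrm_abs_diff: "bs V ==> x \<in> carrier V ==> y \<in> carrier V ==>
    \<bar>nrm V x - nrm V y\<bar> \<le> dst V x y"
  using nrm_le_diff[of V x y] nrm_le_diff[of V y x] nrm_commute[of V x y] by simp

lemma nrm_small_eq:
  assumes "bs V" "x \<in> carrier V" "y \<in> carrier V" "!!e. e > 0 ==> dst V x y \<le> e"
  shows "x = y"
proof -
  have "dst V x y \<le> 0" by (rule field_le_epsilon) (use assms in auto)
  hence "dst V x y = 0" by (rule antisym) (use assms in auto)
  thus ?thesis using assms nrm_eq_0[of V "x \<ominus>\<^bsub>V\<^esub> y"] bs_diff_zero by auto
qed

lemma bs_complete: "bs V ==> vcauchy V s ==> \<exists>l. vlim V s l"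
  unfolding banach_space_def vcauchy_def vlim_def by blast

lemma vlim_carrier: "vlim V s l ==> l \<in> carrier V" "vlim V s l ==> s n \<in> carrier V"
  by (auto simp: vlim_def)

lemma vlim_unique:
  assumes "bs V" "vlim V s l" "vlim V s l'" shows "l = l'"
proof (rule nrm_small_eq[OF assms(1)])
  show c: "l \<in> carrier V" "l' \<in> carrier V" using assms by (auto simp: vlim_def)
  have "(%n. dst V (s n) l + dst V (s n) l') \<longlonglongrightarrow> 0 + 0"
    by (rule tendsto_add) (use assms in \<open>auto simp: vlim_def\<close>)
  moreover have "dst V l l' \<le> dst V (s n) l + dst V (s n) l'" for n
    using nrm_dist_trans[of V l "s n" l'] nrm_commute[of V l "s n"] assms by (auto simp: vlim_def)
  ultimately have "dst V l l' \<le> 0"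
    by (intro LIMSEQ_le_const[where X="%n. dst V (s n) l + dst V (s n) l'"]) auto
  thus "dst V l l' \<le> e" if "e > 0" for e using that by simp
qed

lemma vlim_cauchy:
  assumes "bs V" "vlim V s l" shows "vcauchy V s"
  unfolding vcauchy_def
proof (intro conjI allI impI)
  show "s n \<in> carrier V" for n using assms by (auto simp: vlim_def)
  fix e :: real assume "e > 0"
  hence "e/2 > 0" by simp
  then obtain N where N: "!!n. n \<ge> N ==> dst V (s n) l < e/2"
  proof -
    have "eventually (%n. dst V (s n) l < e/2) sequentially"
      using assms(2) \<open>e/2 > 0\<close> by (intro order_tendstoD(2)[of _ 0]) (auto simp: vlim_def)
    thus ?thesis using that by (auto simp: eventually_sequentially)
  qed
  show "\<exists>N. \<forall>m\<ge>N. \<forall>n\<ge>N. dst V (s m) (s n) < e"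
  proof (intro exI allI impI)
    fix m n assume "m \<ge> N" "n \<ge> N"
    thus "dst V (s m) (s n) < e"
      using nrm_dist_trans[of V "s m" l "s n"] nrm_commute[of V l "s n"] N[of m] N[of n] assms
      by (auto simp: vlim_def)
  qed
qed

lemma vlim_const: "bs V ==> x \<in> carrier V ==> vlim V (%n. x) x"
  by (simp add: vlim_def)

lemma vlim_le:
  assumes V: "bs V" and s: "!!n. s n \<in> carrier V" "l \<in> carrier V"
    and le: "!!n. dst V (s n) l \<le> t n" and t: "t \<longlonglongrightarrow> 0"
  shows "vlim V s l"
  unfolding vlim_def
proof (intro conjI allI s)
  show "(%n. dst V (s n) l) \<longlonglongrightarrow> 0"
    by (rule tendsto_sandwich[OF _ _ tendsto_const t]) (use V s le in auto)
qed

lemma vlim_add: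
  fixes V (structure) assumes "bs V" "vlim V s l" "vlim V t m" shows "vlim V (%n. s n \<oplus> t n) (l \<oplus> m)"
proof (rule vlim_le[OF assms(1)])
  show "s n \<oplus> t n \<in> carrier V" "l \<oplus> m \<in> carrier V" for n using assms by (auto simp: vlim_def)
  show "dst V (s n \<oplus> t n) (l \<oplus> m) \<le> dst V (s n) l + dst V (t n) m" for n
    using assms by (auto simp: vlim_def bs_diff_add intro!: nrm_add)
  show "(%n. dst V (s n) l + dst V (t n) m) \<longlonglongrightarrow> 0"
    using assms tendsto_add[of "%n. dst V (s n) l" 0 sequentially "%n. dst V (t n) m" 0]
    by (auto simp: vlim_def)
qed

lemma vlim_smult:
  fixes V (structure) assumes "bs V" "vlim V s l" shows "vlim V (%n. a \<odot> s n) (a \<odot> l)"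
proof (rule vlim_le[OF assms(1)])
  show "a \<odot> s n \<in> carrier V" "a \<odot> l \<in> carrier V" for n using assms by (auto simp: vlim_def)
  show "dst V (a \<odot> s n) (a \<odot> l) \<le> v a * dst V (s n) l" for n
    using assms by (simp add: vlim_def bs_smult(7)[symmetric])
  show "(%n. v a * dst V (s n) l) \<longlonglongrightarrow> 0"
    using assms by (auto simp: vlim_def intro: tendsto_mult_right_zero)
qed

lemma vlim_nrm:
  assumes "bs V" "vlim V s l" shows "(%n. nrm V (s n)) \<longlonglongrightarrow> nrm V l"
proof -
  have "(%n. nrm V (s n) - nrm V l) \<longlonglongrightarrow> 0"
    by (rule Lim_null_comparison[where g="%n. dst V (s n) l"])
       (use assms nrm_abs_diff[OF assms(1)] in \<open>auto simp: vlim_def\<close>)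
  thus ?thesis by (simp add: LIM_zero_iff)
qed

section \<open>Bounded linear maps\<close>

lemma blI:
  assumes "!!x. x \<in> carrier V ==> f x \<in> carrier W" "!!x. x \<notin> carrier V ==> f x = undefined"
    and "!!x y. x \<in> carrier V ==> y \<in> carrier V ==> f (x \<oplus>\<^bsub>V\<^esub> y) = f x \<oplus>\<^bsub>W\<^esub> f y"
    and "!!a x. x \<in> carrier V ==> f (a \<odot>\<^bsub>V\<^esub> x) = a \<odot>\<^bsub>W\<^esub> f x"
    and "!!x. x \<in> carrier V ==> nrm W (f x) \<le> B * nrm V x"
  shows "f \<in> bl_hom V W"
  unfolding bl_hom_def using assms by (auto simp: PiE_iff extensional_def intro!: exI[of _ B])

lemma bl_closed [simp]: "f \<in> bl_hom V W ==> x \<in> carrier V ==> f x \<in> carrier W"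
  and bl_undef: "f \<in> bl_hom V W ==> x \<notin> carrier V ==> f x = undefined"
  and bl_add [simp]: "f \<in> bl_hom V W ==> x \<in> carrier V ==> y \<in> carrier V ==> f (x \<oplus>\<^bsub>V\<^esub> y) = f x \<oplus>\<^bsub>W\<^esub> f y"
  and bl_smult [simp]: "f \<in> bl_hom V W ==> x \<in> carrier V ==> f (a \<odot>\<^bsub>V\<^esub> x) = a \<odot>\<^bsub>W\<^esub> f x"
  unfolding bl_hom_def by auto

text \<open>The bound in \<open>bl_hom\<close> may have any sign; raising it to at least 1 gives a
  positive factor, by which inequalities can be multiplied.\<close>

lemma bl_bound:
  assumes "bs V" "f \<in> bl_hom V W"
  obtains B where "B > 0" "!!x. x \<in> carrier V ==> nrm W (f x) \<le> B * nrm V x"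
proof -
  obtain B where B: "!!x. x \<in> carrier V ==> nrm W (f x) \<le> B * nrm V x"
    using assms(2) unfolding bl_hom_def by blast
  have "nrm W (f x) \<le> max B 1 * nrm V x" if "x \<in> carrier V" for x
    by (rule order_trans[OF B[OF that] mult_right_mono]) (use that assms in auto)
  moreover have "max B 1 > 0" by simp
  ultimately show ?thesis using that by blast
qed

lemma bl_ext: "f \<in> bl_hom V W ==> g \<in> bl_hom V W ==> (!!x. x \<in> carrier V ==> f x = g x) ==> f = g"
  unfolding bl_hom_def by (auto intro: PiE_ext)

lemma bl_diff: "f \<in> bl_hom V W ==> bs V ==> bs W ==> x \<in> carrier V ==> y \<in> carrier V ==>
    f (x \<ominus>\<^bsub>V\<^esub> y) = f x \<ominus>\<^bsub>W\<^esub> f y"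
  by (simp add: bs_dif_conv)

lemma bl_zero: fixes V (structure) shows "f \<in> bl_hom V W ==> bs V ==> bs W ==> f \<zero> = \<zero>\<^bsub>W\<^esub>"
  using bl_smult[of f V W "\<zero>" 0] bl_closed[of f V W "\<zero>"] by simp

lemma bl_id [simp]: "ban_id V \<in> bl_hom V V" if "bs V"
  by (rule blI[where B=1]) (use that in \<open>auto simp: ban_id_def\<close>)

lemma ban_id_apply [simp]: "x \<in> carrier V ==> ban_id V x = x"
  by (simp add: ban_id_def)

lemma bl_comp [simp]:
  assumes "f \<in> bl_hom V W" "g \<in> bl_hom W Z" "bs V" "bs W"
  shows "compose (carrier V) g f \<in> bl_hom V Z"
proof -
  obtain B where B: "B > 0" "!!x. x \<in> carrier V ==> nrm W (f x) \<le> B * nrm V x"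
    by (rule bl_bound[OF assms(3,1)]) blast
  obtain C where C: "C > 0" "!!x. x \<in> carrier W ==> nrm Z (g x) \<le> C * nrm W x"
    by (rule bl_bound[OF assms(4,2)]) blast
  show ?thesis
  proof (rule blI[where B="C * B"])
    fix x assume x: "x \<in> carrier V"
    have "nrm Z (g (f x)) \<le> C * (B * nrm V x)"
      by (rule order_trans[OF C(2)]) (use assms x B C in \<open>auto intro!: mult_left_mono\<close>)
    thus "nrm Z (compose (carrier V) g f x) \<le> C * B * nrm V x" using x by (simp add: compose_eq)
  qed (use assms in \<open>auto simp: compose_def\<close>)
qed

lemma bl_id_left [simp]: "f \<in> bl_hom V W ==> compose (carrier V) (ban_id W) f = f"
  unfolding bl_hom_def by (intro extensionalityI[of _ "carrier V"]) (auto simp: compose_def ban_id_def PiE_iff extensional_def)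

lemma bl_id_right [simp]: "f \<in> bl_hom V W ==> compose (carrier V) f (ban_id V) = f"
  unfolding bl_hom_def by (intro extensionalityI[of _ "carrier V"]) (auto simp: compose_def ban_id_def PiE_iff extensional_def)

lemma bl_assoc: "f \<in> bl_hom V W ==>
   compose (carrier V) h (compose (carrier V) g f) = compose (carrier V) (compose (carrier W) h g) f"
  by (rule ext) (auto simp: compose_def)

lemma bl_vlim:
  assumes "f \<in> bl_hom V W" "bs V" "bs W" "vlim V s l" shows "vlim W (%n. f (s n)) (f l)"
proof -
  obtain B where B: "B > 0" "!!x. x \<in> carrier V ==> nrm W (f x) \<le> B * nrm V x"
    by (rule bl_bound[OF assms(2,1)]) blast
  show ?thesis
  proof (rule vlim_le[OF assms(3)])
    show "f (s n) \<in> carrier W" "f l \<in> carrier W" for n using assms by (auto simp: vlim_def)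
    show "dst W (f (s n)) (f l) \<le> B * dst V (s n) l" for n
      using B(2)[of "s n \<ominus>\<^bsub>V\<^esub> l"] assms by (auto simp: vlim_def bl_diff)
    show "(%n. B * dst V (s n) l) \<longlonglongrightarrow> 0"
      using assms by (auto simp: vlim_def intro: tendsto_mult_right_zero)
  qed
qed

lemma bl_ext_dense:
  assumes "f \<in> bl_hom V W" "g \<in> bl_hom V W" "bs V" "bs W"
    and dense: "!!x. x \<in> carrier V ==> \<exists>s. vlim V s x \<and> (\<forall>n. f (s n) = g (s n))"
  shows "f = g"
proof (rule bl_ext[OF assms(1,2)])
  fix x assume "x \<in> carrier V"
  then obtain s where s: "vlim V s x" "!!n. f (s n) = g (s n)" using dense by blast
  have "vlim W (%n. f (s n)) (g x)" using bl_vlim[OF assms(2,3,4) s(1)] s(2) by simp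
  thus "f x = g x" using vlim_unique[OF assms(4) bl_vlim[OF assms(1,3,4) s(1)]] by simp
qed

lemma ban_isoI:
  assumes "f \<in> bl_hom A B" "g \<in> bl_hom B A" "!!x. x \<in> carrier A ==> g (f x) = x"
    "!!y. y \<in> carrier B ==> f (g y) = y"
  shows "ban_iso A B f"
  unfolding ban_iso_def
  by (intro conjI bexI[of _ g]) (use assms in \<open>auto simp: compose_def ban_id_def fun_eq_iff\<close>)

lemma ban_isoE:
  assumes "ban_iso A B f"
  obtains g where "f \<in> bl_hom A B" "g \<in> bl_hom B A" "!!x. x \<in> carrier A ==> g (f x) = x"
    "!!y. y \<in> carrier B ==> f (g y) = y"
proof -
  from assms obtain g where g: "f \<in> bl_hom A B" "g \<in> bl_hom B A"
    "compose (carrier A) g f = ban_id A" "compose (carrier B) f g = ban_id B"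
    unfolding ban_iso_def by blast
  show thesis
  proof (rule that[OF g(1,2)])
    show "g (f x) = x" if "x \<in> carrier A" for x
      using fun_cong[OF g(3), of x] that by (simp add: compose_eq ban_id_def)
    show "f (g y) = y" if "y \<in> carrier B" for y
      using fun_cong[OF g(4), of y] that by (simp add: compose_eq ban_id_def)
  qed
qed

text \<open>For the strong convention this is the place where the valuation has to be
  nonarchimedean.\<close>

lemma bs_base [simp]: "bs (base_field v)"
proof (rule bsI)
  show "\<exists>l\<in>carrier (base_field v). (%n. nrm (base_field v) (s n \<oplus>\<^bsub>base_field v\<^esub> (- 1) \<odot>\<^bsub>base_field v\<^esub> l)) \<longlonglongrightarrow> 0"
    if "\<forall>e>0. \<exists>N. \<forall>m\<ge>N. \<forall>n\<ge>N. nrm (base_field v) (s m \<oplus>\<^bsub>base_field v\<^esub> (- 1) \<odot>\<^bsub>base_field v\<^esub> s n) < e" for s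
    using that cvf unfolding complete_valued_field_def base_field_def by simp
  show "nrm (base_field v) (x \<oplus>\<^bsub>base_field v\<^esub> y) \<le> tri c (nrm (base_field v) x) (nrm (base_field v) y)" for x y
    using conv v_add by (auto simp: base_field_def tri_def nonarchimedean_def split: convention.split)
qed (auto simp: base_field_def algebra_simps)

lemma base_simps [simp]: "carrier (base_field v) = UNIV" "\<zero>\<^bsub>base_field v\<^esub> = 0"
  "x \<oplus>\<^bsub>base_field v\<^esub> y = x + y" "x \<odot>\<^bsub>base_field v\<^esub> y = x * y" "nrm (base_field v) x = v x"
  by (auto simp: base_field_def)

lemma base_diff [simp]: "x \<ominus>\<^bsub>base_field v\<^esub> y = x - y"
  by (simp add: bs_dif_conv)

end

section \<open>The completed projective tensor product\<close>

text \<open>On representing lists scalars act through the left factors, the choice made in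
  \<open>tensor\<close>. The scalar -1 then represents the negatives that occur in
  \<open>tens_dist\<close>.\<close>

definition tens_scale :: "('k, 'a) nspace => 'k => ('a \<times> 'b) list => ('a \<times> 'b) list" where
  "tens_scale V a l = map (%(x, y). (a \<odot>\<^bsub>V\<^esub> x, y)) l"

lemma tens_scale_simps [simp]: "tens_scale V a [] = []"
  "tens_scale V a ((x, y) # l) = (a \<odot>\<^bsub>V\<^esub> x, y) # tens_scale V a l"
  "tens_scale V a (l @ m) = tens_scale V a l @ tens_scale V a m"
  by (auto simp: tens_scale_def)

lemma tens_cost_Nil [simp]: "tens_cost c V W [] = 0"
  by (simp add: tens_cost_def split: convention.split)

lemma tens_cost_Cons [simp]: "tens_cost c V W ((x, y) # l) = tri c (nrm V x * nrm W y) (tens_cost c V W l)"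
  by (simp add: tens_cost_def tri_def split: convention.split)

locale tens2 = valued v c for v :: "'k::field => real" and c +
  fixes V :: "('k, 'a) nspace" and W :: "('k, 'b) nspace"
  assumes V [simp]: "banach_space v c V" and W [simp]: "banach_space v c W"
begin

abbreviation "ok l \<equiv> set l \<subseteq> carrier V \<times> carrier W"
abbreviation "teq \<equiv> tens_eq V W"
abbreviation "S \<equiv> tens_snrm c V W"
abbreviation "cost \<equiv> tens_cost c V W"
abbreviation "sc \<equiv> tens_scale V"
abbreviation "d \<equiv> tens_dist c V W"
abbreviation "ca \<equiv> tens_cauchy c V W"
abbreviation "q \<equiv> tens_class c V W"

lemma teq_ok: "teq l l' ==> ok l \<and> ok l'"
  by (induction rule: tens_eq.induct) auto

lemma teq_refl [simp]: "ok l ==> teq l l" by (rule tens_eq.refl)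

lemma ok_sc [simp]: "ok l ==> ok (sc a l)"
  by (induction l) auto

lemma sc_1 [simp]: "ok l ==> sc 1 l = l" by (induction l) auto
lemma sc_sc [simp]: "ok l ==> sc a (sc b l) = sc (a * b) l" by (induction l) (auto simp: bs_smult)

lemma cost_nonneg [simp]: "ok l ==> 0 \<le> cost l"
  by (induction l) (auto simp: tri_nonneg)

lemma cost_append: "ok l ==> ok m ==> cost (l @ m) = tri c (cost l) (cost m)"
  by (induction l) (auto simp: tri_assoc)

lemma cost_sc: "ok l ==> cost (sc a l) = v a * cost l"
  by (induction l) (auto simp: mult.assoc tri_mult)

lemma teq_sc: "teq l m ==> teq (sc a l) (sc a m)"
proof (induction rule: tens_eq.induct)
  \<comment> \<open>Scaling the left entry by a and moving b across do not interfere, because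
    scalars commute.\<close>
  case (balanced x y b)
  have "teq [(b \<odot>\<^bsub>V\<^esub> (a \<odot>\<^bsub>V\<^esub> x), y)] [(a \<odot>\<^bsub>V\<^esub> x, b \<odot>\<^bsub>W\<^esub> y)]"
    by (rule tens_eq.balanced) (use balanced in auto)
  thus ?case using balanced by (simp add: bs_smult mult.commute)
next
  case (add_left x x' y)
  thus ?case using tens_eq.add_left[of "a \<odot>\<^bsub>V\<^esub> x" V "a \<odot>\<^bsub>V\<^esub> x'" y W] by (simp add: bs_smult)
next
  case (commute l l') thus ?case using tens_eq.commute[of "sc a l" V W "sc a l'"] by simp
qed (auto intro: tens_eq.intros)

lemma teq_append: "teq l m ==> teq l' m' ==> teq (l @ l') (m @ m')" by (rule tens_eq.append)
lemma teq_commute: "ok l ==> ok l' ==> teq (l @ l') (l' @ l)" by (rule tens_eq.commute)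

lemma teq_lcommute: "ok l ==> ok l' ==> ok m ==> teq (l @ l' @ m) (l' @ l @ m)"
  using teq_append[OF teq_commute teq_refl, of l l' m] by simp

text \<open>Additivity on the left merges x \<otimes> y and (-1)x \<otimes> y into 0 \<otimes> y.
  The inductive step first has to bring these two terms together, past the tail.\<close>

lemma teq_cancel: "ok l ==> teq (l @ sc (- 1) l) []"
proof (induction l)
  case (Cons p l)
  obtain x y where p: "p = (x, y)" by force
  have c: "x \<in> carrier V" "y \<in> carrier W" "ok l" using Cons p by auto
  let ?q = "((- 1) \<odot>\<^bsub>V\<^esub> x, y)"
  have z: "x \<oplus>\<^bsub>V\<^esub> (- 1) \<odot>\<^bsub>V\<^esub> x = \<zero>\<^bsub>V\<^esub>" using c by (simp flip: bs_neg_conv)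
  have "teq [(x, y), ?q] [(\<zero>\<^bsub>V\<^esub>, y)]"
    using tens_eq.sym[OF tens_eq.add_left[of x V "(- 1) \<odot>\<^bsub>V\<^esub> x" y W]] c z by simp
  hence 1: "teq [(x, y), ?q] []" using tens_eq.trans tens_eq.zero c by metis
  have "teq ([(x, y)] @ (l @ [?q] @ sc (-1) l)) ([(x, y)] @ ([?q] @ l @ sc (-1) l))"
    by (rule teq_append[OF _ teq_lcommute]) (use c in auto)
  moreover have "teq ([(x, y), ?q] @ (l @ sc (-1) l)) ([] @ [])"
    by (rule teq_append[OF 1]) (use Cons in auto)
  ultimately show ?case using p tens_eq.trans by fastforce
qed auto

lemma teq_cancel': "ok l ==> teq (sc (- 1) l @ l) []"
  using teq_cancel teq_commute tens_eq.trans ok_sc by metis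

lemma S_set: "ok l ==> {cost l' | l'. teq l l'} \<noteq> {}" "bdd_below {cost l' | l'. teq l l'}"
  using teq_refl teq_ok by (fastforce, auto intro!: bdd_belowI[of _ 0])

lemma S_nonneg [simp]: "ok l ==> 0 \<le> S l"
  unfolding tens_snrm_def by (rule cInf_greatest) (use S_set teq_ok in auto)

lemma S_le: "teq l l' ==> S l \<le> cost l'"
  unfolding tens_snrm_def by (rule cInf_lower) (use S_set in auto)

lemma S_le_cost: "ok l ==> S l \<le> cost l" by (simp add: S_le)

lemma S_approx: assumes "ok l" "e > 0" obtains l' where "teq l l'" "cost l' < S l + e"
proof -
  have "\<exists>x\<in>{cost l' | l'. teq l l'}. x < S l + e"
    using cInf_lessD[OF S_set(1)[OF assms(1)], of "S l + e"] assms
    unfolding tens_snrm_def by auto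
  thus ?thesis using that by auto
qed

lemma S_cong: "teq l l' ==> S l = S l'"
proof -
  assume "teq l l'"
  hence "teq l m \<longleftrightarrow> teq l' m" for m using tens_eq.trans tens_eq.sym by metis
  thus ?thesis by (simp add: tens_snrm_def)
qed

text \<open>Near-optimal representatives of both lists are concatenated. A slack of e/2 on each side
  raises the sum by e and the maximum by e/2.\<close>

lemma S_append: assumes "ok l" "ok m" shows "S (l @ m) \<le> tri c (S l) (S m)"
proof (rule field_le_epsilon)
  fix e :: real assume "e > 0"
  hence e: "e / 2 > 0" by simp
  obtain l' where l': "teq l l'" "cost l' < S l + e / 2" using S_approx[OF assms(1) e] .
  obtain m' where m': "teq m m'" "cost m' < S m + e / 2" using S_approx[OF assms(2) e] .
  have "S (l @ m) \<le> cost (l' @ m')" by (rule S_le[OF teq_append[OF l'(1) m'(1)]])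
  also have "\<dots> = tri c (cost l') (cost m')" using teq_ok l' m' cost_append by blast
  also have "\<dots> \<le> tri c (S l + e / 2) (S m + e / 2)" by (rule tri_mono) (use l' m' in auto)
  also have "\<dots> \<le> tri c (S l) (S m) + e" using \<open>e > 0\<close> by (cases c) (auto simp: tri_def max_def)
  finally show "S (l @ m) \<le> tri c (S l) (S m) + e" .
qed

lemma S_append_le: "ok l ==> ok m ==> S (l @ m) \<le> S l + S m"
  by (rule order_trans[OF S_append tri_le]) auto

text \<open>Dividing by \<open>v a + 1\<close>, not by \<open>v a\<close>, keeps the scalar 0 from
  being a special case.\<close>

lemma v_eps: assumes "0 < e" shows "v a * (e / (v a + 1)) < e"
proof -
  have "0 < v a + 1" using v_nonneg[of a] by linarith
  hence "v a * (e / (v a + 1)) = e - e / (v a + 1)" by (simp add: field_simps)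
  thus ?thesis using assms \<open>0 < v a + 1\<close> by simp
qed

lemma S_sc_le: assumes "ok l" shows "S (sc a l) \<le> v a * S l"
proof (rule field_le_epsilon)
  fix e :: real assume "e > 0"
  hence e: "e / (v a + 1) > 0" by (simp add: add_nonneg_pos)
  obtain l' where l': "teq l l'" "cost l' < S l + e / (v a + 1)" using S_approx[OF assms(1) e] .
  have "S (sc a l) \<le> cost (sc a l')" by (rule S_le[OF teq_sc[OF l'(1)]])
  also have "\<dots> = v a * cost l'" using teq_ok l' cost_sc by blast
  also have "\<dots> \<le> v a * (S l + e / (v a + 1))" by (rule mult_left_mono) (use l' in auto)
  also have "\<dots> \<le> v a * S l + e"
    using v_eps[OF \<open>e > 0\<close>, of a] by (simp add: algebra_simps)
  finally show "S (sc a l) \<le> v a * S l + e" .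
qed

lemma S_Nil [simp]: "S [] = 0"
  using S_le_cost[of "[]"] antisym[OF _ S_nonneg[of "[]"]] by simp

text \<open>The reverse of \<open>S_sc_le\<close> comes from applying \<open>S_sc_le\<close> to the
  inverse scalar, which is why 0 is treated apart.\<close>

lemma S_sc [simp]: assumes "ok l" shows "S (sc a l) = v a * S l"
proof (cases "a = 0")
  case True thus ?thesis using S_sc_le[OF assms, of a] S_nonneg[OF ok_sc[OF assms], of a] by simp
next
  case False
  have "S (sc (inverse a) (sc a l)) \<le> v (inverse a) * S (sc a l)" by (rule S_sc_le) (use assms in auto)
  hence "S l \<le> v (inverse a) * S (sc a l)" using False assms by simp
  hence "v a * S l \<le> v a * (v (inverse a) * S (sc a l))" by (rule mult_left_mono) auto
  also have "v a * (v (inverse a) * S (sc a l)) = v (a * inverse a) * S (sc a l)" by (simp only: v_mult mult.assoc)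
  also have "\<dots> = S (sc a l)" using False by simp
  finally show ?thesis using S_sc_le[OF assms, of a] by simp
qed

lemma d_eq: "ok l' ==> d l l' = S (l @ sc (-1) l')"
proof -
  assume "ok l'"
  hence "map (%(x, y). (\<ominus>\<^bsub>V\<^esub> x, y)) l' = sc (-1) l'"
    by (induction l') (auto simp: bs_neg_conv)
  thus ?thesis by (simp add: tens_dist_def)
qed

lemma d_nonneg [simp]: "ok l ==> ok l' ==> 0 \<le> d l l'" by (simp add: d_eq)

lemma d_self [simp]: "ok l ==> d l l = 0" using S_cong[OF teq_cancel] by (simp add: d_eq)

lemma d_teq: "teq l l' ==> d l l' = 0"
  using S_cong[OF teq_append[OF _ teq_refl], of l l' "sc (-1) l'"] S_cong[OF teq_cancel, of l'] teq_ok[of l l']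
  by (simp add: d_eq)

lemma d_Nil: "ok l ==> d l [] = S l" by (simp add: d_eq)

lemma d_commute: assumes "ok l" "ok m" shows "d l m = d m l"
proof -
  have "S (sc (-1) (l @ sc (-1) m)) = S (l @ sc (-1) m)" by (subst S_sc) (use assms in auto)
  moreover have "sc (-1) (l @ sc (-1) m) = sc (-1) l @ m" using assms by simp
  moreover have "S (sc (-1) l @ m) = S (m @ sc (-1) l)" by (rule S_cong[OF teq_commute]) (use assms in auto)
  ultimately show ?thesis using assms by (simp add: d_eq)
qed

text \<open>The cancelling pair -m, m is inserted between l and -n.\<close>

lemma d_triangle: assumes "ok l" "ok m" "ok n" shows "d l n \<le> d l m + d m n"
proof -
  have "teq (l @ ((sc (-1) m @ m) @ sc (-1) n)) (l @ ([] @ sc (-1) n))"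
    by (intro teq_append teq_cancel' teq_refl) (use assms in auto)
  hence "S (l @ sc (-1) n) = S ((l @ sc (-1) m) @ (m @ sc (-1) n))" using S_cong by fastforce
  also have "\<dots> \<le> S (l @ sc (-1) m) + S (m @ sc (-1) n)" by (rule S_append_le) (use assms in auto)
  finally show ?thesis using assms by (simp add: d_eq)
qed

lemma d_append: assumes "ok l" "ok m" "ok l'" "ok m'" shows "d (l @ m) (l' @ m') \<le> d l l' + d m m'"
proof -
  have "teq (l @ (m @ sc (-1) l' @ sc (-1) m')) (l @ (sc (-1) l' @ m @ sc (-1) m'))"
    by (intro teq_append teq_lcommute teq_refl) (use assms in auto)
  hence "S ((l @ m) @ sc (-1) (l' @ m')) = S ((l @ sc (-1) l') @ (m @ sc (-1) m'))" using S_cong by fastforce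
  also have "\<dots> \<le> S (l @ sc (-1) l') + S (m @ sc (-1) m')" by (rule S_append_le) (use assms in auto)
  finally show ?thesis using assms by (simp add: d_eq)
qed

lemma d_sc: assumes "ok l" "ok m" shows "d (sc a l) (sc a m) = v a * d l m"
proof -
  have "sc a l @ sc (-1) (sc a m) = sc a (l @ sc (-1) m)" using assms by simp
  thus ?thesis using assms S_sc[of "l @ sc (-1) m" a] by (simp add: d_eq del: S_sc sc_sc)
qed

lemma d_S: assumes "ok l" "ok m" shows "\<bar>S l - S m\<bar> \<le> d l m"
  using d_triangle[of l m "[]"] d_triangle[of m l "[]"] d_commute[of l m] assms by (simp add: d_Nil)

lemma ca_ok [simp]: "ca s ==> ok (s n)" by (simp add: tens_cauchy_def)

lemma caD: "ca s ==> e > 0 ==> \<exists>N. \<forall>m\<ge>N. \<forall>n\<ge>N. d (s m) (s n) < e" by (simp add: tens_cauchy_def)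

lemma ca_const [simp]: "ok l ==> ca (%n. l)" by (simp add: tens_cauchy_def)

lemma tendsto0_le: "(!!n. 0 \<le> f n) ==> (!!n. f n \<le> g n) ==> g \<longlonglongrightarrow> 0 ==> f \<longlonglongrightarrow> (0::real)"
  by (rule tendsto_sandwich[of "%_. 0" f _ g]) auto

lemma q_mem: "t \<in> q s \<longleftrightarrow> ca t \<and> (%n. d (s n) (t n)) \<longlonglongrightarrow> 0" by (simp add: tens_class_def)

lemma q_self: "ca s ==> s \<in> q s" by (simp add: q_mem)

lemma q_eq: assumes "ca s" "ca t" shows "q s = q t \<longleftrightarrow> (%n. d (s n) (t n)) \<longlonglongrightarrow> 0"
proof
  assume "q s = q t" thus "(%n. d (s n) (t n)) \<longlonglongrightarrow> 0" using q_self[OF assms(2)] q_mem by auto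
next
  have *: "q t \<subseteq> q s" if *: "ca s" "ca t" "(%n. d (s n) (t n)) \<longlonglongrightarrow> 0" for s t
  proof
    fix u assume u: "u \<in> q t"
    have "(%n. d (s n) (u n)) \<longlonglongrightarrow> 0"
    proof (rule tendsto0_le)
      show "d (s n) (u n) \<le> d (s n) (t n) + d (t n) (u n)" for n
        by (rule d_triangle) (use * u in \<open>auto simp: q_mem simp del: subset_iff\<close>)
      show "(%n. d (s n) (t n) + d (t n) (u n)) \<longlonglongrightarrow> 0"
        using tendsto_add[OF *(3), of "%n. d (t n) (u n)" 0] u by (auto simp: q_mem)
    qed (use * u in \<open>auto simp: q_mem\<close>)
    thus "u \<in> q s" using u by (simp add: q_mem)
  qed
  assume "(%n. d (s n) (t n)) \<longlonglongrightarrow> 0"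
  moreover have "d (s n) (t n) = d (t n) (s n)" for n using d_commute assms by simp
  ultimately show "q s = q t" using *[of s t] *[of t s] assms by auto
qed

lemma q_eqI: "ca s ==> ca t ==> (!!n. teq (s n) (t n)) ==> q s = q t"
  by (subst q_eq) (auto simp: d_teq)

lemma q_mem_eq: "ca s ==> t \<in> q s ==> ca t \<and> q t = q s" using q_eq[of s t] q_mem by auto

lemma ca_append: assumes "ca s" "ca t" shows "ca (%n. s n @ t n)"
  unfolding tens_cauchy_def
proof (intro conjI allI impI)
  show "ok (s n @ t n)" for n using assms by auto
  fix e :: real assume "e > 0" hence e: "e/2 > 0" by simp
  obtain N where N: "!!m n. m \<ge> N ==> n \<ge> N ==> d (s m) (s n) < e/2" using caD[OF assms(1) e] by blast
  obtain M where M: "!!m n. m \<ge> M ==> n \<ge> M ==> d (t m) (t n) < e/2" using caD[OF assms(2) e] by blast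
  show "\<exists>N. \<forall>m\<ge>N. \<forall>n\<ge>N. d (s m @ t m) (s n @ t n) < e"
  proof (intro exI[of _ "max N M"] allI impI)
    fix m n assume "max N M \<le> m" "max N M \<le> n"
    thus "d (s m @ t m) (s n @ t n) < e"
      using N[of m n] M[of m n] d_append[of "s m" "t m" "s n" "t n"] assms by simp
  qed
qed

lemma ca_sc: assumes "ca s" shows "ca (%n. sc a (s n))"
  unfolding tens_cauchy_def
proof (intro conjI allI impI)
  show "ok (sc a (s n))" for n using assms by (intro ok_sc) simp
  fix e :: real assume "e > 0" hence e: "e/(v a + 1) > 0" by (simp add: add_nonneg_pos)
  obtain N where N: "!!m n. m \<ge> N ==> n \<ge> N ==> d (s m) (s n) < e/(v a + 1)" using caD[OF assms(1) e] by blast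
  show "\<exists>N. \<forall>m\<ge>N. \<forall>n\<ge>N. d (sc a (s m)) (sc a (s n)) < e"
  proof (intro exI[of _ N] allI impI)
    fix m n assume "N \<le> m" "N \<le> n"
    hence "d (sc a (s m)) (sc a (s n)) \<le> v a * (e/(v a + 1))"
      using mult_left_mono[OF less_imp_le[OF N[of m n]] v_nonneg[of a]] assms by (simp add: d_sc)
    also have "\<dots> < e" by (rule v_eps[OF \<open>e > 0\<close>])
    finally show "d (sc a (s m)) (sc a (s n)) < e" .
  qed
qed

section \<open>The completion is a Banach space\<close>

abbreviation "T \<equiv> tensor c V W"

lemma T_carrier: "carrier T = {q s | s. ca s}" and T_zero: "\<zero>\<^bsub>T\<^esub> = q (%n. [])"
  by (auto simp: tensor_def)

lemma T_carrier_iff: "A \<in> carrier T \<longleftrightarrow> (\<exists>s. ca s \<and> A = q s)" by (auto simp: T_carrier)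

text \<open>The definition takes a union over all pairs of representatives. Every pair yields the
  same class, since distances of concatenations are bounded by the sums of the distances, and a
  union of equal sets over a nonempty index set is that set.\<close>

lemma T_add: assumes "ca s" "ca t" shows "q s \<oplus>\<^bsub>T\<^esub> q t = q (%n. s n @ t n)"
proof -
  have "q (%n. s' n @ t' n) = q (%n. s n @ t n)" if "s' \<in> q s" "t' \<in> q t" for s' t'
  proof -
    note * = q_mem_eq[OF assms(1) that(1)] q_mem_eq[OF assms(2) that(2)]
    have 1: "(%n. d (s' n) (s n)) \<longlonglongrightarrow> 0" "(%n. d (t' n) (t n)) \<longlonglongrightarrow> 0" using * q_eq assms by auto
    have "(%n. d (s' n @ t' n) (s n @ t n)) \<longlonglongrightarrow> 0"
    proof (rule tendsto0_le)
      show "d (s' n @ t' n) (s n @ t n) \<le> d (s' n) (s n) + d (t' n) (t n)" for n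
        by (rule d_append) (use * assms in auto)
      show "(%n. d (s' n) (s n) + d (t' n) (t n)) \<longlonglongrightarrow> 0" using tendsto_add[OF 1] by simp
    qed (use * assms in auto)
    thus ?thesis using * assms by (subst q_eq) (auto intro: ca_append)
  qed
  moreover have "q s \<oplus>\<^bsub>T\<^esub> q t = (\<Union>s'\<in>q s. \<Union>t'\<in>q t. q (%n. s' n @ t' n))" by (simp add: tensor_def)
  ultimately have "q s \<oplus>\<^bsub>T\<^esub> q t = (\<Union>s'\<in>q s. \<Union>t'\<in>q t. q (%n. s n @ t n))" by simp
  thus ?thesis using q_self[OF assms(1)] q_self[OF assms(2)] by blast
qed

lemma T_smult: assumes "ca s" shows "a \<odot>\<^bsub>T\<^esub> q s = q (%n. sc a (s n))"
proof -
  have "q (%n. sc a (s' n)) = q (%n. sc a (s n))" if "s' \<in> q s" for s'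
  proof -
    note * = q_mem_eq[OF assms(1) that(1)]
    have 1: "(%n. d (s' n) (s n)) \<longlonglongrightarrow> 0" using * q_eq assms by auto
    have "(%n. d (sc a (s' n)) (sc a (s n))) \<longlonglongrightarrow> 0"
      using tendsto_mult_right_zero[OF 1, of "v a"] * assms by (simp add: d_sc)
    thus ?thesis using * assms by (subst q_eq) (auto intro: ca_sc)
  qed
  moreover have "a \<odot>\<^bsub>T\<^esub> q s = (\<Union>s'\<in>q s. q (%n. sc a (s' n)))" by (simp add: tensor_def tens_scale_def)
  ultimately have "a \<odot>\<^bsub>T\<^esub> q s = (\<Union>s'\<in>q s. q (%n. sc a (s n)))" by simp
  thus ?thesis using q_self[OF assms] by blast
qed

lemma S_conv: assumes "ca s" shows "convergent (%n. S (s n))"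
proof -
  have "Cauchy (%n. S (s n))"
    unfolding Cauchy_def
  proof (intro allI impI)
    fix e :: real assume "e > 0"
    then obtain N where N: "!!m n. m \<ge> N ==> n \<ge> N ==> d (s m) (s n) < e" using caD[OF assms] by blast
    show "\<exists>M. \<forall>m\<ge>M. \<forall>n\<ge>M. dist (S (s m)) (S (s n)) < e"
    proof (intro exI[of _ N] allI impI)
      fix m n assume "m \<ge> N" "n \<ge> N"
      thus "dist (S (s m)) (S (s n)) < e" using N[of m n] d_S[of "s m" "s n"] assms by (simp add: dist_real_def)
    qed
  qed
  thus ?thesis by (simp add: Cauchy_convergent_iff)
qed

text \<open>The norm is computed along a representative picked by \<open>SOME\<close>. Any other
  representative has the same limit, because seminorms differ by at most the distance of the
  lists.\<close>

lemma T_nrm: assumes "ca s" shows "(%n. S (s n)) \<longlonglongrightarrow> nrm T (q s)"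
proof -
  define t where "t = (SOME t. t \<in> q s)"
  have t: "t \<in> q s" unfolding t_def by (rule someI[of _ s]) (rule q_self[OF assms])
  have t': "ca t" "q t = q s" using q_mem_eq[OF assms t] by auto
  have 1: "(%n. S (t n)) \<longlonglongrightarrow> nrm T (q s)"
    using S_conv[OF t'(1)] by (simp add: tensor_def t_def convergent_LIMSEQ_iff)
  have 2: "(%n. S (s n) - S (t n)) \<longlonglongrightarrow> 0"
    by (rule Lim_null_comparison[where g="%n. d (s n) (t n)"]) (use d_S t t' assms in \<open>auto simp: q_mem\<close>)
  show ?thesis using tendsto_add[OF 1 2] by simp
qed

lemma T_nrm_const: "ok l ==> nrm T (q (%n. l)) = S l"
  using LIMSEQ_unique[OF T_nrm[of "%n. l"] tendsto_const] by simp

lemma T_dif: "ca s ==> ca t ==> q s \<oplus>\<^bsub>T\<^esub> (-1) \<odot>\<^bsub>T\<^esub> q t = q (%n. s n @ sc (-1) (t n))"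
  by (simp add: T_smult T_add ca_sc)

lemma T_dif_nrm: "ca s ==> ca t ==> (%n. d (s n) (t n)) \<longlonglongrightarrow> nrm T (q s \<oplus>\<^bsub>T\<^esub> (-1) \<odot>\<^bsub>T\<^esub> q t)"
  using T_nrm[OF ca_append[OF _ ca_sc], of s t "-1"] by (simp add: T_dif d_eq)

text \<open>A diagonal argument: \<open>L m\<close> is an entry of a representative of
  \<open>A m\<close> from which on all later entries stay within 1/(m+1) of it.\<close>

lemma T_complete:
  assumes A: "!!n. A n \<in> carrier T"
    and ce: "\<forall>e>0. \<exists>N. \<forall>m\<ge>N. \<forall>n\<ge>N. nrm T (A m \<oplus>\<^bsub>T\<^esub> (-1) \<odot>\<^bsub>T\<^esub> A n) < e"
  shows "\<exists>L\<in>carrier T. (%n. nrm T (A n \<oplus>\<^bsub>T\<^esub> (-1) \<odot>\<^bsub>T\<^esub> L)) \<longlonglongrightarrow> 0"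
proof -
  have "\<forall>n. \<exists>s. ca s \<and> A n = q s" using A T_carrier_iff by blast
  then obtain s where s: "!!n. ca (s n)" "!!n. A n = q (s n)" by metis
  have "\<forall>m. \<exists>k. \<forall>p\<ge>k. d (s m p) (s m k) < 1 / Suc m"
  proof
    fix m
    obtain N where "!!p r. p \<ge> N ==> r \<ge> N ==> d (s m p) (s m r) < 1 / Suc m"
      using caD[OF s(1)[of m], of "1 / Suc m"] by auto
    thus "\<exists>k. \<forall>p\<ge>k. d (s m p) (s m k) < 1 / Suc m" by blast
  qed
  then obtain k where k: "!!m p. p \<ge> k m ==> d (s m p) (s m (k m)) < 1 / Suc m" by metis
  define L where "L m = s m (k m)" for m
  have okL: "ok (L m)" for m using s L_def by auto
  have inv: "\<exists>N. \<forall>m\<ge>N. 1 / real (Suc m) < e" if "e > 0" for e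
    using order_tendstoD(2)[OF lim_inverse_n'[THEN LIMSEQ_Suc] that] by (simp add: eventually_sequentially)
  have caL: "ca L"
    unfolding tens_cauchy_def
  proof (intro conjI allI impI okL)
    fix e :: real assume "e > 0" hence e3: "e/3 > 0" by simp
    obtain N where N: "!!m n. m \<ge> N ==> n \<ge> N ==> nrm T (A m \<oplus>\<^bsub>T\<^esub> (-1) \<odot>\<^bsub>T\<^esub> A n) < e/3" using ce e3 by blast
    obtain M where M: "!!m. m \<ge> M ==> 1 / real (Suc m) < e/3" using inv[OF e3] by blast
    show "\<exists>N. \<forall>m\<ge>N. \<forall>n\<ge>N. d (L m) (L n) < e"
    proof (intro exI[of _ "max N M"] allI impI)
      fix m n assume mn: "max N M \<le> m" "max N M \<le> n"
      have "eventually (%p. d (s m p) (s n p) < e/3) sequentially"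
        using order_tendstoD(2)[OF T_dif_nrm[OF s(1) s(1), of m n], of "e/3"] N[of m n] mn s by simp
      then obtain p0 where p0: "!!p. p \<ge> p0 ==> d (s m p) (s n p) < e/3" by (auto simp: eventually_sequentially)
      \<comment> \<open>The index p lies past \<open>k m\<close> and \<open>k n\<close>, where the
        two representatives are near \<open>L m\<close> and \<open>L n\<close>, and past
        \<open>p0\<close>, where they are near each other.\<close>
      define p where "p = max p0 (max (k m) (k n))"
      have "d (L m) (L n) \<le> d (L m) (s m p) + (d (s m p) (s n p) + d (s n p) (L n))"
        using d_triangle[of "L m" "s m p" "L n"] d_triangle[of "s m p" "s n p" "L n"] okL s by simp
      moreover have "d (L m) (s m p) = d (s m p) (L m)" using d_commute okL s by simp
      moreover have "d (s m p) (L m) < e/3" using order_less_trans[OF k[of m p] M[of m]] mn unfolding L_def p_def by simp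
      moreover have "d (s n p) (L n) < e/3" using order_less_trans[OF k[of n p] M[of n]] mn unfolding L_def p_def by simp
      moreover have "d (s m p) (s n p) < e/3" using p0 by (simp add: p_def)
      ultimately show "d (L m) (L n) < e" by linarith
    qed
  qed
  have "(%m. nrm T (A m \<oplus>\<^bsub>T\<^esub> (-1) \<odot>\<^bsub>T\<^esub> q L)) \<longlonglongrightarrow> 0"
  proof (rule LIMSEQ_I)
    fix e :: real assume "e > 0" hence e3: "e/3 > 0" by simp
    obtain N where N: "!!m n. m \<ge> N ==> n \<ge> N ==> d (L m) (L n) < e/3" using caD[OF caL e3] by blast
    obtain M where M: "!!m. m \<ge> M ==> 1 / real (Suc m) < e/3" using inv[OF e3] by blast
    show "\<exists>no. \<forall>n\<ge>no. norm (nrm T (A n \<oplus>\<^bsub>T\<^esub> (-1) \<odot>\<^bsub>T\<^esub> q L) - 0) < e"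
    proof (intro exI[of _ "max N M"] allI impI)
      fix m assume m: "max N M \<le> m"
      have lim: "(%p. d (s m p) (L p)) \<longlonglongrightarrow> nrm T (A m \<oplus>\<^bsub>T\<^esub> (-1) \<odot>\<^bsub>T\<^esub> q L)"
        using T_dif_nrm[OF s(1) caL, of m] s by simp
      have "d (s m p) (L p) \<le> 2*e/3" if "p \<ge> max (k m) N" for p
        using d_triangle[of "s m p" "L m" "L p"] k[of m p] M[of m] N[of m p] m okL s that by (simp add: L_def)
      hence "nrm T (A m \<oplus>\<^bsub>T\<^esub> (-1) \<odot>\<^bsub>T\<^esub> q L) \<le> 2*e/3" by (intro LIMSEQ_le_const2[OF lim]) blast
      moreover have "0 \<le> nrm T (A m \<oplus>\<^bsub>T\<^esub> (-1) \<odot>\<^bsub>T\<^esub> q L)"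
        by (rule LIMSEQ_le_const[OF lim]) (use okL s in auto)
      ultimately show "norm (nrm T (A m \<oplus>\<^bsub>T\<^esub> (-1) \<odot>\<^bsub>T\<^esub> q L) - 0) < e" using \<open>e > 0\<close> by simp
    qed
  qed
  thus ?thesis using caL T_carrier_iff by blast
qed

lemma T_bs: "bs T"
proof (rule bsI)
  show "A \<oplus>\<^bsub>T\<^esub> B \<in> carrier T" if "A \<in> carrier T" "B \<in> carrier T" for A B
    using that ca_append by (auto simp: T_carrier T_add)
  show "\<zero>\<^bsub>T\<^esub> \<in> carrier T" unfolding T_carrier_iff T_zero by (rule exI[of _ "%n. []"]) simp
  show "a \<odot>\<^bsub>T\<^esub> A \<in> carrier T" if "A \<in> carrier T" for a A
    using that ca_sc by (auto simp: T_carrier T_smult)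
  show "(A \<oplus>\<^bsub>T\<^esub> B) \<oplus>\<^bsub>T\<^esub> C = A \<oplus>\<^bsub>T\<^esub> (B \<oplus>\<^bsub>T\<^esub> C)" if "A \<in> carrier T" "B \<in> carrier T" "C \<in> carrier T" for A B C
    using that unfolding T_carrier_iff by (auto simp: T_add ca_append)
  show "A \<oplus>\<^bsub>T\<^esub> B = B \<oplus>\<^bsub>T\<^esub> A" if "A \<in> carrier T" "B \<in> carrier T" for A B
    using that unfolding T_carrier_iff by (clarsimp simp: T_add) (rule q_eqI; simp add: ca_append teq_commute)
  show "\<zero>\<^bsub>T\<^esub> \<oplus>\<^bsub>T\<^esub> A = A" if "A \<in> carrier T" for A
    using that unfolding T_carrier_iff by (auto simp: T_add T_zero)
  show "(- 1) \<odot>\<^bsub>T\<^esub> A \<oplus>\<^bsub>T\<^esub> A = \<zero>\<^bsub>T\<^esub>" if "A \<in> carrier T" for A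
    using that unfolding T_carrier_iff
    by (clarsimp simp: T_add T_zero T_smult ca_sc) (rule q_eqI; simp add: ca_sc ca_append teq_cancel')
  \<comment> \<open>Additivity on the left splits the head; the two scaled heads and the two scaled
    tails then have to be sorted apart.\<close>
  have ld: "teq (sc (a + b) l) (sc a l @ sc b l)" if "ok l" for a b l
    using that
  proof (induction l)
    case (Cons p l)
    obtain x y where p: "p = (x, y)" by force
    have c: "x \<in> carrier V" "y \<in> carrier W" "ok l" using Cons p by auto
    have "teq [((a + b) \<odot>\<^bsub>V\<^esub> x, y)] [(a \<odot>\<^bsub>V\<^esub> x, y), (b \<odot>\<^bsub>V\<^esub> x, y)]"
      using tens_eq.add_left[of "a \<odot>\<^bsub>V\<^esub> x" V "b \<odot>\<^bsub>V\<^esub> x" y W] c by (simp add: bs_smult)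
    hence 1: "teq ([((a + b) \<odot>\<^bsub>V\<^esub> x, y)] @ sc (a + b) l) ([(a \<odot>\<^bsub>V\<^esub> x, y), (b \<odot>\<^bsub>V\<^esub> x, y)] @ (sc a l @ sc b l))"
      by (rule teq_append) (use Cons in auto)
    have "teq ([(a \<odot>\<^bsub>V\<^esub> x, y)] @ ([(b \<odot>\<^bsub>V\<^esub> x, y)] @ sc a l @ sc b l)) ([(a \<odot>\<^bsub>V\<^esub> x, y)] @ (sc a l @ [(b \<odot>\<^bsub>V\<^esub> x, y)] @ sc b l))"
      by (intro teq_append teq_lcommute teq_refl) (use c in auto)
    with 1 show ?case using p tens_eq.trans by fastforce
  qed auto
  show "(a + b) \<odot>\<^bsub>T\<^esub> A = a \<odot>\<^bsub>T\<^esub> A \<oplus>\<^bsub>T\<^esub> b \<odot>\<^bsub>T\<^esub> A" if "A \<in> carrier T" for a b A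
    using that unfolding T_carrier_iff by (clarsimp simp: T_add T_smult ca_sc) (rule q_eqI; simp add: ca_sc ca_append ld)
  show "a \<odot>\<^bsub>T\<^esub> (A \<oplus>\<^bsub>T\<^esub> B) = a \<odot>\<^bsub>T\<^esub> A \<oplus>\<^bsub>T\<^esub> a \<odot>\<^bsub>T\<^esub> B" if "A \<in> carrier T" "B \<in> carrier T" for a A B
    using that unfolding T_carrier_iff by (auto simp: T_add T_smult ca_append ca_sc)
  show "(a * b) \<odot>\<^bsub>T\<^esub> A = a \<odot>\<^bsub>T\<^esub> (b \<odot>\<^bsub>T\<^esub> A)" if "A \<in> carrier T" for a b A
    using that unfolding T_carrier_iff by (auto simp: T_smult ca_sc)
  show "1 \<odot>\<^bsub>T\<^esub> A = A" if "A \<in> carrier T" for A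
    using that unfolding T_carrier_iff by (auto simp: T_smult)
  show "0 \<le> nrm T A" if tA: "A \<in> carrier T" for A
  proof -
    obtain s where s: "ca s" "A = q s" using tA by (auto simp: T_carrier)
    show ?thesis unfolding s(2) by (rule LIMSEQ_le_const[OF T_nrm[OF s(1)]]) (use s in simp)
  qed
  show "A = \<zero>\<^bsub>T\<^esub>" if tA: "A \<in> carrier T" "nrm T A = 0" for A
  proof -
    obtain s where s: "ca s" "A = q s" using tA by (auto simp: T_carrier)
    have "(%n. S (s n)) \<longlonglongrightarrow> 0" using T_nrm[OF s(1)] tA(2) unfolding s(2) by simp
    thus ?thesis using s(1) unfolding T_zero s(2) by (subst q_eq) (simp_all add: d_Nil)
  qed
  show "nrm T \<zero>\<^bsub>T\<^esub> = 0" using T_nrm_const[of "[]"] T_zero by simp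
  show "nrm T (a \<odot>\<^bsub>T\<^esub> A) = v a * nrm T A" if tA: "A \<in> carrier T" for a A
  proof -
    obtain s where s: "ca s" "A = q s" using tA by (auto simp: T_carrier)
    have "(%n. v a * S (s n)) \<longlonglongrightarrow> nrm T (a \<odot>\<^bsub>T\<^esub> A)"
      using T_nrm[OF ca_sc[OF s(1)], of a] s by (simp add: T_smult)
    thus ?thesis using tendsto_mult_left[OF T_nrm[OF s(1)], of "v a"] s LIMSEQ_unique by blast
  qed
  show "nrm T (A \<oplus>\<^bsub>T\<^esub> B) \<le> tri c (nrm T A) (nrm T B)" if tA: "A \<in> carrier T" "B \<in> carrier T" for A B
  proof -
    obtain s t where s: "ca s" "A = q s" "ca t" "B = q t" using tA by (auto simp: T_carrier)
    have "(%n. S (s n @ t n)) \<longlonglongrightarrow> nrm T (A \<oplus>\<^bsub>T\<^esub> B)"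
      using T_nrm[OF ca_append[OF s(1,3)]] s by (simp add: T_add)
    moreover have "(%n. tri c (S (s n)) (S (t n))) \<longlonglongrightarrow> tri c (nrm T A) (nrm T B)"
      using s T_nrm by (intro tri_tendsto) auto
    ultimately show ?thesis by (rule LIMSEQ_le) (use s S_append in auto)
  qed
qed (use T_complete in auto)

lemma T_const_carrier: "ok l ==> q (%n. l) \<in> carrier T" unfolding T_carrier_iff by (rule exI[of _ "%n. l"]) simp

text \<open>A Cauchy sequence of finite sums converges in the completion to the class that it
  represents; so the finite sums of elementary tensors are dense.\<close>

lemma T_dense: assumes "ca s" shows "vlim T (%n. q (%_. s n)) (q s)"
  unfolding vlim_def
proof (intro conjI allI)
  show "q (%_. s n) \<in> carrier T" for n using assms T_const_carrier by simp
  show qs: "q s \<in> carrier T" using assms T_carrier_iff by blast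
  have e: "q (%_. s n) \<ominus>\<^bsub>T\<^esub> q s = q (%_. s n) \<oplus>\<^bsub>T\<^esub> (-1) \<odot>\<^bsub>T\<^esub> q s" for n
    by (rule bs_dif_conv[OF T_bs]) (use qs assms T_const_carrier in auto)
  show "(%n. dst T (q (%_. s n)) (q s)) \<longlonglongrightarrow> 0"
  proof (rule LIMSEQ_I)
    fix r :: real assume "r > 0" hence e2: "r/2 > 0" by simp
    obtain N where N: "!!m n. m \<ge> N ==> n \<ge> N ==> d (s m) (s n) < r/2" using caD[OF assms e2] by blast
    show "\<exists>no. \<forall>n\<ge>no. norm (dst T (q (%_. s n)) (q s) - 0) < r"
    proof (intro exI[of _ N] allI impI)
      fix n assume n: "n \<ge> N"
      have "(%p. d (s n) (s p)) \<longlonglongrightarrow> dst T (q (%_. s n)) (q s)"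
        unfolding e by (rule T_dif_nrm) (use assms in auto)
      hence "dst T (q (%_. s n)) (q s) \<le> r/2"
        by (rule LIMSEQ_le_const2) (use N n in \<open>force intro: less_imp_le\<close>)
      moreover have "dst T (q (%_. s n)) (q s) \<ge> 0"
        using nrm_nonneg[OF T_bs] bs_closed(4)[OF T_bs] qs assms T_const_carrier by simp
      ultimately show "norm (dst T (q (%_. s n)) (q s) - 0) < r" using \<open>r > 0\<close> by simp
    qed
  qed
qed

lemma q_Cons: "ok ((x, y) # l) ==> q (%_. (x, y) # l) = elt c V W x y \<oplus>\<^bsub>T\<^esub> q (%_. l)"
  unfolding elt_def by (subst T_add) auto

end

section \<open>The universal property of the tensor product\<close>

text \<open>The bound is an explicit argument because maps in three variables are lifted one pair at
  a time, and its dependence on the variable held fixed has to be tracked; see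
  \<open>bb_lift\<close>.\<close>

definition (in valued) bb ::
  "('k, 'a) nspace => ('k, 'b) nspace => ('k, 'd) nspace => real => ('a => 'b => 'd) => bool" where
  "bb V W Z B \<beta> \<longleftrightarrow> 0 \<le> B \<and>
     (\<forall>x\<in>carrier V. \<forall>y\<in>carrier W. \<beta> x y \<in> carrier Z \<and> nrm Z (\<beta> x y) \<le> B * (nrm V x * nrm W y)) \<and>
     (\<forall>x\<in>carrier V. \<forall>x'\<in>carrier V. \<forall>y\<in>carrier W. \<beta> (x \<oplus>\<^bsub>V\<^esub> x') y = \<beta> x y \<oplus>\<^bsub>Z\<^esub> \<beta> x' y) \<and>
     (\<forall>x\<in>carrier V. \<forall>y\<in>carrier W. \<forall>y'\<in>carrier W. \<beta> x (y \<oplus>\<^bsub>W\<^esub> y') = \<beta> x y \<oplus>\<^bsub>Z\<^esub> \<beta> x y') \<and>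
     (\<forall>a. \<forall>x\<in>carrier V. \<forall>y\<in>carrier W. \<beta> (a \<odot>\<^bsub>V\<^esub> x) y = a \<odot>\<^bsub>Z\<^esub> \<beta> x y) \<and>
     (\<forall>a. \<forall>x\<in>carrier V. \<forall>y\<in>carrier W. \<beta> x (a \<odot>\<^bsub>W\<^esub> y) = a \<odot>\<^bsub>Z\<^esub> \<beta> x y)"

lemma (in valued) bbI:
  assumes "0 \<le> B"
    and "!!x y. x \<in> carrier V ==> y \<in> carrier W ==> \<beta> x y \<in> carrier Z"
    and "!!x y. x \<in> carrier V ==> y \<in> carrier W ==> nrm Z (\<beta> x y) \<le> B * (nrm V x * nrm W y)"
    and "!!x x' y. x \<in> carrier V ==> x' \<in> carrier V ==> y \<in> carrier W ==> \<beta> (x \<oplus>\<^bsub>V\<^esub> x') y = \<beta> x y \<oplus>\<^bsub>Z\<^esub> \<beta> x' y"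
    and "!!x y y'. x \<in> carrier V ==> y \<in> carrier W ==> y' \<in> carrier W ==> \<beta> x (y \<oplus>\<^bsub>W\<^esub> y') = \<beta> x y \<oplus>\<^bsub>Z\<^esub> \<beta> x y'"
    and "!!a x y. x \<in> carrier V ==> y \<in> carrier W ==> \<beta> (a \<odot>\<^bsub>V\<^esub> x) y = a \<odot>\<^bsub>Z\<^esub> \<beta> x y"
    and "!!a x y. x \<in> carrier V ==> y \<in> carrier W ==> \<beta> x (a \<odot>\<^bsub>W\<^esub> y) = a \<odot>\<^bsub>Z\<^esub> \<beta> x y"
  shows "bb V W Z B \<beta>"
  unfolding bb_def using assms by auto

lemma (in valued) bbD:
  assumes "bb V W Z B \<beta>"
  shows "0 \<le> B"
    and "x \<in> carrier V ==> y \<in> carrier W ==> \<beta> x y \<in> carrier Z"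
    and "x \<in> carrier V ==> y \<in> carrier W ==> nrm Z (\<beta> x y) \<le> B * (nrm V x * nrm W y)"
    and "x \<in> carrier V ==> x' \<in> carrier V ==> y \<in> carrier W ==> \<beta> (x \<oplus>\<^bsub>V\<^esub> x') y = \<beta> x y \<oplus>\<^bsub>Z\<^esub> \<beta> x' y"
    and "x \<in> carrier V ==> y \<in> carrier W ==> y' \<in> carrier W ==> \<beta> x (y \<oplus>\<^bsub>W\<^esub> y') = \<beta> x y \<oplus>\<^bsub>Z\<^esub> \<beta> x y'"
    and "x \<in> carrier V ==> y \<in> carrier W ==> \<beta> (a \<odot>\<^bsub>V\<^esub> x) y = a \<odot>\<^bsub>Z\<^esub> \<beta> x y"
    and "x \<in> carrier V ==> y \<in> carrier W ==> \<beta> x (a \<odot>\<^bsub>W\<^esub> y) = a \<odot>\<^bsub>Z\<^esub> \<beta> x y"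
  using assms unfolding bb_def by auto

locale tens_bil = tens2 v c V W for v :: "'k::field => real" and c
    and V :: "('k, 'a) nspace" and W :: "('k, 'b) nspace" +
  fixes Z :: "('k, 'd) nspace" and B :: real and \<beta> :: "'a => 'b => 'd"
  assumes Z [simp]: "banach_space v c Z" and bb: "bb V W Z B \<beta>"
begin

lemmas b = bbD[OF bb]

definition bsum :: "('a \<times> 'b) list => 'd" where
  "bsum l = foldr (%(x, y) z. \<beta> x y \<oplus>\<^bsub>Z\<^esub> z) l \<zero>\<^bsub>Z\<^esub>"

lemma bsum_simps [simp]: "bsum [] = \<zero>\<^bsub>Z\<^esub>" "bsum ((x, y) # l) = \<beta> x y \<oplus>\<^bsub>Z\<^esub> bsum l"
  by (auto simp: bsum_def)

lemma bsum_closed [simp]: "ok l ==> bsum l \<in> carrier Z"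
  by (induction l) (auto simp: b)

lemma bsum_append: "ok l ==> ok m ==> bsum (l @ m) = bsum l \<oplus>\<^bsub>Z\<^esub> bsum m"
  by (induction l) (auto simp: b bs_ac)

lemma bsum_sc: "ok l ==> bsum (sc a l) = a \<odot>\<^bsub>Z\<^esub> bsum l"
  by (induction l) (auto simp: b bs_smult)

lemma beta_zero: assumes "y \<in> carrier W" shows "\<beta> \<zero>\<^bsub>V\<^esub> y = \<zero>\<^bsub>Z\<^esub>"
  using b(6)[of "\<zero>\<^bsub>V\<^esub>" y 0] b(2)[of "\<zero>\<^bsub>V\<^esub>" y] assms by simp

text \<open>Each rule generating \<open>tens_eq\<close> is an identity that a bilinear map
  satisfies, so the value of a list depends only on the algebraic tensor it represents.\<close>

lemma bsum_teq: "teq l m ==> bsum l = bsum m"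
proof (induction rule: tens_eq.induct)
  case (append l m l' m')
  thus ?case using teq_ok by (metis bsum_append)
next
  case (commute l l') thus ?case using bsum_append bs_ac(2)[OF Z bsum_closed bsum_closed] by metis
qed (auto simp: beta_zero b)

lemma bsum_cost: "ok l ==> nrm Z (bsum l) \<le> B * cost l"
proof (induction l)
  case (Cons p l)
  obtain x y where p: "p = (x, y)" by force
  have c: "x \<in> carrier V" "y \<in> carrier W" "ok l" using Cons p by auto
  have "nrm Z (bsum (p # l)) \<le> tri c (nrm Z (\<beta> x y)) (nrm Z (bsum l))"
    unfolding p bsum_simps by (rule nrm_tri) (use c b in auto)
  also have "\<dots> \<le> tri c (B * (nrm V x * nrm W y)) (B * cost l)"
    by (rule tri_mono) (use c Cons b in auto)
  finally show ?case unfolding p by (simp add: tri_mult b(1))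
qed simp

text \<open>The estimate by the cost holds for every list representing the same tensor, so it passes
  to the infimum. The slack is divided by B + 1 to cover B = 0.\<close>

lemma bsum_S: assumes "ok l" shows "nrm Z (bsum l) \<le> B * S l"
proof (rule field_le_epsilon)
  fix e :: real assume "e > 0"
  hence e: "e / (B + 1) > 0" using b(1) by simp
  obtain l' where l': "teq l l'" "cost l' < S l + e / (B + 1)" using S_approx[OF assms(1) e] .
  have "nrm Z (bsum l) \<le> B * cost l'" using bsum_cost[of l'] teq_ok[OF l'(1)] bsum_teq[OF l'(1)] by simp
  also have "\<dots> \<le> B * (S l + e / (B + 1))" by (rule mult_left_mono) (use l' b(1) in auto)
  also have "\<dots> = B * S l + B * (e / (B + 1))" by (simp add: algebra_simps)
  also have "B * (e / (B + 1)) = e - e / (B + 1)" using b(1) by (simp add: field_simps)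
  finally show "nrm Z (bsum l) \<le> B * S l + e" using e by linarith
qed

lemma bsum_diff: assumes "ok l" "ok m" shows "dst Z (bsum l) (bsum m) \<le> B * d l m"
proof -
  have "bsum l \<ominus>\<^bsub>Z\<^esub> bsum m = bsum (l @ sc (-1) m)"
    using assms by (simp add: bsum_append bsum_sc bs_dif_conv)
  thus ?thesis using bsum_S[of "l @ sc (-1) m"] assms by (simp add: d_eq)
qed

lemma bsum_lim_ex: assumes "ca s" shows "\<exists>z. vlim Z (%n. bsum (s n)) z"
proof (rule bs_complete)
  show "vcauchy Z (%n. bsum (s n))"
    unfolding vcauchy_def
  proof (intro conjI allI impI)
    fix e :: real assume "e > 0"
    hence e: "e / (B + 1) > 0" using b(1) by simp
    obtain N where N: "!!m n. m \<ge> N ==> n \<ge> N ==> d (s m) (s n) < e / (B + 1)" using caD[OF assms e] by blast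
    show "\<exists>N. \<forall>m\<ge>N. \<forall>n\<ge>N. dst Z (bsum (s m)) (bsum (s n)) < e"
    proof (intro exI[of _ N] allI impI)
      fix m n assume "m \<ge> N" "n \<ge> N"
      hence "B * d (s m) (s n) \<le> B * (e / (B + 1))" using N b(1) by (intro mult_left_mono) (auto intro: less_imp_le)
      also have "B * (e / (B + 1)) = e - e / (B + 1)" using b(1) by (simp add: field_simps)
      finally show "dst Z (bsum (s m)) (bsum (s n)) < e"
        using bsum_diff[of "s m" "s n"] assms e by simp
    qed
  qed (use assms in simp)
qed simp

lemma bsum_lim_cong: assumes "ca s" "ca t" "q s = q t" "vlim Z (%n. bsum (s n)) z"
  shows "vlim Z (%n. bsum (t n)) z"
proof (rule vlim_le[OF Z])
  show "bsum (t n) \<in> carrier Z" "z \<in> carrier Z" for n using assms by (auto simp: vlim_def)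
  have 1: "dst Z (bsum (t n)) (bsum (s n)) \<le> B * d (s n) (t n)" for n
    using bsum_diff[of "t n" "s n"] assms d_commute[of "t n" "s n"] by simp
  show "dst Z (bsum (t n)) z \<le> B * d (s n) (t n) + dst Z (bsum (s n)) z" for n
    using nrm_dist_trans[OF Z, of "bsum (t n)" "bsum (s n)" z] 1[of n] assms vlim_carrier(1)[OF assms(4)] by simp
  have "(%n. d (s n) (t n)) \<longlonglongrightarrow> 0" using assms q_eq by blast
  from tendsto_add[OF tendsto_mult_right_zero[OF this, of B], of "%n. dst Z (bsum (s n)) z" 0]
  show "(%n. B * d (s n) (t n) + dst Z (bsum (s n)) z) \<longlonglongrightarrow> 0" using assms by (simp add: vlim_def)
qed

text \<open>The limit is demanded along every representing sequence, so that no representative has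
  to be chosen; \<open>bsum_lim_cong\<close> shows that these limits coincide.\<close>

definition lift :: "('a, 'b) tens => 'd" where
  "lift = (\<lambda>A\<in>carrier T. THE z. \<forall>s. ca s --> q s = A --> vlim Z (%n. bsum (s n)) z)"

lemma lift_lim: assumes "ca s" shows "vlim Z (%n. bsum (s n)) (lift (q s))"
proof -
  obtain z where z: "vlim Z (%n. bsum (s n)) z" using bsum_lim_ex[OF assms] by blast
  have "(THE z. \<forall>t. ca t --> q t = q s --> vlim Z (%n. bsum (t n)) z) = z"
  proof (rule the_equality)
    show "\<forall>t. ca t --> q t = q s --> vlim Z (%n. bsum (t n)) z"
      using bsum_lim_cong[OF assms _ _ z] by simp
    show "z' = z" if "\<forall>t. ca t --> q t = q s --> vlim Z (%n. bsum (t n)) z'" for z'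
      using that assms vlim_unique[OF Z _ z] by blast
  qed
  moreover have "q s \<in> carrier T" using assms by (auto simp: T_carrier)
  ultimately show ?thesis using z by (simp add: lift_def)
qed

lemma lift_nrm: assumes "A \<in> carrier T" shows "nrm Z (lift A) \<le> B * nrm T A"
proof -
  obtain s where s: "ca s" "A = q s" using assms by (auto simp: T_carrier)
  show ?thesis unfolding s(2)
    by (rule LIMSEQ_le[OF vlim_nrm[OF Z lift_lim[OF s(1)]] tendsto_mult_left[OF T_nrm[OF s(1)]]])
       (use s bsum_S in auto)
qed

lemma lift_hom: "lift \<in> bl_hom T Z"
proof (rule blI[OF _ _ _ _ lift_nrm])
  show "lift A \<in> carrier Z" if "A \<in> carrier T" for A
    using that vlim_carrier(1)[OF lift_lim] by (auto simp: T_carrier)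
  show "lift A = undefined" if "A \<notin> carrier T" for A using that by (simp add: lift_def)
  show "lift (A \<oplus>\<^bsub>T\<^esub> C) = lift A \<oplus>\<^bsub>Z\<^esub> lift C" if tA: "A \<in> carrier T" "C \<in> carrier T" for A C
  proof -
    obtain s t where s: "ca s" "A = q s" "ca t" "C = q t" using tA by (auto simp: T_carrier)
    have "vlim Z (%n. bsum (s n @ t n)) (lift A \<oplus>\<^bsub>Z\<^esub> lift C)"
      using vlim_add[OF Z lift_lim[OF s(1)] lift_lim[OF s(3)]] s by (simp add: bsum_append)
    thus ?thesis using vlim_unique[OF Z lift_lim[OF ca_append[OF s(1,3)]]] s by (simp add: T_add)
  qed
  show "lift (a \<odot>\<^bsub>T\<^esub> A) = a \<odot>\<^bsub>Z\<^esub> lift A" if tA: "A \<in> carrier T" for a A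
  proof -
    obtain s where s: "ca s" "A = q s" using tA by (auto simp: T_carrier)
    have "vlim Z (%n. bsum (sc a (s n))) (a \<odot>\<^bsub>Z\<^esub> lift A)"
      using vlim_smult[OF Z lift_lim[OF s(1)], of a] s by (simp add: bsum_sc)
    thus ?thesis using vlim_unique[OF Z lift_lim[OF ca_sc[OF s(1)]]] s by (simp add: T_smult)
  qed
qed

lemma lift_elt: assumes "x \<in> carrier V" "y \<in> carrier W" shows "lift (elt c V W x y) = \<beta> x y"
proof -
  have "vlim Z (%n. \<beta> x y) (lift (elt c V W x y))"
    using lift_lim[of "%n. [(x, y)]"] assms by (simp add: elt_def b)
  thus ?thesis using vlim_unique[OF Z _ vlim_const[OF Z]] assms b by blast
qed

end

section \<open>Maps out of tensor products and the monoidal structure\<close>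

context valued
begin

lemma tens2I: "bs V ==> bs W ==> tens2 v c V W"
  by unfold_locales

lemma bs_tensor [simp]: "bs V ==> bs W ==> bs (tensor c V W)"
  by (rule tens2.T_bs[OF tens2I])

text \<open>Linearity extends the agreement from elementary tensors to their finite sums, and
  continuity extends it to the completion, in which these sums are dense.\<close>

lemma tens_ext:
  assumes V: "bs V" and W: "bs W" and Z: "bs Z"
    and f: "f \<in> bl_hom (tensor c V W) Z" and g: "g \<in> bl_hom (tensor c V W) Z"
    and eq: "!!x y. x \<in> carrier V ==> y \<in> carrier W ==> f (elt c V W x y) = g (elt c V W x y)"
  shows "f = g"
proof -
  interpret tens2 v c V W by (rule tens2I[OF V W])
  have e: "elt c V W x y \<in> carrier T" if "x \<in> carrier V" "y \<in> carrier W" for x y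
    unfolding elt_def by (rule T_const_carrier) (use that in auto)
  have l: "f (q (%_. l)) = g (q (%_. l))" if "ok l" for l
    using that
  proof (induction l)
    case Nil show ?case using bl_zero[OF f T_bs Z] bl_zero[OF g T_bs Z] by (simp add: T_zero)
  next
    case (Cons p l)
    obtain x y where p: "p = (x, y)" by force
    have c: "x \<in> carrier V" "y \<in> carrier W" "ok l" "ok ((x, y) # l)" using Cons p by auto
    show ?case unfolding p q_Cons[OF c(4)]
      using bl_add[OF f e[OF c(1,2)] T_const_carrier[OF c(3)]] bl_add[OF g e[OF c(1,2)] T_const_carrier[OF c(3)]]
        eq[OF c(1,2)] Cons.IH[OF c(3)] by simp
  qed
  show ?thesis
  proof (rule bl_ext_dense[OF f g T_bs Z])
    fix A assume "A \<in> carrier T"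
    then obtain s where s: "ca s" "A = q s" by (auto simp: T_carrier)
    show "\<exists>s. vlim T s A \<and> (\<forall>n. f (s n) = g (s n))"
      using T_dense[OF s(1)] l s by (intro exI[of _ "%n. q (%_. s n)"]) simp
  qed
qed

text \<open>\<open>tens_lift\<close> is defined by a description. The map \<open>lift\<close> built
  from limits satisfies it, and \<open>tens_ext\<close> leaves no other candidate.\<close>

lemma tens_lift:
  assumes "bs V" "bs W" "bs Z" "bb V W Z B \<beta>"
  shows tens_lift_hom: "tens_lift c V W Z \<beta> \<in> bl_hom (tensor c V W) Z"
    and tens_lift_elt: "!!x y. x \<in> carrier V ==> y \<in> carrier W ==> tens_lift c V W Z \<beta> (elt c V W x y) = \<beta> x y"
    and tens_lift_bound: "!!t. t \<in> carrier (tensor c V W) ==>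
      nrm Z (tens_lift c V W Z \<beta> t) \<le> B * nrm (tensor c V W) t"
proof -
  interpret tens_bil v c V W Z B \<beta>
    by (intro tens_bil.intro tens2I tens_bil_axioms.intro assms)
  have "tens_lift c V W Z \<beta> = lift"
    unfolding tens_lift_def
  proof (rule the_equality)
    show "lift \<in> bl_hom T Z \<and> (\<forall>x\<in>carrier V. \<forall>y\<in>carrier W. lift (elt c V W x y) = \<beta> x y)"
      using lift_hom lift_elt by blast
    show "\<phi> = lift" if "\<phi> \<in> bl_hom T Z \<and> (\<forall>x\<in>carrier V. \<forall>y\<in>carrier W. \<phi> (elt c V W x y) = \<beta> x y)" for \<phi>
      by (rule tens_ext[OF assms(1-3) _ lift_hom]) (use that lift_elt in auto)
  qed
  thus "tens_lift c V W Z \<beta> \<in> bl_hom (tensor c V W) Z"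
    "!!x y. x \<in> carrier V ==> y \<in> carrier W ==> tens_lift c V W Z \<beta> (elt c V W x y) = \<beta> x y"
    "!!t. t \<in> carrier (tensor c V W) ==> nrm Z (tens_lift c V W Z \<beta> t) \<le> B * nrm (tensor c V W) t"
    using lift_hom lift_elt lift_nrm by auto
qed

lemma tens_lift_unique:
  assumes "bs V" "bs W" "bs Z" "bb V W Z B \<beta>" "f \<in> bl_hom (tensor c V W) Z"
    "!!x y. x \<in> carrier V ==> y \<in> carrier W ==> f (elt c V W x y) = \<beta> x y"
  shows "f = tens_lift c V W Z \<beta>"
  by (rule tens_ext[OF assms(1-3,5) tens_lift_hom[OF assms(1-4)]]) (use assms tens_lift_elt[OF assms(1-4)] in auto)

lemma elt_bb: assumes "bs V" "bs W" shows "bb V W (tensor c V W) 1 (elt c V W)"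
proof -
  interpret tens2 v c V W by (rule tens2I[OF assms])
  show ?thesis
  proof (rule bbI)
    show "elt c V W x y \<in> carrier T" if "x \<in> carrier V" "y \<in> carrier W" for x y
      unfolding elt_def by (rule T_const_carrier) (use that in auto)
    show "nrm T (elt c V W x y) \<le> 1 * (nrm V x * nrm W y)" if "x \<in> carrier V" "y \<in> carrier W" for x y
      using S_le_cost[of "[(x, y)]"] T_nrm_const[of "[(x, y)]"] that by (simp add: elt_def)
    show "elt c V W (x \<oplus>\<^bsub>V\<^esub> x') y = elt c V W x y \<oplus>\<^bsub>T\<^esub> elt c V W x' y"
      if "x \<in> carrier V" "x' \<in> carrier V" "y \<in> carrier W" for x x' y
    proof -
      have "elt c V W x y \<oplus>\<^bsub>T\<^esub> elt c V W x' y = q (%n. [(x, y), (x', y)])"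
        unfolding elt_def by (subst T_add) (use that in auto)
      thus ?thesis unfolding elt_def
        by simp (rule q_eqI; use that tens_eq.add_left[of x V x' y W] in simp)
    qed
    show "elt c V W x (y \<oplus>\<^bsub>W\<^esub> y') = elt c V W x y \<oplus>\<^bsub>T\<^esub> elt c V W x y'"
      if "x \<in> carrier V" "y \<in> carrier W" "y' \<in> carrier W" for x y y'
    proof -
      have "elt c V W x y \<oplus>\<^bsub>T\<^esub> elt c V W x y' = q (%n. [(x, y), (x, y')])"
        unfolding elt_def by (subst T_add) (use that in auto)
      thus ?thesis unfolding elt_def
        by simp (rule q_eqI; use that tens_eq.add_right[of x V y W y'] in simp)
    qed
    show s: "elt c V W (a \<odot>\<^bsub>V\<^esub> x) y = a \<odot>\<^bsub>T\<^esub> elt c V W x y"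
      if "x \<in> carrier V" "y \<in> carrier W" for a x y
      unfolding elt_def by (subst T_smult) (use that in auto)
    show "elt c V W x (a \<odot>\<^bsub>W\<^esub> y) = a \<odot>\<^bsub>T\<^esub> elt c V W x y"
      if "x \<in> carrier V" "y \<in> carrier W" for a x y
    proof -
      have "q (%n. [(a \<odot>\<^bsub>V\<^esub> x, y)]) = q (%n. [(x, a \<odot>\<^bsub>W\<^esub> y)])"
        by (rule q_eqI; use that tens_eq.balanced[of x V y W a] in simp)
      thus ?thesis using s[OF that] by (simp add: elt_def)
    qed
  qed simp
qed

lemmas elt_closed [simp] = bbD(2)[OF elt_bb]
  and elt_nrm = bbD(3)[OF elt_bb, simplified]
  and elt_add = bbD(4,5)[OF elt_bb]
  and elt_smult = bbD(6,7)[OF elt_bb]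

lemma bl_plus:
  assumes "f \<in> bl_hom V W" "g \<in> bl_hom V W" "bs V" "bs W"
  shows "(\<lambda>x\<in>carrier V. f x \<oplus>\<^bsub>W\<^esub> g x) \<in> bl_hom V W"
proof -
  obtain B where B: "B > 0" "!!x. x \<in> carrier V ==> nrm W (f x) \<le> B * nrm V x"
    by (rule bl_bound[OF assms(3,1)]) blast
  obtain C where C: "C > 0" "!!x. x \<in> carrier V ==> nrm W (g x) \<le> C * nrm V x"
    by (rule bl_bound[OF assms(3,2)]) blast
  show ?thesis
  proof (rule blI[where B="B + C"])
    fix x assume x: "x \<in> carrier V"
    thus "nrm W ((\<lambda>x\<in>carrier V. f x \<oplus>\<^bsub>W\<^esub> g x) x) \<le> (B + C) * nrm V x"
      using B(2)[OF x] C(2)[OF x] nrm_add[OF assms(4), of "f x" "g x"] assms by (simp add: algebra_simps)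
  qed (use assms in \<open>auto simp: bs_ac bs_smult\<close>)
qed

lemma bl_scale:
  assumes "f \<in> bl_hom V W" "bs V" "bs W"
  shows "(\<lambda>x\<in>carrier V. a \<odot>\<^bsub>W\<^esub> f x) \<in> bl_hom V W"
proof -
  obtain B where B: "B > 0" "!!x. x \<in> carrier V ==> nrm W (f x) \<le> B * nrm V x"
    by (rule bl_bound[OF assms(2,1)]) blast
  show ?thesis
  proof (rule blI[where B="v a * B"])
    fix x assume x: "x \<in> carrier V"
    thus "nrm W ((\<lambda>x\<in>carrier V. a \<odot>\<^bsub>W\<^esub> f x) x) \<le> v a * B * nrm V x"
      using mult_left_mono[OF B(2)[OF x] v_nonneg[of a]] assms by (simp add: algebra_simps)
  qed (use assms in \<open>auto simp: bs_smult mult.commute\<close>)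
qed

text \<open>By uniqueness of lifts: the pointwise sum of the two lifts is a bounded linear map that
  induces \<gamma>.\<close>

lemma tens_lift_plus:
  assumes "bs V" "bs W" "bs Z" "bb V W Z B \<beta>" "bb V W Z B' \<beta>'" "bb V W Z B'' \<gamma>"
    and "!!x y. x \<in> carrier V ==> y \<in> carrier W ==> \<gamma> x y = \<beta> x y \<oplus>\<^bsub>Z\<^esub> \<beta>' x y" "t \<in> carrier (tensor c V W)"
  shows "tens_lift c V W Z \<gamma> t = tens_lift c V W Z \<beta> t \<oplus>\<^bsub>Z\<^esub> tens_lift c V W Z \<beta>' t"
proof -
  note L = tens_lift_hom[OF assms(1-4)] tens_lift_hom[OF assms(1-3,5)]
  note E = tens_lift_elt[OF assms(1-4)] tens_lift_elt[OF assms(1-3,5)]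
  have "(\<lambda>x\<in>carrier (tensor c V W). tens_lift c V W Z \<beta> x \<oplus>\<^bsub>Z\<^esub> tens_lift c V W Z \<beta>' x) = tens_lift c V W Z \<gamma>"
    by (rule tens_lift_unique[OF assms(1-3,6) bl_plus[OF L]]) (use assms E in auto)
  from fun_cong[OF this, of t] show ?thesis using assms by simp
qed

lemma tens_lift_scale:
  assumes "bs V" "bs W" "bs Z" "bb V W Z B \<beta>" "bb V W Z B'' \<gamma>"
    and "!!x y. x \<in> carrier V ==> y \<in> carrier W ==> \<gamma> x y = a \<odot>\<^bsub>Z\<^esub> \<beta> x y" "t \<in> carrier (tensor c V W)"
  shows "tens_lift c V W Z \<gamma> t = a \<odot>\<^bsub>Z\<^esub> tens_lift c V W Z \<beta> t"
proof -
  note L = tens_lift_hom[OF assms(1-4)]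
  note E = tens_lift_elt[OF assms(1-4)]
  have "(\<lambda>x\<in>carrier (tensor c V W). a \<odot>\<^bsub>Z\<^esub> tens_lift c V W Z \<beta> x) = tens_lift c V W Z \<gamma>"
    by (rule tens_lift_unique[OF assms(1-3,5) bl_scale[OF L]]) (use assms E in auto)
  from fun_cong[OF this, of t] show ?thesis using assms by simp
qed

text \<open>The passage from two variables to three. Lifting in the first two with z fixed leaves a
  map that is again bilinear, now in the tensor and z, because lifts add and scale; a bound
  proportional to the norm of z makes it bounded.\<close>

lemma bb_lift:
  assumes "bs U" "bs V" "bs W" "bs Z" "0 \<le> K"
    and b: "!!z. z \<in> carrier W ==> bb U V Z (K * nrm W z) (\<beta> z)"
    and add: "!!z z' x y. z \<in> carrier W ==> z' \<in> carrier W ==> x \<in> carrier U ==> y \<in> carrier V ==>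
      \<beta> (z \<oplus>\<^bsub>W\<^esub> z') x y = \<beta> z x y \<oplus>\<^bsub>Z\<^esub> \<beta> z' x y"
    and smult: "!!a z x y. z \<in> carrier W ==> x \<in> carrier U ==> y \<in> carrier V ==>
      \<beta> (a \<odot>\<^bsub>W\<^esub> z) x y = a \<odot>\<^bsub>Z\<^esub> \<beta> z x y"
  shows "bb (tensor c U V) W Z K (%t z. tens_lift c U V Z (\<beta> z) t)"
proof (rule bbI)
  note L = tens_lift_hom[OF assms(1,2,4) b]
  show "tens_lift c U V Z (\<beta> z) t \<in> carrier Z" if "t \<in> carrier (tensor c U V)" "z \<in> carrier W" for t z
    using L[OF that(2)] that by simp
  show "nrm Z (tens_lift c U V Z (\<beta> z) t) \<le> K * (nrm (tensor c U V) t * nrm W z)"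
    if "t \<in> carrier (tensor c U V)" "z \<in> carrier W" for t z
    using tens_lift_bound[OF assms(1,2,4) b[OF that(2)] that(1)] by (simp add: algebra_simps)
  show "tens_lift c U V Z (\<beta> (z \<oplus>\<^bsub>W\<^esub> z')) t = tens_lift c U V Z (\<beta> z) t \<oplus>\<^bsub>Z\<^esub> tens_lift c U V Z (\<beta> z') t"
    if "t \<in> carrier (tensor c U V)" "z \<in> carrier W" "z' \<in> carrier W" for t z z'
    by (rule tens_lift_plus[OF assms(1,2,4) b b b]) (use that assms add in auto)
  show "tens_lift c U V Z (\<beta> (a \<odot>\<^bsub>W\<^esub> z)) t = a \<odot>\<^bsub>Z\<^esub> tens_lift c U V Z (\<beta> z) t"
    if "t \<in> carrier (tensor c U V)" "z \<in> carrier W" for t z a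
    by (rule tens_lift_scale[OF assms(1,2,4) b b]) (use that assms smult in auto)
  show "tens_lift c U V Z (\<beta> z) (t \<oplus>\<^bsub>tensor c U V\<^esub> t') = tens_lift c U V Z (\<beta> z) t \<oplus>\<^bsub>Z\<^esub> tens_lift c U V Z (\<beta> z) t'"
    if "t \<in> carrier (tensor c U V)" "t' \<in> carrier (tensor c U V)" "z \<in> carrier W" for t t' z
    by (rule bl_add[OF L]) (use that in auto)
  show "tens_lift c U V Z (\<beta> z) (a \<odot>\<^bsub>tensor c U V\<^esub> t) = a \<odot>\<^bsub>Z\<^esub> tens_lift c U V Z (\<beta> z) t"
    if "t \<in> carrier (tensor c U V)" "z \<in> carrier W" for t z a
    by (rule bl_smult[OF L]) (use that in auto)
qed fact

lemma bb_comp: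
  assumes "bs V" "bs W" "bs V'" "bs W'" "f \<in> bl_hom V V'" "g \<in> bl_hom W W'" "bb V' W' Z B \<beta>"
  shows "\<exists>C. bb V W Z C (%x y. \<beta> (f x) (g y))"
proof -
  obtain F where F: "F > 0" "!!x. x \<in> carrier V ==> nrm V' (f x) \<le> F * nrm V x"
    by (rule bl_bound[OF assms(1,5)]) blast
  obtain G where G: "G > 0" "!!x. x \<in> carrier W ==> nrm W' (g x) \<le> G * nrm W x"
    by (rule bl_bound[OF assms(2,6)]) blast
  note b = bbD[OF assms(7)]
  have "bb V W Z (B * (F * G)) (%x y. \<beta> (f x) (g y))"
  proof (rule bbI)
    fix x y assume x: "x \<in> carrier V" and y: "y \<in> carrier W"
    have "nrm Z (\<beta> (f x) (g y)) \<le> B * (nrm V' (f x) * nrm W' (g y))" by (rule b) (use x y assms in auto)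
    also have "\<dots> \<le> B * ((F * nrm V x) * (G * nrm W y))"
      by (intro mult_left_mono mult_mono F(2)[OF x] G(2)[OF y] b(1)) (use x y assms F in auto)
    finally show "nrm Z (\<beta> (f x) (g y)) \<le> B * (F * G) * (nrm V x * nrm W y)" by (simp add: algebra_simps)
  qed (use assms b F(1) G(1) in auto)
  thus ?thesis by blast
qed

lemma tens_map:
  assumes "bs V" "bs W" "bs V'" "bs W'" "f \<in> bl_hom V V'" "g \<in> bl_hom W W'"
  shows tens_map_hom [simp]: "tens_map c V V' W W' f g \<in> bl_hom (tensor c V W) (tensor c V' W')"
    and tens_map_elt [simp]: "!!x y. x \<in> carrier V ==> y \<in> carrier W ==>
      tens_map c V V' W W' f g (elt c V W x y) = elt c V' W' (f x) (g y)"
proof -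
  obtain C where C: "bb V W (tensor c V' W') C (%x y. elt c V' W' (f x) (g y))"
    using bb_comp[OF assms elt_bb] assms by blast
  note L = tens_lift[OF assms(1,2) bs_tensor[OF assms(3,4)] C]
  show "tens_map c V V' W W' f g \<in> bl_hom (tensor c V W) (tensor c V' W')"
    "!!x y. x \<in> carrier V ==> y \<in> carrier W ==>
      tens_map c V V' W W' f g (elt c V W x y) = elt c V' W' (f x) (g y)"
    unfolding tens_map_def using L by auto
qed

lemma tens_map_comp:
  assumes "bs V" "bs W" "bs V'" "bs W'" "bs V''" "bs W''" "f \<in> bl_hom V V'" "g \<in> bl_hom W W'"
    "f' \<in> bl_hom V' V''" "g' \<in> bl_hom W' W''"
  shows "compose (carrier (tensor c V W)) (tens_map c V' V'' W' W'' f' g') (tens_map c V V' W W' f g)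
    = tens_map c V V'' W W'' (compose (carrier V) f' f) (compose (carrier W) g' g)"
proof (rule tens_ext[of V W "tensor c V'' W''"])
  note m = tens_map_hom[OF assms(1-4,7,8)] tens_map_hom[OF assms(3-6,9,10)]
  show "compose (carrier (tensor c V W)) (tens_map c V' V'' W' W'' f' g') (tens_map c V V' W W' f g)
    \<in> bl_hom (tensor c V W) (tensor c V'' W'')"
    by (rule bl_comp[OF m]) (use assms in auto)
  show "tens_map c V V'' W W'' (compose (carrier V) f' f) (compose (carrier W) g' g)
    \<in> bl_hom (tensor c V W) (tensor c V'' W'')"
    by (rule tens_map_hom[OF assms(1,2,5,6) bl_comp[OF assms(7,9)] bl_comp[OF assms(8,10)]]) (use assms in auto)
  show "compose (carrier (tensor c V W)) (tens_map c V' V'' W' W'' f' g') (tens_map c V V' W W' f g) (elt c V W x y)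
    = tens_map c V V'' W W'' (compose (carrier V) f' f) (compose (carrier W) g' g) (elt c V W x y)"
    if "x \<in> carrier V" "y \<in> carrier W" for x y
    using that assms tens_map_elt[OF assms(1,2,5,6) bl_comp[OF assms(7,9)] bl_comp[OF assms(8,10)], of x y]
    by (simp add: compose_eq)
qed (use assms in auto)

lemma tens_map_id: assumes "bs V" "bs W"
  shows "tens_map c V V W W (ban_id V) (ban_id W) = ban_id (tensor c V W)"
  by (rule tens_ext[of V W "tensor c V W"]) (use assms in auto)

lemma bl_elt_left: assumes "bs V" "bs W" "z \<in> carrier W"
  shows "(\<lambda>x\<in>carrier V. elt c V W x z) \<in> bl_hom V (tensor c V W)"
  by (rule blI[where B="nrm W z"]) (use assms elt_nrm in \<open>auto simp: elt_add elt_smult mult.commute\<close>)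

lemma bl_elt_right: assumes "bs V" "bs W" "z \<in> carrier V"
  shows "(\<lambda>y\<in>carrier W. elt c V W z y) \<in> bl_hom W (tensor c V W)"
  by (rule blI[where B="nrm V z"]) (use assms elt_nrm in \<open>auto simp: elt_add elt_smult mult.commute\<close>)

text \<open>For fixed z the maps t \<mapsto> f(t \<otimes> z) and t \<mapsto> g(t \<otimes> z) agree
  on elementary tensors, hence everywhere; so f and g agree on the elementary tensors of the outer
  product.\<close>

lemma tens_ext_l:
  assumes "bs U" "bs V" "bs W" "bs Z"
    and f: "f \<in> bl_hom (tensor c (tensor c U V) W) Z" and g: "g \<in> bl_hom (tensor c (tensor c U V) W) Z"
    and eq: "!!x y z. x \<in> carrier U ==> y \<in> carrier V ==> z \<in> carrier W ==>
      f (elt c (tensor c U V) W (elt c U V x y) z) = g (elt c (tensor c U V) W (elt c U V x y) z)"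
  shows "f = g"
proof (rule tens_ext[OF _ _ _ f g])
  fix t z assume t: "t \<in> carrier (tensor c U V)" and z: "z \<in> carrier W"
  let ?T = "tensor c U V"
  let ?h = "\<lambda>x\<in>carrier ?T. elt c ?T W x z"
  have h: "?h \<in> bl_hom ?T (tensor c ?T W)" by (rule bl_elt_left) (use assms z in auto)
  have "compose (carrier ?T) f ?h = compose (carrier ?T) g ?h"
    by (rule tens_ext[of U V Z, OF _ _ _ bl_comp[OF h f] bl_comp[OF h g]]) (use assms z in \<open>auto simp: compose_eq\<close>)
  from fun_cong[OF this, of t] show "f (elt c ?T W t z) = g (elt c ?T W t z)" using t by (simp add: compose_eq)
qed (use assms in auto)

lemma tens_assoc:
  assumes "bs U" "bs V" "bs W"
  shows tens_assoc_hom [simp]: "tens_assoc c U V W \<in> bl_hom (tensor c (tensor c U V) W) (tensor c U (tensor c V W))"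
    and tens_assoc_lift: "!!t z. t \<in> carrier (tensor c U V) ==> z \<in> carrier W ==>
       tens_assoc c U V W (elt c (tensor c U V) W t z) =
       tens_lift c U V (tensor c U (tensor c V W)) (%x y. elt c U (tensor c V W) x (elt c V W y z)) t"
    and tens_assoc_elt [simp]: "!!x y z. x \<in> carrier U ==> y \<in> carrier V ==> z \<in> carrier W ==>
       tens_assoc c U V W (elt c (tensor c U V) W (elt c U V x y) z) = elt c U (tensor c V W) x (elt c V W y z)"
proof -
  let ?Z = "tensor c U (tensor c V W)"
  have b: "bb U V ?Z (1 * nrm W z) (%x y. elt c U (tensor c V W) x (elt c V W y z))" if z: "z \<in> carrier W" for z
  proof (rule bbI)
    fix x y assume x: "x \<in> carrier U" "y \<in> carrier V"
    have "nrm ?Z (elt c U (tensor c V W) x (elt c V W y z)) \<le> nrm U x * nrm (tensor c V W) (elt c V W y z)"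
      by (rule elt_nrm) (use x z assms in auto)
    also have "\<dots> \<le> nrm U x * (nrm V y * nrm W z)"
      by (intro mult_left_mono elt_nrm) (use x z assms in auto)
    finally show "nrm ?Z (elt c U (tensor c V W) x (elt c V W y z)) \<le> 1 * nrm W z * (nrm U x * nrm V y)"
      by (simp add: algebra_simps)
  qed (use assms z in \<open>auto simp: elt_add elt_smult\<close>)
  have B: "bb (tensor c U V) W ?Z 1 (%t z. tens_lift c U V ?Z (%x y. elt c U (tensor c V W) x (elt c V W y z)) t)"
    by (rule bb_lift[OF _ _ _ _ _ b]) (use assms in \<open>auto simp: elt_add elt_smult\<close>)
  have T: "bs (tensor c U V)" "bs ?Z" using assms by auto
  note L = tens_lift[OF T(1) assms(3) T(2) B]
  show "tens_assoc c U V W \<in> bl_hom (tensor c (tensor c U V) W) ?Z"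
    unfolding tens_assoc_def Let_def by (rule L)
  show 1: "tens_assoc c U V W (elt c (tensor c U V) W t z) =
       tens_lift c U V (tensor c U (tensor c V W)) (%x y. elt c U (tensor c V W) x (elt c V W y z)) t"
    if "t \<in> carrier (tensor c U V)" "z \<in> carrier W" for t z
    unfolding tens_assoc_def Let_def by (rule L(2)) (use that in auto)
  show "tens_assoc c U V W (elt c (tensor c U V) W (elt c U V x y) z) = elt c U (tensor c V W) x (elt c V W y z)"
    if "x \<in> carrier U" "y \<in> carrier V" "z \<in> carrier W" for x y z
    using 1[of "elt c U V x y" z] tens_lift_elt[OF assms(1,2) T(2) b[OF that(3)] that(1,2)] that assms by simp
qed

lemma tens_lunit:
  fixes V (structure) assumes "bs V"
  shows tens_lunit_hom [simp]: "tens_lunit v c V \<in> bl_hom (tensor c (base_field v) V) V"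
    and tens_lunit_elt [simp]: "!!a x. x \<in> carrier V ==> tens_lunit v c V (elt c (base_field v) V a x) = a \<odot> x"
proof -
  have B: "bb (base_field v) V V 1 (%a x. a \<odot> x)"
    by (rule bbI) (use assms in \<open>auto simp: bs_smult mult.commute\<close>)
  note L = tens_lift[OF bs_base assms assms B]
  show "tens_lunit v c V \<in> bl_hom (tensor c (base_field v) V) V"
    "!!a x. x \<in> carrier V ==> tens_lunit v c V (elt c (base_field v) V a x) = a \<odot> x"
    unfolding tens_lunit_def using L by auto
qed

lemma tens_runit:
  fixes V (structure) assumes "bs V"
  shows tens_runit_hom [simp]: "tens_runit v c V \<in> bl_hom (tensor c V (base_field v)) V"
    and tens_runit_elt [simp]: "!!a x. x \<in> carrier V ==> tens_runit v c V (elt c V (base_field v) x a) = a \<odot> x"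
proof -
  have B: "bb V (base_field v) V 1 (%x a. a \<odot> x)"
    by (rule bbI) (use assms in \<open>auto simp: bs_smult mult.commute\<close>)
  note L = tens_lift[OF assms bs_base assms B]
  show "tens_runit v c V \<in> bl_hom (tensor c V (base_field v)) V"
    "!!a x. x \<in> carrier V ==> tens_runit v c V (elt c V (base_field v) x a) = a \<odot> x"
    unfolding tens_runit_def using L by auto
qed

text \<open>Four variables are lifted pair by pair: \<open>b1\<close> serves to lift in x', y' with
  x, y fixed, \<open>b2\<close> to lift in x, y with the second tensor t fixed, and \<open>B\<close>
  lets both tensors vary.\<close>

lemma tens_swap_mid:
  fixes V :: "('k, 'a) nspace"
  assumes V: "bs V"
  defines "T \<equiv> tensor c V V"
  shows tens_swap_mid_hom: "tens_swap_mid c V \<in> bl_hom (tensor c T T) (tensor c T T)"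
    and tens_swap_mid_elt: "!!x y x' y'. x \<in> carrier V ==> y \<in> carrier V ==> x' \<in> carrier V ==> y' \<in> carrier V ==>
      tens_swap_mid c V (elt c T T (elt c V V x y) (elt c V V x' y')) = elt c T T (elt c V V x x') (elt c V V y y')"
proof -
  let ?Z = "tensor c T T"
  have bT: "bs T" "bs ?Z" using V by (auto simp: T_def)
  let ?g = "%x y x' y'. elt c T T (elt c V V x x') (elt c V V y y')"
  have eT: "elt c V V x y \<in> carrier T" if "x \<in> carrier V" "y \<in> carrier V" for x y using that V by (simp add: T_def)
  have eN: "nrm ?Z (?g x y x' y') \<le> nrm V x * nrm V y * (nrm V x' * nrm V y')"
    if "x \<in> carrier V" "y \<in> carrier V" "x' \<in> carrier V" "y' \<in> carrier V" for x y x' y'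
  proof -
    have "nrm ?Z (?g x y x' y') \<le> nrm T (elt c V V x x') * nrm T (elt c V V y y')"
      by (rule elt_nrm) (use that bT eT in auto)
    also have "\<dots> \<le> (nrm V x * nrm V x') * (nrm V y * nrm V y')"
      by (intro mult_mono) (use that V bT eT elt_nrm[OF V V, folded T_def] in auto)
    finally show ?thesis by (simp add: algebra_simps)
  qed
  note add = elt_add[OF V V, folded T_def] elt_add[OF bT(1) bT(1)]
  note sm = elt_smult[OF V V, folded T_def] elt_smult[OF bT(1) bT(1)]
  have b1: "bb V V ?Z (nrm V x * nrm V y) (?g x y)" if "x \<in> carrier V" "y \<in> carrier V" for x y
    by (rule bbI) (use that V bT eT eN in \<open>auto simp: add sm\<close>)
  note L1 = tens_lift[OF V V bT(2) b1, folded T_def]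
  have b2: "bb V V ?Z (1 * nrm T t) (%x y. tens_lift c V V ?Z (?g x y) t)" if t: "t \<in> carrier T" for t
  proof (rule bbI)
    show "tens_lift c V V ?Z (?g x y) t \<in> carrier ?Z" if "x \<in> carrier V" "y \<in> carrier V" for x y
      using L1(1)[OF that] t by simp
    show "nrm ?Z (tens_lift c V V ?Z (?g x y) t) \<le> 1 * nrm T t * (nrm V x * nrm V y)"
      if "x \<in> carrier V" "y \<in> carrier V" for x y
      using L1(3)[OF that t] by (simp add: mult.commute)
    show "tens_lift c V V ?Z (?g (x \<oplus>\<^bsub>V\<^esub> x') y) t = tens_lift c V V ?Z (?g x y) t \<oplus>\<^bsub>?Z\<^esub> tens_lift c V V ?Z (?g x' y) t"
      if "x \<in> carrier V" "x' \<in> carrier V" "y \<in> carrier V" for x x' y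
      by (rule tens_lift_plus[OF V V bT(2) b1 b1 b1, folded T_def]) (use that V bT eT t in \<open>auto simp: add\<close>)
    show "tens_lift c V V ?Z (?g x (y \<oplus>\<^bsub>V\<^esub> y')) t = tens_lift c V V ?Z (?g x y) t \<oplus>\<^bsub>?Z\<^esub> tens_lift c V V ?Z (?g x y') t"
      if "x \<in> carrier V" "y \<in> carrier V" "y' \<in> carrier V" for x y y'
      by (rule tens_lift_plus[OF V V bT(2) b1 b1 b1, folded T_def]) (use that V bT eT t in \<open>auto simp: add\<close>)
    show "tens_lift c V V ?Z (?g (a \<odot>\<^bsub>V\<^esub> x) y) t = a \<odot>\<^bsub>?Z\<^esub> tens_lift c V V ?Z (?g x y) t"
      if "x \<in> carrier V" "y \<in> carrier V" for a x y
      by (rule tens_lift_scale[OF V V bT(2) b1 b1, folded T_def]) (use that V bT eT t in \<open>auto simp: sm\<close>)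
    show "tens_lift c V V ?Z (?g x (a \<odot>\<^bsub>V\<^esub> y)) t = a \<odot>\<^bsub>?Z\<^esub> tens_lift c V V ?Z (?g x y) t"
      if "x \<in> carrier V" "y \<in> carrier V" for a x y
      by (rule tens_lift_scale[OF V V bT(2) b1 b1, folded T_def]) (use that V bT eT t in \<open>auto simp: sm\<close>)
  qed (use t bT in simp)
  have B: "bb T T ?Z 1 (%s t. tens_lift c V V ?Z (%x y. tens_lift c V V ?Z (?g x y) t) s)"
    unfolding T_def
    by (rule bb_lift[OF V V _ _ _ b2, unfolded T_def])
       (use V bT bl_add[OF L1(1)] bl_smult[OF L1(1)] in \<open>auto simp: T_def\<close>)
  note L = tens_lift[OF bT(1) bT(1) bT(2) B]
  show "tens_swap_mid c V \<in> bl_hom (tensor c T T) (tensor c T T)"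
    unfolding tens_swap_mid_def Let_def T_def[symmetric] by (rule L)
  show "tens_swap_mid c V (elt c T T (elt c V V x y) (elt c V V x' y')) = elt c T T (elt c V V x x') (elt c V V y y')"
    if x: "x \<in> carrier V" "y \<in> carrier V" "x' \<in> carrier V" "y' \<in> carrier V" for x y x' y'
    unfolding tens_swap_mid_def Let_def T_def[symmetric]
    using L(2)[OF eT eT, of x y x' y'] tens_lift_elt[OF V V bT(2) b2[OF eT], of x' y' x y]
      L1(2)[of x y x' y'] x by simp
qed

end

section \<open>Continuous functions on a compact group\<close>

locale cgrp = valued v c for v :: "'k::field => real" and c +
  fixes G :: "'g::topological_group_add itself"
  assumes compact_G: "compact (UNIV :: 'g set)"
begin

abbreviation Cb :: "('k, 'a) nspace => ('k, 'g => 'a) nspace" where "Cb \<equiv> Cblu"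
abbreviation C :: "('k, 'g => 'k) nspace" where "C \<equiv> Cblu (base_field v)"
abbreviation "tC V \<equiv> tensor c C V"

text \<open>The open sets on which P x holds near x cover G, and a finite subcover leaves finitely
  many centres. Compactness enters below in this form.\<close>

lemma compact_cover:
  assumes "!!x::'g. eventually (P x) (nhds x)"
  shows "\<exists>F. finite F \<and> (\<forall>y. \<exists>x\<in>F. P x y)"
proof -
  have "\<forall>x. \<exists>U. open U \<and> x \<in> U \<and> (\<forall>y\<in>U. P x y)" using assms by (simp add: eventually_nhds)
  then obtain U where U: "!!x. open (U x)" "!!x. x \<in> U x" "!!x y. y \<in> U x ==> P x y" by metis
  have "(UNIV::'g set) \<subseteq> (\<Union>x\<in>UNIV. U x)" using U by blast
  then obtain F where F: "finite F" "UNIV \<subseteq> (\<Union>x\<in>F. U x)"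
    using compactE_image[OF compact_G, of UNIV U] U by metis
  show ?thesis using F U(3) by (intro exI[of _ F]) blast
qed

lemma cont_intoD: "cont_into V f ==> f x \<in> carrier V"
  "cont_into V f ==> e > 0 ==> eventually (%y. dst V (f y) (f x) < e) (nhds x)"
  unfolding cont_into_def by auto

lemma cont_bdd:
  assumes "bs V" "cont_into V (f :: 'g => 'a)"
  shows "bdd_above (range (%x. nrm V (f x)))"
proof -
  obtain F where F: "finite F" "!!y. \<exists>x\<in>F. dst V (f y) (f x) < 1"
    using compact_cover[of "%x y. dst V (f y) (f x) < 1"] cont_intoD(2)[OF assms(2), of 1] by auto
  have fc: "f x \<in> carrier V" for x by (rule cont_intoD[OF assms(2)])
  show ?thesis
  proof (rule bdd_aboveI2)
    fix y
    obtain x where x: "x \<in> F" "dst V (f y) (f x) < 1" using F by blast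
    have "nrm V (f y) \<le> dst V (f y) (f x) + nrm V (f x)" by (rule nrm_le_diff) (use assms fc in auto)
    also have "nrm V (f x) \<le> (\<Sum>x\<in>F. nrm V (f x))"
      by (rule member_le_sum) (use x F assms fc in auto)
    finally show "nrm V (f y) \<le> 1 + (\<Sum>x\<in>F. nrm V (f x))" using x by simp
  qed
qed

text \<open>Addition is jointly continuous at (0, x), so f(h + y) is near f(x) for h near 0 and y
  near x. Compactness leaves finitely many x, and the finitely many conditions on h can be met
  together.\<close>

lemma cont_luc:
  assumes "bs V" "cont_into V (f :: 'g => 'a)"
  shows "left_unif_cont V f"
  unfolding left_unif_cont_def
proof (intro allI impI)
  fix e :: real assume "e > 0" hence e2: "e/2 > 0" by simp
  have fc: "f x \<in> carrier V" for x by (rule cont_intoD[OF assms(2)])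
  have "\<exists>Ph. eventually Ph (nhds 0) \<and> eventually (%y. \<forall>h. Ph h --> dst V (f (h + y)) (f y) < e) (nhds x)" for x
  proof -
    have "filterlim (%p. fst p + snd p) (nhds (0 + x)) (nhds 0 \<times>\<^sub>F nhds x)" by (rule tendsto_add_Pair)
    hence "eventually (%p. dst V (f (fst p + snd p)) (f x) < e/2) (nhds 0 \<times>\<^sub>F nhds x)"
      using cont_intoD(2)[OF assms(2) e2, of "0 + x"] by (auto simp: filterlim_iff)
    then obtain P Q where P: "eventually P (nhds 0)" and Q: "eventually Q (nhds x)"
      and PQ: "!!h y. P h ==> Q y ==> dst V (f (h + y)) (f x) < e/2"
      unfolding eventually_prod_filter by auto
    \<comment> \<open>The case h = 0 of the estimate says that f y itself is near f x.\<close>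
    have P0: "P 0" by (rule eventually_nhds_x_imp_x[OF P])
    have "dst V (f (h + y)) (f y) < e" if "P h" "Q y" for h y
      using PQ[OF that] PQ[OF P0 that(2)] nrm_dist_trans[OF assms(1), of "f (h + y)" "f x" "f y"]
        nrm_commute[OF assms(1), of "f x" "f y"] fc by simp
    hence "eventually (%y. \<forall>h. P h --> dst V (f (h + y)) (f y) < e) (nhds x)"
      using Q by (auto elim: eventually_mono)
    thus ?thesis using P by blast
  qed
  hence "\<exists>Ph. \<forall>x. eventually (Ph x) (nhds 0) \<and>
      eventually (%y. \<forall>h. Ph x h --> dst V (f (h + y)) (f y) < e) (nhds x)"
    by (intro choice allI)
  then obtain Ph where Ph: "!!x. eventually (Ph x) (nhds 0)"
    "!!x. eventually (%y. \<forall>h. Ph x h --> dst V (f (h + y)) (f y) < e) (nhds x)"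
    by blast
  obtain F where F: "finite F" "!!y. \<exists>x\<in>F. \<forall>h. Ph x h --> dst V (f (h + y)) (f y) < e"
    using compact_cover[of "%x y. \<forall>h. Ph x h --> dst V (f (h + y)) (f y) < e", OF Ph(2)]
    by blast
  have "eventually (%h. \<forall>x\<in>F. Ph x h) (nhds 0)" using F(1) Ph(1) by (simp add: eventually_ball_finite)
  thus "eventually (%h. \<forall>x. dst V (f (h + x)) (f x) < e) (nhds 0)"
  proof (rule eventually_mono)
    fix h assume h: "\<forall>x\<in>F. Ph x h"
    show "\<forall>x. dst V (f (h + x)) (f x) < e"
    proof
      fix y show "dst V (f (h + y)) (f y) < e" using F(2)[of y] h by blast
    qed
  qed
qed

section \<open>The Banach space of continuous functions on G\<close>

lemma Cb_carrier: "bs V ==> f \<in> carrier (Cb V) \<longleftrightarrow> cont_into V f"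
  by (auto simp: Cblu_def cont_bdd cont_luc)

lemma Cb_simps: fixes V (structure) shows "\<zero>\<^bsub>Cb V\<^esub> = (%_. \<zero>)" "f \<oplus>\<^bsub>Cb V\<^esub> f' = (%x. f x \<oplus> f' x)"
  "a \<odot>\<^bsub>Cb V\<^esub> f = (%x. a \<odot> f x)"
  by (auto simp: Cblu_def)

lemma Cb_nrm_ge: "bs V ==> f \<in> carrier (Cb V) ==> nrm V (f x) \<le> nrm (Cb V) f"
  using cont_bdd[of V f] Cb_carrier[of V f] by (auto simp: Cblu_def intro: cSUP_upper)

lemma Cb_nrm_le: "(!!x. nrm V (f x) \<le> b) ==> nrm (Cb V) f \<le> b"
  by (auto simp: Cblu_def intro: cSUP_least)

lemma Cb_closed: "bs V ==> f \<in> carrier (Cb V) ==> f x \<in> carrier V"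
  by (simp add: Cb_carrier cont_intoD)

lemma Cb_nrm_nonneg: "bs V ==> f \<in> carrier (Cb V) ==> 0 \<le> nrm (Cb V) f"
  by (rule order_trans[OF nrm_nonneg Cb_nrm_ge[of V f undefined]]) (auto intro: Cb_closed)

lemma cont_const: "bs V ==> x \<in> carrier V ==> cont_into V (%_. x)"
  by (simp add: cont_into_def)

lemma cont_le:
  assumes "bs W" "!!x. f x \<in> carrier W" "cont_into V g" "0 \<le> K"
    "!!x y. dst W (f y) (f x) \<le> K * dst V (g y) (g x)"
  shows "cont_into W f"
  unfolding cont_into_def
proof (intro conjI allI impI assms)
  fix x and e :: real assume "e > 0"
  hence "e / (K + 1) > 0" using assms by simp
  from cont_intoD(2)[OF assms(3) this, of x]
  show "eventually (%y. dst W (f y) (f x) < e) (nhds x)"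
  proof (rule eventually_mono)
    fix y assume "dst V (g y) (g x) < e / (K + 1)"
    hence "K * dst V (g y) (g x) \<le> K * (e / (K + 1))" using assms(4) by (intro mult_left_mono) auto
    also have "\<dots> = e - e / (K + 1)" using assms(4) by (simp add: field_simps)
    also have "\<dots> < e" using \<open>e / (K + 1) > 0\<close> by simp
    finally show "dst W (f y) (f x) < e" using assms(5)[of y x] by simp
  qed
qed

lemma cont_bl: assumes "bs V" "bs W" "\<phi> \<in> bl_hom V W" "cont_into V f" shows "cont_into W (%x. \<phi> (f x))"
proof -
  obtain B where B: "B > 0" "!!x. x \<in> carrier V ==> nrm W (\<phi> x) \<le> B * nrm V x"
    by (rule bl_bound[OF assms(1,3)]) blast
  have fc: "f x \<in> carrier V" for x by (rule cont_intoD[OF assms(4)])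
  show ?thesis
  proof (rule cont_le[OF assms(2) _ assms(4)])
    show "dst W (\<phi> (f y)) (\<phi> (f x)) \<le> B * dst V (f y) (f x)" for x y
      using B(2)[of "f y \<ominus>\<^bsub>V\<^esub> f x"] bl_diff[OF assms(3,1,2), of "f y" "f x"] assms fc by simp
  qed (use assms B fc in auto)
qed

lemma cont_comp: "cont_into V f ==> (!!x. (p \<longlongrightarrow> p x) (nhds x)) ==> cont_into V (%x. f (p x))"
  unfolding cont_into_def filterlim_iff by blast

lemma cont_add: fixes V (structure) assumes "bs V" "cont_into V f" "cont_into V g" shows "cont_into V (%x. f x \<oplus> g x)"
  unfolding cont_into_def
proof (intro conjI allI impI)
  have fc: "f x \<in> carrier V" "g x \<in> carrier V" for x using assms cont_intoD by auto
  show "f x \<oplus> g x \<in> carrier V" for x using assms fc by simp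
  fix x and e :: real assume "e > 0" hence e: "e/2 > 0" by simp
  show "eventually (%y. dst V (f y \<oplus> g y) (f x \<oplus> g x) < e) (nhds x)"
    using cont_intoD(2)[OF assms(2) e, of x] cont_intoD(2)[OF assms(3) e, of x]
  proof eventually_elim
    fix y assume "dst V (f y) (f x) < e/2" "dst V (g y) (g x) < e/2"
    thus "dst V (f y \<oplus> g y) (f x \<oplus> g x) < e"
      using nrm_add[OF assms(1), of "f y \<ominus> f x" "g y \<ominus> g x"] assms fc by (simp add: bs_diff_add)
  qed
qed

lemma bl_mult: "bs V ==> (\<lambda>x\<in>carrier V. a \<odot>\<^bsub>V\<^esub> x) \<in> bl_hom V V"
  by (rule blI[where B="v a"]) (auto simp: bs_smult mult.commute)

lemma cont_smult: assumes "bs V" "cont_into V f" shows "cont_into V (%x. a \<odot>\<^bsub>V\<^esub> f x)"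
  using cont_bl[OF assms(1,1) bl_mult[OF assms(1)] assms(2), of a] cont_intoD(1)[OF assms(2)] by simp

lemma bs_Cb [simp]: assumes V: "bs V" shows "bs (Cb V)"
proof (rule bsI)
  note S = Cb_simps Cb_carrier[OF V]
  show "f \<oplus>\<^bsub>Cb V\<^esub> g \<in> carrier (Cb V)" if "f \<in> carrier (Cb V)" "g \<in> carrier (Cb V)" for f g
    using that cont_add[OF V] by (simp add: S)
  show "\<zero>\<^bsub>Cb V\<^esub> \<in> carrier (Cb V)" using V by (simp add: S cont_const)
  show "a \<odot>\<^bsub>Cb V\<^esub> f \<in> carrier (Cb V)" if "f \<in> carrier (Cb V)" for a f
    using that cont_smult[OF V] by (simp add: S)
  show "f \<oplus>\<^bsub>Cb V\<^esub> g \<oplus>\<^bsub>Cb V\<^esub> h = f \<oplus>\<^bsub>Cb V\<^esub> (g \<oplus>\<^bsub>Cb V\<^esub> h)"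
    if "f \<in> carrier (Cb V)" "g \<in> carrier (Cb V)" "h \<in> carrier (Cb V)" for f g h
    using that Cb_closed[OF V] by (simp add: Cb_simps fun_eq_iff bs_ac[OF V])
  show "f \<oplus>\<^bsub>Cb V\<^esub> g = g \<oplus>\<^bsub>Cb V\<^esub> f" if "f \<in> carrier (Cb V)" "g \<in> carrier (Cb V)" for f g
    using that Cb_closed[OF V] bs_ac(2)[OF V] by (simp add: Cb_simps fun_eq_iff)
  show "\<zero>\<^bsub>Cb V\<^esub> \<oplus>\<^bsub>Cb V\<^esub> f = f" if "f \<in> carrier (Cb V)" for f
    using that Cb_closed[OF V] V by (simp add: Cb_simps fun_eq_iff)
  show "- 1 \<odot>\<^bsub>Cb V\<^esub> f \<oplus>\<^bsub>Cb V\<^esub> f = \<zero>\<^bsub>Cb V\<^esub>" if "f \<in> carrier (Cb V)" for f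
    using that Cb_closed[OF V] V by (simp add: Cb_simps fun_eq_iff flip: bs_neg_conv)
  show "(a + b) \<odot>\<^bsub>Cb V\<^esub> f = a \<odot>\<^bsub>Cb V\<^esub> f \<oplus>\<^bsub>Cb V\<^esub> b \<odot>\<^bsub>Cb V\<^esub> f" if "f \<in> carrier (Cb V)" for a b f
    using that Cb_closed[OF V] by (simp add: Cb_simps fun_eq_iff bs_smult[OF V])
  show "a \<odot>\<^bsub>Cb V\<^esub> (f \<oplus>\<^bsub>Cb V\<^esub> g) = a \<odot>\<^bsub>Cb V\<^esub> f \<oplus>\<^bsub>Cb V\<^esub> a \<odot>\<^bsub>Cb V\<^esub> g"
    if "f \<in> carrier (Cb V)" "g \<in> carrier (Cb V)" for a f g
    using that Cb_closed[OF V] by (simp add: Cb_simps fun_eq_iff bs_smult[OF V])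
  show "(a * b) \<odot>\<^bsub>Cb V\<^esub> f = a \<odot>\<^bsub>Cb V\<^esub> (b \<odot>\<^bsub>Cb V\<^esub> f)" if "f \<in> carrier (Cb V)" for a b f
    using that Cb_closed[OF V] by (simp add: Cb_simps fun_eq_iff bs_smult[OF V])
  show "1 \<odot>\<^bsub>Cb V\<^esub> f = f" if "f \<in> carrier (Cb V)" for f
    using that Cb_closed[OF V] V by (simp add: Cb_simps fun_eq_iff)
  show "0 \<le> nrm (Cb V) f" if "f \<in> carrier (Cb V)" for f using Cb_nrm_nonneg[OF V that] .
  show "f = \<zero>\<^bsub>Cb V\<^esub>" if "f \<in> carrier (Cb V)" "nrm (Cb V) f = 0" for f
  proof (rule ext)
    fix x
    have "nrm V (f x) = 0" using Cb_nrm_ge[OF V that(1), of x] that(2) Cb_closed[OF V that(1), of x] V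
      by (intro antisym) auto
    thus "f x = \<zero>\<^bsub>Cb V\<^esub> x" using nrm_eq_0[OF V Cb_closed[OF V that(1)]] by (simp add: Cb_simps)
  qed
  show "nrm (Cb V) \<zero>\<^bsub>Cb V\<^esub> = 0" using V by (simp add: Cblu_def)
  show "nrm (Cb V) (a \<odot>\<^bsub>Cb V\<^esub> f) = v a * nrm (Cb V) f" if f: "f \<in> carrier (Cb V)" for a f
  proof (rule antisym)
    show "nrm (Cb V) (a \<odot>\<^bsub>Cb V\<^esub> f) \<le> v a * nrm (Cb V) f"
      by (rule Cb_nrm_le) (use Cb_closed[OF V f] Cb_nrm_ge[OF V f] V in \<open>auto simp: Cb_simps intro!: mult_left_mono\<close>)
    show "v a * nrm (Cb V) f \<le> nrm (Cb V) (a \<odot>\<^bsub>Cb V\<^esub> f)"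
    proof (cases "a = 0")
      case True
      have "a \<odot>\<^bsub>Cb V\<^esub> f \<in> carrier (Cb V)" using f cont_smult[OF V] by (simp add: S)
      from Cb_nrm_nonneg[OF V this] show ?thesis using True by simp
    next
      case False
      hence va: "v a > 0" using v_nonneg[of a] v_eq_0[of a] by linarith
      have af: "a \<odot>\<^bsub>Cb V\<^esub> f \<in> carrier (Cb V)" using f cont_smult[OF V] by (simp add: S)
      have "nrm (Cb V) f \<le> nrm (Cb V) (a \<odot>\<^bsub>Cb V\<^esub> f) / v a"
      proof (rule Cb_nrm_le)
        fix x
        have "v a * nrm V (f x) \<le> nrm (Cb V) (a \<odot>\<^bsub>Cb V\<^esub> f)"
          using Cb_nrm_ge[OF V af, of x] V Cb_closed[OF V f] by (simp add: Cb_simps)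
        thus "nrm V (f x) \<le> nrm (Cb V) (a \<odot>\<^bsub>Cb V\<^esub> f) / v a" using va by (simp add: field_simps)
      qed
      thus ?thesis using va by (simp add: field_simps)
    qed
  qed
  show "nrm (Cb V) (f \<oplus>\<^bsub>Cb V\<^esub> g) \<le> tri c (nrm (Cb V) f) (nrm (Cb V) g)"
    if "f \<in> carrier (Cb V)" "g \<in> carrier (Cb V)" for f g
  proof (rule Cb_nrm_le)
    fix x
    have "nrm V (f x \<oplus>\<^bsub>V\<^esub> g x) \<le> tri c (nrm V (f x)) (nrm V (g x))"
      by (rule nrm_tri[OF V]) (use that Cb_closed[OF V] in auto)
    also have "\<dots> \<le> tri c (nrm (Cb V) f) (nrm (Cb V) g)" by (intro tri_mono Cb_nrm_ge V that)
    finally show "nrm V ((f \<oplus>\<^bsub>Cb V\<^esub> g) x) \<le> tri c (nrm (Cb V) f) (nrm (Cb V) g)" by (simp add: Cb_simps)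
  qed
  show "\<exists>l\<in>carrier (Cb V). (%n. nrm (Cb V) (s n \<oplus>\<^bsub>Cb V\<^esub> - 1 \<odot>\<^bsub>Cb V\<^esub> l)) \<longlonglongrightarrow> 0"
    if sc: "\<forall>n. s n \<in> carrier (Cb V)"
      "\<forall>e>0. \<exists>N. \<forall>m\<ge>N. \<forall>n\<ge>N. nrm (Cb V) (s m \<oplus>\<^bsub>Cb V\<^esub> - 1 \<odot>\<^bsub>Cb V\<^esub> s n) < e" for s
  proof -
    have sx: "s n x \<in> carrier V" for n x using sc Cb_closed[OF V] by blast
    have d: "dst V (s m x) (s n x) \<le> nrm (Cb V) (s m \<oplus>\<^bsub>Cb V\<^esub> - 1 \<odot>\<^bsub>Cb V\<^esub> s n)" for m n x
    proof -
      have "s m \<oplus>\<^bsub>Cb V\<^esub> - 1 \<odot>\<^bsub>Cb V\<^esub> s n \<in> carrier (Cb V)"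
        using sc by (simp add: S cont_add[OF V] cont_smult[OF V])
      from Cb_nrm_ge[OF V this, of x] show ?thesis using sx V by (simp add: Cb_simps bs_dif_conv)
    qed
    have "\<exists>l. vlim V (%n. s n x) l" for x
    proof (rule bs_complete[OF V])
      show "vcauchy V (%n. s n x)"
        unfolding vcauchy_def using sx sc(2) d by (meson le_less_trans)
    qed
    then obtain l where l: "!!x. vlim V (%n. s n x) (l x)" by metis
    have lc: "l x \<in> carrier V" for x by (rule vlim_carrier(1)[OF l])
    have u: "\<exists>N. \<forall>n\<ge>N. \<forall>x. dst V (s n x) (l x) \<le> e" if "e > 0" for e
    proof -
      obtain N where N: "!!m n. m \<ge> N ==> n \<ge> N ==> nrm (Cb V) (s m \<oplus>\<^bsub>Cb V\<^esub> - 1 \<odot>\<^bsub>Cb V\<^esub> s n) < e"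
        using sc(2) \<open>e > 0\<close> by blast
      show ?thesis
      proof (intro exI[of _ N] allI impI)
        fix n x assume n: "n \<ge> N"
        \<comment> \<open>Letting m grow in the uniform Cauchy estimate turns it into a rate of
          convergence to the pointwise limit that is the same at every point.\<close>
        have lim: "(%m. e + dst V (s m x) (l x)) \<longlonglongrightarrow> e + 0"
          by (rule tendsto_add) (use l[of x] in \<open>auto simp: vlim_def\<close>)
        show "dst V (s n x) (l x) \<le> e"
        proof (rule LIMSEQ_le_const[OF lim[simplified]], intro exI[of _ N] allI impI)
          fix m assume "m \<ge> N"
          thus "dst V (s n x) (l x) \<le> e + dst V (s m x) (l x)"
            using nrm_dist_trans[OF V, of "s n x" "s m x" "l x"] sx lc d[of n x m] N[OF n, of m] by simp
        qed
      qed
    qed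
    have "cont_into V l"
      unfolding cont_into_def
    proof (intro conjI allI impI lc)
      fix x and e :: real assume "e > 0" hence e: "e/3 > 0" by simp
      obtain N where N: "!!n x. n \<ge> N ==> dst V (s n x) (l x) \<le> e/3" using u[OF e] by blast
      have "cont_into V (s N)" using sc S by blast
      from cont_intoD(2)[OF this e, of x] show "eventually (%y. dst V (l y) (l x) < e) (nhds x)"
      proof eventually_elim
        case (elim y)
        have "dst V (l y) (l x) \<le> dst V (l y) (s N y) + (dst V (s N y) (s N x) + dst V (s N x) (l x))"
          using nrm_dist_trans[OF V, of "l y" "s N y" "l x"] nrm_dist_trans[OF V, of "s N y" "s N x" "l x"] lc sx by simp
        thus ?case using elim N[of N y] N[of N x] nrm_commute[OF V, of "l y" "s N y"] lc sx by simp
      qed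
    qed
    hence l': "l \<in> carrier (Cb V)" by (simp add: S)
    have "(%n. nrm (Cb V) (s n \<oplus>\<^bsub>Cb V\<^esub> - 1 \<odot>\<^bsub>Cb V\<^esub> l)) \<longlonglongrightarrow> 0"
    proof (rule LIMSEQ_I)
      fix r :: real assume "r > 0" hence r: "r/2 > 0" by simp
      obtain N where N: "!!n x. n \<ge> N ==> dst V (s n x) (l x) \<le> r/2" using u[OF r] by blast
      show "\<exists>no. \<forall>n\<ge>no. norm (nrm (Cb V) (s n \<oplus>\<^bsub>Cb V\<^esub> - 1 \<odot>\<^bsub>Cb V\<^esub> l) - 0) < r"
      proof (intro exI[of _ N] allI impI)
        fix n assume n: "n \<ge> N"
        have "s n \<oplus>\<^bsub>Cb V\<^esub> - 1 \<odot>\<^bsub>Cb V\<^esub> l \<in> carrier (Cb V)"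
          using sc l' by (simp add: S cont_add[OF V] cont_smult[OF V])
        from Cb_nrm_nonneg[OF V this]
        have 1: "0 \<le> nrm (Cb V) (s n \<oplus>\<^bsub>Cb V\<^esub> - 1 \<odot>\<^bsub>Cb V\<^esub> l)" .
        have "nrm (Cb V) (s n \<oplus>\<^bsub>Cb V\<^esub> - 1 \<odot>\<^bsub>Cb V\<^esub> l) \<le> r/2"
          by (rule Cb_nrm_le) (use N[OF n] sx lc V in \<open>simp add: Cb_simps bs_dif_conv\<close>)
        thus "norm (nrm (Cb V) (s n \<oplus>\<^bsub>Cb V\<^esub> - 1 \<odot>\<^bsub>Cb V\<^esub> l) - 0) < r" using \<open>r > 0\<close> 1 by simp
      qed
    qed
    thus ?thesis using l' by blast
  qed
qed

lemma Cb_diff: assumes "bs V" "f \<in> carrier (Cb V)" "g \<in> carrier (Cb V)"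
  shows "f \<ominus>\<^bsub>Cb V\<^esub> g = (%x. f x \<ominus>\<^bsub>V\<^esub> g x)"
  using assms Cb_closed[OF assms(1)] by (simp add: bs_dif_conv Cb_simps)

lemma cont_bb:
  fixes V (structure) and f :: "'g => 'a" and g :: "'g => 'b"
  assumes "bs V" "bs W" "bs Z" "bb V W Z B \<beta>" "cont_into V f" "cont_into W g"
  shows "cont_into Z (%x. \<beta> (f x) (g x))"
  unfolding cont_into_def
proof (intro conjI allI impI)
  have fc: "f x \<in> carrier V" "g x \<in> carrier W" for x using assms cont_intoD by auto
  note b = bbD[OF assms(4)]
  show "\<beta> (f x) (g x) \<in> carrier Z" for x using b(2) fc by simp
  fix x and e :: real assume "e > 0"
  have fC: "f \<in> carrier (Cb V)" "g \<in> carrier (Cb W)" using assms by (auto simp: Cb_carrier)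
  \<comment> \<open>M bounds both functions. In the telescoped difference each of the two terms is
    at most B M r, and r = e/(2K) with K = (B + 1)M makes them together smaller than e, also when B
    = 0.\<close>
  define M where "M = max (nrm (Cb V) f) (nrm (Cb W) g) + 1"
  have M: "nrm V (f y) \<le> M" "nrm W (g y) \<le> M" for y
    using Cb_nrm_ge[OF assms(1) fC(1), of y] Cb_nrm_ge[OF assms(2) fC(2), of y] by (auto simp: M_def)
  have M0: "M > 0" using Cb_nrm_nonneg[OF assms(1) fC(1)] by (simp add: M_def)
  have B0: "0 \<le> B" using b(1) .
  define K where "K = (B + 1) * M"
  have K: "K > 0" using B0 M0 by (simp add: K_def)
  define r where "r = e / (2 * K)"
  have r: "r > 0" using K \<open>e > 0\<close> by (simp add: r_def)
  have k: "2 * (B * M * r) < e"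
  proof -
    have "2 * (K * r) = e" using K by (simp add: r_def)
    moreover have "K * r = B * M * r + M * r" by (simp add: K_def algebra_simps)
    ultimately show ?thesis using mult_pos_pos[OF M0 r] by linarith
  qed
  show "eventually (%y. dst Z (\<beta> (f y) (g y)) (\<beta> (f x) (g x)) < e) (nhds x)"
    using cont_intoD(2)[OF assms(5) r, of x] cont_intoD(2)[OF assms(6) r, of x]
  proof eventually_elim
    case (elim y)
    have i: "\<beta> (f y \<ominus> f x) (g y) = \<beta> (f y) (g y) \<ominus>\<^bsub>Z\<^esub> \<beta> (f x) (g y)"
      "\<beta> (f x) (g y \<ominus>\<^bsub>W\<^esub> g x) = \<beta> (f x) (g y) \<ominus>\<^bsub>Z\<^esub> \<beta> (f x) (g x)"
      using fc b assms by (auto simp: bs_dif_conv)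
    have "dst Z (\<beta> (f y) (g y)) (\<beta> (f x) (g x)) \<le> nrm Z (\<beta> (f y \<ominus> f x) (g y)) + nrm Z (\<beta> (f x) (g y \<ominus>\<^bsub>W\<^esub> g x))"
      unfolding i by (rule nrm_dist_trans) (use fc b assms in auto)
    also have "nrm Z (\<beta> (f y \<ominus> f x) (g y)) \<le> B * (dst V (f y) (f x) * nrm W (g y))"
      by (rule b(3)) (use fc assms in auto)
    also have "\<dots> \<le> B * (r * M)"
      by (intro mult_left_mono mult_mono B0) (use elim M fc assms r in auto)
    also have "nrm Z (\<beta> (f x) (g y \<ominus>\<^bsub>W\<^esub> g x)) \<le> B * (nrm V (f x) * dst W (g y) (g x))"
      by (rule b(3)) (use fc assms in auto)
    also have "\<dots> \<le> B * (M * r)"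
      by (intro mult_left_mono mult_mono B0) (use elim M M0 fc assms r in auto)
    finally show ?case using k by (simp add: algebra_simps)
  qed
qed

section \<open>The canonical map from C \<otimes> V to C(G,V)\<close>

lemma bb_smult: "bs V ==> bb (base_field v) V V 1 (%a x. a \<odot>\<^bsub>V\<^esub> x)"
  by (rule bbI) (auto simp: bs_smult mult.commute)

lemma can_bb: assumes V: "bs V" shows "bb C V (Cb V) 1 (%f w g. f g \<odot>\<^bsub>V\<^esub> w)"
proof (rule bbI)
  show "(%g. f g \<odot>\<^bsub>V\<^esub> w) \<in> carrier (Cb V)" if "f \<in> carrier C" "w \<in> carrier V" for f w
    using that cont_bb[OF bs_base V V bb_smult[OF V] _ cont_const[OF V], of f w] V by (simp add: Cb_carrier)
  show "nrm (Cb V) (%g. f g \<odot>\<^bsub>V\<^esub> w) \<le> 1 * (nrm C f * nrm V w)" if "f \<in> carrier C" "w \<in> carrier V" for f w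
    by (rule Cb_nrm_le)
      (use that V Cb_nrm_ge[OF bs_base that(1)] in \<open>auto intro!: mult_right_mono\<close>)
qed (use V in \<open>auto simp: Cb_simps bs_smult mult.commute\<close>)

lemma can_hom [simp]: "bs V ==> can v c V \<in> bl_hom (tC V) (Cb V)"
  and can_elt [simp]: "bs V ==> f \<in> carrier C ==> w \<in> carrier V ==> can v c V (elt c C V f w) = (%g. f g \<odot>\<^bsub>V\<^esub> w)"
  and can_nrm: "bs V ==> t \<in> carrier (tC V) ==> nrm (Cb V) (can v c V t) \<le> nrm (tC V) t"
  unfolding can_def using tens_lift[OF _ _ _ can_bb, of V] by auto

definition Cmap :: "('k, 'a) nspace => ('a => 'b) => ('g => 'a) => ('g => 'b)" where
  "Cmap V \<phi> = (\<lambda>f\<in>carrier (Cb V). %g. \<phi> (f g))"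

lemma Cmap_hom: assumes "bs V" "bs W" "\<phi> \<in> bl_hom V W" shows "Cmap V \<phi> \<in> bl_hom (Cb V) (Cb W)"
proof -
  obtain B where B: "B > 0" "!!x. x \<in> carrier V ==> nrm W (\<phi> x) \<le> B * nrm V x"
    by (rule bl_bound[OF assms(1,3)]) blast
  show ?thesis
  proof (rule blI[where B=B])
    fix f assume f: "f \<in> carrier (Cb V)"
    show "Cmap V \<phi> f \<in> carrier (Cb W)"
      using f assms by (simp add: Cmap_def Cb_carrier cont_bl[OF assms])
    show "nrm (Cb W) (Cmap V \<phi> f) \<le> B * nrm (Cb V) f"
    proof (rule Cb_nrm_le)
      fix x
      have "nrm W (\<phi> (f x)) \<le> B * nrm V (f x)" by (rule B) (use f assms Cb_closed in auto)
      also have "\<dots> \<le> B * nrm (Cb V) f" by (rule mult_left_mono[OF Cb_nrm_ge]) (use assms f B in auto)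
      finally show "nrm W (Cmap V \<phi> f x) \<le> B * nrm (Cb V) f" using f by (simp add: Cmap_def)
    qed
    show "Cmap V \<phi> (f \<oplus>\<^bsub>Cb V\<^esub> g) = Cmap V \<phi> f \<oplus>\<^bsub>Cb W\<^esub> Cmap V \<phi> g" if g: "g \<in> carrier (Cb V)" for g
    proof -
      have "f \<oplus>\<^bsub>Cb V\<^esub> g \<in> carrier (Cb V)" using f g assms by simp
      thus ?thesis using f g assms Cb_closed[OF assms(1)] unfolding Cb_simps Cmap_def by simp
    qed
    show "Cmap V \<phi> (a \<odot>\<^bsub>Cb V\<^esub> f) = a \<odot>\<^bsub>Cb W\<^esub> Cmap V \<phi> f" for a
    proof -
      have "a \<odot>\<^bsub>Cb V\<^esub> f \<in> carrier (Cb V)" using f assms by simp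
      thus ?thesis using f assms Cb_closed[OF assms(1)] unfolding Cb_simps Cmap_def by simp
    qed
  qed (simp add: Cmap_def)
qed

text \<open>Both composites are bounded linear on C \<otimes> V and send f \<otimes> w to the
  function g \<mapsto> f(g) \<phi>(w).\<close>

lemma can_natural:
  assumes "bs V" "bs W" "\<phi> \<in> bl_hom V W" "t \<in> carrier (tC V)"
  shows "can v c W (tens_map c C C V W (ban_id C) \<phi> t) = (%g. \<phi> (can v c V t g))"
proof -
  have h: "tens_map c C C V W (ban_id C) \<phi> \<in> bl_hom (tC V) (tC W)"
    using assms by (intro tens_map_hom) auto
  have T: "bs (tC V)" "bs (tC W)" "bs (Cb V)" "bs (Cb W)" using assms by auto
  have 1: "compose (carrier (tC V)) (can v c W) (tens_map c C C V W (ban_id C) \<phi>) \<in> bl_hom (tC V) (Cb W)"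
    by (rule bl_comp[OF h can_hom[OF assms(2)] T(1,2)])
  have 2: "compose (carrier (tC V)) (Cmap V \<phi>) (can v c V) \<in> bl_hom (tC V) (Cb W)"
    by (rule bl_comp[OF can_hom[OF assms(1)] Cmap_hom[OF assms(1-3)] T(1,3)])
  have "compose (carrier (tC V)) (can v c W) (tens_map c C C V W (ban_id C) \<phi>)
      = compose (carrier (tC V)) (Cmap V \<phi>) (can v c V)"
  proof (rule tens_ext[OF _ assms(1) T(4) 1 2])
    fix f w assume fw: "f \<in> carrier C" "w \<in> carrier V"
    have e: "elt c C V f w \<in> carrier (tC V)" using fw assms by simp
    have m: "(%g. f g \<odot>\<^bsub>V\<^esub> w) \<in> carrier (Cb V)" by (rule bbD(2)[OF can_bb[OF assms(1)] fw])
    have t: "tens_map c C C V W (ban_id C) \<phi> (elt c C V f w) = elt c C W f (\<phi> w)"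
      using fw assms by (subst tens_map_elt) auto
    have "can v c W (elt c C W f (\<phi> w)) = (%g. f g \<odot>\<^bsub>W\<^esub> \<phi> w)"
      by (rule can_elt[OF assms(2) fw(1) bl_closed[OF assms(3) fw(2)]])
    thus "compose (carrier (tC V)) (can v c W) (tens_map c C C V W (ban_id C) \<phi>) (elt c C V f w) =
        compose (carrier (tC V)) (Cmap V \<phi>) (can v c V) (elt c C V f w)"
      unfolding compose_eq[OF e] t can_elt[OF assms(1) fw] Cmap_def restrict_apply'[OF m]
      using bl_smult[OF assms(3) fw(2)] by simp
  qed simp
  from fun_cong[OF this, of t] show ?thesis
    unfolding compose_eq[OF assms(4)] Cmap_def restrict_apply'[OF bl_closed[OF can_hom[OF assms(1)] assms(4)]] .
qed

end

section \<open>Isomorphisms, transport of structure and finite sums\<close>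

context valued
begin

lemma ban_iso_hom: "ban_iso A B f ==> f \<in> bl_hom A B"
  by (simp add: ban_iso_def)

text \<open>The lower bound makes f injective and at the same time bounds its inverse by 1; the
  inverse is linear because f is linear and injective.\<close>

lemma ban_iso_bij:
  assumes f: "f \<in> bl_hom V W" and V: "bs V" and W: "bs W"
    and surj: "!!y. y \<in> carrier W ==> \<exists>x\<in>carrier V. f x = y"
    and lower: "!!x. x \<in> carrier V ==> nrm V x \<le> nrm W (f x)"
  shows "ban_iso V W f"
proof -
  have inj: "x = y" if "x \<in> carrier V" "y \<in> carrier V" "f x = f y" for x y
  proof (rule nrm_small_eq[OF V that(1,2)])
    fix e :: real assume "e > 0"
    have "f (x \<ominus>\<^bsub>V\<^esub> y) = \<zero>\<^bsub>W\<^esub>" using bl_diff[OF f V W that(1,2)] that f W by simp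
    thus "dst V x y \<le> e" using lower[of "x \<ominus>\<^bsub>V\<^esub> y"] that V W \<open>e > 0\<close> by simp
  qed
  define g where "g = (\<lambda>y\<in>carrier W. THE x. x \<in> carrier V \<and> f x = y)"
  have g: "g y \<in> carrier V \<and> f (g y) = y" if y: "y \<in> carrier W" for y
  proof -
    obtain x where x: "x \<in> carrier V" "f x = y" using surj[OF y] by blast
    have "(THE x. x \<in> carrier V \<and> f x = y) = x" by (rule the_equality) (use x inj in auto)
    thus ?thesis using x y by (simp add: g_def)
  qed
  have gf: "g (f x) = x" if "x \<in> carrier V" for x
  proof -
    have "f x \<in> carrier W" using f that by simp
    thus ?thesis using inj g that by blast
  qed
  have "g \<in> bl_hom W V"
  proof (rule blI[where B=1])
    show "g (x \<oplus>\<^bsub>W\<^esub> y) = g x \<oplus>\<^bsub>V\<^esub> g y" if "x \<in> carrier W" "y \<in> carrier W" for x y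
      by (rule inj) (use g that f V W in auto)
    show "g (a \<odot>\<^bsub>W\<^esub> x) = a \<odot>\<^bsub>V\<^esub> g x" if "x \<in> carrier W" for a x
      by (rule inj) (use g that f V W in auto)
    show "nrm V (g x) \<le> 1 * nrm W x" if "x \<in> carrier W" for x
      using g[OF that] lower[of "g x"] by simp
  qed (use g in \<open>auto simp: g_def\<close>)
  thus ?thesis by (rule ban_isoI[OF f]) (use g gf in auto)
qed

lemma ban_iso_trans:
  assumes "ban_iso A B f" "ban_iso B D g" "bs A" "bs B" "bs D"
  shows "ban_iso A D (compose (carrier A) g f)"
proof -
  obtain f' where f: "f \<in> bl_hom A B" "f' \<in> bl_hom B A" "!!x. x \<in> carrier A ==> f' (f x) = x"
    "!!y. y \<in> carrier B ==> f (f' y) = y" by (rule ban_isoE[OF assms(1)]) blast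
  obtain g' where g: "g \<in> bl_hom B D" "g' \<in> bl_hom D B" "!!x. x \<in> carrier B ==> g' (g x) = x"
    "!!y. y \<in> carrier D ==> g (g' y) = y" by (rule ban_isoE[OF assms(2)]) blast
  show ?thesis
    by (rule ban_isoI[OF bl_comp[OF f(1) g(1)] bl_comp[OF g(2) f(2)]])
       (use assms bl_closed[OF f(1)] bl_closed[OF f(2)] bl_closed[OF g(1)] bl_closed[OF g(2)] f g
         in \<open>auto simp: compose_eq\<close>)
qed

text \<open>Transport of structure along a map that is injective on the carrier. It serves to move
  Banach spaces into the universe type.\<close>

definition push :: "('a => 'b) => ('k, 'a) nspace => ('k, 'b) nspace" where
  "push e V = (let d = inv_into (carrier V) e in
     \<lparr>carrier = e ` carrier V, mult = undefined, one = undefined, zero = e \<zero>\<^bsub>V\<^esub>,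
      add = (%x y. e (d x \<oplus>\<^bsub>V\<^esub> d y)), smult = (%a x. e (a \<odot>\<^bsub>V\<^esub> d x)), nrm = (%x. nrm V (d x))\<rparr>)"

lemma push:
  assumes V: "bs V" and e: "inj_on e (carrier V)"
  shows push_bs: "bs (push e V)" and push_iso: "ban_iso V (push e V) (restrict e (carrier V))"
    and push_carrier: "carrier (push e V) = e ` carrier V"
    and push_nrm: "!!x. x \<in> carrier V ==> nrm (push e V) (e x) = nrm V x"
proof -
  have d [simp]: "inv_into (carrier V) e (e x) = x" if "x \<in> carrier V" for x
    using inv_into_f_f[OF e that] .
  have S: "\<zero>\<^bsub>push e V\<^esub> = e \<zero>\<^bsub>V\<^esub>"
    "!!x y. x \<in> carrier V ==> y \<in> carrier V ==> e x \<oplus>\<^bsub>push e V\<^esub> e y = e (x \<oplus>\<^bsub>V\<^esub> y)"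
    "!!a x. x \<in> carrier V ==> a \<odot>\<^bsub>push e V\<^esub> e x = e (a \<odot>\<^bsub>V\<^esub> x)"
    "!!x. x \<in> carrier V ==> nrm (push e V) (e x) = nrm V x"
    by (auto simp: push_def Let_def)
  show C: "carrier (push e V) = e ` carrier V" by (auto simp: push_def Let_def)
  show "!!x. x \<in> carrier V ==> nrm (push e V) (e x) = nrm V x" by (rule S)
  show B: "bs (push e V)"
  proof (rule bsI)
    show "\<exists>l\<in>carrier (push e V). (%n. nrm (push e V) (s n \<oplus>\<^bsub>push e V\<^esub> - 1 \<odot>\<^bsub>push e V\<^esub> l)) \<longlonglongrightarrow> 0"
      if s: "\<forall>n. s n \<in> carrier (push e V)"
        "\<forall>r>0. \<exists>N. \<forall>m\<ge>N. \<forall>n\<ge>N. nrm (push e V) (s m \<oplus>\<^bsub>push e V\<^esub> - 1 \<odot>\<^bsub>push e V\<^esub> s n) < r" for s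
    proof -
      have "\<forall>n. \<exists>t. t \<in> carrier V \<and> s n = e t" using s(1) C by auto
      then obtain t where t: "!!n. t n \<in> carrier V" "!!n. s n = e (t n)" by metis
      have "vcauchy V t" unfolding vcauchy_def using s(2) t V by (simp add: S bs_dif_conv)
      then obtain l where l: "vlim V t l" using bs_complete[OF V] by blast
      have "l \<in> carrier V" by (rule vlim_carrier(1)[OF l])
      moreover have "(%n. dst V (t n) l) \<longlonglongrightarrow> 0" using l by (simp add: vlim_def)
      ultimately show ?thesis using t V by (intro bexI[of _ "e l"]) (auto simp: S C bs_dif_conv)
    qed
    show "- 1 \<odot>\<^bsub>push e V\<^esub> x \<oplus>\<^bsub>push e V\<^esub> x = \<zero>\<^bsub>push e V\<^esub>" if "x \<in> carrier (push e V)" for x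
      using that V by (auto simp: S C simp flip: bs_neg_conv)
    show "x \<oplus>\<^bsub>push e V\<^esub> y \<oplus>\<^bsub>push e V\<^esub> z = x \<oplus>\<^bsub>push e V\<^esub> (y \<oplus>\<^bsub>push e V\<^esub> z)"
      if "x \<in> carrier (push e V)" "y \<in> carrier (push e V)" "z \<in> carrier (push e V)" for x y z
      using that V unfolding C by (auto simp: S bs_ac[OF V])
    show "x \<oplus>\<^bsub>push e V\<^esub> y = y \<oplus>\<^bsub>push e V\<^esub> x"
      if "x \<in> carrier (push e V)" "y \<in> carrier (push e V)" for x y
      using that bs_ac(2)[OF V] unfolding C by (auto simp: S)
    show "nrm (push e V) (x \<oplus>\<^bsub>push e V\<^esub> y) \<le> tri c (nrm (push e V) x) (nrm (push e V) y)"
      if "x \<in> carrier (push e V)" "y \<in> carrier (push e V)" for x y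
      using that V nrm_tri[OF V] unfolding C by (auto simp: S)
    show "x = \<zero>\<^bsub>push e V\<^esub>" if "x \<in> carrier (push e V)" "nrm (push e V) x = 0" for x
      using that nrm_eq_0[OF V] unfolding C by (auto simp: S)
  qed (use V in \<open>auto simp: S C bs_smult\<close>)
  show "ban_iso V (push e V) (restrict e (carrier V))"
  proof (rule ban_iso_bij[OF _ V B])
    show "restrict e (carrier V) \<in> bl_hom V (push e V)"
      by (rule blI[where B=1]) (use V in \<open>auto simp: S C\<close>)
  qed (use V in \<open>auto simp: S C\<close>)
qed

lemma bl_finsum:
  assumes "\<phi> \<in> bl_hom V W" "bs V" "bs W" "finite F" "!!x. x \<in> F ==> h x \<in> carrier V"
  shows "\<phi> (finsum V h F) = finsum W (%x. \<phi> (h x)) F"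
  using assms(4,5)
proof (induction F rule: finite_induct)
  case empty
  interpret V: abelian_group V by (rule bs_ag[OF assms(2)])
  interpret W: abelian_group W by (rule bs_ag[OF assms(3)])
  show ?case using bl_zero[OF assms(1-3)] by simp
next
  case (insert x F)
  interpret V: abelian_group V by (rule bs_ag[OF assms(2)])
  interpret W: abelian_group W by (rule bs_ag[OF assms(3)])
  have h: "h \<in> F \<rightarrow> carrier V" "(%x. \<phi> (h x)) \<in> F \<rightarrow> carrier W" "h x \<in> carrier V" "\<phi> (h x) \<in> carrier W"
    using insert bl_closed[OF assms(1)] by auto
  show ?case using insert h V.finsum_closed[OF h(1)]
    by (simp add: V.finsum_insert W.finsum_insert bl_add[OF assms(1)])
qed

lemma bs_finsum_closed: assumes "bs V" "!!x. x \<in> F ==> h x \<in> carrier V" shows "finsum V h F \<in> carrier V"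
proof -
  interpret V: abelian_group V by (rule bs_ag[OF assms(1)])
  show ?thesis using assms by (intro V.finsum_closed) auto
qed

lemma bs_finsum_insert: assumes "bs V" "finite F" "x \<notin> F" "!!y. y \<in> insert x F ==> h y \<in> carrier V"
  shows "finsum V h (insert x F) = h x \<oplus>\<^bsub>V\<^esub> finsum V h F"
proof -
  interpret V: abelian_group V by (rule bs_ag[OF assms(1)])
  show ?thesis using assms by (intro V.finsum_insert) auto
qed

lemma bs_finsum_empty: "bs V ==> finsum V h {} = \<zero>\<^bsub>V\<^esub>"
  by (rule abelian_monoid.finsum_empty[OF abelian_group.axioms(1)[OF bs_ag]])

lemma bs_finsum_add: assumes "bs V" "!!x. x \<in> F ==> h x \<in> carrier V" "!!x. x \<in> F ==> h' x \<in> carrier V"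
  shows "finsum V (%x. h x \<oplus>\<^bsub>V\<^esub> h' x) F = finsum V h F \<oplus>\<^bsub>V\<^esub> finsum V h' F"
proof -
  interpret V: abelian_group V by (rule bs_ag[OF assms(1)])
  show ?thesis using assms by (intro V.finsum_addf) auto
qed

lemma bs_finsum_single:
  fixes V (structure) assumes "bs V" "finite F" "x \<in> F" "h x \<in> carrier V" "!!y. y \<in> F ==> y \<noteq> x ==> h y = \<zero>"
  shows "finsum V h F = h x"
proof -
  interpret V: abelian_group V by (rule bs_ag[OF assms(1)])
  have "finsum V h F = finsum V (%y. if x = y then h y else \<zero>) F"
  proof (rule V.finsum_cong')
    show "(%y. if x = y then h y else \<zero>) \<in> F \<rightarrow> carrier V" using assms by auto
    show "h y = (if x = y then h y else \<zero>)" if "y \<in> F" for y using assms(5)[OF that] by auto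
  qed simp
  also have "\<dots> = h x" proof (rule V.finsum_singleton)
    show "h \<in> F \<rightarrow> carrier V"
    proof
      fix y assume "y \<in> F" thus "h y \<in> carrier V" using assms by (cases "y = x") auto
    qed
  qed (use assms in auto)
  finally show ?thesis .
qed

text \<open>A maximum of numbers that are at most M is at most M, whatever their number; the empty
  sum asks for M to be nonnegative.\<close>

lemma nrm_finsum_strong:
  assumes "c = Strong" "bs V" "finite F" "0 \<le> M" "!!x. x \<in> F ==> h x \<in> carrier V \<and> nrm V (h x) \<le> M"
  shows "nrm V (finsum V h F) \<le> M"
  using assms(3,5)
proof (induction F rule: finite_induct)
  case empty show ?case unfolding bs_finsum_empty[OF assms(2)] nrm_zero[OF assms(2)] by (rule assms(4))
next
  case (insert x F)
  have "nrm V (finsum V h (insert x F)) = nrm V (h x \<oplus>\<^bsub>V\<^esub> finsum V h F)"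
    using insert assms by (subst bs_finsum_insert) auto
  also have "\<dots> \<le> tri c (nrm V (h x)) (nrm V (finsum V h F))"
    by (rule nrm_tri[OF assms(2)]) (use insert in \<open>auto intro!: bs_finsum_closed[OF assms(2)]\<close>)
  also have "\<dots> \<le> M" using insert assms(1) by (simp add: tri_def)
  finally show ?case .
qed

end

section \<open>Locally constant functions\<close>

context cgrp
begin

text \<open>R is an equivalence relation with open classes, so compactness leaves finitely many
  classes. The representative \<open>r\<close> depends on the class alone and turns the finitely
  many centres into a transversal.\<close>

lemma partition:
  fixes R :: "'g => 'g => bool"
  assumes "!!x. eventually (R x) (nhds x)" "!!x. R x x" "!!x y. R x y ==> R y x"
    "!!x y z. R x y ==> R y z ==> R x z"
  shows "\<exists>F. finite F \<and> (\<forall>y. \<exists>x\<in>F. R x y) \<and> (\<forall>x\<in>F. \<forall>x'\<in>F. \<forall>y. R x y --> R x' y --> x = x')"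
proof -
  obtain E where E: "finite E" "!!y. \<exists>x\<in>E. R x y" using compact_cover[OF assms(1)] by blast
  define r where "r x = (SOME z. R x z)" for x
  have r: "R x (r x)" for x unfolding r_def by (rule someI[of _ x]) (rule assms(2))
  have req: "r x = r x'" if "R x x'" for x x'
  proof -
    have "R x z \<longleftrightarrow> R x' z" for z using that assms(3,4) by blast
    thus ?thesis by (simp add: r_def)
  qed
  have 1: "\<exists>x\<in>r ` E. R x y" for y using E(2)[of y] r assms(3,4) by blast
  have "x = x'" if x: "x \<in> r ` E" "x' \<in> r ` E" "R x y" "R x' y" for x x' y
    proof -
      obtain z z' where z: "x = r z" "x' = r z'" using x by blast
      have "R z z'" using r[of z] r[of z'] z x assms(3,4) by blast
      thus ?thesis using req z by simp
    qed
  thus ?thesis using E(1) 1 by (intro exI[of _ "r ` E"]) blast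
qed

text \<open>The indicator function of the class of x, with values in the field; the name does not
  refer to ind-objects.\<close>

definition ind :: "('g => 'g => bool) => 'g => 'g => 'k" where
  "ind R x y = (if R x y then 1 else 0)"

text \<open>On the class of y, which is a neighbourhood of y, the indicator is constant.\<close>

lemma ind_C:
  fixes R :: "'g => 'g => bool"
  assumes "!!x. eventually (R x) (nhds x)" "!!x y. R x y ==> R y x" "!!x y z. R x y ==> R y z ==> R x z"
  shows "ind R x \<in> carrier C"
  unfolding Cb_carrier[OF bs_base] cont_into_def
proof (intro conjI allI impI)
  fix y and e :: real assume "e > 0"
  show "eventually (%z. dst (base_field v) (ind R x z) (ind R x y) < e) (nhds y)"
    using assms(1)[of y]
  proof (rule eventually_mono)
    fix z assume z: "R y z"
    have "R x z \<longleftrightarrow> R x y" using z assms(2,3) by blast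
    thus "dst (base_field v) (ind R x z) (ind R x y) < e" using \<open>e > 0\<close> by (simp add: ind_def)
  qed
qed simp

lemma ind_nrm: "nrm C (ind R x) \<le> 1"
  by (rule Cb_nrm_le) (simp add: ind_def)

lemma Cb_eval: assumes V: "bs V" shows "(\<lambda>f\<in>carrier (Cb V). f g) \<in> bl_hom (Cb V) V"
  by (rule blI[where B=1]) (use V Cb_closed[OF V] Cb_nrm_ge[OF V] bs_closed[OF bs_Cb[OF V]] in \<open>auto simp: Cb_simps\<close>)

lemma Cb_finsum_apply:
  assumes "bs V" "finite F" "!!x. x \<in> F ==> h x \<in> carrier (Cb V)"
  shows "finsum (Cb V) h F g = finsum V (%x. h x g) F"
proof -
  have "(\<lambda>f\<in>carrier (Cb V). f g) (finsum (Cb V) h F) = finsum V (%x. (\<lambda>f\<in>carrier (Cb V). f g) (h x)) F"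
    by (rule bl_finsum[OF Cb_eval]) (use assms in auto)
  also have "\<dots> = finsum V (%x. h x g) F"
  proof -
    interpret V: abelian_group V by (rule bs_ag[OF assms(1)])
    show ?thesis by (rule V.finsum_cong') (use assms Cb_closed[OF assms(1)] in auto)
  qed
  finally have "(\<lambda>f\<in>carrier (Cb V). f g) (finsum (Cb V) h F) = finsum V (%x. h x g) F" .
  moreover have "finsum (Cb V) h F \<in> carrier (Cb V)"
    by (rule bs_finsum_closed) (use assms in auto)
  ultimately show ?thesis by simp
qed

lemma ind_finsum:
  fixes V (structure) and R :: "'g => 'g => bool"
  assumes "bs V" "finite F" "x \<in> F" "R x y" "!!x x' y. x \<in> F ==> x' \<in> F ==> R x y ==> R x' y ==> x = x'"
    "!!x. w x \<in> carrier V"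
  shows "finsum V (%x. ind R x y \<odot> w x) F = w x"
proof -
  have "finsum V (%x. ind R x y \<odot> w x) F = ind R x y \<odot> w x"
    by (rule bs_finsum_single) (use assms in \<open>auto simp: ind_def\<close>)
  thus ?thesis using assms by (simp add: ind_def)
qed

lemma strong_dist_less: "c = Strong ==> bs V ==> x \<in> carrier V ==> y \<in> carrier V ==> z \<in> carrier V ==>
    dst V x y < e ==> dst V y z < e ==> dst V x z < e"
  using nrm_dist_tri[of V x y z] by (simp add: tri_def)

text \<open>A finite sum of tensors f \<otimes> w is compared with a sum over the classes of a
  partition so fine that every f involved is nearly constant on each class. By the strong triangle
  inequality the latter has norm at most the supremum of the function \<open>can\<close> assigns to
  the given sum, and the error is arbitrarily small. Density of finite sums gives the rest.\<close>

lemma can_strong_lower: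
  assumes S: "c = Strong" and bV: "bs V" and t: "t \<in> carrier (tC V)"
  shows "nrm (tC V) t \<le> nrm (Cb V) (can v c V t)"
proof -
  interpret tens2 v c C V by (rule tens2I) (use bV in auto)
  note V = bV
  note elb = elt_add[OF bs_Cb[OF bs_base] V] elt_smult[OF bs_Cb[OF bs_base] V]
  have T: "bs T" using V by simp
  let ?can = "can v c V"
  note can = can_hom[OF V]
  have main: "nrm T (q (%_. l)) \<le> nrm (Cb V) (?can (q (%_. l)))" if l: "ok l" for l
  proof (rule field_le_epsilon)
    fix e :: real assume e: "e > 0"
    \<comment> \<open>One tolerance for all coefficient functions, which costs at most e after
      multiplication by any of the vectors w in the list.\<close>
    have "\<exists>\<delta>>0. \<forall>(f, w)\<in>set m. \<delta> * nrm V w \<le> e" if "ok m" for m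
      using that
    proof (induction m)
      case Nil show ?case by (auto intro: exI[of _ 1])
    next
      case (Cons p m)
      obtain f w where p: "p = (f, w)" by force
      obtain \<delta> where \<delta>: "\<delta> > 0" "\<forall>(f, w)\<in>set m. \<delta> * nrm V w \<le> e" using Cons by auto
      have w: "w \<in> carrier V" and wm: "!!f w. (f, w) \<in> set m ==> w \<in> carrier V" using Cons p by auto
      define \<delta>' where "\<delta>' = min \<delta> (e / (nrm V w + 1))"
      have nw: "nrm V w \<ge> 0" using w by simp
      have "\<delta>' > 0" using \<delta> e nw by (simp add: \<delta>'_def)
      moreover have "\<delta>' * nrm V w \<le> e"
      proof -
        have "\<delta>' * nrm V w \<le> (e / (nrm V w + 1)) * nrm V w" by (rule mult_right_mono) (auto simp: \<delta>'_def nw)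
        also have "\<dots> = e - e / (nrm V w + 1)" using nw by (simp add: field_simps)
        also have "\<dots> \<le> e" using e nw by simp
        finally show ?thesis .
      qed
      moreover have "\<delta>' * nrm V w' \<le> e" if "(f', w') \<in> set m" for f' w'
      proof -
        have "\<delta>' * nrm V w' \<le> \<delta> * nrm V w'" by (rule mult_right_mono) (use wm[OF that] in \<open>auto simp: \<delta>'_def\<close>)
        thus ?thesis using \<delta>(2) that by fastforce
      qed
      ultimately show ?case unfolding p by (intro exI[of _ \<delta>']) auto
    qed
    then obtain \<delta> where \<delta>: "\<delta> > 0" "!!f w. (f, w) \<in> set l ==> \<delta> * nrm V w \<le> e" using l by blast
    \<comment> \<open>Points are related when every coefficient function of the list differs by less
      than \<delta> between them. The strong inequality makes this transitive, so it is an
      equivalence relation with open classes.\<close>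
    define R where "R x y \<longleftrightarrow> (\<forall>(f, w)\<in>set l. v (f x - f y) < \<delta>)" for x y :: 'g
    have fC: "f \<in> carrier C" if "(f, w) \<in> set l" for f w using l that by auto
    have Rn: "eventually (R x) (nhds x)" for x
    proof -
      have "eventually (%y. \<forall>p\<in>set l. v (fst p y - fst p x) < \<delta>) (nhds x)"
      proof (rule eventually_ball_finite)
        show "\<forall>p\<in>set l. eventually (%y. v (fst p y - fst p x) < \<delta>) (nhds x)"
        proof
          fix p assume p: "p \<in> set l"
          have "fst p \<in> carrier C" using fC[of "fst p" "snd p"] p by simp
          hence "cont_into (base_field v) (fst p)" by (simp only: Cb_carrier[OF bs_base])
          from cont_intoD(2)[OF this \<delta>(1), of x] show "eventually (%y. v (fst p y - fst p x) < \<delta>) (nhds x)" by simp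
        qed
      qed simp
      thus ?thesis unfolding R_def
        by (rule eventually_mono) (metis (no_types, lifting) case_prodI2 fst_conv minus_diff_eq v_minus)
    qed
    have Rr: "R x x" for x using \<delta> by (simp add: R_def)
    have Rs: "R y x" if "R x y" for x y
      using that unfolding R_def by (metis (no_types, lifting) case_prodD case_prodI2 minus_diff_eq v_minus)
    have Rt: "R x z" if "R x y" "R y z" for x y z
      unfolding R_def
    proof (intro ballI, clarify)
      fix f w assume "(f, w) \<in> set l"
      hence "v (f x - f y) < \<delta>" "v (f y - f z) < \<delta>" using that by (auto simp: R_def)
      thus "v (f x - f z) < \<delta>" using strong_dist_less[OF S bs_base, of "f x" "f y" "f z" \<delta>] by simp
    qed
  obtain F where F': "finite F \<and> (\<forall>y. \<exists>x\<in>F. R x y) \<and> (\<forall>x\<in>F. \<forall>x'\<in>F. \<forall>y. R x y --> R x' y --> x = x')"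
    using partition[OF Rn Rr Rs Rt] by (rule exE)
  have F: "finite F" "!!y. \<exists>x\<in>F. R x y" "!!x x' y. x \<in> F ==> x' \<in> F ==> R x y ==> R x' y ==> x = x'"
    using F' by blast+
    have iC: "ind R x \<in> carrier C" for x by (rule ind_C[OF Rn Rs Rt])
    \<comment> \<open>The tensor of the locally constant function that takes, on each class, the
      value of the given function at the chosen point.\<close>
    define D where "D m = finsum T (%x. elt c C V (ind R x) (?can (q (%_. m)) x)) F" for m
    have qT: "q (%_. m) \<in> carrier T" if "ok m" for m by (rule T_const_carrier[OF that])
    have cV: "?can (q (%_. m)) x \<in> carrier V" if "ok m" for m x
      by (rule Cb_closed[OF V bl_closed[OF can qT[OF that]]])
    have DT: "D m \<in> carrier T" if "ok m" for m
      unfolding D_def by (rule bs_finsum_closed[OF T]) (use cV[OF that] iC V in simp)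
    \<comment> \<open>The induction runs over lists with entries from l, because R was fixed by l.
      The error stays at most e instead of accumulating, since the errors of head and tail enter
      through a maximum.\<close>
    have approx: "dst T (q (%_. m)) (D m) \<le> e" if "set m \<subseteq> set l" for m
      using that
    proof (induction m)
      case Nil
      have "q (%_. []) = \<zero>\<^bsub>T\<^esub>" by (simp add: T_zero)
      moreover have "?can \<zero>\<^bsub>T\<^esub> x = \<zero>\<^bsub>V\<^esub>" for x using bl_zero[OF can T bs_Cb[OF V]] by (simp add: Cb_simps)
      moreover have "elt c C V f \<zero>\<^bsub>V\<^esub> = \<zero>\<^bsub>T\<^esub>" if "f \<in> carrier C" for f
        using elb(4)[OF that bs_closed(1)[OF V], of 0] elt_closed[OF _ V that bs_closed(1)[OF V]] V by simp
      moreover have "finsum T (%x. \<zero>\<^bsub>T\<^esub>) F = \<zero>\<^bsub>T\<^esub>"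
        by (rule abelian_monoid.finsum_zero[OF abelian_group.axioms(1)[OF bs_ag[OF T]]])
      ultimately have "D [] = \<zero>\<^bsub>T\<^esub>" using iC by (simp add: D_def)
      thus ?case using T e \<open>q (%_. []) = \<zero>\<^bsub>T\<^esub>\<close> by simp
    next
      case (Cons p m)
      obtain f w where p: "p = (f, w)" by force
      have f: "f \<in> carrier C" and w: "w \<in> carrier V" and m: "ok m" and okp: "ok ((f, w) # m)"
        and fw: "(f, w) \<in> set l" using Cons p l by auto
      have el: "elt c C V f w \<in> carrier T" using f w V by simp
      have 1: "q (%_. p # m) = elt c C V f w \<oplus>\<^bsub>T\<^esub> q (%_. m)" unfolding p by (rule q_Cons[OF okp])
      have 2: "?can (q (%_. p # m)) x = f x \<odot>\<^bsub>V\<^esub> w \<oplus>\<^bsub>V\<^esub> ?can (q (%_. m)) x" for x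
        unfolding 1 bl_add[OF can el qT[OF m]] using can_elt[OF V f w] by (simp add: Cb_simps)
      \<comment> \<open>The sum f' of these functions replaces f on each class by its value at the
        chosen point.\<close>
      define h where "h x = f x \<odot>\<^bsub>C\<^esub> ind R x" for x
      have hC: "h x \<in> carrier C" for x unfolding h_def using iC by simp
      define f' where "f' = finsum C h F"
      have f': "f' \<in> carrier C" unfolding f'_def by (rule bs_finsum_closed) (use hC in auto)
      have 3: "elt c C V (ind R x) (?can (q (%_. p # m)) x)
          = elt c C V (h x) w \<oplus>\<^bsub>T\<^esub> elt c C V (ind R x) (?can (q (%_. m)) x)" for x
        unfolding 2 h_def using elb iC cV[OF m] w V by simp
      have "D (p # m) = finsum T (%x. elt c C V (h x) w) F \<oplus>\<^bsub>T\<^esub> D m"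
        unfolding D_def 3 by (rule bs_finsum_add[OF T]) (use hC iC w V cV[OF m] in auto)
      also have "finsum T (%x. elt c C V (h x) w) F = elt c C V f' w"
      proof -
        have "(\<lambda>x\<in>carrier C. elt c C V x w) (finsum C h F) = finsum T (%x. (\<lambda>x\<in>carrier C. elt c C V x w) (h x)) F"
          by (rule bl_finsum[OF bl_elt_left]) (use V w hC F in auto)
        thus ?thesis using f' hC by (simp add: f'_def)
      qed
      finally have 4: "D (p # m) = elt c C V f' w \<oplus>\<^bsub>T\<^esub> D m" .
      have "q (%_. p # m) \<ominus>\<^bsub>T\<^esub> D (p # m) = (elt c C V f w \<ominus>\<^bsub>T\<^esub> elt c C V f' w) \<oplus>\<^bsub>T\<^esub> (q (%_. m) \<ominus>\<^bsub>T\<^esub> D m)"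
        unfolding 1 4 by (rule bs_diff_add[OF T]) (use el qT[OF m] DT[OF m] f' w V in auto)
      moreover have "elt c C V f w \<ominus>\<^bsub>T\<^esub> elt c C V f' w = elt c C V (f \<ominus>\<^bsub>C\<^esub> f') w"
        using f f' w V by (simp add: bs_dif_conv elb)
      moreover have "nrm T (elt c C V (f \<ominus>\<^bsub>C\<^esub> f') w) \<le> e"
      proof -
        have "dst C f f' \<le> \<delta>"
        proof (rule Cb_nrm_le)
          fix y
          obtain x where x: "x \<in> F" "R x y" using F(2) by blast
          have "f' y = finsum (base_field v) (%x. h x y) F"
            unfolding f'_def by (rule Cb_finsum_apply) (use F hC in auto)
          also have "(%x. h x y) = (%x. ind R x y \<odot>\<^bsub>base_field v\<^esub> f x)"
            by (simp add: h_def Cb_simps mult.commute)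
          also have "finsum (base_field v) \<dots> F = f x"
            by (rule ind_finsum[where R=R, OF bs_base F(1) x F(3)]) auto
          finally have "f' y = f x" .
          moreover have "v (f x - f y) < \<delta>" using x(2) fw by (auto simp: R_def)
          ultimately show "nrm (base_field v) ((f \<ominus>\<^bsub>C\<^esub> f') y) \<le> \<delta>"
            using v_minus[of "f x - f y"] f f' by (simp add: Cb_diff)
        qed
        hence "dst C f f' * nrm V w \<le> \<delta> * nrm V w" by (rule mult_right_mono) (use w in simp)
        thus ?thesis using elt_nrm[OF bs_Cb[OF bs_base] V, of "f \<ominus>\<^bsub>C\<^esub> f'" w] f f' w \<delta>(2)[OF fw] by simp
      qed
      moreover have "dst T (q (%_. m)) (D m) \<le> e" using Cons by simp
      ultimately have a: "q (%_. p # m) \<ominus>\<^bsub>T\<^esub> D (p # m) = elt c C V (f \<ominus>\<^bsub>C\<^esub> f') w \<oplus>\<^bsub>T\<^esub> (q (%_. m) \<ominus>\<^bsub>T\<^esub> D m)"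
        "nrm T (elt c C V (f \<ominus>\<^bsub>C\<^esub> f') w) \<le> e" "dst T (q (%_. m)) (D m) \<le> e" by auto
      have "dst T (q (%_. p # m)) (D (p # m))
          \<le> tri c (nrm T (elt c C V (f \<ominus>\<^bsub>C\<^esub> f') w)) (dst T (q (%_. m)) (D m))"
        unfolding a(1) by (rule nrm_tri[OF T]) (use f f' w V qT[OF m] DT[OF m] in auto)
      also have "\<dots> \<le> e" using a S by (simp add: tri_def)
      finally show ?case .
    qed
    let ?N = "nrm (Cb V) (?can (q (%_. l)))"
    have N0: "0 \<le> ?N" by (rule Cb_nrm_nonneg[OF V bl_closed[OF can qT[OF l]]])
    have "nrm T (D l) \<le> ?N"
      unfolding D_def
    proof (rule nrm_finsum_strong[OF S T F(1) N0], intro conjI)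
      fix x
      show "elt c C V (ind R x) (?can (q (%_. l)) x) \<in> carrier T" using cV[OF l] iC V by simp
      have "nrm T (elt c C V (ind R x) (?can (q (%_. l)) x)) \<le> nrm C (ind R x) * nrm V (?can (q (%_. l)) x)"
        by (rule elt_nrm) (use iC V cV[OF l] in auto)
      also have "\<dots> \<le> 1 * ?N"
        by (rule mult_mono) (use ind_nrm Cb_nrm_ge[OF V bl_closed[OF can qT[OF l]]] V cV[OF l] in auto)
      finally show "nrm T (elt c C V (ind R x) (?can (q (%_. l)) x)) \<le> ?N" by simp
    qed
    thus "nrm T (q (%_. l)) \<le> ?N + e"
      using nrm_le_diff[OF T qT[OF l] DT[OF l]] approx[of l] by simp
  qed
  obtain s where s: "ca s" "t = q s" using t by (auto simp: T_carrier)
  note lim = T_dense[OF s(1)]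
  show ?thesis unfolding s(2)
    by (rule LIMSEQ_le[OF vlim_nrm[OF T lim] vlim_nrm[OF bs_Cb[OF V] bl_vlim[OF can T bs_Cb[OF V] lim]]])
       (use main s in auto)
qed

text \<open>For the values of f, being less than e apart is an equivalence relation, and its classes
  in G are open. Tensoring the indicators of these finitely many classes with the values of f at
  chosen points gives the approximation.\<close>

lemma can_strong_dense:
  assumes S: "c = Strong" and V: "bs V" and f: "f \<in> carrier (Cb V)" and e: "e > 0"
  shows "\<exists>t\<in>carrier (tC V). dst (Cb V) f (can v c V t) \<le> e"
proof -
  let ?T = "tC V"
  have fc: "f x \<in> carrier V" for x by (rule Cb_closed[OF V f])
  define R where "R x y \<longleftrightarrow> dst V (f y) (f x) < e" for x y :: 'g
  have Rn: "eventually (R x) (nhds x)" for x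
    using f cont_intoD(2)[of V f e x] e unfolding R_def Cb_carrier[OF V] by simp
  have Rr: "R x x" for x using e V fc by (simp add: R_def)
  have Rs: "R y x" if "R x y" for x y using that nrm_commute[OF V fc fc] by (simp add: R_def)
  have Rt: "R x z" if "R x y" "R y z" for x y z
    using strong_dist_less[OF S V fc fc fc] that unfolding R_def by blast
  obtain F where F': "finite F \<and> (\<forall>y. \<exists>x\<in>F. R x y) \<and> (\<forall>x\<in>F. \<forall>x'\<in>F. \<forall>y. R x y --> R x' y --> x = x')"
    using partition[OF Rn Rr Rs Rt] by (rule exE)
  have F: "finite F" "!!y. \<exists>x\<in>F. R x y" "!!x x' y. x \<in> F ==> x' \<in> F ==> R x y ==> R x' y ==> x = x'"
    using F' by blast+
  have iC: "ind R x \<in> carrier C" for x by (rule ind_C[OF Rn Rs Rt])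
  define t where "t = finsum ?T (%x. elt c C V (ind R x) (f x)) F"
  have t: "t \<in> carrier ?T" unfolding t_def by (rule bs_finsum_closed) (use V iC fc in auto)
  have cc: "(%g. ind R x g \<odot>\<^bsub>V\<^esub> f x) \<in> carrier (Cb V)" for x by (rule bbD(2)[OF can_bb[OF V] iC fc])
  have "can v c V t = finsum (Cb V) (%x. can v c V (elt c C V (ind R x) (f x))) F"
    unfolding t_def by (rule bl_finsum[OF can_hom]) (use V F iC fc in auto)
  also have "(%x. can v c V (elt c C V (ind R x) (f x))) = (%x g. ind R x g \<odot>\<^bsub>V\<^esub> f x)"
    using can_elt[OF V iC fc] by simp
  finally have ct: "can v c V t = finsum (Cb V) (%x g. ind R x g \<odot>\<^bsub>V\<^esub> f x) F" .
  have "nrm V ((f \<ominus>\<^bsub>Cb V\<^esub> can v c V t) y) \<le> e" for y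
  proof -
    obtain x where x: "x \<in> F" "R x y" using F(2) by blast
    have "can v c V t y = f x"
      unfolding ct Cb_finsum_apply[OF V F(1) cc] by (rule ind_finsum[where R=R, OF V F(1) x F(3) fc])
    thus ?thesis using x(2) unfolding Cb_diff[OF V f bl_closed[OF can_hom[OF V] t]] R_def by simp
  qed
  thus ?thesis using t Cb_nrm_le by blast
qed

text \<open>Since \<open>can\<close> does not decrease norms, tensors whose images converge to f are
  themselves Cauchy. So the dense range is everything, and \<open>ban_iso_bij\<close>
  applies.\<close>

lemma can_iso_strong:
  assumes S: "c = Strong" and V: "bs V"
  shows "ban_iso (tC V) (Cb V) (can v c V)"
proof (rule ban_iso_bij)
  let ?T = "tC V"
  have T: "bs ?T" and CV: "bs (Cb V)" using V by auto
  show can: "can v c V \<in> bl_hom ?T (Cb V)" using V by simp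
  show "bs ?T" "bs (Cb V)" by fact+
  show lower: "nrm ?T x \<le> nrm (Cb V) (can v c V x)" if "x \<in> carrier ?T" for x
    by (rule can_strong_lower[OF S V that])
  fix f assume f: "f \<in> carrier (Cb V)"
  have "\<forall>n. \<exists>t\<in>carrier ?T. dst (Cb V) f (can v c V t) \<le> 1 / Suc n"
    using can_strong_dense[OF S V f] by simp
  then obtain t where t: "!!n. t n \<in> carrier ?T" "!!n. dst (Cb V) f (can v c V (t n)) \<le> 1 / Suc n"
    by metis
  have ctc: "can v c V (t n) \<in> carrier (Cb V)" for n by (rule bl_closed[OF can t(1)])
  have lim: "vlim (Cb V) (%n. can v c V (t n)) f"
  proof (rule vlim_le[OF CV])
    show "dst (Cb V) (can v c V (t n)) f \<le> 1 / Suc n" for n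
      using t(2)[of n] nrm_commute[OF CV f ctc] by simp
    show "(%n. 1 / real (Suc n)) \<longlonglongrightarrow> 0" by (rule LIMSEQ_Suc[OF lim_inverse_n'])
  qed (use f ctc in auto)
  have "vcauchy ?T t"
    unfolding vcauchy_def
  proof (intro conjI allI impI t(1))
    fix e :: real assume "e > 0"
    then obtain N where N: "!!m n. m \<ge> N ==> n \<ge> N ==> dst (Cb V) (can v c V (t m)) (can v c V (t n)) < e"
      using vlim_cauchy[OF CV lim] unfolding vcauchy_def by blast
    show "\<exists>N. \<forall>m\<ge>N. \<forall>n\<ge>N. dst ?T (t m) (t n) < e"
    proof (intro exI[of _ N] allI impI)
      fix m n assume "m \<ge> N" "n \<ge> N"
      hence "dst (Cb V) (can v c V (t m)) (can v c V (t n)) < e" by (rule N)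
      hence "nrm (Cb V) (can v c V (t m \<ominus>\<^bsub>?T\<^esub> t n)) < e" unfolding bl_diff[OF can T CV t(1) t(1)] .
      thus "dst ?T (t m) (t n) < e"
        by (rule le_less_trans[OF lower[OF bs_closed(4)[OF T t(1) t(1)]]])
    qed
  qed
  then obtain l where l: "vlim ?T t l" using bs_complete[OF T] by blast
  have "can v c V l = f" by (rule vlim_unique[OF CV bl_vlim[OF can T CV l] lim])
  thus "\<exists>x\<in>carrier ?T. can v c V x = f" using vlim_carrier(1)[OF l] by blast
qed

text \<open>Naturality of \<open>can\<close>: an isomorphism of V with W identifies C \<otimes> V
  with C \<otimes> W and C(G,V) with C(G,W). The inverse of \<open>can\<close> for V is assembled
  from these and the inverse for W.\<close>

lemma can_iso_transport:
  assumes V: "bs V" and W: "bs W" and i: "ban_iso V W i" and cW: "ban_iso (tC W) (Cb W) (can v c W)"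
  shows "ban_iso (tC V) (Cb V) (can v c V)"
proof -
  obtain f g where f: "f \<in> bl_hom V W" "g \<in> bl_hom W V" "!!x. x \<in> carrier V ==> g (f x) = x"
    "!!y. y \<in> carrier W ==> f (g y) = y" by (rule ban_isoE[OF i]) blast
  obtain h where h: "h \<in> bl_hom (Cb W) (tC W)" "!!x. x \<in> carrier (tC W) ==> h (can v c W x) = x"
    "!!y. y \<in> carrier (Cb W) ==> can v c W (h y) = y" by (rule ban_isoE[OF cW]) blast
  let ?mf = "tens_map c C C V W (ban_id C) f" and ?mg = "tens_map c C C W V (ban_id C) g"
  have B: "bs (tC V)" "bs (tC W)" "bs (Cb V)" "bs (Cb W)" "bs C" using V W by auto
  have mf: "?mf \<in> bl_hom (tC V) (tC W)" by (rule tens_map_hom) (use V W f in auto)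
  have mg: "?mg \<in> bl_hom (tC W) (tC V)" by (rule tens_map_hom) (use V W f in auto)
  let ?k = "compose (carrier (Cb V)) ?mg (compose (carrier (Cb V)) h (Cmap V f))"
  have 1: "compose (carrier (Cb V)) h (Cmap V f) \<in> bl_hom (Cb V) (tC W)"
    by (rule bl_comp[OF Cmap_hom[OF V W f(1)] h(1) B(3,4)])
  have k: "?k \<in> bl_hom (Cb V) (tC V)" by (rule bl_comp[OF 1 mg B(3,2)])
  have k_eq: "?k u = ?mg (h (%x. f (u x)))" if "u \<in> carrier (Cb V)" for u
    using that by (simp add: compose_eq Cmap_def)
  have fu: "(%x. f (u x)) \<in> carrier (Cb W)" if "u \<in> carrier (Cb V)" for u
    using that cont_bl[OF V W f(1), of u] by (simp add: Cb_carrier V W)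
  show ?thesis
  proof (rule ban_isoI[OF can_hom[OF V] k])
    fix u assume u: "u \<in> carrier (Cb V)"
    have "can v c V (?k u) = (%x. g (can v c W (h (%x. f (u x))) x))"
      unfolding k_eq[OF u] by (rule can_natural[OF W V f(2) bl_closed[OF h(1) fu[OF u]]])
    also have "\<dots> = u" using h(3)[OF fu[OF u]] f(3)[OF Cb_closed[OF V u]] by simp
    finally show "can v c V (?k u) = u" .
  next
    fix t assume t: "t \<in> carrier (tC V)"
    have "?k (can v c V t) = ?mg (h (%x. f (can v c V t x)))"
      by (rule k_eq[OF bl_closed[OF can_hom[OF V] t]])
    also have "(%x. f (can v c V t x)) = can v c W (?mf t)"
      by (rule can_natural[OF V W f(1) t, symmetric])
    also have "h \<dots> = ?mf t" by (rule h(2)[OF bl_closed[OF mf t]])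
    also have "?mg (?mf t) = compose (carrier (tC V)) ?mg ?mf t" using t by (simp add: compose_eq)
    also have "compose (carrier (tC V)) ?mg ?mf
        = tens_map c C C V V (compose (carrier C) (ban_id C) (ban_id C)) (compose (carrier V) g f)"
      by (rule tens_map_comp[OF B(5) V B(5) W B(5) V bl_id[OF B(5)] f(1) bl_id[OF B(5)] f(2)])
    also have "compose (carrier C) (ban_id C) (ban_id C) = ban_id C" by (rule bl_id_left[OF bl_id[OF B(5)]])
    also have "compose (carrier V) g f = ban_id V" using f(3) by (auto simp: compose_def ban_id_def fun_eq_iff)
    also have "tens_map c C C V V (ban_id C) (ban_id V) = ban_id (tC V)" by (rule tens_map_id[OF B(5) V])
    finally show "?k (can v c V t) = t" using t by simp
  qed
qed

end

text \<open>The injection \<open>en\<close> closes the universe under families over \<nat> \<times>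
  G: functions on G are coded by families that ignore the number, tuples of indices by families that
  ignore the group element. The condition \<open>usual\<close> supplies the isomorphism of C
  \<otimes> V with C(G,V), which the usual triangle inequality does not give in general.\<close>

locale universe = cgrp v c G for v :: "'k::field => real" and c and G :: "'g::topological_group_add itself" +
  fixes enk :: "'k => 'u" and en :: "(nat \<times> 'g => 'u) => 'u"
  assumes inj_enk: "inj enk" and inj_en: "inj en"
    and usual: "c = Usual ==> \<forall>V :: ('k, 'u) nspace. banach_space v c V -->
      ban_iso (tensor c (Cblu (base_field v)) V) (Cblu V :: ('k, 'g => 'u) nspace) (can v c V)"
begin

text \<open>This class contains all iterated tensor products with \<open>C(G,k)\<close> of spaces in the universe.\<close>

definition small :: "('k, 'a) nspace => bool" where
  "small V \<longleftrightarrow> bs V \<and> (\<exists>(V' :: ('k, 'u) nspace) f. bs V' \<and> ban_iso V V' f)"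

lemma small_bs: "small V ==> bs V" by (simp add: small_def)

lemma can_iso_u: assumes "bs (V :: ('k, 'u) nspace)" shows "ban_iso (tC V) (Cb V) (can v c V)"
  using usual can_iso_strong[OF _ assms] assms by (cases c) auto

lemma can_iso: assumes "small V" shows "ban_iso (tC V) (Cb V) (can v c V)"
  using assms can_iso_transport[OF _ _ _ can_iso_u] unfolding small_def by blast

lemma small_iso: assumes "bs V" "small W" "ban_iso V W f" shows "small V"
  using assms ban_iso_trans[OF assms(3)] unfolding small_def by blast

lemma small_inj: assumes "bs V" "inj_on (e :: _ => 'u) (carrier V)" shows "small V"
  using push_bs[OF assms] push_iso[OF assms] assms(1) unfolding small_def by blast

lemma small_u: "bs (V :: ('k, 'u) nspace) ==> small V"
  by (rule small_inj[of _ id]) auto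

lemma small_base: "small (base_field v)"
  by (rule small_inj[of _ enk]) (use inj_enk in auto)

definition enf :: "('g => 'u) => 'u" where "enf f = en (%(n, x). f x)"

lemma inj_enf: "inj enf"
proof (rule injI)
  fix f g assume "enf f = enf g"
  hence "(%(n::nat, x). f x) = (%(n, x). g x)" using inj_en by (auto simp: enf_def dest: injD)
  hence "f x = g x" for x by (metis case_prod_conv)
  thus "f = g" by blast
qed

text \<open>A copy W of V in the universe gives an isomorphism of C(G,V) with C(G,W), and functions
  from G to the universe are coded in it by \<open>enf\<close>.\<close>

lemma small_Cb: assumes "small V" shows "small (Cb V)"
proof -
  obtain W :: "('k, 'u) nspace" and f where W: "bs W" "ban_iso V W f" using assms unfolding small_def by blast
  have V: "bs V" by (rule small_bs[OF assms])
  obtain g where g: "f \<in> bl_hom V W" "g \<in> bl_hom W V" "!!x. x \<in> carrier V ==> g (f x) = x"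
    "!!y. y \<in> carrier W ==> f (g y) = y" by (rule ban_isoE[OF W(2)]) blast
  note h = Cmap_hom[OF V W(1) g(1)] Cmap_hom[OF W(1) V g(2)]
  have "ban_iso (Cb V) (Cb W) (Cmap V f)"
  proof (rule ban_isoI[OF h])
    show "Cmap W g (Cmap V f u) = u" if u: "u \<in> carrier (Cb V)" for u
      using bl_closed[OF h(1) u] u g(3)[OF Cb_closed[OF V u]] by (simp add: Cmap_def)
    show "Cmap V f (Cmap W g u) = u" if u: "u \<in> carrier (Cb W)" for u
      using bl_closed[OF h(2) u] u g(4)[OF Cb_closed[OF W(1) u]] by (simp add: Cmap_def)
  qed
  moreover have "small (Cb W)"
    by (rule small_inj[OF bs_Cb[OF W(1)], of enf]) (rule inj_on_subset[OF inj_enf], simp)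
  ultimately show ?thesis using small_iso[OF bs_Cb[OF V]] by blast
qed

text \<open>C \<otimes> V is isomorphic to C(G,V), to which \<open>small_Cb\<close> applies. The
  class is thus closed under tensoring with C.\<close>

lemma small_tensor: assumes "small V" shows "small (tC V)"
  by (rule small_iso[OF bs_tensor small_Cb[OF assms] can_iso[OF assms]]) (use small_bs[OF assms] in auto)

lemma small_C: "small C" by (rule small_Cb[OF small_base])

end

section \<open>The bialgebra of functions on the group\<close>

context valued
begin

text \<open>Members of \<open>bl_hom\<close> are undefined off the carrier. \<open>lin\<close>
  leaves the values there free, so that composites can be written as plain functions.\<close>

definition lin :: "('k, 'a) nspace => ('k, 'b) nspace => ('a => 'b) => bool" where
  "lin V W f \<longleftrightarrow> restrict f (carrier V) \<in> bl_hom V W"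

lemma bl_lin: assumes "f \<in> bl_hom V W" shows "lin V W f"
proof -
  have "f \<in> extensional (carrier V)" using assms unfolding bl_hom_def PiE_iff by blast
  thus ?thesis using assms by (simp add: lin_def extensional_restrict)
qed

lemma linD: assumes "lin V W f"
  shows "x \<in> carrier V ==> f x \<in> carrier W"
    "x \<in> carrier V ==> y \<in> carrier V ==> x \<oplus>\<^bsub>V\<^esub> y \<in> carrier V ==> f (x \<oplus>\<^bsub>V\<^esub> y) = f x \<oplus>\<^bsub>W\<^esub> f y"
  using assms bl_closed[of "restrict f (carrier V)" V W x] bl_add[of "restrict f (carrier V)" V W x y]
  unfolding lin_def by (auto simp: restrict_def split: if_splits)

lemma lin_comp:
  assumes f: "lin V W f" and g: "lin W Z g" and "bs V" "bs W"
  shows "lin V Z (%x. g (f x))"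
proof -
  have "compose (carrier V) (restrict g (carrier W)) (restrict f (carrier V)) \<in> bl_hom V Z"
    by (rule bl_comp) (use assms in \<open>auto simp: lin_def\<close>)
  moreover have "compose (carrier V) (restrict g (carrier W)) (restrict f (carrier V)) = restrict (%x. g (f x)) (carrier V)"
    using linD(1)[OF f] by (auto simp: compose_def fun_eq_iff)
  ultimately show ?thesis by (simp add: lin_def)
qed

lemma lin_elt_left: "bs V ==> bs W ==> z \<in> carrier W ==> lin V (tensor c V W) (%x. elt c V W x z)"
  unfolding lin_def by (rule bl_elt_left)

lemma lin_elt_right: "bs V ==> bs W ==> z \<in> carrier V ==> lin W (tensor c V W) (%y. elt c V W z y)"
  unfolding lin_def by (rule bl_elt_right)

lemma lin_smult_left: "bs V ==> w \<in> carrier V ==> lin (base_field v) V (%a. a \<odot>\<^bsub>V\<^esub> w)"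
  unfolding lin_def by (rule blI[where B="nrm V w"]) (auto simp: bs_smult mult.commute)

lemma tens_ext_lin:
  assumes "bs V" "bs W" "bs Z" "lin (tensor c V W) Z f" "lin (tensor c V W) Z g"
    and "!!x y. x \<in> carrier V ==> y \<in> carrier W ==> f (elt c V W x y) = g (elt c V W x y)"
    and "t \<in> carrier (tensor c V W)"
  shows "f t = g t"
proof -
  have "restrict f (carrier (tensor c V W)) = restrict g (carrier (tensor c V W))"
    by (rule tens_ext[OF assms(1-3)]) (use assms in \<open>auto simp: lin_def\<close>)
  from fun_cong[OF this, of t] show ?thesis using assms(7) by simp
qed

lemma tens_ext_lin_l:
  assumes "bs U" "bs V" "bs W" "bs Z"
    "lin (tensor c (tensor c U V) W) Z f" "lin (tensor c (tensor c U V) W) Z g"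
    and "!!x y z. x \<in> carrier U ==> y \<in> carrier V ==> z \<in> carrier W ==>
      f (elt c (tensor c U V) W (elt c U V x y) z) = g (elt c (tensor c U V) W (elt c U V x y) z)"
    and "t \<in> carrier (tensor c (tensor c U V) W)"
  shows "f t = g t"
proof -
  have "restrict f (carrier (tensor c (tensor c U V) W)) = restrict g (carrier (tensor c (tensor c U V) W))"
    by (rule tens_ext_l[OF assms(1-4)]) (use assms in \<open>auto simp: lin_def\<close>)
  from fun_cong[OF this, of t] show ?thesis using assms(8) by simp
qed

lemma compose_cong:
  "(!!x. x \<in> A ==> g (f x) = g' (f' x)) ==> compose A g f = compose A g' f'"
  by (auto simp: compose_def)

end

section \<open>Evaluation at a group element\<close>

context cgrp
begin

definition ev :: "('k, 'a) nspace => 'g => ('g => 'k, 'a) tens => 'a" where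
  "ev V g = (\<lambda>t\<in>carrier (tC V). can v c V t g)"

lemma lin_eval: "bs V ==> lin (Cb V) V (%f. f g)"
  unfolding lin_def by (rule Cb_eval)

lemma bs_C: "bs C" by simp

lemma ev_hom: assumes V: "bs V" shows "ev V g \<in> bl_hom (tC V) V"
  using lin_comp[OF bl_lin[OF can_hom[OF V]] lin_eval[OF V], of g] V by (simp add: lin_def ev_def)

lemma ev_can: "t \<in> carrier (tC V) ==> ev V g t = can v c V t g"
  by (simp add: ev_def)

lemma ev_elt: "bs V ==> f \<in> carrier C ==> w \<in> carrier V ==> ev V g (elt c C V f w) = f g \<odot>\<^bsub>V\<^esub> w"
  by (simp add: ev_def)

lemma ev_closed: "bs V ==> t \<in> carrier (tC V) ==> ev V g t \<in> carrier V"
  by (rule bl_closed[OF ev_hom])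

lemma ev_natural:
  assumes "bs V" "bs W" "\<phi> \<in> bl_hom V W" "t \<in> carrier (tC V)"
  shows "ev W g (tens_map c C C V W (ban_id C) \<phi> t) = \<phi> (ev V g t)"
  using can_natural[OF assms] bl_closed[OF tens_map_hom[OF bs_C assms(1) bs_C assms(2) bl_id[OF bs_C] assms(3)] assms(4)]
    assms(4) by (simp add: ev_can)

lemma ev_cont: assumes V: "bs V" and t: "t \<in> carrier (tC V)" shows "cont_into V (%g. ev V g t)"
  using bl_closed[OF can_hom[OF V] t] t by (simp add: ev_can Cb_carrier[OF V])

text \<open>The bound does not depend on g, because \<open>can\<close> does not increase norms and
  its values carry the supremum norm.\<close>

lemma ev_bound:
  assumes V: "bs V" and W: "bs W" and r: "r \<in> bl_hom V (tC W)"
  obtains B where "!!x g. x \<in> carrier V ==> nrm W (ev W g (r x)) \<le> B * nrm V x"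
proof -
  obtain B where B: "B > 0" "!!x. x \<in> carrier V ==> nrm (tC W) (r x) \<le> B * nrm V x"
    by (rule bl_bound[OF V r]) blast
  have "nrm W (ev W g (r x)) \<le> B * nrm V x" if x: "x \<in> carrier V" for x g
  proof -
    have rx: "r x \<in> carrier (tC W)" by (rule bl_closed[OF r x])
    have "nrm W (ev W g (r x)) \<le> nrm (Cb W) (can v c W (r x))"
      unfolding ev_can[OF rx] by (rule Cb_nrm_ge[OF W bl_closed[OF can_hom[OF W] rx]])
    also have "\<dots> \<le> nrm (tC W) (r x)" by (rule can_nrm[OF W rx])
    also have "\<dots> \<le> B * nrm V x" by (rule B(2)[OF x])
    finally show ?thesis .
  qed
  thus ?thesis using that by blast
qed

end

context universe
begin

lemma ev_inj:
  assumes V: "small V" and t: "t \<in> carrier (tC V)" "t' \<in> carrier (tC V)"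
    and eq: "!!g. ev V g t = ev V g t'"
  shows "t = t'"
proof -
  obtain k where "!!x. x \<in> carrier (tC V) ==> k (can v c V x) = x" by (rule ban_isoE[OF can_iso[OF V]]) blast
  moreover have "can v c V t = can v c V t'" using eq t by (auto simp: ev_can)
  ultimately show ?thesis using t by metis
qed

text \<open>A family of linear maps that is pointwise continuous in g and bounded uniformly in g is
  one bounded map from W to C(G,V); it is composed with the inverse of \<open>can\<close>.\<close>

lemma ev_surj:
  assumes V: "small V" and W: "bs W"
    and s: "!!g x. x \<in> carrier W ==> s g x \<in> carrier V"
    and cont: "!!x. x \<in> carrier W ==> cont_into V (%g. s g x)"
    and add: "!!g x y. x \<in> carrier W ==> y \<in> carrier W ==> s g (x \<oplus>\<^bsub>W\<^esub> y) = s g x \<oplus>\<^bsub>V\<^esub> s g y"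
    and smult: "!!g a x. x \<in> carrier W ==> s g (a \<odot>\<^bsub>W\<^esub> x) = a \<odot>\<^bsub>V\<^esub> s g x"
    and bound: "!!g x. x \<in> carrier W ==> nrm V (s g x) \<le> B * nrm W x"
  shows "\<exists>r\<in>bl_hom W (tC V). \<forall>g. \<forall>x\<in>carrier W. ev V g (r x) = s g x"
proof -
  have bV: "bs V" by (rule small_bs[OF V])
  obtain k where k: "k \<in> bl_hom (Cb V) (tC V)" "!!y. y \<in> carrier (Cb V) ==> can v c V (k y) = y"
    by (rule ban_isoE[OF can_iso[OF V]]) blast
  let ?S = "\<lambda>x\<in>carrier W. (%g. s g x)"
  have S: "?S \<in> bl_hom W (Cb V)"
  proof (rule blI[where B=B])
    show "?S x \<in> carrier (Cb V)" if "x \<in> carrier W" for x using that cont by (simp add: Cb_carrier[OF bV])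
    show "nrm (Cb V) (?S x) \<le> B * nrm W x" if "x \<in> carrier W" for x
      by (rule Cb_nrm_le) (use that bound in simp)
  qed (use W in \<open>auto simp: Cb_simps add smult\<close>)
  have r: "compose (carrier W) k ?S \<in> bl_hom W (tC V)"
    by (rule bl_comp[OF S k(1) W bs_Cb[OF bV]])
  have "ev V g (compose (carrier W) k ?S x) = s g x" if x: "x \<in> carrier W" for g x
  proof -
    have "(%g. s g x) \<in> carrier (Cb V)" using bl_closed[OF S x] x by simp
    thus ?thesis using x bl_closed[OF k(1)] k(2) by (simp add: compose_eq ev_can)
  qed
  thus ?thesis using r by blast
qed

section \<open>Multiplication, comultiplication and counit on C(G,k)\<close>

abbreviation "CC \<equiv> tC C"
abbreviation "mult_C \<equiv> mu (group_bialg v c :: ('k, 'g => 'k) bialg)"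
abbreviation "\<Delta> \<equiv> comul (group_bialg v c :: ('k, 'g => 'k) bialg)"

lemma gb_simps: "space (group_bialg v c) = C" "unt (group_bialg v c) = (%a g. a)"
  "counit (group_bialg v c) = (\<lambda>f\<in>carrier C. f 0)"
  by (auto simp: group_bialg_def Let_def)

lemma mult_C: "mult_C \<in> bl_hom CC C"
  "f \<in> carrier C ==> f' \<in> carrier C ==> mult_C (elt c C C f f') = (%g. f g * f' g)"
  "f \<in> carrier C ==> f' \<in> carrier C ==> (%g. f g * f' g) \<in> carrier C"
proof -
  have B: "bb C C C 1 (%f f' g. f g * f' g)"
  proof (rule bbI)
    show "(%g. f g * f' g) \<in> carrier C" if "f \<in> carrier C" "f' \<in> carrier C" for f f'
      using cont_bb[OF bs_base bs_base bs_base bb_smult[OF bs_base], of f f'] that by (simp add: Cb_carrier[OF bs_base])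
    show "nrm C (%g. f g * f' g) \<le> 1 * (nrm C f * nrm C f')" if "f \<in> carrier C" "f' \<in> carrier C" for f f'
    proof (rule Cb_nrm_le)
      fix g
      have "v (f g) * v (f' g) \<le> nrm C f * nrm C f'"
        using Cb_nrm_ge[OF bs_base that(1), of g] Cb_nrm_ge[OF bs_base that(2), of g] Cb_nrm_nonneg[OF bs_base that(1)]
        by (intro mult_mono) auto
      thus "nrm (base_field v) (f g * f' g) \<le> 1 * (nrm C f * nrm C f')" by simp
    qed
  qed (auto simp: Cb_simps algebra_simps)
  note L = tens_lift[OF bs_C bs_C bs_C B]
  show "mult_C \<in> bl_hom CC C" using L(1) by (simp add: group_bialg_def Let_def)
  show "f \<in> carrier C ==> f' \<in> carrier C ==> mult_C (elt c C C f f') = (%g. f g * f' g)"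
    using L(2) by (simp add: group_bialg_def Let_def)
  show "f \<in> carrier C ==> f' \<in> carrier C ==> (%g. f g * f' g) \<in> carrier C" by (rule bbD(2)[OF B])
qed

lemma unit_C: "(%a g. a) \<in> bl_hom (base_field v) C"
  by (rule blI[where B=1]) (auto simp: Cb_carrier[OF bs_base] Cb_simps cont_const intro: Cb_nrm_le)

lemma const_C: "(%g. a) \<in> carrier C"
  by (rule bl_closed[OF unit_C]) simp

lemma translate_cont:
  assumes "bs V" "cont_into V (f :: 'g => 'a)"
  shows "cont_into V (%h. f (g + h))" "cont_into V (%h. f (- g + h))" "cont_into V (%h. f (- h))"
    "cont_into V (%h. f (h + g))"
  by (rule cont_comp[OF assms(2)], intro tendsto_intros filterlim_ident)+

text \<open>This is left uniform continuity of f read in the supremum norm: f(y + h) and f(g + h)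
  differ by the left translation by y - g at the point g + h.\<close>

lemma translate_cont_Cb:
  assumes V: "bs V" and f: "cont_into V (f :: 'g => 'a)"
  shows "cont_into (Cb V) (%g h. f (g + h))"
  unfolding cont_into_def
proof (intro conjI allI impI)
  have t: "(%h. f (g + h)) \<in> carrier (Cb V)" for g using translate_cont(1)[OF assms] by (simp add: Cb_carrier[OF V])
  show "(%h. f (g + h)) \<in> carrier (Cb V)" for g by (rule t)
  fix g :: 'g and e :: real assume "e > 0"
  hence e: "e/2 > 0" by simp
  have 1: "eventually (%h. \<forall>x. dst V (f (h + x)) (f x) < e/2) (nhds 0)"
    using cont_luc[OF assms] e unfolding left_unif_cont_def by blast
  have "filterlim (%y. y + - g) (nhds (g + - g)) (nhds g)"
    by (rule tendsto_add[OF filterlim_ident tendsto_const])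
  hence 2: "filterlim (%y. y + - g) (nhds 0) (nhds g)" by simp
  have "eventually (%y. \<forall>x. dst V (f (y + - g + x)) (f x) < e/2) (nhds g)"
    by (rule eventually_compose_filterlim[OF 1 2])
  thus "eventually (%y. dst (Cb V) (%h. f (y + h)) (%h. f (g + h)) < e) (nhds g)"
  proof (rule eventually_mono)
    fix y assume y: "\<forall>x. dst V (f (y + - g + x)) (f x) < e/2"
    have "dst (Cb V) (%h. f (y + h)) (%h. f (g + h)) \<le> e/2"
    proof (rule Cb_nrm_le)
      fix h
      have "y + - g + (g + h) = y + h" by (simp only: add.assoc minus_add_cancel)
      hence "dst V (f (y + h)) (f (g + h)) < e/2" using spec[OF y, of "g + h"] by (simp only:)
      thus "nrm V (((%h. f (y + h)) \<ominus>\<^bsub>Cb V\<^esub> (%h. f (g + h))) h) \<le> e/2"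
        unfolding Cb_diff[OF V t t] by simp
    qed
    thus "dst (Cb V) (%h. f (y + h)) (%h. f (g + h)) < e" using \<open>e > 0\<close> by simp
  qed
qed

text \<open>The translates of f form a continuous family with norms at most that of f, so
  \<open>ev_surj\<close> yields a bounded map r with the required evaluations. As \<open>can\<close>
  is injective, the inverse image in the definition of the comultiplication is r f.\<close>

lemma comul_C: "\<Delta> \<in> bl_hom C CC" "f \<in> carrier C ==> can v c C (\<Delta> f) = (%g h. f (g + h))"
proof -
  let ?D = "%f g h. f (g + h)"
  have D: "?D f \<in> carrier (Cb C)" if "f \<in> carrier C" for f
    using that translate_cont_Cb[OF bs_base, of f] by (simp add: Cb_carrier[OF bs_C] Cb_carrier[OF bs_base])
  have t: "(%h. f (g + h)) \<in> carrier C" if "f \<in> carrier C" for f g using Cb_closed[OF bs_C D[OF that]] .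
  have "\<exists>r\<in>bl_hom C CC. \<forall>g. \<forall>x\<in>carrier C. ev C g (r x) = (%g h. x (g + h)) g"
  proof (rule ev_surj[OF small_C bs_C, where B=1])
    show "cont_into C (%g h. x (g + h))" if "x \<in> carrier C" for x using D[OF that] by (simp add: Cb_carrier[OF bs_C])
    show "nrm C (%h. x (g + h)) \<le> 1 * nrm C x" if "x \<in> carrier C" for g x
      by (rule Cb_nrm_le) (use Cb_nrm_ge[OF bs_base that] in simp)
  qed (use t in \<open>auto simp: Cb_simps\<close>)
  then obtain r where r: "r \<in> bl_hom C CC" "!!g x. x \<in> carrier C ==> ev C g (r x) = (%h. x (g + h))" by blast
  have cr: "can v c C (r f) = ?D f" if "f \<in> carrier C" for f
    using r(2)[OF that] ev_can[OF bl_closed[OF r(1) that]] by auto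
  have inj: "inj_on (can v c C) (carrier CC)"
  proof (rule inj_onI)
    fix x y assume xy: "x \<in> carrier CC" "y \<in> carrier CC" "can v c C x = can v c C y"
    show "x = y" by (rule ev_inj[OF small_C xy(1,2)]) (use xy in \<open>simp add: ev_can\<close>)
  qed
  have "\<Delta> f = r f" if "f \<in> carrier C" for f
    using inv_into_f_f[OF inj bl_closed[OF r(1) that]] that by (simp add: group_bialg_def Let_def cr)
  moreover have "\<Delta> f = undefined" if "f \<notin> carrier C" for f using that by (simp add: group_bialg_def Let_def)
  ultimately have "\<Delta> = r" using bl_undef[OF r(1)] by (metis ext)
  thus "\<Delta> \<in> bl_hom C CC" "f \<in> carrier C ==> can v c C (\<Delta> f) = (%g h. f (g + h))" using r(1) cr by auto
qed

lemma counit_C: "(\<lambda>f\<in>carrier C. f 0) \<in> bl_hom C (base_field v)"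
  by (rule Cb_eval[OF bs_base])

text \<open>Both sides are linear in s, and for s = x \<otimes> y both are x(g) y(h) w.\<close>

lemma ev_assoc:
  fixes V (structure) assumes V: "bs V" and s: "s \<in> carrier CC" and w: "w \<in> carrier V"
  shows "ev V h (ev (tC V) g (tens_assoc c C C V (elt c CC V s w))) = can v c C s g h \<odot> w"
proof (rule tens_ext_lin[OF bs_C bs_C V _ _ _ s])
  have B: "bs CC" "bs (tC V)" "bs (tensor c CC V)" "bs (tC (tC V))" "bs (Cb C)" using V by auto
  show "lin CC V (%s. ev V h (ev (tC V) g (tens_assoc c C C V (elt c CC V s w))))"
    by (rule lin_comp[OF _ bl_lin[OF ev_hom[OF V]] B(1,2)],
        rule lin_comp[OF _ bl_lin[OF ev_hom[OF B(2)]] B(1,4)],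
        rule lin_comp[OF lin_elt_left[OF B(1) V w] bl_lin[OF tens_assoc_hom[OF bs_C bs_C V]] B(1,3)])
  show "lin CC V (%s. can v c C s g h \<odot> w)"
    by (rule lin_comp[OF _ lin_smult_left[OF V w] B(1) bs_base],
        rule lin_comp[OF _ lin_eval[OF bs_base] B(1) bs_C],
        rule lin_comp[OF bl_lin[OF can_hom[OF bs_C]] lin_eval[OF bs_C] B(1,5)])
  fix x y assume xy: "x \<in> carrier C" "y \<in> carrier C"
  have "tens_assoc c C C V (elt c CC V (elt c C C x y) w) = elt c C (tC V) x (elt c C V y w)"
    by (rule tens_assoc_elt[OF bs_C bs_C V xy w])
  moreover have "elt c C V y w \<in> carrier (tC V)" by (rule elt_closed[OF bs_C V xy(2) w])
  ultimately show "ev V h (ev (tC V) g (tens_assoc c C C V (elt c CC V (elt c C C x y) w)))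
      = can v c C (elt c C C x y) g h \<odot> w"
    using xy w V by (simp add: ev_elt can_elt[OF bs_C] bl_smult[OF ev_hom[OF V]] bs_smult Cb_simps)
qed

text \<open>On f \<otimes> w both sides equal f(g + h) w. The outer factor C is evaluated first, at
  g, and the one left over at h; in this order coassociativity reads as the law of a right
  action.\<close>

lemma ev_coassoc:
  assumes V: "bs V" and t: "t \<in> carrier (tC V)"
  shows "ev V h (ev (tC V) g (tens_assoc c C C V (tens_map c C CC V V \<Delta> (ban_id V) t))) = ev V (g + h) t"
proof (rule tens_ext_lin[OF bs_C V V _ _ _ t])
  have B: "bs CC" "bs (tC V)" "bs (tensor c CC V)" "bs (tC (tC V))" using V by auto
  note m = tens_map_hom[OF bs_C V B(1) V comul_C(1) bl_id[OF V]]
  show "lin (tC V) V (%t. ev V h (ev (tC V) g (tens_assoc c C C V (tens_map c C CC V V \<Delta> (ban_id V) t))))"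
    by (rule lin_comp[OF _ bl_lin[OF ev_hom[OF V]] B(2,2)],
        rule lin_comp[OF _ bl_lin[OF ev_hom[OF B(2)]] B(2,4)],
        rule lin_comp[OF bl_lin[OF m] bl_lin[OF tens_assoc_hom[OF bs_C bs_C V]] B(2,3)])
  show "lin (tC V) V (ev V (g + h))" by (rule bl_lin[OF ev_hom[OF V]])
  fix f w assume fw: "f \<in> carrier C" "w \<in> carrier V"
  show "ev V h (ev (tC V) g (tens_assoc c C C V (tens_map c C CC V V \<Delta> (ban_id V) (elt c C V f w))))
    = ev V (g + h) (elt c C V f w)"
    unfolding tens_map_elt[OF bs_C V B(1) V comul_C(1) bl_id[OF V] fw] ban_id_apply[OF fw(2)]
      ev_assoc[OF V bl_closed[OF comul_C(1) fw(1)] fw(2)] comul_C(2)[OF fw(1)] ev_elt[OF V fw] ..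
qed

lemma ev_counit:
  assumes V: "bs V" and t: "t \<in> carrier (tC V)"
  shows "tens_lunit v c V (tens_map c C (base_field v) V V (\<lambda>f\<in>carrier C. f 0) (ban_id V) t) = ev V 0 t"
proof (rule tens_ext_lin[OF bs_C V V _ _ _ t])
  have B: "bs (tC V)" "bs (tensor c (base_field v) V)" using V by auto
  note m = tens_map_hom[OF bs_C V bs_base V counit_C bl_id[OF V]]
  show "lin (tC V) V (%t. tens_lunit v c V (tens_map c C (base_field v) V V (\<lambda>f\<in>carrier C. f 0) (ban_id V) t))"
    by (rule lin_comp[OF bl_lin[OF m] bl_lin[OF tens_lunit_hom[OF V]] B])
  show "lin (tC V) V (ev V 0)" by (rule bl_lin[OF ev_hom[OF V]])
  fix f w assume fw: "f \<in> carrier C" "w \<in> carrier V"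
  show "tens_lunit v c V (tens_map c C (base_field v) V V (\<lambda>f\<in>carrier C. f 0) (ban_id V) (elt c C V f w))
    = ev V 0 (elt c C V f w)"
    unfolding tens_map_elt[OF bs_C V bs_base V counit_C bl_id[OF V] fw] ban_id_apply[OF fw(2)]
      tens_lunit_elt[OF V fw(2)] ev_elt[OF V fw] using fw by simp
qed

lemma ev_runit:
  assumes t: "t \<in> carrier CC"
  shows "tens_runit v c C (tens_map c C C C (base_field v) (ban_id C) (\<lambda>f\<in>carrier C. f 0) t) = (%g. can v c C t g 0)"
proof (rule ext, rule tens_ext_lin[OF bs_C bs_C bs_base _ _ _ t])
  fix g
  have B: "bs CC" "bs (tC (base_field v))" "bs (Cb C)" by auto
  note m = tens_map_hom[OF bs_C bs_C bs_C bs_base bl_id[OF bs_C] counit_C]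
  show "lin CC (base_field v) (%t. tens_runit v c C (tens_map c C C C (base_field v) (ban_id C) (\<lambda>f\<in>carrier C. f 0) t) g)"
    by (rule lin_comp[OF _ lin_eval[OF bs_base] B(1) bs_C],
        rule lin_comp[OF bl_lin[OF m] bl_lin[OF tens_runit_hom[OF bs_C]] B(1,2)])
  show "lin CC (base_field v) (%t. can v c C t g 0)"
    by (rule lin_comp[OF _ lin_eval[OF bs_base] B(1) bs_C],
        rule lin_comp[OF bl_lin[OF can_hom[OF bs_C]] lin_eval[OF bs_C] B(1,3)])
  fix f w assume fw: "f \<in> carrier C" "w \<in> carrier C"
  show "tens_runit v c C (tens_map c C C C (base_field v) (ban_id C) (\<lambda>f\<in>carrier C. f 0) (elt c C C f w)) g
    = can v c C (elt c C C f w) g 0"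
    unfolding tens_map_elt[OF bs_C bs_C bs_C bs_base bl_id[OF bs_C] counit_C fw] ban_id_apply[OF fw(1)]
      tens_runit_elt[OF bs_C fw(1)] can_elt[OF bs_C fw] using fw by (simp add: Cb_simps mult.commute)
qed

text \<open>Multiplication in C \<otimes> C is pointwise multiplication of functions of two
  variables. The identity is bilinear in s and t and is extended from elementary tensors first in s,
  then in t.\<close>

lemma can_mult_mult:
  assumes s: "s \<in> carrier CC" and t: "t \<in> carrier CC"
  shows "can v c C (tens_map c CC C CC C mult_C mult_C (tens_swap_mid c C (elt c CC CC s t))) g h
    = can v c C s g h * can v c C t g h"
proof -
  have B: "bs CC" "bs (tensor c CC CC)" "bs (Cb C)" by auto
  note m = tens_map_hom[OF B(1) B(1) bs_C bs_C mult_C(1) mult_C(1)]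
  have lc: "lin CC (base_field v) (%t. can v c C t g h)"
    by (rule lin_comp[OF _ lin_eval[OF bs_base] B(1) bs_C],
        rule lin_comp[OF bl_lin[OF can_hom[OF bs_C]] lin_eval[OF bs_C] B(1,3)])
  have lz: "lin (tensor c CC CC) (base_field v) (%z. can v c C (tens_map c CC C CC C mult_C mult_C (tens_swap_mid c C z)) g h)"
    by (rule lin_comp[OF _ lc B(2,1)], rule lin_comp[OF bl_lin[OF tens_swap_mid_hom[OF bs_C]] bl_lin[OF m] B(2,2)])
  have scale: "lin (base_field v) (base_field v) (%x. x * a)" "lin (base_field v) (base_field v) (%x. a * x)" for a
    using lin_smult_left[OF bs_base, of a] by (simp_all add: mult.commute)
  have 1: "can v c C (tens_map c CC C CC C mult_C mult_C (tens_swap_mid c C (elt c CC CC s (elt c C C x y)))) g h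
      = can v c C s g h * can v c C (elt c C C x y) g h" if xy: "x \<in> carrier C" "y \<in> carrier C" for x y
  proof (rule tens_ext_lin[OF bs_C bs_C bs_base _ _ _ s])
    have e: "elt c C C x y \<in> carrier CC" using xy by simp
    show "lin CC (base_field v) (%s. can v c C (tens_map c CC C CC C mult_C mult_C
        (tens_swap_mid c C (elt c CC CC s (elt c C C x y)))) g h)"
      by (rule lin_comp[OF lin_elt_left[OF B(1,1) e] lz B(1,2)])
    show "lin CC (base_field v) (%s. can v c C s g h * can v c C (elt c C C x y) g h)"
      by (rule lin_comp[OF lc scale(1) B(1) bs_base])
    fix x' y' assume xy': "x' \<in> carrier C" "y' \<in> carrier C"
    have p: "(%g. x' g * x g) \<in> carrier C" "(%g. y' g * y g) \<in> carrier C" using xy xy' mult_C(3) by auto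
    have "tens_map c CC C CC C mult_C mult_C (tens_swap_mid c C (elt c CC CC (elt c C C x' y') (elt c C C x y)))
      = elt c C C (%g. x' g * x g) (%g. y' g * y g)"
      unfolding tens_swap_mid_elt[OF bs_C xy' xy]
      using tens_map_elt[OF B(1) B(1) bs_C bs_C mult_C(1) mult_C(1), of "elt c C C x' x" "elt c C C y' y"] xy xy'
      by (simp add: mult_C(2))
    thus "can v c C (tens_map c CC C CC C mult_C mult_C (tens_swap_mid c C (elt c CC CC (elt c C C x' y') (elt c C C x y)))) g h
      = can v c C (elt c C C x' y') g h * can v c C (elt c C C x y) g h"
      using can_elt[OF bs_C p] can_elt[OF bs_C xy] can_elt[OF bs_C xy'] by (simp add: Cb_simps algebra_simps)
  qed
  show ?thesis
  proof (rule tens_ext_lin[OF bs_C bs_C bs_base _ _ _ t])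
    show "lin CC (base_field v) (%t. can v c C (tens_map c CC C CC C mult_C mult_C (tens_swap_mid c C (elt c CC CC s t))) g h)"
      by (rule lin_comp[OF lin_elt_right[OF B(1,1) s] lz B(1,2)])
    show "lin CC (base_field v) (%t. can v c C s g h * can v c C t g h)"
      by (rule lin_comp[OF lc scale(2) B(1) bs_base])
  qed (rule 1)
qed

lemma CC_eqI: "s \<in> carrier CC ==> t \<in> carrier CC ==> can v c C s = can v c C t ==> s = t"
  by (rule ev_inj[OF small_C]) (simp_all add: ev_can)

text \<open>Maps out of tensor products are compared on elementary tensors, elements of tensor
  products by their evaluations. The facts \<open>1\<close> to \<open>10\<close> follow the order of
  the clauses in \<open>is_bialgebra\<close>.\<close>

theorem group_bialgebra: "is_bialgebra v c (group_bialg v c :: ('k, 'g => 'k) bialg)"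
proof -
  let ?k = "base_field v" and ?i = "ban_id C" and ?u = "%a (g::'g). a" and ?e = "\<lambda>f\<in>carrier C. f (0::'g)"
  let ?kA = "tensor c ?k C" and ?Ak = "tC ?k" and ?TA = "tensor c CC C" and ?AT = "tC CC"
  let ?TT = "tensor c CC CC" and ?kk = "tensor c ?k ?k"
  have B: "bs CC" "bs ?kA" "bs ?Ak" "bs ?TA" "bs ?AT" "bs ?TT" "bs ?kk" by auto
  note i = bl_id[OF bs_C]
  note m = mult_C(1) and me = mult_C(2) and mc = mult_C(3) and u = unit_C and D = comul_C(1) and e = counit_C
  note mi = tens_map[OF B(1) bs_C bs_C bs_C m i] and im = tens_map[OF bs_C B(1) bs_C bs_C i m]
  note ui = tens_map[OF bs_base bs_C bs_C bs_C u i] and iu = tens_map[OF bs_C bs_base bs_C bs_C i u]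
  note iD = tens_map_hom[OF bs_C bs_C bs_C B(1) i D] and Di = tens_map_hom[OF bs_C bs_C B(1) bs_C D i]
  note ee = tens_map[OF bs_C bs_C bs_base bs_base e e]
  note DD = tens_map[OF bs_C bs_C B(1) B(1) D D] and mm = tens_map_hom[OF B(1) B(1) bs_C bs_C m m]
  note as = tens_assoc_hom[OF bs_C bs_C bs_C]
  have el: "elt c C C x y \<in> carrier CC" if "x \<in> carrier C" "y \<in> carrier C" for x y using that by simp
  have 1: "compose (carrier ?TA) mult_C (tens_map c CC C C C mult_C ?i)
      = compose (carrier ?TA) mult_C (compose (carrier ?TA) (tens_map c C C CC C ?i mult_C) (tens_assoc c C C C))"
  proof (rule compose_cong)
    fix t assume t: "t \<in> carrier ?TA"
    have "mult_C (tens_map c CC C C C mult_C ?i t) = mult_C (tens_map c C C CC C ?i mult_C (tens_assoc c C C C t))"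
    proof (rule tens_ext_lin_l[OF bs_C bs_C bs_C bs_C _ _ _ t])
      show "lin ?TA C (%t. mult_C (tens_map c CC C C C mult_C ?i t))"
        by (rule lin_comp[OF bl_lin[OF mi(1)] bl_lin[OF m] B(4,1)])
      show "lin ?TA C (%t. mult_C (tens_map c C C CC C ?i mult_C (tens_assoc c C C C t)))"
        by (rule lin_comp[OF _ bl_lin[OF m] B(4,1)], rule lin_comp[OF bl_lin[OF as] bl_lin[OF im(1)] B(4,5)])
      fix x y z assume x: "x \<in> carrier C" "y \<in> carrier C" "z \<in> carrier C"
      show "mult_C (tens_map c CC C C C mult_C ?i (elt c CC C (elt c C C x y) z)) =
         mult_C (tens_map c C C CC C ?i mult_C (tens_assoc c C C C (elt c CC C (elt c C C x y) z)))"
        unfolding mi(2)[OF el[OF x(1,2)] x(3)] tens_assoc_elt[OF bs_C bs_C bs_C x] im(2)[OF x(1) el[OF x(2,3)]]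
          ban_id_apply[OF x(1)] ban_id_apply[OF x(3)] me[OF x(1,2)] me[OF x(2,3)]
          me[OF mc[OF x(1,2)] x(3)] me[OF x(1) mc[OF x(2,3)]] by (simp add: mult.assoc)
    qed
    thus "mult_C (tens_map c CC C C C mult_C ?i t)
      = mult_C (compose (carrier ?TA) (tens_map c C C CC C ?i mult_C) (tens_assoc c C C C) t)"
      using t by (simp add: compose_eq)
  qed
  have 2: "compose (carrier ?kA) mult_C (tens_map c ?k C C C ?u ?i) = tens_lunit v c C"
  proof (rule bl_ext[OF bl_comp[OF ui(1) m B(2,1)] tens_lunit_hom[OF bs_C]])
    fix t assume t: "t \<in> carrier ?kA"
    have "mult_C (tens_map c ?k C C C ?u ?i t) = tens_lunit v c C t"
    proof (rule tens_ext_lin[OF bs_base bs_C bs_C _ _ _ t])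
      show "lin ?kA C (%t. mult_C (tens_map c ?k C C C ?u ?i t))"
        by (rule lin_comp[OF bl_lin[OF ui(1)] bl_lin[OF m] B(2,1)])
      show "lin ?kA C (tens_lunit v c C)" by (rule bl_lin[OF tens_lunit_hom[OF bs_C]])
      fix a x assume x: "a \<in> carrier ?k" "x \<in> carrier C"
      show "mult_C (tens_map c ?k C C C ?u ?i (elt c ?k C a x)) = tens_lunit v c C (elt c ?k C a x)"
        unfolding ui(2)[OF x] ban_id_apply[OF x(2)] me[OF const_C x(2)] tens_lunit_elt[OF bs_C x(2)]
        by (simp add: Cb_simps)
    qed
    thus "compose (carrier ?kA) mult_C (tens_map c ?k C C C ?u ?i) t = tens_lunit v c C t"
      using t by (simp add: compose_eq)
  qed
  have 3: "compose (carrier ?Ak) mult_C (tens_map c C C ?k C ?i ?u) = tens_runit v c C"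
  proof (rule bl_ext[OF bl_comp[OF iu(1) m B(3,1)] tens_runit_hom[OF bs_C]])
    fix t assume t: "t \<in> carrier ?Ak"
    have "mult_C (tens_map c C C ?k C ?i ?u t) = tens_runit v c C t"
    proof (rule tens_ext_lin[OF bs_C bs_base bs_C _ _ _ t])
      show "lin ?Ak C (%t. mult_C (tens_map c C C ?k C ?i ?u t))"
        by (rule lin_comp[OF bl_lin[OF iu(1)] bl_lin[OF m] B(3,1)])
      show "lin ?Ak C (tens_runit v c C)" by (rule bl_lin[OF tens_runit_hom[OF bs_C]])
      fix x a assume x: "x \<in> carrier C" "a \<in> carrier ?k"
      show "mult_C (tens_map c C C ?k C ?i ?u (elt c C ?k x a)) = tens_runit v c C (elt c C ?k x a)"
        unfolding iu(2)[OF x] ban_id_apply[OF x(1)] me[OF x(1) const_C] tens_runit_elt[OF bs_C x(1)]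
        by (simp add: Cb_simps mult.commute)
    qed
    thus "compose (carrier ?Ak) mult_C (tens_map c C C ?k C ?i ?u) t = tens_runit v c C t"
      using t by (simp add: compose_eq)
  qed
  have 4: "compose (carrier C) (tens_map c C C C CC ?i \<Delta>) \<Delta>
      = compose (carrier C) (tens_assoc c C C C) (compose (carrier C) (tens_map c C CC C C \<Delta> ?i) \<Delta>)"
  proof (rule compose_cong)
    fix f assume f: "f \<in> carrier C"
    have Df: "\<Delta> f \<in> carrier CC" by (rule bl_closed[OF D f])
    \<comment> \<open>Two evaluations separate the elements of C \<otimes> (C \<otimes> C); at g and
      then at h both sides become the evaluation of \<Delta> f at g + h.\<close>
    have "tens_map c C C C CC ?i \<Delta> (\<Delta> f) = tens_assoc c C C C (tens_map c C CC C C \<Delta> ?i (\<Delta> f))"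
    proof (rule ev_inj[OF small_tensor[OF small_C]])
      show a: "tens_map c C C C CC ?i \<Delta> (\<Delta> f) \<in> carrier ?AT" by (rule bl_closed[OF iD Df])
      show b: "tens_assoc c C C C (tens_map c C CC C C \<Delta> ?i (\<Delta> f)) \<in> carrier ?AT"
        by (rule bl_closed[OF as bl_closed[OF Di Df]])
      fix g
      show "ev CC g (tens_map c C C C CC ?i \<Delta> (\<Delta> f)) = ev CC g (tens_assoc c C C C (tens_map c C CC C C \<Delta> ?i (\<Delta> f)))"
      proof (rule ev_inj[OF small_C ev_closed[OF B(1) a] ev_closed[OF B(1) b]])
        fix h
        have t: "ev C g (\<Delta> f) \<in> carrier C" by (rule ev_closed[OF bs_C Df])
        have "ev C h (ev CC g (tens_map c C C C CC ?i \<Delta> (\<Delta> f))) = ev C h (\<Delta> (ev C g (\<Delta> f)))"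
          by (simp only: ev_natural[OF bs_C B(1) D Df])
        also have "\<dots> = ev C (g + h) (\<Delta> f)"
          using ev_can[OF bl_closed[OF D t], of h] comul_C(2)[OF t] ev_can[OF Df] comul_C(2)[OF f]
          by (simp add: add.assoc)
        finally show "ev C h (ev CC g (tens_map c C C C CC ?i \<Delta> (\<Delta> f)))
            = ev C h (ev CC g (tens_assoc c C C C (tens_map c C CC C C \<Delta> ?i (\<Delta> f))))"
          by (simp only: ev_coassoc[OF bs_C Df])
      qed
    qed
    thus "tens_map c C C C CC ?i \<Delta> (\<Delta> f) = tens_assoc c C C C (compose (carrier C) (tens_map c C CC C C \<Delta> ?i) \<Delta> f)"
      using f by (simp add: compose_eq)
  qed
  have 5: "compose (carrier C) (tens_lunit v c C) (compose (carrier C) (tens_map c C ?k C C ?e ?i) \<Delta>) = ?i"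
    unfolding ban_id_def[of C]
  proof (rule extensionalityI[of _ "carrier C"])
    fix f assume f: "f \<in> carrier C"
    have Df: "\<Delta> f \<in> carrier CC" by (rule bl_closed[OF D f])
    show "compose (carrier C) (tens_lunit v c C) (compose (carrier C) (tens_map c C ?k C C ?e (\<lambda>x\<in>carrier C. x)) \<Delta>) f
        = (\<lambda>x\<in>carrier C. x) f"
      using f ev_counit[OF bs_C Df] ev_can[OF Df] comul_C(2)[OF f] by (simp add: compose_eq ban_id_def)
  qed auto
  have 6: "compose (carrier C) (tens_runit v c C) (compose (carrier C) (tens_map c C C C ?k ?i ?e) \<Delta>) = ?i"
    unfolding ban_id_def[of C]
  proof (rule extensionalityI[of _ "carrier C"])
    fix f assume f: "f \<in> carrier C"
    have Df: "\<Delta> f \<in> carrier CC" by (rule bl_closed[OF D f])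
    show "compose (carrier C) (tens_runit v c C) (compose (carrier C) (tens_map c C C C ?k (\<lambda>x\<in>carrier C. x) ?e) \<Delta>) f
        = (\<lambda>x\<in>carrier C. x) f"
      using f ev_runit[OF Df] comul_C(2)[OF f] by (simp add: compose_eq ban_id_def)
  qed auto
  have 7: "compose (carrier CC) \<Delta> mult_C
     = compose (carrier CC) (tens_map c CC C CC C mult_C mult_C)
         (compose (carrier CC) (tens_swap_mid c C) (tens_map c C CC C CC \<Delta> \<Delta>))"
  proof (rule compose_cong)
    fix t assume t: "t \<in> carrier CC"
    note sw = tens_swap_mid_hom[OF bs_C]
    have "\<Delta> (mult_C t) = tens_map c CC C CC C mult_C mult_C (tens_swap_mid c C (tens_map c C CC C CC \<Delta> \<Delta> t))"
    proof (rule tens_ext_lin[OF bs_C bs_C B(1) _ _ _ t])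
      show "lin CC CC (%t. \<Delta> (mult_C t))" by (rule lin_comp[OF bl_lin[OF m] bl_lin[OF D] B(1) bs_C])
      show "lin CC CC (%t. tens_map c CC C CC C mult_C mult_C (tens_swap_mid c C (tens_map c C CC C CC \<Delta> \<Delta> t)))"
        by (rule lin_comp[OF _ bl_lin[OF mm] B(1,6)], rule lin_comp[OF bl_lin[OF DD(1)] bl_lin[OF sw] B(1,6)])
      fix x y assume x: "x \<in> carrier C" "y \<in> carrier C"
      have Dx: "\<Delta> x \<in> carrier CC" "\<Delta> y \<in> carrier CC" using x bl_closed[OF D] by auto
      show "\<Delta> (mult_C (elt c C C x y)) = tens_map c CC C CC C mult_C mult_C
         (tens_swap_mid c C (tens_map c C CC C CC \<Delta> \<Delta> (elt c C C x y)))"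
        unfolding DD(2)[OF x] me[OF x]
      proof (rule CC_eqI)
        show "\<Delta> (%g. x g * y g) \<in> carrier CC" by (rule bl_closed[OF D mc[OF x]])
        show "tens_map c CC C CC C mult_C mult_C (tens_swap_mid c C (elt c CC CC (\<Delta> x) (\<Delta> y))) \<in> carrier CC"
          by (rule bl_closed[OF mm bl_closed[OF sw elt_closed[OF B(1,1) Dx]]])
        show "can v c C (\<Delta> (%g. x g * y g))
          = can v c C (tens_map c CC C CC C mult_C mult_C (tens_swap_mid c C (elt c CC CC (\<Delta> x) (\<Delta> y))))"
          by (intro ext) (simp add: can_mult_mult[OF Dx] comul_C(2) x mc[OF x])
      qed
    qed
    thus "\<Delta> (mult_C t) = tens_map c CC C CC C mult_C mult_C
         (compose (carrier CC) (tens_swap_mid c C) (tens_map c C CC C CC \<Delta> \<Delta>) t)" using t by (simp add: compose_eq)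
  qed
  have 8: "\<Delta> (?u a) = elt c C C (?u a) (?u 1)" for a
    by (rule CC_eqI[OF bl_closed[OF D const_C] el[OF const_C const_C]])
      (simp add: comul_C(2)[OF const_C] can_elt[OF bs_C const_C const_C] Cb_simps)
  have 9: "compose (carrier CC) ?e mult_C = compose (carrier CC) (tens_lunit v c ?k) (tens_map c C ?k C ?k ?e ?e)"
  proof (rule compose_cong)
    fix t assume t: "t \<in> carrier CC"
    show "?e (mult_C t) = tens_lunit v c ?k (tens_map c C ?k C ?k ?e ?e t)"
    proof (rule tens_ext_lin[OF bs_C bs_C bs_base _ _ _ t])
      show "lin CC ?k (%t. ?e (mult_C t))" by (rule lin_comp[OF bl_lin[OF m] bl_lin[OF e] B(1) bs_C])
      show "lin CC ?k (%t. tens_lunit v c ?k (tens_map c C ?k C ?k ?e ?e t))"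
        by (rule lin_comp[OF bl_lin[OF ee(1)] bl_lin[OF tens_lunit_hom[OF bs_base]] B(1,7)])
      fix x y assume x: "x \<in> carrier C" "y \<in> carrier C"
      have "?e y \<in> carrier ?k" by simp
      from tens_lunit_elt[OF bs_base this, of "?e x"]
      show "?e (mult_C (elt c C C x y)) = tens_lunit v c ?k (tens_map c C ?k C ?k ?e ?e (elt c C C x y))"
        unfolding ee(2)[OF x] me[OF x] using x mc[OF x] by simp
    qed
  qed
  have 10: "compose UNIV ?e ?u = ban_id ?k"
    using const_C by (simp add: compose_def ban_id_def fun_eq_iff)
  show ?thesis
    unfolding is_bialgebra_def Let_def gb_simps
    using 1 2 3 4 5 6 7 8 9 10 m u D e by simp
qed

end

section \<open>Morphisms of ind-objects\<close>

text \<open>Agreement of two families of elements of \<open>colim Y\<close> at one stage for all parameters in \<open>P\<close>;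
  equality of germs is the case where \<open>P\<close> is the source.\<close>

definition geq :: "('j, 'n, 'k, 'b) ind => 'p set => 'j => ('p => 'b) => 'j => ('p => 'b) => bool" where
  "geq Y P j f j' f' \<longleftrightarrow> (\<exists>l\<in>idx Y. \<exists>a\<in>arr Y j l. \<exists>b\<in>arr Y j' l. \<forall>x\<in>P. trn Y j l a (f x) = trn Y j' l b (f' x))"

lemma geqI: "l \<in> idx Y ==> a \<in> arr Y j l ==> b \<in> arr Y j' l ==>
    (!!x. x \<in> P ==> trn Y j l a (f x) = trn Y j' l b (f' x)) ==> geq Y P j f j' f'"
  unfolding geq_def by blast

lemma geqE:
  assumes "geq Y P j f j' f'"
  obtains l a b where "l \<in> idx Y" "a \<in> arr Y j l" "b \<in> arr Y j' l"
    "!!x. x \<in> P ==> trn Y j l a (f x) = trn Y j' l b (f' x)"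
  using assms unfolding geq_def by blast

lemma geq_sym: "geq Y P j f j' f' ==> geq Y P j' f' j f"
  unfolding geq_def by metis

lemma geq_cong: "geq Y P j f j' f' ==> (!!x. x \<in> P ==> f x = h x) ==> (!!x. x \<in> P ==> f' x = h' x) ==> geq Y P j h j' h'"
  unfolding geq_def by metis

lemma geq_pre: "geq Y P j f j' f' ==> (!!x. x \<in> Q ==> k x \<in> P) ==> geq Y Q j (%x. f (k x)) j' (%x. f' (k x))"
  unfolding geq_def by metis

lemma compose_eq_iff: "compose A g f = compose A g' f' \<longleftrightarrow> (\<forall>x\<in>A. g (f x) = g' (f' x))"
  by (auto simp: compose_def fun_eq_iff)

lemma germ_iff: "(j', f') \<in> germ A Y j f \<longleftrightarrow> j' \<in> idx Y \<and> f' \<in> bl_hom A (at_idx Y j') \<and> geq Y (carrier A) j f j' f'"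
  unfolding germ_def geq_def compose_eq_iff by blast

context valued
begin

abbreviation "isind \<equiv> is_ind v c"

lemma indD:
  assumes "isind Y"
  shows ind_cat: "is_category (shape Y)" and ind_filt: "filtered (shape Y)"
    and ind_bs: "j \<in> idx Y ==> bs (at_idx Y j)"
    and ind_trn: "j \<in> idx Y ==> l \<in> idx Y ==> a \<in> arr Y j l ==> trn Y j l a \<in> bl_hom (at_idx Y j) (at_idx Y l)"
    and ind_trn_id: "j \<in> idx Y ==> x \<in> elts Y j ==> trn Y j j (Idm (shape Y) j) x = x"
    and ind_trn_comp: "i \<in> idx Y ==> j \<in> idx Y ==> l \<in> idx Y ==> a \<in> arr Y i j ==> b \<in> arr Y j l ==> x \<in> elts Y i ==>
      trn Y i l (Cmp (shape Y) i j l b a) x = trn Y j l b (trn Y i j a x)"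
    and ind_id_arr: "j \<in> idx Y ==> Idm (shape Y) j \<in> arr Y j j"
    and ind_comp_arr: "i \<in> idx Y ==> j \<in> idx Y ==> l \<in> idx Y ==> a \<in> arr Y i j ==> b \<in> arr Y j l ==> Cmp (shape Y) i j l b a \<in> arr Y i l"
    and ind_ne: "idx Y \<noteq> {}"
    and ind_span: "i \<in> idx Y ==> j \<in> idx Y ==> \<exists>l\<in>idx Y. arr Y i l \<noteq> {} \<and> arr Y j l \<noteq> {}"
    and ind_coeq: "i \<in> idx Y ==> j \<in> idx Y ==> a \<in> arr Y i j ==> b \<in> arr Y i j ==>
      \<exists>l\<in>idx Y. \<exists>h\<in>arr Y j l. Cmp (shape Y) i j l h a = Cmp (shape Y) i j l h b"
proof -
  show f: "filtered (shape Y)" using assms by (simp add: is_ind_def)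
  show cat: "is_category (shape Y)" using f by (simp add: filtered_def)
  have F: "is_functor (shape Y) (ban_cat v c) (diag Y)" using assms by (simp add: is_ind_def)
  show "j \<in> idx Y ==> bs (at_idx Y j)" using F unfolding is_functor_def ban_cat_def by simp
  show "j \<in> idx Y ==> l \<in> idx Y ==> a \<in> arr Y j l ==> trn Y j l a \<in> bl_hom (at_idx Y j) (at_idx Y l)"
    using F unfolding is_functor_def ban_cat_def by simp
  show "j \<in> idx Y ==> x \<in> elts Y j ==> trn Y j j (Idm (shape Y) j) x = x"
    using F unfolding is_functor_def ban_cat_def by simp
  show "trn Y i l (Cmp (shape Y) i j l b a) x = trn Y j l b (trn Y i j a x)"
    if "i \<in> idx Y" "j \<in> idx Y" "l \<in> idx Y" "a \<in> arr Y i j" "b \<in> arr Y j l" "x \<in> elts Y i"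
  proof -
    have "trn Y i l (Cmp (shape Y) i j l b a) = compose (elts Y i) (trn Y j l b) (trn Y i j a)"
      using F that unfolding is_functor_def ban_cat_def by simp
    thus ?thesis using that by (simp add: compose_eq)
  qed
  show "j \<in> idx Y ==> Idm (shape Y) j \<in> arr Y j j"
    "i \<in> idx Y ==> j \<in> idx Y ==> l \<in> idx Y ==> a \<in> arr Y i j ==> b \<in> arr Y j l ==> Cmp (shape Y) i j l b a \<in> arr Y i l"
    using cat unfolding is_category_def by blast+
  show "idx Y \<noteq> {}" "i \<in> idx Y ==> j \<in> idx Y ==> \<exists>l\<in>idx Y. arr Y i l \<noteq> {} \<and> arr Y j l \<noteq> {}"
    "i \<in> idx Y ==> j \<in> idx Y ==> a \<in> arr Y i j ==> b \<in> arr Y i j ==>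
      \<exists>l\<in>idx Y. \<exists>h\<in>arr Y j l. Cmp (shape Y) i j l h a = Cmp (shape Y) i j l h b"
    using f unfolding filtered_def by blast+
qed

lemma ind_trn_closed: "isind Y ==> j \<in> idx Y ==> l \<in> idx Y ==> a \<in> arr Y j l ==> x \<in> elts Y j ==>
    trn Y j l a x \<in> elts Y l"
  by (rule bl_closed[OF ind_trn])

text \<open>Choose a common target m of j and k, then an arrow out of m that equalises the two
  composites from i.\<close>

lemma ind_amalg:
  assumes Y: "isind Y" and "i \<in> idx Y" "j \<in> idx Y" "k \<in> idx Y" "a \<in> arr Y i j" "b \<in> arr Y i k"
  shows "\<exists>l\<in>idx Y. \<exists>p\<in>arr Y j l. \<exists>q\<in>arr Y k l. \<forall>x\<in>elts Y i. trn Y j l p (trn Y i j a x) = trn Y k l q (trn Y i k b x)"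
proof -
  obtain m p q where m: "m \<in> idx Y" "p \<in> arr Y j m" "q \<in> arr Y k m" using ind_span[OF Y assms(3,4)] by blast
  have 1: "Cmp (shape Y) i j m p a \<in> arr Y i m" "Cmp (shape Y) i k m q b \<in> arr Y i m"
    using ind_comp_arr[OF Y] assms m by auto
  obtain l h where l: "l \<in> idx Y" "h \<in> arr Y m l"
    and e: "Cmp (shape Y) i m l h (Cmp (shape Y) i j m p a) = Cmp (shape Y) i m l h (Cmp (shape Y) i k m q b)"
    using ind_coeq[OF Y assms(2) m(1) 1] by blast
  have pq: "Cmp (shape Y) j m l h p \<in> arr Y j l" "Cmp (shape Y) k m l h q \<in> arr Y k l"
    using ind_comp_arr[OF Y] assms m l by auto
  have "trn Y j l (Cmp (shape Y) j m l h p) (trn Y i j a x) = trn Y k l (Cmp (shape Y) k m l h q) (trn Y i k b x)"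
    if x: "x \<in> elts Y i" for x
  proof -
    have "trn Y j l (Cmp (shape Y) j m l h p) (trn Y i j a x) = trn Y m l h (trn Y j m p (trn Y i j a x))"
      by (rule ind_trn_comp[OF Y assms(3) m(1) l(1) m(2) l(2)]) (rule ind_trn_closed[OF Y assms(2,3,5) x])
    also have "\<dots> = trn Y i l (Cmp (shape Y) i m l h (Cmp (shape Y) i j m p a)) x"
      using ind_trn_comp[OF Y assms(2,3) m(1) assms(5) m(2) x] ind_trn_comp[OF Y assms(2) m(1) l(1) 1(1) l(2) x] by simp
    also have "\<dots> = trn Y m l h (trn Y k m q (trn Y i k b x))" unfolding e
      using ind_trn_comp[OF Y assms(2,4) m(1) assms(6) m(3) x] ind_trn_comp[OF Y assms(2) m(1) l(1) 1(2) l(2) x] by simp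
    also have "\<dots> = trn Y k l (Cmp (shape Y) k m l h q) (trn Y i k b x)"
      by (rule ind_trn_comp[OF Y assms(4) m(1) l(1) m(3) l(2), symmetric]) (rule ind_trn_closed[OF Y assms(2,4,6) x])
    finally show ?thesis .
  qed
  thus ?thesis using l(1) pq by blast
qed

lemma geq_refl: "isind Y ==> j \<in> idx Y ==> geq Y P j f j f"
  using ind_id_arr[of Y j] unfolding geq_def by blast

lemma geq_trn:
  assumes Y: "isind Y" and "j \<in> idx Y" "l \<in> idx Y" "a \<in> arr Y j l" "!!x. x \<in> P ==> f x \<in> elts Y j"
  shows "geq Y P j f l (%x. trn Y j l a (f x))"
proof (rule geqI[OF assms(3,4) ind_id_arr[OF Y assms(3)]])
  fix x assume x: "x \<in> P"
  show "trn Y j l a (f x) = trn Y l l (Idm (shape Y) l) (trn Y j l a (f x))"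
    by (rule ind_trn_id[OF Y assms(3) ind_trn_closed[OF Y assms(2,3,4) assms(5)[OF x]], symmetric])
qed

text \<open>The stages of the two agreements both receive arrows from the middle index j', so
  \<open>ind_amalg\<close> joins them over it.\<close>

lemma geq_trans:
  assumes Y: "isind Y" and j: "j \<in> idx Y" "j' \<in> idx Y" "j'' \<in> idx Y"
    and c: "!!x. x \<in> P ==> f x \<in> elts Y j" "!!x. x \<in> P ==> f' x \<in> elts Y j'"
      "!!x. x \<in> P ==> f'' x \<in> elts Y j''"
    and g: "geq Y P j f j' f'" "geq Y P j' f' j'' f''"
  shows "geq Y P j f j'' f''"
proof -
  obtain l a b where l: "l \<in> idx Y" "a \<in> arr Y j l" "b \<in> arr Y j' l"
    "!!x. x \<in> P ==> trn Y j l a (f x) = trn Y j' l b (f' x)" by (rule geqE[OF g(1)]) blast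
  obtain m p q where m: "m \<in> idx Y" "p \<in> arr Y j' m" "q \<in> arr Y j'' m"
    "!!x. x \<in> P ==> trn Y j' m p (f' x) = trn Y j'' m q (f'' x)" by (rule geqE[OF g(2)]) blast
  obtain n s t where n: "n \<in> idx Y" "s \<in> arr Y l n" "t \<in> arr Y m n"
    "!!x. x \<in> elts Y j' ==> trn Y l n s (trn Y j' l b x) = trn Y m n t (trn Y j' m p x)"
    using ind_amalg[OF Y j(2) l(1) m(1) l(3) m(2)] by blast
  show ?thesis
  proof (rule geqI[OF n(1) ind_comp_arr[OF Y j(1) l(1) n(1) l(2) n(2)] ind_comp_arr[OF Y j(3) m(1) n(1) m(3) n(3)]])
    fix x assume x: "x \<in> P"
    show "trn Y j n (Cmp (shape Y) j l n s a) (f x) = trn Y j'' n (Cmp (shape Y) j'' m n t q) (f'' x)"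
      unfolding ind_trn_comp[OF Y j(1) l(1) n(1) l(2) n(2) c(1)[OF x]]
        ind_trn_comp[OF Y j(3) m(1) n(1) m(3) n(3) c(3)[OF x]] l(4)[OF x] m(4)[OF x, symmetric]
      by (rule n(4)[OF c(2)[OF x]])
  qed
qed

lemma germ_self: "isind Y ==> j \<in> idx Y ==> f \<in> bl_hom A (at_idx Y j) ==> (j, f) \<in> germ A Y j f"
  by (simp add: germ_iff geq_refl)

lemma germ_eqI:
  assumes Y: "isind Y" and j: "j \<in> idx Y" "j' \<in> idx Y" and f: "f \<in> bl_hom A (at_idx Y j)" "f' \<in> bl_hom A (at_idx Y j')"
    and g: "geq Y (carrier A) j f j' f'"
  shows "germ A Y j f = germ A Y j' f'"
proof -
  have "(l, h) \<in> germ A Y j f \<longleftrightarrow> (l, h) \<in> germ A Y j' f'" for l h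
  proof -
    have "geq Y (carrier A) j f l h \<longleftrightarrow> geq Y (carrier A) j' f' l h" if l: "l \<in> idx Y" "h \<in> bl_hom A (at_idx Y l)"
    proof
      assume 1: "geq Y (carrier A) j f l h"
      show "geq Y (carrier A) j' f' l h"
        by (rule geq_trans[OF Y j(2,1) l(1) _ _ _ geq_sym[OF g] 1]) (rule bl_closed[OF f(2)] bl_closed[OF f(1)] bl_closed[OF l(2)], assumption)+
    next
      assume 1: "geq Y (carrier A) j' f' l h"
      show "geq Y (carrier A) j f l h"
        by (rule geq_trans[OF Y j l(1) _ _ _ g 1]) (rule bl_closed[OF f(1)] bl_closed[OF f(2)] bl_closed[OF l(2)], assumption)+
    qed
    thus ?thesis unfolding germ_iff by blast
  qed
  thus ?thesis by auto
qed

lemma ihD: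
  assumes X: "isind X" and Y: "isind Y" and \<phi>: "\<phi> \<in> ind_hom X Y" and i: "i \<in> idx X"
  shows ih_ne: "\<exists>j f. (j, f) \<in> \<phi> i"
    and ih_mem: "(j, f) \<in> \<phi> i ==> j \<in> idx Y" "(j, f) \<in> \<phi> i ==> f \<in> bl_hom (at_idx X i) (at_idx Y j)"
    and ih_germ: "(j, f) \<in> \<phi> i ==> \<phi> i = germ (at_idx X i) Y j f"
proof -
  obtain j0 f0 where 0: "j0 \<in> idx Y" "f0 \<in> bl_hom (at_idx X i) (at_idx Y j0)" "\<phi> i = germ (at_idx X i) Y j0 f0"
    using \<phi> i unfolding ind_hom_def by blast
  show "\<exists>j f. (j, f) \<in> \<phi> i" using germ_self[OF Y 0(1,2)] 0(3) by blast
  show 1: "(j, f) \<in> \<phi> i ==> j \<in> idx Y" "(j, f) \<in> \<phi> i ==> f \<in> bl_hom (at_idx X i) (at_idx Y j)" for j f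
    unfolding 0(3) germ_iff by blast+
  show "\<phi> i = germ (at_idx X i) Y j f" if jf: "(j, f) \<in> \<phi> i"
  proof -
    have "geq Y (elts X i) j0 f0 j f" using jf unfolding 0(3) germ_iff by blast
    from germ_eqI[OF Y 0(1) 1(1)[OF jf] 0(2) 1(2)[OF jf] this] show ?thesis unfolding 0(3) .
  qed
qed

lemma ih_geq:
  assumes X: "isind X" and Y: "isind Y" and \<phi>: "\<phi> \<in> ind_hom X Y" and i: "i \<in> idx X"
    and "(j, f) \<in> \<phi> i" "(j', f') \<in> \<phi> i"
  shows "geq Y (elts X i) j f j' f'"
  using assms(6) unfolding ih_germ[OF X Y \<phi> i assms(5)] germ_iff by blast

lemma ih_nat:
  assumes X: "isind X" and Y: "isind Y" and \<phi>: "\<phi> \<in> ind_hom X Y" and i: "i \<in> idx X" "i' \<in> idx X" "a \<in> arr X i i'"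
    and m: "(j, f) \<in> \<phi> i" "(j', f') \<in> \<phi> i'"
  shows "geq Y (elts X i) j f j' (%x. f' (trn X i i' a x))"
proof -
  have "\<phi> i = germ (at_idx X i) Y j' (compose (elts X i) f' (trn X i i' a))"
    using \<phi> i m(2) unfolding ind_hom_def by blast
  hence "geq Y (elts X i) j' (compose (elts X i) f' (trn X i i' a)) j f"
    using m(1) by (simp only: germ_iff)
  from geq_sym[OF this] show ?thesis by (rule geq_cong) (auto simp: compose_eq)
qed

text \<open>Compatibility of the chosen representatives suffices, since any other representative of
  the same germ agrees with the chosen one at a later stage.\<close>

lemma ih_intro:
  assumes X: "isind X" and Y: "isind Y"
    and J: "!!i. i \<in> idx X ==> J i \<in> idx Y" and F: "!!i. i \<in> idx X ==> F i \<in> bl_hom (at_idx X i) (at_idx Y (J i))"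
    and N: "!!i i' a. i \<in> idx X ==> i' \<in> idx X ==> a \<in> arr X i i' ==>
      geq Y (elts X i) (J i) (F i) (J i') (%x. F i' (trn X i i' a x))"
    and \<phi>: "\<phi> \<in> extensional (idx X)" "!!i. i \<in> idx X ==> \<phi> i = germ (at_idx X i) Y (J i) (F i)"
  shows "\<phi> \<in> ind_hom X Y"
  unfolding ind_hom_def
proof (intro CollectI conjI ballI \<phi>(1), goal_cases)
  case (1 i) thus ?case using J F \<phi>(2) by blast
next
  case (2 i i' a p)
  obtain j f where p: "p = (j, f)" by force
  have "(j, f) \<in> germ (at_idx X i') Y (J i') (F i')" using 2(4) unfolding p \<phi>(2)[OF 2(2)] .
  hence jf: "j \<in> idx Y" "f \<in> bl_hom (at_idx X i') (at_idx Y j)" "geq Y (elts X i') (J i') (F i') j f"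
    unfolding germ_iff by blast+
  note t = ind_trn[OF X 2(1,2,3)]
  have ft: "compose (elts X i) f (trn X i i' a) \<in> bl_hom (at_idx X i) (at_idx Y j)"
    by (rule bl_comp[OF t jf(2) ind_bs[OF X 2(1)] ind_bs[OF X 2(2)]])
  have "geq Y (elts X i) (J i') (%x. F i' (trn X i i' a x)) j (%x. f (trn X i i' a x))"
    by (rule geq_pre[OF jf(3)]) (rule bl_closed[OF t])
  from geq_trans[OF Y J[OF 2(1)] J[OF 2(2)] jf(1) _ _ _ N[OF 2(1,2,3)] this]
  have "geq Y (elts X i) (J i) (F i) j (%x. f (trn X i i' a x))"
    using bl_closed[OF F[OF 2(1)]] bl_closed[OF F[OF 2(2)]] bl_closed[OF jf(2)] bl_closed[OF t] by blast
  hence "geq Y (elts X i) (J i) (F i) j (compose (elts X i) f (trn X i i' a))"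
    by (rule geq_cong) (auto simp: compose_eq)
  from germ_eqI[OF Y J[OF 2(1)] jf(1) F[OF 2(1)] ft this]
  show ?case unfolding p using \<phi>(2)[OF 2(1)] by simp
qed

lemma ih_ext: "\<phi> \<in> ind_hom X Y ==> \<phi> \<in> extensional (idx X)"
  by (simp add: ind_hom_def)

lemma ih_eqI:
  assumes X: "isind X" and Y: "isind Y" and \<phi>: "\<phi> \<in> ind_hom X Y" and \<psi>: "\<psi> \<in> ind_hom X Y"
    and eq: "!!i. i \<in> idx X ==> \<exists>j f j' f'. (j, f) \<in> \<phi> i \<and> (j', f') \<in> \<psi> i \<and> geq Y (elts X i) j f j' f'"
  shows "\<phi> = \<psi>"
proof (rule extensionalityI[OF ih_ext[OF \<phi>] ih_ext[OF \<psi>]])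
  fix i assume i: "i \<in> idx X"
  obtain j f j' f' where j: "(j, f) \<in> \<phi> i" "(j', f') \<in> \<psi> i" "geq Y (elts X i) j f j' f'"
    using eq[OF i] by blast
  show "\<phi> i = \<psi> i"
    unfolding ih_germ[OF X Y \<phi> i j(1)] ih_germ[OF X Y \<psi> i j(2)]
    by (rule germ_eqI[OF Y _ _ _ _ j(3)])
      (rule ih_mem[OF X Y \<phi> i j(1)] ih_mem[OF X Y \<psi> i j(2)])+
qed

text \<open>Both arguments are moved to the stage m where they agree and are compared there through
  one member of \<open>\<Phi> m\<close>. The parameter q admits a whole family of maps at once: a
  single map in \<open>geq_hom\<close>, all group elements when an action is applied.\<close>

lemma geq_map:
  assumes Y: "isind Y" and Z: "isind Z"
    and ne: "!!j. j \<in> idx Y ==> \<exists>l h. (l, h) \<in> \<Phi> j"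
    and mem: "!!j l h q y. j \<in> idx Y ==> (l, h) \<in> \<Phi> j ==> l \<in> idx Z"
      "!!j l h q y. j \<in> idx Y ==> (l, h) \<in> \<Phi> j ==> q \<in> Q ==> y \<in> elts Y j ==> h q y \<in> elts Z l"
    and nat: "!!j j' a l h l' h'. j \<in> idx Y ==> j' \<in> idx Y ==> a \<in> arr Y j j' ==> (l, h) \<in> \<Phi> j ==> (l', h') \<in> \<Phi> j' ==>
      geq Z (Q \<times> elts Y j) l (%(q, y). h q y) l' (%(q, y). h' q (trn Y j j' a y))"
    and j: "j \<in> idx Y" "j' \<in> idx Y" and f: "!!p. p \<in> P ==> f p \<in> elts Y j" "!!p. p \<in> P ==> f' p \<in> elts Y j'"
    and l: "(l, h) \<in> \<Phi> j" "(l', h') \<in> \<Phi> j'" and g: "geq Y P j f j' f'"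
  shows "geq Z (Q \<times> P) l (%(q, p). h q (f p)) l' (%(q, p). h' q (f' p))"
proof -
  obtain m a b where m: "m \<in> idx Y" "a \<in> arr Y j m" "b \<in> arr Y j' m"
    "!!x. x \<in> P ==> trn Y j m a (f x) = trn Y j' m b (f' x)" by (rule geqE[OF g]) blast
  obtain n k where n: "(n, k) \<in> \<Phi> m" using ne[OF m(1)] by blast
  have 1: "geq Z (Q \<times> P) l (%x. (%(q, y). h q y) (case x of (q, p) => (q, f p)))
      n (%x. (%(q, y). k q (trn Y j m a y)) (case x of (q, p) => (q, f p)))"
    by (rule geq_pre[OF nat[OF j(1) m(1,2) l(1) n]]) (use f in auto)
  have 2: "geq Z (Q \<times> P) l' (%x. (%(q, y). h' q y) (case x of (q, p) => (q, f' p)))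
      n (%x. (%(q, y). k q (trn Y j' m b y)) (case x of (q, p) => (q, f' p)))"
    by (rule geq_pre[OF nat[OF j(2) m(1,3) l(2) n]]) (use f in auto)
  have g1: "geq Z (Q \<times> P) l (%(q, p). h q (f p)) n (%(q, p). k q (trn Y j m a (f p)))"
    by (rule geq_cong[OF 1]) auto
  have g2: "geq Z (Q \<times> P) n (%(q, p). k q (trn Y j m a (f p))) l' (%(q, p). h' q (f' p))"
    by (rule geq_cong[OF geq_sym[OF 2]]) (auto simp: m(4))
  show ?thesis
    by (rule geq_trans[OF Z mem(1)[OF j(1) l(1)] mem(1)[OF m(1) n] mem(1)[OF j(2) l(2)] _ _ _ g1 g2])
      (use mem(2)[OF j(1) l(1)] mem(2)[OF m(1) n] mem(2)[OF j(2) l(2)] f ind_trn_closed[OF Y j(1) m(1,2)] in auto)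
qed

lemma geq_hom:
  assumes Y: "isind Y" and Z: "isind Z" and \<phi>: "\<phi> \<in> ind_hom Y Z"
    and j: "j \<in> idx Y" "j' \<in> idx Y" and f: "!!p. p \<in> P ==> f p \<in> elts Y j" "!!p. p \<in> P ==> f' p \<in> elts Y j'"
    and l: "(l, h) \<in> \<phi> j" "(l', h') \<in> \<phi> j'" and g: "geq Y P j f j' f'"
  shows "geq Z P l (%p. h (f p)) l' (%p. h' (f' p))"
proof -
  \<comment> \<open>A morphism is a family of maps over the one-point parameter set.\<close>
  let ?\<Phi> = "%j. {(l, k). \<exists>h. (l, h) \<in> \<phi> j \<and> k = (%_::unit. h)}"
  have "geq Z (UNIV \<times> P) l (%(q, p). (%_::unit. h) q (f p)) l' (%(q, p). (%_. h') q (f' p))"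
  proof (rule geq_map[OF Y Z, where \<Phi>="?\<Phi>"])
    fix j assume j: "j \<in> idx Y"
    show "\<exists>l h. (l, h) \<in> ?\<Phi> j" using ih_ne[OF Y Z \<phi> j] by blast
    show "l \<in> idx Z" if "(l, h) \<in> ?\<Phi> j" for l h using that ih_mem[OF Y Z \<phi> j] by blast
    show "h q y \<in> elts Z l" if "(l, h) \<in> ?\<Phi> j" "y \<in> elts Y j" for l h q y
      using that bl_closed[OF ih_mem(2)[OF Y Z \<phi> j]] by blast
    fix j' a l h l' h' assume "j' \<in> idx Y" "a \<in> arr Y j j'" "(l, h) \<in> ?\<Phi> j" "(l', h') \<in> ?\<Phi> j'"
    then obtain k k' where k: "(l, k) \<in> \<phi> j" "h = (%_. k)" "(l', k') \<in> \<phi> j'" "h' = (%_. k')" "j' \<in> idx Y" "a \<in> arr Y j j'" by blast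
    show "geq Z (UNIV \<times> elts Y j) l (%(q, y). h q y) l' (%(q, y). h' q (trn Y j j' a y))"
      by (rule geq_cong[OF geq_pre[OF ih_nat[OF Y Z \<phi> j k(5,6,1,3)], where Q="UNIV \<times> elts Y j" and k=snd]])
        (use k in auto)
  qed (use j f l g in auto)
  from geq_pre[OF this, of P "%p. ((), p)"] show ?thesis by simp
qed

text \<open>By \<open>geq_hom\<close> the composites of any two choices of representatives agree at
  some stage, so the union defining \<open>ind_comp\<close> collapses to one germ.\<close>

lemma ind_comp_germ:
  assumes X: "isind X" and Y: "isind Y" and Z: "isind Z" and \<phi>: "\<phi> \<in> ind_hom X Y" and \<psi>: "\<psi> \<in> ind_hom Y Z"
    and i: "i \<in> idx X" and j: "(j, f) \<in> \<phi> i" and l: "(l, h) \<in> \<psi> j"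
  shows "ind_comp X Y Z \<psi> \<phi> i = germ (at_idx X i) Z l (compose (elts X i) h f)"
proof -
  let ?A = "at_idx X i"
  have *: "germ ?A Z l' (compose (carrier ?A) h' f') = germ ?A Z l (compose (carrier ?A) h f)"
    if j': "(j', f') \<in> \<phi> i" and l': "(l', h') \<in> \<psi> j'" for j' f' l' h'
  proof -
    note J = ih_mem[OF X Y \<phi> i j] ih_mem[OF X Y \<phi> i j']
    note L = ih_mem[OF Y Z \<psi> J(1) l] ih_mem[OF Y Z \<psi> J(3) l']
    have "geq Z (carrier ?A) l' (%p. h' (f' p)) l (%p. h (f p))"
      by (rule geq_hom[OF Y Z \<psi> J(3,1) _ _ l' l ih_geq[OF X Y \<phi> i j' j]])
        (rule bl_closed[OF J(2)] bl_closed[OF J(4)], assumption)+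
    hence "geq Z (carrier ?A) l' (compose (carrier ?A) h' f') l (compose (carrier ?A) h f)"
      by (rule geq_cong) (auto simp: compose_eq)
    from germ_eqI[OF Z L(3,1) bl_comp[OF J(4) L(4) ind_bs[OF X i] ind_bs[OF Y J(3)]]
        bl_comp[OF J(2) L(2) ind_bs[OF X i] ind_bs[OF Y J(1)]] this] show ?thesis .
  qed
  show ?thesis
  proof
    show "ind_comp X Y Z \<psi> \<phi> i \<subseteq> germ ?A Z l (compose (carrier ?A) h f)"
      unfolding ind_comp_def restrict_apply'[OF i] using * by blast
    show "germ ?A Z l (compose (carrier ?A) h f) \<subseteq> ind_comp X Y Z \<psi> \<phi> i"
      unfolding ind_comp_def restrict_apply'[OF i] using j l by blast
  qed
qed

lemma ind_comp_mem:
  assumes X: "isind X" and Y: "isind Y" and Z: "isind Z" and \<phi>: "\<phi> \<in> ind_hom X Y" and \<psi>: "\<psi> \<in> ind_hom Y Z"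
    and i: "i \<in> idx X" and j: "(j, f) \<in> \<phi> i" and l: "(l, h) \<in> \<psi> j"
  shows "(l, compose (elts X i) h f) \<in> ind_comp X Y Z \<psi> \<phi> i"
proof -
  note J = ih_mem[OF X Y \<phi> i j]
  note L = ih_mem[OF Y Z \<psi> J(1) l]
  show ?thesis unfolding ind_comp_germ[OF assms]
    by (rule germ_self[OF Z L(1) bl_comp[OF J(2) L(2) ind_bs[OF X i] ind_bs[OF Y J(1)]]])
qed

lemma ind_comp_hom:
  assumes X: "isind X" and Y: "isind Y" and Z: "isind Z" and \<phi>: "\<phi> \<in> ind_hom X Y" and \<psi>: "\<psi> \<in> ind_hom Y Z"
  shows "ind_comp X Y Z \<psi> \<phi> \<in> ind_hom X Z"
proof -
  have "\<forall>i. \<exists>j f l h. i \<in> idx X --> (j, f) \<in> \<phi> i \<and> (l, h) \<in> \<psi> j"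
    using ih_ne[OF X Y \<phi>] ih_mem(1)[OF X Y \<phi>] ih_ne[OF Y Z \<psi>] by metis
  then obtain J F L H where m: "!!i. i \<in> idx X ==> (J i, F i) \<in> \<phi> i" "!!i. i \<in> idx X ==> (L i, H i) \<in> \<psi> (J i)"
    by metis
  have J: "J i \<in> idx Y" "F i \<in> bl_hom (at_idx X i) (at_idx Y (J i))" if "i \<in> idx X" "i \<in> idx X" for i
    using ih_mem[OF X Y \<phi> that(1) m(1)[OF that(1)]] by auto
  have L: "L i \<in> idx Z" "H i \<in> bl_hom (at_idx Y (J i)) (at_idx Z (L i))" if "i \<in> idx X" "i \<in> idx X" for i
    using ih_mem[OF Y Z \<psi> J(1)[OF that] m(2)[OF that(1)]] by auto
  show ?thesis
  proof (rule ih_intro[OF X Z, where J=L and F="%i. compose (elts X i) (H i) (F i)"])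
    show "L i \<in> idx Z" if "i \<in> idx X" for i by (rule L(1)[OF that that])
    show "compose (elts X i) (H i) (F i) \<in> bl_hom (at_idx X i) (at_idx Z (L i))" if "i \<in> idx X" for i
      by (rule bl_comp[OF J(2)[OF that that] L(2)[OF that that] ind_bs[OF X that] ind_bs[OF Y J(1)[OF that that]]])
    show "ind_comp X Y Z \<psi> \<phi> \<in> extensional (idx X)" by (simp add: ind_comp_def)
    show "ind_comp X Y Z \<psi> \<phi> i = germ (at_idx X i) Z (L i) (compose (elts X i) (H i) (F i))" if "i \<in> idx X" for i
      by (rule ind_comp_germ[OF X Y Z \<phi> \<psi> that m(1)[OF that] m(2)[OF that]])
    fix i i' a assume i: "i \<in> idx X" "i' \<in> idx X" "a \<in> arr X i i'"
    have t: "trn X i i' a x \<in> elts X i'" if "x \<in> elts X i" for x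
      by (rule ind_trn_closed[OF X i that])
    have "geq Z (elts X i) (L i) (%p. H i (F i p)) (L i') (%p. H i' (F i' (trn X i i' a p)))"
      by (rule geq_hom[OF Y Z \<psi> J(1)[OF i(1,1)] J(1)[OF i(2,2)] _ _ m(2)[OF i(1)] m(2)[OF i(2)]
            ih_nat[OF X Y \<phi> i m(1)[OF i(1)] m(1)[OF i(2)]]])
        (use t bl_closed[OF J(2)[OF i(1,1)]] bl_closed[OF J(2)[OF i(2,2)]] in auto)
    thus "geq Z (elts X i) (L i) (compose (elts X i) (H i) (F i)) (L i')
        (%x. compose (elts X i') (H i') (F i') (trn X i i' a x))"
      by (rule geq_cong) (use t in \<open>auto simp: compose_eq\<close>)
  qed
qed

lemma ind_id_mem: "isind X ==> i \<in> idx X ==> (i, ban_id (at_idx X i)) \<in> ind_id X i"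
  by (simp add: ind_id_def germ_self ind_bs)

lemma ind_id_hom: assumes X: "isind X" shows "ind_id X \<in> ind_hom X X"
proof (rule ih_intro[OF X X, where J="%i. i" and F="%i. ban_id (at_idx X i)"])
  fix i i' a assume i: "i \<in> idx X" "i' \<in> idx X" "a \<in> arr X i i'"
  have "geq X (elts X i) i (%x. x) i' (%x. trn X i i' a x)" by (rule geq_trn[OF X i])
  thus "geq X (elts X i) i (ban_id (at_idx X i)) i' (%x. ban_id (at_idx X i') (trn X i i' a x))"
    by (rule geq_cong) (use ind_trn_closed[OF X i] in auto)
qed (use ind_bs[OF X] in \<open>auto simp: ind_id_def\<close>)

lemma ind_comp_assoc:
  assumes X: "isind X" and Y: "isind Y" and Z: "isind Z" and W: "isind W"
    and \<phi>: "\<phi> \<in> ind_hom X Y" and \<psi>: "\<psi> \<in> ind_hom Y Z" and \<xi>: "\<xi> \<in> ind_hom Z W"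
  shows "ind_comp X Z W \<xi> (ind_comp X Y Z \<psi> \<phi>) = ind_comp X Y W (ind_comp Y Z W \<xi> \<psi>) \<phi>"
proof (rule ih_eqI[OF X W])
  show "ind_comp X Z W \<xi> (ind_comp X Y Z \<psi> \<phi>) \<in> ind_hom X W"
    by (rule ind_comp_hom[OF X Z W ind_comp_hom[OF X Y Z \<phi> \<psi>] \<xi>])
  show "ind_comp X Y W (ind_comp Y Z W \<xi> \<psi>) \<phi> \<in> ind_hom X W"
    by (rule ind_comp_hom[OF X Y W \<phi> ind_comp_hom[OF Y Z W \<psi> \<xi>]])
  fix i assume i: "i \<in> idx X"
  obtain j f where j: "(j, f) \<in> \<phi> i" using ih_ne[OF X Y \<phi> i] by blast
  note J = ih_mem[OF X Y \<phi> i j]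
  obtain l h where l: "(l, h) \<in> \<psi> j" using ih_ne[OF Y Z \<psi> J(1)] by blast
  note L = ih_mem[OF Y Z \<psi> J(1) l]
  obtain m k where m: "(m, k) \<in> \<xi> l" using ih_ne[OF Z W \<xi> L(1)] by blast
  note M = ih_mem[OF Z W \<xi> L(1) m]
  have 1: "(m, compose (elts X i) k (compose (elts X i) h f)) \<in> ind_comp X Z W \<xi> (ind_comp X Y Z \<psi> \<phi>) i"
    by (rule ind_comp_mem[OF X Z W ind_comp_hom[OF X Y Z \<phi> \<psi>] \<xi> i ind_comp_mem[OF X Y Z \<phi> \<psi> i j l] m])
  have 2: "(m, compose (elts X i) (compose (elts Y j) k h) f) \<in> ind_comp X Y W (ind_comp Y Z W \<xi> \<psi>) \<phi> i"
    by (rule ind_comp_mem[OF X Y W \<phi> ind_comp_hom[OF Y Z W \<psi> \<xi>] i j ind_comp_mem[OF Y Z W \<psi> \<xi> J(1) l m]])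
  have 3: "compose (elts X i) k (compose (elts X i) h f) = compose (elts X i) (compose (elts Y j) k h) f"
    by (rule bl_assoc[OF J(2)])
  show "\<exists>j f j' f'. (j, f) \<in> ind_comp X Z W \<xi> (ind_comp X Y Z \<psi> \<phi>) i \<and> (j', f') \<in> ind_comp X Y W (ind_comp Y Z W \<xi> \<psi>) \<phi> i \<and>
      geq W (elts X i) j f j' f'"
    using 1 2 geq_refl[OF W M(1)] unfolding 3 by blast
qed

lemma ind_comp_id:
  assumes X: "isind X" and Y: "isind Y" and \<phi>: "\<phi> \<in> ind_hom X Y"
  shows "ind_comp X X Y \<phi> (ind_id X) = \<phi>" "ind_comp X Y Y (ind_id Y) \<phi> = \<phi>"
proof -
  show "ind_comp X X Y \<phi> (ind_id X) = \<phi>"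
  proof (rule ih_eqI[OF X Y ind_comp_hom[OF X X Y ind_id_hom[OF X] \<phi>] \<phi>])
    fix i assume i: "i \<in> idx X"
    obtain j f where j: "(j, f) \<in> \<phi> i" using ih_ne[OF X Y \<phi> i] by blast
    note J = ih_mem[OF X Y \<phi> i j]
    have "(j, compose (elts X i) f (ban_id (at_idx X i))) \<in> ind_comp X X Y \<phi> (ind_id X) i"
      by (rule ind_comp_mem[OF X X Y ind_id_hom[OF X] \<phi> i ind_id_mem[OF X i] j])
    hence "(j, f) \<in> ind_comp X X Y \<phi> (ind_id X) i" unfolding bl_id_right[OF J(2)] .
    thus "\<exists>j f j' f'. (j, f) \<in> ind_comp X X Y \<phi> (ind_id X) i \<and> (j', f') \<in> \<phi> i \<and> geq Y (elts X i) j f j' f'"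
      using j geq_refl[OF Y J(1)] by blast
  qed
  show "ind_comp X Y Y (ind_id Y) \<phi> = \<phi>"
  proof (rule ih_eqI[OF X Y ind_comp_hom[OF X Y Y \<phi> ind_id_hom[OF Y]] \<phi>])
    fix i assume i: "i \<in> idx X"
    obtain j f where j: "(j, f) \<in> \<phi> i" using ih_ne[OF X Y \<phi> i] by blast
    note J = ih_mem[OF X Y \<phi> i j]
    have "(j, compose (elts X i) (ban_id (at_idx Y j)) f) \<in> ind_comp X Y Y (ind_id Y) \<phi> i"
      by (rule ind_comp_mem[OF X Y Y \<phi> ind_id_hom[OF Y] i j ind_id_mem[OF Y J(1)]])
    hence "(j, f) \<in> ind_comp X Y Y (ind_id Y) \<phi> i" unfolding bl_id_left[OF J(2)] .
    thus "\<exists>j f j' f'. (j, f) \<in> ind_comp X Y Y (ind_id Y) \<phi> i \<and> (j', f') \<in> \<phi> i \<and> geq Y (elts X i) j f j' f'"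
      using j geq_refl[OF Y J(1)] by blast
  qed
qed

section \<open>Constant ind-objects and tensor products of ind-objects\<close>

lemma ind_const_simps [simp]: "shape (ind_const A) = unit_cat" "at_idx (ind_const A) i = A"
  "trn (ind_const A) i j a = ban_id A"
  by (auto simp: ind_const_def)

lemma unit_cat_simps [simp]: "Ob unit_cat = UNIV" "Ar unit_cat i j = UNIV" "Idm unit_cat i = ()" "Cmp unit_cat i j l b a = ()"
  by (auto simp: unit_cat_def)

lemma ind_const_isind: assumes A: "bs A" shows "isind (ind_const A)"
proof -
  have "filtered unit_cat" unfolding filtered_def is_category_def by simp
  moreover have "is_functor unit_cat (ban_cat v c) (diag (ind_const A))"
    unfolding is_functor_def ban_cat_def using A bl_id_left[OF bl_id[OF A]] by simp
  ultimately show ?thesis by (simp add: is_ind_def)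
qed

lemma ind_tensor_simps [simp]: "idx (ind_tensor c X Y) = idx X \<times> idx Y"
  "at_idx (ind_tensor c X Y) p = tensor c (at_idx X (fst p)) (at_idx Y (snd p))"
  "arr (ind_tensor c X Y) p q = arr X (fst p) (fst q) \<times> arr Y (snd p) (snd q)"
  "trn (ind_tensor c X Y) p q a = tens_map c (at_idx X (fst p)) (at_idx X (fst q)) (at_idx Y (snd p)) (at_idx Y (snd q))
                                 (trn X (fst p) (fst q) (fst a)) (trn Y (snd p) (snd q) (snd a))"
  by (auto simp: ind_tensor_def prod_cat_def)

lemma prod_filtered:
  assumes "filtered A" "filtered B" shows "filtered (prod_cat A B)"
proof -
  have A: "is_category A" and B: "is_category B" using assms by (auto simp: filtered_def)
  have "is_category (prod_cat A B)"
    using A B unfolding is_category_def prod_cat_def by (auto simp: mem_Times_iff)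
  moreover have "Ob (prod_cat A B) \<noteq> {}" using assms by (auto simp: filtered_def prod_cat_def)
  moreover have "\<exists>l\<in>Ob (prod_cat A B). Ar (prod_cat A B) i l \<noteq> {} \<and> Ar (prod_cat A B) j l \<noteq> {}"
    if ij: "i \<in> Ob (prod_cat A B)" "j \<in> Ob (prod_cat A B)" for i j
  proof -
    have o: "fst i \<in> Ob A" "fst j \<in> Ob A" "snd i \<in> Ob B" "snd j \<in> Ob B" using ij by (auto simp: prod_cat_def)
    obtain l where l: "l \<in> Ob A" "Ar A (fst i) l \<noteq> {}" "Ar A (fst j) l \<noteq> {}" using assms(1) o unfolding filtered_def by blast
    obtain m where m: "m \<in> Ob B" "Ar B (snd i) m \<noteq> {}" "Ar B (snd j) m \<noteq> {}" using assms(2) o unfolding filtered_def by blast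
    show ?thesis by (rule bexI[of _ "(l, m)"]) (use l m in \<open>auto simp: prod_cat_def\<close>)
  qed
  moreover have "\<exists>l\<in>Ob (prod_cat A B). \<exists>h\<in>Ar (prod_cat A B) j l. Cmp (prod_cat A B) i j l h f = Cmp (prod_cat A B) i j l h g"
    if ij: "i \<in> Ob (prod_cat A B)" "j \<in> Ob (prod_cat A B)" "f \<in> Ar (prod_cat A B) i j" "g \<in> Ar (prod_cat A B) i j" for i j f g
  proof -
    have o: "fst i \<in> Ob A" "fst j \<in> Ob A" "snd i \<in> Ob B" "snd j \<in> Ob B"
      "fst f \<in> Ar A (fst i) (fst j)" "fst g \<in> Ar A (fst i) (fst j)" "snd f \<in> Ar B (snd i) (snd j)" "snd g \<in> Ar B (snd i) (snd j)"
      using ij by (auto simp: prod_cat_def)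
    obtain l h where l: "l \<in> Ob A" "h \<in> Ar A (fst j) l" "Cmp A (fst i) (fst j) l h (fst f) = Cmp A (fst i) (fst j) l h (fst g)"
      using assms(1) o unfolding filtered_def by blast
    obtain m k where m: "m \<in> Ob B" "k \<in> Ar B (snd j) m" "Cmp B (snd i) (snd j) m k (snd f) = Cmp B (snd i) (snd j) m k (snd g)"
      using assms(2) o unfolding filtered_def by blast
    show ?thesis
      by (rule bexI[of _ "(l, m)"], rule bexI[of _ "(h, k)"]) (use l m in \<open>auto simp: prod_cat_def\<close>)
  qed
  ultimately show ?thesis unfolding filtered_def by blast
qed

lemma ind_tensor_isind: assumes X: "isind X" and Y: "isind Y" shows "isind (ind_tensor c X Y)"
proof -
  have 1: "filtered (shape (ind_tensor c X Y))"
    using prod_filtered[OF ind_filt[OF X] ind_filt[OF Y]] by (simp add: ind_tensor_def)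
  have idm: "trn Z j j (Idm (shape Z) j) = ban_id (at_idx Z j)" if "isind Z" "j \<in> idx Z" for Z :: "('x, 'y, 'k, 'z) ind" and j
    using that unfolding is_ind_def is_functor_def ban_cat_def by simp
  have cmp: "trn Z i l (Cmp (shape Z) i j l b a) = compose (elts Z i) (trn Z j l b) (trn Z i j a)"
    if "isind Z" "i \<in> idx Z" "j \<in> idx Z" "l \<in> idx Z" "a \<in> arr Z i j" "b \<in> arr Z j l" for Z :: "('x, 'y, 'k, 'z) ind" and i j l a b
    using that unfolding is_ind_def is_functor_def ban_cat_def by simp
  have "is_functor (shape (ind_tensor c X Y)) (ban_cat v c) (diag (ind_tensor c X Y))"
    unfolding is_functor_def
  proof (intro conjI ballI)
    fix p assume "p \<in> idx (ind_tensor c X Y)"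
    hence p: "fst p \<in> idx X" "snd p \<in> idx Y" by auto
    note bp = ind_bs[OF X p(1)] ind_bs[OF Y p(2)]
    show "at_idx (ind_tensor c X Y) p \<in> Ob (ban_cat v c)" using bp by (simp add: ban_cat_def)
    show "trn (ind_tensor c X Y) p p (Idm (shape (ind_tensor c X Y)) p) = Idm (ban_cat v c) (at_idx (ind_tensor c X Y) p)"
      using idm[OF X p(1)] idm[OF Y p(2)] tens_map_id[OF bp] by (simp add: ban_cat_def ind_tensor_def prod_cat_def)
    fix q assume "q \<in> idx (ind_tensor c X Y)"
    hence q: "fst q \<in> idx X" "snd q \<in> idx Y" by auto
    note bq = ind_bs[OF X q(1)] ind_bs[OF Y q(2)]
    fix a assume "a \<in> arr (ind_tensor c X Y) p q"
    hence a: "fst a \<in> arr X (fst p) (fst q)" "snd a \<in> arr Y (snd p) (snd q)" by auto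
    note ta = ind_trn[OF X p(1) q(1) a(1)] ind_trn[OF Y p(2) q(2) a(2)]
    show "trn (ind_tensor c X Y) p q a \<in> Ar (ban_cat v c) (at_idx (ind_tensor c X Y) p) (at_idx (ind_tensor c X Y) q)"
      using tens_map_hom[OF bp bq ta] by (simp add: ban_cat_def)
    fix r assume "r \<in> idx (ind_tensor c X Y)"
    hence r: "fst r \<in> idx X" "snd r \<in> idx Y" by auto
    note br = ind_bs[OF X r(1)] ind_bs[OF Y r(2)]
    fix b assume "b \<in> arr (ind_tensor c X Y) q r"
    hence b: "fst b \<in> arr X (fst q) (fst r)" "snd b \<in> arr Y (snd q) (snd r)" by auto
    note tb = ind_trn[OF X q(1) r(1) b(1)] ind_trn[OF Y q(2) r(2) b(2)]
    show "trn (ind_tensor c X Y) p r (Cmp (shape (ind_tensor c X Y)) p q r b a) =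
      Cmp (ban_cat v c) (at_idx (ind_tensor c X Y) p) (at_idx (ind_tensor c X Y) q) (at_idx (ind_tensor c X Y) r)
        (trn (ind_tensor c X Y) q r b) (trn (ind_tensor c X Y) p q a)"
      using cmp[OF X p(1) q(1) r(1) a(1) b(1)] cmp[OF Y p(2) q(2) r(2) a(2) b(2)] tens_map_comp[OF bp bq br ta tb]
      by (simp add: ban_cat_def ind_tensor_def prod_cat_def)
  qed
  thus ?thesis using 1 by (simp add: is_ind_def)
qed

text \<open>A pair of stages at which the factors agree is a stage of the tensor product, and the
  maps agree there because the tensor product is functorial.\<close>

lemma geq_tensor:
  assumes X: "isind X" and Y: "isind Y" and bA: "bs A" and bB: "bs B"
    and i: "i \<in> idx X" "i' \<in> idx X" "j \<in> idx Y" "j' \<in> idx Y"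
    and f: "f \<in> bl_hom A (at_idx X i)" "f' \<in> bl_hom A (at_idx X i')"
    and h: "h \<in> bl_hom B (at_idx Y j)" "h' \<in> bl_hom B (at_idx Y j')"
    and g: "geq X (carrier A) i f i' f'" "geq Y (carrier B) j h j' h'"
  shows "geq (ind_tensor c X Y) (carrier (tensor c A B)) (i, j) (tens_map c A (at_idx X i) B (at_idx Y j) f h)
     (i', j') (tens_map c A (at_idx X i') B (at_idx Y j') f' h')"
proof -
  obtain l a b where l: "l \<in> idx X" "a \<in> arr X i l" "b \<in> arr X i' l"
    "!!x. x \<in> carrier A ==> trn X i l a (f x) = trn X i' l b (f' x)" by (rule geqE[OF g(1)]) blast
  obtain m p q where m: "m \<in> idx Y" "p \<in> arr Y j m" "q \<in> arr Y j' m"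
    "!!x. x \<in> carrier B ==> trn Y j m p (h x) = trn Y j' m q (h' x)" by (rule geqE[OF g(2)]) blast
  note B = ind_bs[OF X i(1)] ind_bs[OF X i(2)] ind_bs[OF Y i(3)] ind_bs[OF Y i(4)] ind_bs[OF X l(1)] ind_bs[OF Y m(1)]
  note T = ind_trn[OF X i(1) l(1,2)] ind_trn[OF X i(2) l(1,3)] ind_trn[OF Y i(3) m(1,2)] ind_trn[OF Y i(4) m(1,3)]
  have "compose (carrier A) (trn X i l a) f = compose (carrier A) (trn X i' l b) f'"
    "compose (carrier B) (trn Y j m p) h = compose (carrier B) (trn Y j' m q) h'"
    using l(4) m(4) by (auto simp: compose_eq_iff)
  hence "compose (carrier (tensor c A B)) (tens_map c (at_idx X i) (at_idx X l) (at_idx Y j) (at_idx Y m) (trn X i l a) (trn Y j m p))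
       (tens_map c A (at_idx X i) B (at_idx Y j) f h)
    = compose (carrier (tensor c A B)) (tens_map c (at_idx X i') (at_idx X l) (at_idx Y j') (at_idx Y m) (trn X i' l b) (trn Y j' m q))
       (tens_map c A (at_idx X i') B (at_idx Y j') f' h')"
    using tens_map_comp[OF bA bB B(1,3,5,6) f(1) h(1) T(1,3)] tens_map_comp[OF bA bB B(2,4,5,6) f(2) h(2) T(2,4)] by simp
  thus ?thesis unfolding compose_eq_iff
    by (intro geqI[of "(l, m)" _ "(a, p)" _ "(b, q)"]) (use l m in auto)
qed

lemma ind_tensor_map:
  assumes X: "isind X" and X': "isind X'" and Y: "isind Y" and Y': "isind Y'"
    and \<phi>: "\<phi> \<in> ind_hom X X'" and \<psi>: "\<psi> \<in> ind_hom Y Y'"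
  shows ind_tensor_map_hom: "ind_tensor_map c X X' Y Y' \<phi> \<psi> \<in> ind_hom (ind_tensor c X Y) (ind_tensor c X' Y')"
    and ind_tensor_map_mem: "!!i j i' f j' h. i \<in> idx X ==> j \<in> idx Y ==> (i', f) \<in> \<phi> i ==> (j', h) \<in> \<psi> j ==>
      ((i', j'), tens_map c (at_idx X i) (at_idx X' i') (at_idx Y j) (at_idx Y' j') f h) \<in> ind_tensor_map c X X' Y Y' \<phi> \<psi> (i, j)"
proof -
  let ?T = "ind_tensor c X Y" and ?T' = "ind_tensor c X' Y'"
  note T = ind_tensor_isind[OF X Y] ind_tensor_isind[OF X' Y']
  have tm: "tens_map c (at_idx X i) (at_idx X' i') (at_idx Y j) (at_idx Y' j') f h \<in> bl_hom (at_idx ?T (i, j)) (at_idx ?T' (i', j'))"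
    if "i \<in> idx X" "j \<in> idx Y" "(i', f) \<in> \<phi> i" "(j', h) \<in> \<psi> j" for i j i' f j' h
    using tens_map_hom[OF ind_bs[OF X that(1)] ind_bs[OF Y that(2)] ind_bs[OF X' ih_mem(1)[OF X X' \<phi> that(1,3)]]
        ind_bs[OF Y' ih_mem(1)[OF Y Y' \<psi> that(2,4)]] ih_mem(2)[OF X X' \<phi> that(1,3)] ih_mem(2)[OF Y Y' \<psi> that(2,4)]] by simp
  have ix: "(i', j') \<in> idx ?T'" if "i \<in> idx X" "j \<in> idx Y" "(i', f) \<in> \<phi> i" "(j', h) \<in> \<psi> j" for i j i' f j' h
    using ih_mem(1)[OF X X' \<phi> that(1,3)] ih_mem(1)[OF Y Y' \<psi> that(2,4)] by simp
  have eq: "germ (at_idx ?T (i, j)) ?T' (i', j') (tens_map c (at_idx X i) (at_idx X' i') (at_idx Y j) (at_idx Y' j') f h)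
     = germ (at_idx ?T (i, j)) ?T' (i'', j'') (tens_map c (at_idx X i) (at_idx X' i'') (at_idx Y j) (at_idx Y' j'') f' h')"
    if m: "i \<in> idx X" "j \<in> idx Y" "(i', f) \<in> \<phi> i" "(j', h) \<in> \<psi> j" "(i'', f') \<in> \<phi> i" "(j'', h') \<in> \<psi> j" for i j i' f j' h i'' f' j'' h'
  proof (rule germ_eqI[OF T(2) ix[OF m(1-4)] ix[OF m(1,2,5,6)] tm[OF m(1-4)] tm[OF m(1,2,5,6)]])
    show "geq ?T' (elts ?T (i, j)) (i', j') (tens_map c (at_idx X i) (at_idx X' i') (at_idx Y j) (at_idx Y' j') f h)
       (i'', j'') (tens_map c (at_idx X i) (at_idx X' i'') (at_idx Y j) (at_idx Y' j'') f' h')"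
      using geq_tensor[OF X' Y' ind_bs[OF X m(1)] ind_bs[OF Y m(2)] ih_mem(1)[OF X X' \<phi> m(1,3)] ih_mem(1)[OF X X' \<phi> m(1,5)]
          ih_mem(1)[OF Y Y' \<psi> m(2,4)] ih_mem(1)[OF Y Y' \<psi> m(2,6)]
          ih_mem(2)[OF X X' \<phi> m(1,3)] ih_mem(2)[OF X X' \<phi> m(1,5)]
          ih_mem(2)[OF Y Y' \<psi> m(2,4)] ih_mem(2)[OF Y Y' \<psi> m(2,6)] ih_geq[OF X X' \<phi> m(1,3,5)] ih_geq[OF Y Y' \<psi> m(2,4,6)]] by simp
  qed
  have germ: "ind_tensor_map c X X' Y Y' \<phi> \<psi> (i, j)
      = germ (at_idx ?T (i, j)) ?T' (i', j') (tens_map c (at_idx X i) (at_idx X' i') (at_idx Y j) (at_idx Y' j') f h)"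
    if m: "i \<in> idx X" "j \<in> idx Y" "(i', f) \<in> \<phi> i" "(j', h) \<in> \<psi> j" for i j i' f j' h
  proof -
    have "(i, j) \<in> idx ?T" using m by simp
    hence 1: "ind_tensor_map c X X' Y Y' \<phi> \<psi> (i, j) = (\<Union>(i', f)\<in>\<phi> i. \<Union>(j', h)\<in>\<psi> j. germ (at_idx ?T (i, j)) ?T' (i', j')
          (tens_map c (at_idx X i) (at_idx X' i') (at_idx Y j) (at_idx Y' j') f h))"
      unfolding ind_tensor_map_def by (simp only: restrict_apply' fst_conv snd_conv)
    show ?thesis
    proof
      show "ind_tensor_map c X X' Y Y' \<phi> \<psi> (i, j) \<subseteq> germ (at_idx ?T (i, j)) ?T' (i', j') (tens_map c (at_idx X i) (at_idx X' i') (at_idx Y j) (at_idx Y' j') f h)"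
        unfolding 1 using eq[OF m(1,2) _ _ m(3,4)] by fast
      show "germ (at_idx ?T (i, j)) ?T' (i', j') (tens_map c (at_idx X i) (at_idx X' i') (at_idx Y j) (at_idx Y' j') f h) \<subseteq> ind_tensor_map c X X' Y Y' \<phi> \<psi> (i, j)"
        unfolding 1 using m(3,4) by fast
    qed
  qed
  show mem: "((i', j'), tens_map c (at_idx X i) (at_idx X' i') (at_idx Y j) (at_idx Y' j') f h) \<in> ind_tensor_map c X X' Y Y' \<phi> \<psi> (i, j)"
    if m: "i \<in> idx X" "j \<in> idx Y" "(i', f) \<in> \<phi> i" "(j', h) \<in> \<psi> j" for i j i' f j' h
    unfolding germ[OF m] by (rule germ_self[OF T(2) ix[OF m] tm[OF m]])
  have "\<forall>i. \<exists>i' f. i \<in> idx X --> (i', f) \<in> \<phi> i" "\<forall>j. \<exists>j' f. j \<in> idx Y --> (j', f) \<in> \<psi> j"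
    using ih_ne[OF X X' \<phi>] ih_ne[OF Y Y' \<psi>] by blast+
  then obtain I F J H where r: "!!i. i \<in> idx X ==> (I i, F i) \<in> \<phi> i" "!!j. j \<in> idx Y ==> (J j, H j) \<in> \<psi> j" by metis
  show "ind_tensor_map c X X' Y Y' \<phi> \<psi> \<in> ind_hom ?T ?T'"
  proof (rule ih_intro[OF T, where J="%p. (I (fst p), J (snd p))" and F="%p. tens_map c (at_idx X (fst p)) (at_idx X' (I (fst p)))
        (at_idx Y (snd p)) (at_idx Y' (J (snd p))) (F (fst p)) (H (snd p))"])
    show "ind_tensor_map c X X' Y Y' \<phi> \<psi> \<in> extensional (idx ?T)" unfolding ind_tensor_map_def by (rule restrict_extensional)
    fix p assume "p \<in> idx ?T"
    then obtain i j where p: "p = (i, j)" "i \<in> idx X" "j \<in> idx Y" by auto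
    note m = p(2,3) r(1)[OF p(2)] r(2)[OF p(3)]
    show "(I (fst p), J (snd p)) \<in> idx ?T'" unfolding p fst_conv snd_conv by (rule ix[OF m])
    show "tens_map c (at_idx X (fst p)) (at_idx X' (I (fst p))) (at_idx Y (snd p)) (at_idx Y' (J (snd p))) (F (fst p)) (H (snd p))
        \<in> bl_hom (at_idx ?T p) (at_idx ?T' (I (fst p), J (snd p)))"
      unfolding p fst_conv snd_conv by (rule tm[OF m])
    show "ind_tensor_map c X X' Y Y' \<phi> \<psi> p = germ (at_idx ?T p) ?T' (I (fst p), J (snd p))
        (tens_map c (at_idx X (fst p)) (at_idx X' (I (fst p))) (at_idx Y (snd p)) (at_idx Y' (J (snd p))) (F (fst p)) (H (snd p)))"
      unfolding p fst_conv snd_conv by (rule germ[OF m])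
    fix q a assume "q \<in> idx ?T" "a \<in> arr ?T p q"
    then obtain i' j' b e where q: "q = (i', j')" "i' \<in> idx X" "j' \<in> idx Y" "a = (b, e)" "b \<in> arr X i i'" "e \<in> arr Y j j'"
      using p by auto
    note m' = q(2,3) r(1)[OF q(2)] r(2)[OF q(3)]
    note tb = ind_trn[OF X p(2) q(2,5)] and te = ind_trn[OF Y p(3) q(3,6)]
    note B = ind_bs[OF X p(2)] ind_bs[OF Y p(3)] ind_bs[OF X q(2)] ind_bs[OF Y q(3)]
      ind_bs[OF X' ih_mem(1)[OF X X' \<phi> m'(1,3)]] ind_bs[OF Y' ih_mem(1)[OF Y Y' \<psi> m'(2,4)]]
    note Fh = ih_mem(2)[OF X X' \<phi> m'(1,3)] ih_mem(2)[OF Y Y' \<psi> m'(2,4)]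
    have g1: "geq X' (elts X i) (I i) (F i) (I i') (compose (elts X i) (F i') (trn X i i' b))"
      by (rule geq_cong[OF ih_nat[OF X X' \<phi> p(2) q(2,5) m(3) m'(3)]]) (auto simp: compose_eq)
    have g2: "geq Y' (elts Y j) (J j) (H j) (J j') (compose (elts Y j) (H j') (trn Y j j' e))"
      by (rule geq_cong[OF ih_nat[OF Y Y' \<psi> p(3) q(3,6) m(4) m'(4)]]) (auto simp: compose_eq)
    have "geq ?T' (carrier (tensor c (at_idx X i) (at_idx Y j))) (I i, J j)
        (tens_map c (at_idx X i) (at_idx X' (I i)) (at_idx Y j) (at_idx Y' (J j)) (F i) (H j)) (I i', J j')
        (tens_map c (at_idx X i) (at_idx X' (I i')) (at_idx Y j) (at_idx Y' (J j'))
          (compose (elts X i) (F i') (trn X i i' b)) (compose (elts Y j) (H j') (trn Y j j' e)))"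
      by (rule geq_tensor[OF X' Y' B(1,2) ih_mem(1)[OF X X' \<phi> m(1,3)] ih_mem(1)[OF X X' \<phi> m'(1,3)] ih_mem(1)[OF Y Y' \<psi> m(2,4)]
            ih_mem(1)[OF Y Y' \<psi> m'(2,4)] ih_mem(2)[OF X X' \<phi> m(1,3)] bl_comp[OF tb Fh(1) B(1,3)]
            ih_mem(2)[OF Y Y' \<psi> m(2,4)] bl_comp[OF te Fh(2) B(2,4)] g1 g2])
    thus "geq ?T' (elts ?T p) (I (fst p), J (snd p))
        (tens_map c (at_idx X (fst p)) (at_idx X' (I (fst p))) (at_idx Y (snd p)) (at_idx Y' (J (snd p))) (F (fst p)) (H (snd p)))
        (I (fst q), J (snd q))
        (%x. tens_map c (at_idx X (fst q)) (at_idx X' (I (fst q))) (at_idx Y (snd q)) (at_idx Y' (J (snd q))) (F (fst q)) (H (snd q))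
          (trn ?T p q a x))"
      unfolding p q fst_conv snd_conv ind_tensor_simps
      by (rule geq_cong) (auto simp flip: tens_map_comp[OF B(1-6) tb te Fh] simp: compose_eq)
  qed
qed

end

section \<open>The associator and the left unitor of ind-objects\<close>

context valued
begin

lemma tens_assoc_natural:
  assumes "bs U" "bs V" "bs W" "bs U'" "bs V'" "bs W'" "f \<in> bl_hom U U'" "g \<in> bl_hom V V'" "h \<in> bl_hom W W'"
    and t: "t \<in> carrier (tensor c (tensor c U V) W)"
  shows "tens_map c U U' (tensor c V W) (tensor c V' W') f (tens_map c V V' W W' g h) (tens_assoc c U V W t)
    = tens_assoc c U' V' W' (tens_map c (tensor c U V) (tensor c U' V') W W' (tens_map c U U' V V' f g) h t)"
proof (rule tens_ext_lin_l[OF assms(1-3) _ _ _ _ t])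
  have B: "bs (tensor c U V)" "bs (tensor c V W)" "bs (tensor c U' V')" "bs (tensor c V' W')"
    "bs (tensor c (tensor c U V) W)" "bs (tensor c U (tensor c V W))"
    "bs (tensor c (tensor c U' V') W')" "bs (tensor c U' (tensor c V' W'))" using assms by auto
  note gh = tens_map[OF assms(2,3,5,6,8,9)] and fg = tens_map[OF assms(1,2,4,5,7,8)]
  note f_gh = tens_map[OF assms(1) B(2) assms(4) B(4) assms(7) gh(1)]
  note fg_h = tens_map[OF B(1) assms(3) B(3) assms(6) fg(1) assms(9)]
  note as = tens_assoc_hom[OF assms(1-3)] tens_assoc_hom[OF assms(4-6)]
  show "bs (tensor c U' (tensor c V' W'))" by fact
  show "lin (tensor c (tensor c U V) W) (tensor c U' (tensor c V' W'))
      (%t. tens_map c U U' (tensor c V W) (tensor c V' W') f (tens_map c V V' W W' g h) (tens_assoc c U V W t))"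
    by (rule lin_comp[OF bl_lin[OF as(1)] bl_lin[OF f_gh(1)] B(5,6)])
  show "lin (tensor c (tensor c U V) W) (tensor c U' (tensor c V' W'))
      (%t. tens_assoc c U' V' W' (tens_map c (tensor c U V) (tensor c U' V') W W' (tens_map c U U' V V' f g) h t))"
    by (rule lin_comp[OF bl_lin[OF fg_h(1)] bl_lin[OF as(2)] B(5,7)])
  fix x y z assume x: "x \<in> carrier U" "y \<in> carrier V" "z \<in> carrier W"
  note x' = bl_closed[OF assms(7) x(1)] bl_closed[OF assms(8) x(2)] bl_closed[OF assms(9) x(3)]
  show "tens_map c U U' (tensor c V W) (tensor c V' W') f (tens_map c V V' W W' g h)
      (tens_assoc c U V W (elt c (tensor c U V) W (elt c U V x y) z))
    = tens_assoc c U' V' W' (tens_map c (tensor c U V) (tensor c U' V') W W' (tens_map c U U' V V' f g) h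
        (elt c (tensor c U V) W (elt c U V x y) z))"
    unfolding tens_assoc_elt[OF assms(1-3) x] fg_h(2)[OF elt_closed[OF assms(1,2) x(1,2)] x(3)] fg(2)[OF x(1,2)]
      tens_assoc_elt[OF assms(4-6) x'] f_gh(2)[OF x(1) elt_closed[OF assms(2,3) x(2,3)]] gh(2)[OF x(2,3)] ..
qed

lemma tens_lunit_natural:
  assumes "bs V" "bs W" "\<phi> \<in> bl_hom V W" and t: "t \<in> carrier (tensor c (base_field v) V)"
  shows "\<phi> (tens_lunit v c V t) = tens_lunit v c W (tens_map c (base_field v) (base_field v) V W (ban_id (base_field v)) \<phi> t)"
proof (rule tens_ext_lin[OF bs_base assms(1,2) _ _ _ t])
  note m = tens_map[OF bs_base assms(1) bs_base assms(2) bl_id[OF bs_base] assms(3)]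
  have B: "bs (tensor c (base_field v) V)" "bs (tensor c (base_field v) W)" using assms by auto
  show "lin (tensor c (base_field v) V) W (%t. \<phi> (tens_lunit v c V t))"
    by (rule lin_comp[OF bl_lin[OF tens_lunit_hom[OF assms(1)]] bl_lin[OF assms(3)] B(1) assms(1)])
  show "lin (tensor c (base_field v) V) W (%t. tens_lunit v c W (tens_map c (base_field v) (base_field v) V W (ban_id (base_field v)) \<phi> t))"
    by (rule lin_comp[OF bl_lin[OF m(1)] bl_lin[OF tens_lunit_hom[OF assms(2)]] B])
  fix a x assume x: "a \<in> carrier (base_field v)" "x \<in> carrier V"
  show "\<phi> (tens_lunit v c V (elt c (base_field v) V a x))
    = tens_lunit v c W (tens_map c (base_field v) (base_field v) V W (ban_id (base_field v)) \<phi> (elt c (base_field v) V a x))"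
    unfolding m(2)[OF x] tens_lunit_elt[OF assms(1) x(2)] ban_id_apply[OF x(1)]
      tens_lunit_elt[OF assms(2) bl_closed[OF assms(3) x(2)]] by (rule bl_smult[OF assms(3) x(2)])
qed

text \<open>Naturality of the associator makes the stagewise maps a morphism of ind-objects.\<close>

lemma ind_assoc:
  assumes X: "isind X" and Y: "isind Y" and Z: "isind Z"
  shows ind_assoc_hom: "ind_assoc c X Y Z \<in> ind_hom (ind_tensor c (ind_tensor c X Y) Z) (ind_tensor c X (ind_tensor c Y Z))"
    and ind_assoc_mem: "!!i j l. i \<in> idx X ==> j \<in> idx Y ==> l \<in> idx Z ==>
      ((i, (j, l)), tens_assoc c (at_idx X i) (at_idx Y j) (at_idx Z l)) \<in> ind_assoc c X Y Z ((i, j), l)"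
proof -
  let ?S = "ind_tensor c (ind_tensor c X Y) Z" and ?T = "ind_tensor c X (ind_tensor c Y Z)"
  note S = ind_tensor_isind[OF ind_tensor_isind[OF X Y] Z] and T = ind_tensor_isind[OF X ind_tensor_isind[OF Y Z]]
  have hom: "tens_assoc c (at_idx X i) (at_idx Y j) (at_idx Z l) \<in> bl_hom (at_idx ?S ((i, j), l)) (at_idx ?T (i, (j, l)))"
    if "i \<in> idx X" "j \<in> idx Y" "l \<in> idx Z" for i j l
    using tens_assoc_hom[OF ind_bs[OF X that(1)] ind_bs[OF Y that(2)] ind_bs[OF Z that(3)]] by simp
  have germ: "ind_assoc c X Y Z ((i, j), l) = germ (at_idx ?S ((i, j), l)) ?T (i, (j, l)) (tens_assoc c (at_idx X i) (at_idx Y j) (at_idx Z l))"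
    if "i \<in> idx X" "j \<in> idx Y" "l \<in> idx Z" for i j l
    using that by (simp add: ind_assoc_def)
  show "((i, (j, l)), tens_assoc c (at_idx X i) (at_idx Y j) (at_idx Z l)) \<in> ind_assoc c X Y Z ((i, j), l)"
    if "i \<in> idx X" "j \<in> idx Y" "l \<in> idx Z" for i j l
    unfolding germ[OF that] by (rule germ_self[OF T _ hom[OF that]]) (use that in simp)
  show "ind_assoc c X Y Z \<in> ind_hom ?S ?T"
  proof (rule ih_intro[OF S T, where J="%((i, j), l). (i, (j, l))" and
        F="%((i, j), l). tens_assoc c (at_idx X i) (at_idx Y j) (at_idx Z l)"])
    show "ind_assoc c X Y Z \<in> extensional (idx ?S)" unfolding ind_assoc_def by (rule restrict_extensional)
    fix p assume "p \<in> idx ?S"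
    then obtain i j l where p: "p = ((i, j), l)" "i \<in> idx X" "j \<in> idx Y" "l \<in> idx Z" by auto
    show "((%((i, j), l). (i, (j, l))) p) \<in> idx ?T" using p by simp
    show "((%((i, j), l). tens_assoc c (at_idx X i) (at_idx Y j) (at_idx Z l)) p)
        \<in> bl_hom (at_idx ?S p) (at_idx ?T ((%((i, j), l). (i, (j, l))) p))"
      unfolding p prod.case by (rule hom[OF p(2-4)])
    show "ind_assoc c X Y Z p = germ (at_idx ?S p) ?T ((%((i, j), l). (i, (j, l))) p)
        ((%((i, j), l). tens_assoc c (at_idx X i) (at_idx Y j) (at_idx Z l)) p)"
      unfolding p prod.case by (rule germ[OF p(2-4)])
    fix q a assume "q \<in> idx ?S" "a \<in> arr ?S p q"
    then obtain i' j' l' a1 a2 a3 where q: "q = ((i', j'), l')" "i' \<in> idx X" "j' \<in> idx Y" "l' \<in> idx Z"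
      "a = ((a1, a2), a3)" "a1 \<in> arr X i i'" "a2 \<in> arr Y j j'" "a3 \<in> arr Z l l'" using p by auto
    have 1: "geq ?T (elts ?S p) (i, (j, l)) (tens_assoc c (at_idx X i) (at_idx Y j) (at_idx Z l)) (i', (j', l'))
        (%x. trn ?T (i, (j, l)) (i', (j', l')) (a1, (a2, a3)) (tens_assoc c (at_idx X i) (at_idx Y j) (at_idx Z l) x))"
    proof (rule geq_trn[OF T])
      show "tens_assoc c (at_idx X i) (at_idx Y j) (at_idx Z l) x \<in> elts ?T (i, (j, l))"
        if "x \<in> elts ?S p" for x
        by (rule bl_closed[OF hom[OF p(2-4)]]) (use that p in simp)
    qed (use p q in auto)
    show "geq ?T (elts ?S p) ((%((i, j), l). (i, (j, l))) p) ((%((i, j), l). tens_assoc c (at_idx X i) (at_idx Y j) (at_idx Z l)) p)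
        ((%((i, j), l). (i, (j, l))) q) (%x. ((%((i, j), l). tens_assoc c (at_idx X i) (at_idx Y j) (at_idx Z l)) q) (trn ?S p q a x))"
      unfolding p q prod.case
    proof (rule geq_cong[OF 1[unfolded p q prod.case]])
      fix x assume "x \<in> elts ?S ((i, j), l)"
      hence x: "x \<in> carrier (tensor c (tensor c (at_idx X i) (at_idx Y j)) (at_idx Z l))" by simp
      show "trn ?T (i, (j, l)) (i', (j', l')) (a1, (a2, a3)) (tens_assoc c (at_idx X i) (at_idx Y j) (at_idx Z l) x)
        = tens_assoc c (at_idx X i') (at_idx Y j') (at_idx Z l') (trn ?S ((i, j), l) ((i', j'), l') ((a1, a2), a3) x)"
        using tens_assoc_natural[OF ind_bs[OF X p(2)] ind_bs[OF Y p(3)] ind_bs[OF Z p(4)] ind_bs[OF X q(2)] ind_bs[OF Y q(3)] ind_bs[OF Z q(4)]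
            ind_trn[OF X p(2) q(2,6)] ind_trn[OF Y p(3) q(3,7)] ind_trn[OF Z p(4) q(4,8)] x] by simp
    qed simp
  qed
qed

lemma ind_lunit:
  assumes X: "isind X"
  shows ind_lunit_hom: "ind_lunit v c X \<in> ind_hom (ind_tensor c (ind_const (base_field v)) X) X"
    and ind_lunit_mem: "!!i u. i \<in> idx X ==> (i, tens_lunit v c (at_idx X i)) \<in> ind_lunit v c X (u, i)"
proof -
  let ?S = "ind_tensor c (ind_const (base_field v)) X"
  note S = ind_tensor_isind[OF ind_const_isind[OF bs_base] X]
  have hom: "tens_lunit v c (at_idx X i) \<in> bl_hom (at_idx ?S (u, i)) (at_idx X i)" if "i \<in> idx X" for u i
    using tens_lunit_hom[OF ind_bs[OF X that]] by simp
  have germ: "ind_lunit v c X (u, i) = germ (at_idx ?S (u, i)) X i (tens_lunit v c (at_idx X i))" if "i \<in> idx X" for u i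
    using that by (simp add: ind_lunit_def)
  show "(i, tens_lunit v c (at_idx X i)) \<in> ind_lunit v c X (u, i)" if "i \<in> idx X" for u i
    unfolding germ[OF that] by (rule germ_self[OF X that hom[OF that]])
  show "ind_lunit v c X \<in> ind_hom ?S X"
  proof (rule ih_intro[OF S X, where J=snd and F="%p. tens_lunit v c (at_idx X (snd p))"])
    show "ind_lunit v c X \<in> extensional (idx ?S)" unfolding ind_lunit_def by (rule restrict_extensional)
    fix p assume "p \<in> idx ?S"
    then obtain u i where p: "p = (u, i)" "i \<in> idx X" by auto
    show "snd p \<in> idx X" using p by simp
    show "tens_lunit v c (at_idx X (snd p)) \<in> bl_hom (at_idx ?S p) (at_idx X (snd p))"
      unfolding p snd_conv by (rule hom[OF p(2)])
    show "ind_lunit v c X p = germ (at_idx ?S p) X (snd p) (tens_lunit v c (at_idx X (snd p)))"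
      unfolding p snd_conv by (rule germ[OF p(2)])
    fix q a assume "q \<in> idx ?S" "a \<in> arr ?S p q"
    then obtain u' i' a1 a2 where q: "q = (u', i')" "i' \<in> idx X" "a = (a1, a2)" "a2 \<in> arr X i i'" using p by auto
    have 1: "geq X (elts ?S p) i (tens_lunit v c (at_idx X i)) i' (%x. trn X i i' a2 (tens_lunit v c (at_idx X i) x))"
      by (rule geq_trn[OF X p(2) q(2,4)]) (use bl_closed[OF hom[OF p(2)]] p in blast)
    show "geq X (elts ?S p) (snd p) (tens_lunit v c (at_idx X (snd p))) (snd q)
        (%x. tens_lunit v c (at_idx X (snd q)) (trn ?S p q a x))"
      unfolding p q snd_conv
    proof (rule geq_cong[OF 1[unfolded p]])
      fix x assume "x \<in> elts ?S (u, i)"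
      hence "x \<in> carrier (tensor c (base_field v) (at_idx X i))" by simp
      from tens_lunit_natural[OF ind_bs[OF X p(2)] ind_bs[OF X q(2)] ind_trn[OF X p(2) q(2,4)] this]
      show "trn X i i' a2 (tens_lunit v c (at_idx X i) x) = tens_lunit v c (at_idx X i') (trn ?S (u, i) (u', i') (a1, a2) x)"
        by simp
    qed simp
  qed
qed

text \<open>A choice of representatives of both morphisms at i is packed into one q with
  \<open>Q i q\<close>. Representatives of equal germs agree whatever the choice, while one agreeing
  choice at each index already forces equality.\<close>

lemma ih_eq_iff:
  assumes X: "isind X" and Y: "isind Y" and \<phi>: "\<phi> \<in> ind_hom X Y" and \<psi>: "\<psi> \<in> ind_hom X Y"
    and ne: "!!i. i \<in> idx X ==> \<exists>q. Q i q"
    and mem: "!!i q. i \<in> idx X ==> Q i q ==> (J q, F i q) \<in> \<phi> i" "!!i q. i \<in> idx X ==> Q i q ==> (J' q, F' i q) \<in> \<psi> i"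
  shows "\<phi> = \<psi> \<longleftrightarrow> (\<forall>i\<in>idx X. \<forall>q. Q i q --> geq Y (elts X i) (J q) (F i q) (J' q) (F' i q))"
    and "(!!i. i \<in> idx X ==> \<exists>q. Q i q \<and> geq Y (elts X i) (J q) (F i q) (J' q) (F' i q)) ==> \<phi> = \<psi>"
proof -
  show *: "(!!i. i \<in> idx X ==> \<exists>q. Q i q \<and> geq Y (elts X i) (J q) (F i q) (J' q) (F' i q)) ==> \<phi> = \<psi>"
  proof (rule ih_eqI[OF X Y \<phi> \<psi>])
    fix i assume i: "i \<in> idx X" and "!!i. i \<in> idx X ==> \<exists>q. Q i q \<and> geq Y (elts X i) (J q) (F i q) (J' q) (F' i q)"
    then obtain q where q: "Q i q" "geq Y (elts X i) (J q) (F i q) (J' q) (F' i q)" by blast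
    show "\<exists>j f j' f'. (j, f) \<in> \<phi> i \<and> (j', f') \<in> \<psi> i \<and> geq Y (elts X i) j f j' f'"
      using mem(1)[OF i q(1)] mem(2)[OF i q(1)] q(2) by blast
  qed
  show "\<phi> = \<psi> \<longleftrightarrow> (\<forall>i\<in>idx X. \<forall>q. Q i q --> geq Y (elts X i) (J q) (F i q) (J' q) (F' i q))"
  proof
    assume e: "\<phi> = \<psi>"
    show "\<forall>i\<in>idx X. \<forall>q. Q i q --> geq Y (elts X i) (J q) (F i q) (J' q) (F' i q)"
    proof (intro ballI allI impI)
      fix i q assume i: "i \<in> idx X" and q: "Q i q"
      show "geq Y (elts X i) (J q) (F i q) (J' q) (F' i q)"
        by (rule ih_geq[OF X Y \<psi> i mem(1)[OF i q, unfolded e] mem(2)[OF i q]])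
    qed
  next
    assume a: "\<forall>i\<in>idx X. \<forall>q. Q i q --> geq Y (elts X i) (J q) (F i q) (J' q) (F' i q)"
    show "\<phi> = \<psi>"
    proof (rule *)
      fix i assume i: "i \<in> idx X"
      obtain q where "Q i q" using ne[OF i] by (rule exE)
      thus "\<exists>q. Q i q \<and> geq Y (elts X i) (J q) (F i q) (J' q) (F' i q)" using a i by blast
    qed
  qed
qed

end

section \<open>Coactions and evaluations\<close>

context universe
begin

abbreviation "kC \<equiv> ind_const C"
abbreviation AX :: "('j, 'n, 'k, 'b) ind => (unit \<times> 'j, unit \<times> 'n, 'k, ('g => 'k, 'b) tens) ind" where
  "AX X \<equiv> ind_tensor c (ind_const C) X"

text \<open>The stages of C \<otimes> X no longer lie in the universe type. Smallness of the stages
  is kept by tensoring with C, and it is what makes evaluations separate elements.\<close>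

definition sind :: "('j, 'n, 'k, 'b) ind => bool" where
  "sind Y \<longleftrightarrow> isind Y \<and> (\<forall>j\<in>idx Y. small (at_idx Y j))"

lemma sindD: "sind Y ==> isind Y" "sind Y ==> j \<in> idx Y ==> small (at_idx Y j)"
  by (auto simp: sind_def)

lemma sind_u: "isind (X :: ('j, 'n, 'k, 'u) ind) ==> sind X"
  by (simp add: sind_def small_u ind_bs)

lemma kC_isind: "isind kC"
  by (rule ind_const_isind[OF bs_C])

lemma AX_isind: "isind X ==> isind (AX X)"
  by (rule ind_tensor_isind[OF kC_isind])

lemma sind_AX: "sind Y ==> sind (AX Y)"
  unfolding sind_def using AX_isind small_tensor by auto

lemma AX_trn: "trn (AX X) (u, j) (u', l) (w, a) = tens_map c C C (at_idx X j) (at_idx X l) (ban_id C) (trn X j l a)"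
  by simp

text \<open>Transition maps of C \<otimes> Y commute with evaluation, so where two elements agree,
  all their evaluations agree. Conversely, if all evaluations agree at one stage, then
  \<open>ev_inj\<close> gives equality there; this needs the stage to be the same for all g.\<close>

lemma geq_AX:
  assumes Y: "sind Y" and j: "j \<in> idx Y" "j' \<in> idx Y"
    and f: "!!x. x \<in> P ==> f x \<in> carrier (tC (at_idx Y j))" "!!x. x \<in> P ==> f' x \<in> carrier (tC (at_idx Y j'))"
  shows "geq (AX Y) P (u, j) f (u', j') f' \<longleftrightarrow>
    geq Y (UNIV \<times> P) j (%(g, x). ev (at_idx Y j) g (f x)) j' (%(g, x). ev (at_idx Y j') g (f' x))"
proof -
  note iY = sindD(1)[OF Y]
  have e: "ev (at_idx Y l) g (trn (AX Y) (u, j) (w, l) (z, a) t) = trn Y j l a (ev (at_idx Y j) g t)"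
    if "j \<in> idx Y" "l \<in> idx Y" "a \<in> arr Y j l" "t \<in> carrier (tC (at_idx Y j))" for j l a g t and u w z :: unit
    unfolding AX_trn by (rule ev_natural[OF ind_bs[OF iY that(1)] ind_bs[OF iY that(2)] ind_trn[OF iY that(1-3)] that(4)])
  have cl: "trn (AX Y) (u, j) (w, l) (z, a) t \<in> carrier (tC (at_idx Y l))"
    if "j \<in> idx Y" "l \<in> idx Y" "a \<in> arr Y j l" "t \<in> carrier (tC (at_idx Y j))" for j l a t and u w z :: unit
    using ind_trn_closed[OF AX_isind[OF iY], of "(u, j)" "(w, l)" "(z, a)" t] that by simp
  show ?thesis
  proof
    assume g: "geq (AX Y) P (u, j) f (u', j') f'"
    obtain l0 a0 b0 where l0: "l0 \<in> idx (AX Y)" "a0 \<in> arr (AX Y) (u, j) l0" "b0 \<in> arr (AX Y) (u', j') l0"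
      "!!x. x \<in> P ==> trn (AX Y) (u, j) l0 a0 (f x) = trn (AX Y) (u', j') l0 b0 (f' x)" by (rule geqE[OF g]) blast
    obtain w l where l: "l0 = (w, l)" by (cases l0)
    obtain z a where a: "a0 = (z, a)" by (cases a0)
    obtain z' b where b: "b0 = (z', b)" by (cases b0)
    have m: "l \<in> idx Y" "a \<in> arr Y j l" "b \<in> arr Y j' l" using l0 l a b by auto
    show "geq Y (UNIV \<times> P) j (%(g, x). ev (at_idx Y j) g (f x)) j' (%(g, x). ev (at_idx Y j') g (f' x))"
    proof (rule geqI[OF m])
      fix p :: "'g \<times> 'd" assume "p \<in> UNIV \<times> P"
      then obtain g x where p: "p = (g, x)" "x \<in> P" by auto
      have "ev (at_idx Y l) g (trn (AX Y) (u, j) (w, l) (z, a) (f x)) = ev (at_idx Y l) g (trn (AX Y) (u', j') (w, l) (z', b) (f' x))"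
        using l0(4)[OF p(2)] unfolding l a b by (simp only:)
      thus "trn Y j l a (case p of (g, x) => ev (at_idx Y j) g (f x)) = trn Y j' l b (case p of (g, x) => ev (at_idx Y j') g (f' x))"
        unfolding p prod.case e[OF j(1) m(1,2) f(1)[OF p(2)]] e[OF j(2) m(1,3) f(2)[OF p(2)]] .
    qed
  next
    assume g: "geq Y (UNIV \<times> P) j (%(g, x). ev (at_idx Y j) g (f x)) j' (%(g, x). ev (at_idx Y j') g (f' x))"
    obtain l a b where l: "l \<in> idx Y" "a \<in> arr Y j l" "b \<in> arr Y j' l"
      "!!p. p \<in> UNIV \<times> P ==> trn Y j l a (case p of (g, x) => ev (at_idx Y j) g (f x)) = trn Y j' l b (case p of (g, x) => ev (at_idx Y j') g (f' x))"
      by (rule geqE[OF g]) blast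
    show "geq (AX Y) P (u, j) f (u', j') f'"
    proof (rule geqI[of "((), l)" _ "((), a)" _ "((), b)"])
      fix x assume x: "x \<in> P"
      show "trn (AX Y) (u, j) ((), l) ((), a) (f x) = trn (AX Y) (u', j') ((), l) ((), b) (f' x)"
      proof (rule ev_inj[OF sindD(2)[OF Y l(1)] cl[OF j(1) l(1,2) f(1)[OF x]] cl[OF j(2) l(1,3) f(2)[OF x]]])
        fix g
        show "ev (at_idx Y l) g (trn (AX Y) (u, j) ((), l) ((), a) (f x)) = ev (at_idx Y l) g (trn (AX Y) (u', j') ((), l) ((), b) (f' x))"
          unfolding e[OF j(1) l(1,2) f(1)[OF x]] e[OF j(2) l(1,3) f(2)[OF x]] using l(4)[of "(g, x)"] x by simp
      qed
    qed (use l in auto)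
  qed
qed

lemma AX_mem:
  assumes X: "isind X" and Y: "isind Y" and \<rho>: "\<rho> \<in> ind_hom X (AX Y)" and i: "i \<in> idx X" and m: "((u, j), r) \<in> \<rho> i"
  shows "j \<in> idx Y" "r \<in> bl_hom (at_idx X i) (tC (at_idx Y j))"
  using ih_mem[OF X AX_isind[OF Y] \<rho> i m] by auto

lemma AX_ne:
  assumes X: "isind X" and Y: "isind Y" and \<rho>: "\<rho> \<in> ind_hom X (AX Y)" and i: "i \<in> idx X"
  shows "\<exists>j r. (((), j), r) \<in> \<rho> i"
  using ih_ne[OF X AX_isind[OF Y] \<rho> i] by auto

text \<open>The parameters come as (h, g, x) because each use of \<open>geq_AX\<close> puts its
  group element in front: first g from the outer factor C, then h from the inner one.\<close>

definition coassociative :: "('k, 'u) uind => ('u => ((unit \<times> 'u) \<times> ('u => ('g => 'k, 'u) tens)) set) => bool" where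
  "coassociative X \<rho> \<longleftrightarrow> (\<forall>i\<in>idx X. \<forall>j r l s. (((), j), r) \<in> \<rho> i --> (((), l), s) \<in> \<rho> j -->
     geq X (UNIV \<times> UNIV \<times> elts X i) l (%(h, g, x). ev (at_idx X l) h (s (ev (at_idx X j) g (r x))))
       j (%(h, g, x). ev (at_idx X j) (g + h) (r x)))"

definition counital :: "('k, 'u) uind => ('u => ((unit \<times> 'u) \<times> ('u => ('g => 'k, 'u) tens)) set) => bool" where
  "counital X \<rho> \<longleftrightarrow> (\<forall>i\<in>idx X. \<forall>j r. (((), j), r) \<in> \<rho> i -->
     geq X (elts X i) j (%x. ev (at_idx X j) 0 (r x)) i (%x. x))"

lemma comodule_iff:
  "is_comodule v c (group_bialg v c :: ('k, 'g => 'k) bialg) M \<longleftrightarrow>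
    isind (fst M) \<and> snd M \<in> ind_hom (fst M) (AX (fst M)) \<and> coassociative (fst M) (snd M) \<and> counital (fst M) (snd M)"
proof (cases "isind (fst M) \<and> snd M \<in> ind_hom (fst M) (AX (fst M))")
  case False thus ?thesis unfolding is_comodule_def Let_def gb_simps by blast
next
  case True
  define X where "X = fst M"
  define \<rho> where "\<rho> = snd M"
  have X: "isind X" and \<rho>: "\<rho> \<in> ind_hom X (AX X)" using True by (auto simp: X_def \<rho>_def)
  let ?k = "ind_const (base_field v)"
  let ?AA = "ind_tensor c kC kC" and ?AAX = "AX (AX X)"
  let ?\<Delta> = "%_::unit. germ C ?AA ((), ()) \<Delta>"
  let ?\<epsilon> = "ind_const_map C (base_field v) (\<lambda>f\<in>carrier C. f (0::'g))"
  note AXi = AX_isind[OF X]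
  note AAXi = AX_isind[OF AXi]
  note AAi = ind_tensor_isind[OF kC_isind kC_isind]
  note AA_Xi = ind_tensor_isind[OF AAi X]
  note ki = ind_const_isind[OF bs_base]
  note kXi = ind_tensor_isind[OF ki X]
  have B: "bs CC" by simp
  have \<Delta>: "?\<Delta> \<in> ind_hom kC ?AA" "(((), ()), \<Delta>) \<in> ?\<Delta> ()"
  proof -
    show "?\<Delta> \<in> ind_hom kC ?AA"
    proof (rule ih_intro[OF kC_isind AAi, where J="%_. ((), ())" and F="%_. \<Delta>"])
      show "geq ?AA (carrier (at_idx kC i)) ((), ()) \<Delta> ((), ()) (%x. \<Delta> (trn kC i i' a x))" for i i' a
        by (rule geq_cong[OF geq_refl[OF AAi, of "((), ())"]]) auto
    qed (use comul_C(1) in auto)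
    show "(((), ()), \<Delta>) \<in> ?\<Delta> ()" by (rule germ_self[OF AAi]) (use comul_C(1) in auto)
  qed
  have \<epsilon>: "?\<epsilon> \<in> ind_hom kC ?k" "((), \<lambda>f\<in>carrier C. f (0::'g)) \<in> ?\<epsilon> ()"
  proof -
    show "?\<epsilon> \<in> ind_hom kC ?k"
    proof (rule ih_intro[OF kC_isind ki, where J="%_. ()" and F="%_. \<lambda>f\<in>carrier C. f (0::'g)"])
      show "geq ?k (carrier (at_idx kC i)) () (\<lambda>f\<in>carrier C. f (0::'g)) () (%x. (\<lambda>f\<in>carrier C. f (0::'g)) (trn kC i i' a x))" for i i' a
        by (rule geq_cong[OF geq_refl[OF ki, of "()"]]) auto
    qed (use counit_C in \<open>auto simp: ind_const_map_def\<close>)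
    show "((), \<lambda>f\<in>carrier C. f (0::'g)) \<in> ?\<epsilon> ()" unfolding ind_const_map_def by (rule germ_self[OF ki]) (use counit_C in auto)
  qed
  note idm = ind_id_mem[OF kC_isind, of "()", simplified]
  have uC: "() \<in> idx kC" by simp
  let ?L = "ind_comp X (AX X) ?AAX (ind_tensor_map c kC kC X (AX X) (ind_id kC) \<rho>) \<rho>"
  let ?R = "ind_comp X (ind_tensor c ?AA X) ?AAX (ind_assoc c kC kC X)
               (ind_comp X (AX X) (ind_tensor c ?AA X) (ind_tensor_map c kC ?AA X X ?\<Delta> (ind_id X)) \<rho>)"
  let ?E = "ind_comp X (ind_tensor c ?k X) X (ind_lunit v c X)
             (ind_comp X (AX X) (ind_tensor c ?k X) (ind_tensor_map c kC ?k X X ?\<epsilon> (ind_id X)) \<rho>)"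
  note t1 = ind_tensor_map_hom[OF kC_isind kC_isind X AXi ind_id_hom[OF kC_isind] \<rho>]
  note t2 = ind_tensor_map_hom[OF kC_isind AAi X X \<Delta>(1) ind_id_hom[OF X]]
  note t3 = ind_tensor_map_hom[OF kC_isind ki X X \<epsilon>(1) ind_id_hom[OF X]]
  note L = ind_comp_hom[OF X AXi AAXi \<rho> t1]
  note R1 = ind_comp_hom[OF X AXi AA_Xi \<rho> t2]
  note R = ind_comp_hom[OF X AA_Xi AAXi R1 ind_assoc_hom[OF kC_isind kC_isind X]]
  note E1 = ind_comp_hom[OF X AXi kXi \<rho> t3]
  note E = ind_comp_hom[OF X kXi X E1 ind_lunit_hom[OF X]]
  note M = AX_mem[OF X X \<rho>]
  \<comment> \<open>Representatives at i of the two sides of coassociativity, built from a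
    representative (j, r) of \<rho> at i and a representative (l, s) of \<rho> at j.\<close>
  let ?FL = "%i (j, r, l, s). compose (elts X i) (tens_map c C C (at_idx X j) (tC (at_idx X l)) (ban_id C) s) r"
  let ?FR = "%i (j, r, l, s). compose (elts X i) (tens_assoc c C C (at_idx X j))
      (compose (elts X i) (tens_map c C CC (at_idx X j) (at_idx X j) \<Delta> (ban_id (at_idx X j))) r)"
  have mL: "(((), ((), l)), ?FL i (j, r, l, s)) \<in> ?L i" if m: "i \<in> idx X" "(((), j), r) \<in> \<rho> i" "(((), l), s) \<in> \<rho> j" for i j r l s
  proof -
    note J = M[OF m(1,2)]
    note S = M[OF J(1) m(3)]
    have "(((), ((), l)), tens_map c C C (at_idx X j) (tC (at_idx X l)) (ban_id C) s) \<in> ind_tensor_map c kC kC X (AX X) (ind_id kC) \<rho> ((), j)"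
      using ind_tensor_map_mem[OF kC_isind kC_isind X AXi ind_id_hom[OF kC_isind] \<rho> _ J(1) idm m(3)] by simp
    from ind_comp_mem[OF X AXi AAXi \<rho> t1 m(1,2) this] show ?thesis by simp
  qed
  have mR: "(((), ((), j)), ?FR i (j, r, l, s)) \<in> ?R i" if m: "i \<in> idx X" "(((), j), r) \<in> \<rho> i" "(((), l), s) \<in> \<rho> j" for i j r l s
  proof -
    note J = M[OF m(1,2)]
    have 1: "((((), ()), j), tens_map c C CC (at_idx X j) (at_idx X j) \<Delta> (ban_id (at_idx X j))) \<in> ind_tensor_map c kC ?AA X X ?\<Delta> (ind_id X) ((), j)"
      using ind_tensor_map_mem[OF kC_isind AAi X X \<Delta>(1) ind_id_hom[OF X] _ J(1) \<Delta>(2) ind_id_mem[OF X J(1)]] by simp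
    have 2: "(((), ((), j)), tens_assoc c C C (at_idx X j)) \<in> ind_assoc c kC kC X (((), ()), j)"
      using ind_assoc_mem[OF kC_isind kC_isind X _ _ J(1), of "()" "()"] by simp
    from ind_comp_mem[OF X AA_Xi AAXi R1 ind_assoc_hom[OF kC_isind kC_isind X] m(1) ind_comp_mem[OF X AXi AA_Xi \<rho> t2 m(1,2) 1] 2]
    show ?thesis by simp
  qed
  have eqL: "?L = ?R \<longleftrightarrow> coassociative X \<rho>"
  proof -
    let ?Q = "%i (j, r, l, s). (((), j), r) \<in> \<rho> i \<and> (((), l), s) \<in> \<rho> j"
    have "?L = ?R \<longleftrightarrow> (\<forall>i\<in>idx X. \<forall>q. ?Q i q -->
        geq ?AAX (elts X i) ((%(j, r, l, s). ((), ((), l))) q) (?FL i q) ((%(j, r, l, s). ((), ((), j))) q) (?FR i q))"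
    proof (rule ih_eq_iff(1)[OF X AAXi L R])
      fix i assume i: "i \<in> idx X"
      obtain j r where j: "(((), j), r) \<in> \<rho> i" using AX_ne[OF X X \<rho> i] by blast
      obtain l s where "(((), l), s) \<in> \<rho> j" using AX_ne[OF X X \<rho> M(1)[OF i j]] by blast
      thus "\<exists>q. ?Q i q" using j by auto
    next
      fix i and q assume i: "i \<in> idx X" and q: "?Q i q"
      obtain j r l s where q': "q = (j, r, l, s)" by (cases q) auto
      have a: "(((), j), r) \<in> \<rho> i" "(((), l), s) \<in> \<rho> j" using q by (auto simp: q')
      show "((%(j, r, l, s). ((), ((), l))) q, ?FL i q) \<in> ?L i" using mL[OF i a] unfolding q' prod.case .
      show "((%(j, r, l, s). ((), ((), j))) q, ?FR i q) \<in> ?R i" using mR[OF i a] unfolding q' prod.case .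
    qed
    also have "\<dots> \<longleftrightarrow> coassociative X \<rho>"
    proof -
      have "geq ?AAX (elts X i) ((), ((), l)) (?FL i (j, r, l, s)) ((), ((), j)) (?FR i (j, r, l, s)) \<longleftrightarrow>
        geq X (UNIV \<times> UNIV \<times> elts X i) l (%(h, g, x). ev (at_idx X l) h (s (ev (at_idx X j) g (r x))))
           j (%(h, g, x). ev (at_idx X j) (g + h) (r x))"
        if m: "i \<in> idx X" "(((), j), r) \<in> \<rho> i" "(((), l), s) \<in> \<rho> j" for i j r l s
      proof -
        note J = M[OF m(1,2)]
        note S = M[OF J(1) m(3)]
        note bj = ind_bs[OF X J(1)] and bl = ind_bs[OF X S(1)]
        have bT: "bs (tC (at_idx X l))" "bs (tC (at_idx X j))" using bj bl by auto
        note h1 = tens_map_hom[OF bs_C bj bs_C bT(1) bl_id[OF bs_C] S(2)]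
        note h2 = tens_map_hom[OF bs_C bj B bj comul_C(1) bl_id[OF bj]]
        note h3 = tens_assoc_hom[OF bs_C bs_C bj]
        have fl: "?FL i (j, r, l, s) x \<in> carrier (tC (tC (at_idx X l)))" if "x \<in> elts X i" for x
          using bl_closed[OF h1 bl_closed[OF J(2) that]] that by (simp add: compose_eq)
        have fr: "?FR i (j, r, l, s) x \<in> carrier (tC (tC (at_idx X j)))" if "x \<in> elts X i" for x
          using bl_closed[OF h3 bl_closed[OF h2 bl_closed[OF J(2) that]]] that by (simp add: compose_eq)
        have "geq ?AAX (elts X i) ((), ((), l)) (?FL i (j, r, l, s)) ((), ((), j)) (?FR i (j, r, l, s)) \<longleftrightarrow>
          geq (AX X) (UNIV \<times> elts X i) ((), l) (%(g, x). ev (tC (at_idx X l)) g (?FL i (j, r, l, s) x))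
            ((), j) (%(g, x). ev (tC (at_idx X j)) g (?FR i (j, r, l, s) x))"
          using geq_AX[OF sind_AX[OF sind_u[OF X]], of "((), l)" "((), j)" "elts X i" "?FL i (j, r, l, s)" "?FR i (j, r, l, s)" "()" "()"]
            J(1) S(1) fl fr by simp
        also have "\<dots> \<longleftrightarrow> geq X (UNIV \<times> UNIV \<times> elts X i)
            l (%(h, p). ev (at_idx X l) h ((%(g, x). ev (tC (at_idx X l)) g (?FL i (j, r, l, s) x)) p))
            j (%(h, p). ev (at_idx X j) h ((%(g, x). ev (tC (at_idx X j)) g (?FR i (j, r, l, s) x)) p))"
        proof (rule geq_AX[OF sind_u[OF X] S(1) J(1)])
          fix p :: "'g \<times> 'u" assume "p \<in> UNIV \<times> elts X i"
          then obtain g x where p: "p = (g, x)" "x \<in> elts X i" by auto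
          show "(%(g, x). ev (tC (at_idx X l)) g (?FL i (j, r, l, s) x)) p \<in> carrier (tC (at_idx X l))"
            "(%(g, x). ev (tC (at_idx X j)) g (?FR i (j, r, l, s) x)) p \<in> carrier (tC (at_idx X j))"
            using ev_closed[OF bT(1) fl[OF p(2)]] ev_closed[OF bT(2) fr[OF p(2)]] p by simp_all
        qed
        also have "\<dots> \<longleftrightarrow> geq X (UNIV \<times> UNIV \<times> elts X i) l (%(h, g, x). ev (at_idx X l) h (s (ev (at_idx X j) g (r x))))
           j (%(h, g, x). ev (at_idx X j) (g + h) (r x))"
        proof -
          have a: "(%(h, p). ev (at_idx X l) h ((%(g, x). ev (tC (at_idx X l)) g (?FL i (j, r, l, s) x)) p)) p
             = (%(h, g, x). ev (at_idx X l) h (s (ev (at_idx X j) g (r x)))) p"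
            if p: "p \<in> UNIV \<times> UNIV \<times> elts X i" for p
          proof -
            obtain h g x where p: "p = (h, g, x)" "x \<in> elts X i" using p by auto
            show ?thesis using ev_natural[OF bj bT(1) S(2) bl_closed[OF J(2) p(2)], of g] p by (simp add: compose_eq)
          qed
          have b: "(%(h, p). ev (at_idx X j) h ((%(g, x). ev (tC (at_idx X j)) g (?FR i (j, r, l, s) x)) p)) p
             = (%(h, g, x). ev (at_idx X j) (g + h) (r x)) p"
            if p: "p \<in> UNIV \<times> UNIV \<times> elts X i" for p
          proof -
            obtain h g x where p: "p = (h, g, x)" "x \<in> elts X i" using p by auto
            show ?thesis using ev_coassoc[OF bj bl_closed[OF J(2) p(2)], of h g] p by (simp add: compose_eq)
          qed
          show ?thesis
          proof
            assume g: "geq X (UNIV \<times> UNIV \<times> elts X i)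
              l (%(h, p). ev (at_idx X l) h ((%(g, x). ev (tC (at_idx X l)) g (?FL i (j, r, l, s) x)) p))
              j (%(h, p). ev (at_idx X j) h ((%(g, x). ev (tC (at_idx X j)) g (?FR i (j, r, l, s) x)) p))"
            show "geq X (UNIV \<times> UNIV \<times> elts X i) l (%(h, g, x). ev (at_idx X l) h (s (ev (at_idx X j) g (r x))))
              j (%(h, g, x). ev (at_idx X j) (g + h) (r x))" by (rule geq_cong[OF g a b])
          next
            assume g: "geq X (UNIV \<times> UNIV \<times> elts X i) l (%(h, g, x). ev (at_idx X l) h (s (ev (at_idx X j) g (r x))))
              j (%(h, g, x). ev (at_idx X j) (g + h) (r x))"
            show "geq X (UNIV \<times> UNIV \<times> elts X i)
              l (%(h, p). ev (at_idx X l) h ((%(g, x). ev (tC (at_idx X l)) g (?FL i (j, r, l, s) x)) p))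
              j (%(h, p). ev (at_idx X j) h ((%(g, x). ev (tC (at_idx X j)) g (?FR i (j, r, l, s) x)) p))"
              by (rule geq_cong[OF g a[symmetric] b[symmetric]])
          qed
        qed
        finally show ?thesis .
      qed
      thus ?thesis unfolding coassociative_def by auto
    qed
    finally show ?thesis .
  qed
  let ?FE = "%i (j, r). compose (elts X i) (tens_lunit v c (at_idx X j))
      (compose (elts X i) (tens_map c C (base_field v) (at_idx X j) (at_idx X j) (\<lambda>f\<in>carrier C. f (0::'g)) (ban_id (at_idx X j))) r)"
  have mE: "(j, ?FE i (j, r)) \<in> ?E i" if m: "i \<in> idx X" "(((), j), r) \<in> \<rho> i" for i j r
  proof -
    note J = M[OF m(1,2)]
    have 1: "(((), j), tens_map c C (base_field v) (at_idx X j) (at_idx X j) (\<lambda>f\<in>carrier C. f (0::'g)) (ban_id (at_idx X j)))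
        \<in> ind_tensor_map c kC ?k X X ?\<epsilon> (ind_id X) ((), j)"
      using ind_tensor_map_mem[OF kC_isind ki X X \<epsilon>(1) ind_id_hom[OF X] uC J(1) \<epsilon>(2) ind_id_mem[OF X J(1)]]
      unfolding ind_const_simps .
    from ind_comp_mem[OF X kXi X E1 ind_lunit_hom[OF X] m(1) ind_comp_mem[OF X AXi kXi \<rho> t3 m(1,2) 1] ind_lunit_mem[OF X J(1)]]
    show ?thesis unfolding prod.case .
  qed
  have eqE: "?E = ind_id X \<longleftrightarrow> counital X \<rho>"
  proof -
    have "?E = ind_id X \<longleftrightarrow> (\<forall>i\<in>idx X. \<forall>q. (((), fst q), snd q) \<in> \<rho> i -->
        geq X (elts X i) (fst q) (?FE i (fst q, snd q)) i (ban_id (at_idx X i)))"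
    proof -
      \<comment> \<open>\<open>ih_eq_iff\<close> lets the stage depend on the choice q alone. The
        stage of the identity is i, so q carries i as an extra component.\<close>
      have 1: "?E = ind_id X \<longleftrightarrow> (\<forall>i\<in>idx X. \<forall>q. ((((), fst q), fst (snd q)) \<in> \<rho> i \<and> snd (snd q) = i) -->
        geq X (elts X i) (fst q) (?FE i (fst q, fst (snd q))) (snd (snd q)) (ban_id (at_idx X i)))"
      proof (rule ih_eq_iff(1)[OF X X E ind_id_hom[OF X]])
        fix i assume i: "i \<in> idx X"
        show "\<exists>q. (((), fst q), fst (snd q)) \<in> \<rho> i \<and> snd (snd q) = i"
          using AX_ne[OF X X \<rho> i] by auto
      next
        fix i q assume i: "i \<in> idx X" and q: "(((), fst q), fst (snd q)) \<in> \<rho> i \<and> snd (snd q) = i"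
        show "(fst q, ?FE i (fst q, fst (snd q))) \<in> ?E i" using mE[OF i] q by blast
        show "(snd (snd q), ban_id (at_idx X i)) \<in> ind_id X i" using ind_id_mem[OF X i] q by simp
      qed
      show ?thesis unfolding 1 by auto
    qed
    also have "\<dots> \<longleftrightarrow> counital X \<rho>"
    proof -
      have "geq X (elts X i) j (?FE i (j, r)) i (ban_id (at_idx X i)) \<longleftrightarrow>
        geq X (elts X i) j (%x. ev (at_idx X j) 0 (r x)) i (%x. x)" if m: "i \<in> idx X" "(((), j), r) \<in> \<rho> i" for i j r
      proof -
        note J = M[OF m]
        have a: "?FE i (j, r) x = ev (at_idx X j) 0 (r x)" if x: "x \<in> elts X i" for x
          using ev_counit[OF ind_bs[OF X J(1)] bl_closed[OF J(2) x]] x by (simp add: compose_eq)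
        show ?thesis
        proof
          assume g: "geq X (elts X i) j (?FE i (j, r)) i (ban_id (at_idx X i))"
          show "geq X (elts X i) j (%x. ev (at_idx X j) 0 (r x)) i (%x. x)"
            by (rule geq_cong[OF g a]) simp_all
        next
          assume g: "geq X (elts X i) j (%x. ev (at_idx X j) 0 (r x)) i (%x. x)"
          show "geq X (elts X i) j (?FE i (j, r)) i (ban_id (at_idx X i))"
            by (rule geq_cong[OF g a[symmetric]]) simp_all
        qed
      qed
      thus ?thesis unfolding counital_def by auto
    qed
    finally show ?thesis .
  qed
  show ?thesis
    unfolding is_comodule_def Let_def gb_simps X_def[symmetric] \<rho>_def[symmetric] using X \<rho> eqL eqE by simp
qed

text \<open>The tuple lists representatives along both paths of the square: (j, r) and (j', f') for
  \<rho> followed by \<phi>, (m, f) and (n, s) for \<phi> followed by \<rho>'. The first part serves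
  to use a morphism, the second to establish one from a single choice per index.\<close>

lemma comodule_hom_iff:
  fixes X Y :: "('k, 'u) uind"
  assumes X: "isind X" and Y: "isind Y" and \<rho>: "\<rho> \<in> ind_hom X (AX X)" and \<rho>': "\<rho>' \<in> ind_hom Y (AX Y)"
  defines "Q \<equiv> %\<phi> i (j, r, j', f', m, f, n, s). (((), j), r) \<in> \<rho> i \<and> (j', f') \<in> \<phi> j \<and> (m, f) \<in> \<phi> i \<and> (((), n), s) \<in> \<rho>' m"
    and "E \<equiv> %i (j, r, j', f', m, f, n, s). geq Y (UNIV \<times> elts X i) j' (%(g, x). f' (ev (at_idx X j) g (r x)))
       n (%(g, x). ev (at_idx Y n) g (s (f x)))"
  shows "\<phi> \<in> comodule_hom c (group_bialg v c :: ('k, 'g => 'k) bialg) (X, \<rho>) (Y, \<rho>') \<longleftrightarrow>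
      \<phi> \<in> ind_hom X Y \<and> (\<forall>i\<in>idx X. \<forall>q. Q \<phi> i q --> E i q)"
    and "\<phi> \<in> ind_hom X Y ==> (!!i. i \<in> idx X ==> \<exists>q. Q \<phi> i q \<and> E i q) ==>
      \<phi> \<in> comodule_hom c (group_bialg v c :: ('k, 'g => 'k) bialg) (X, \<rho>) (Y, \<rho>')"
proof -
  let ?FL = "%i (j, r, j', f', m, f, n, s). compose (elts X i) (tens_map c C C (at_idx X j) (at_idx Y j') (ban_id C) f') r"
  let ?FR = "%i (j, r, j', f', m, f, n, s). compose (elts X i) s f"
  let ?L = "%\<phi>. ind_comp X (AX X) (AX Y) (ind_tensor_map c kC kC X Y (ind_id kC) \<phi>) \<rho>"
  let ?R = "%\<phi>. ind_comp X Y (AX Y) \<rho>' \<phi>"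
  let ?G = "%i q. geq (AX Y) (elts X i) ((%(j, r, j', f', m, f, n, s). ((), j')) q) (?FL i q)
       ((%(j, r, j', f', m, f, n, s). ((), n)) q) (?FR i q)"
  note AXi = AX_isind[OF X] and AYi = AX_isind[OF Y]
  note idm = ind_id_mem[OF kC_isind, of "()", simplified]
  have main: "(?L \<phi> = ?R \<phi> \<longleftrightarrow> (\<forall>i\<in>idx X. \<forall>q. Q \<phi> i q --> E i q)) \<and> ((\<forall>i\<in>idx X. \<exists>q. Q \<phi> i q \<and> E i q) --> ?L \<phi> = ?R \<phi>)"
    if \<phi>: "\<phi> \<in> ind_hom X Y" for \<phi>
  proof -
    note t1 = ind_tensor_map_hom[OF kC_isind kC_isind X Y ind_id_hom[OF kC_isind] \<phi>]
    note L = ind_comp_hom[OF X AXi AYi \<rho> t1] and R = ind_comp_hom[OF X Y AYi \<phi> \<rho>']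
    have ne: "\<exists>q. Q \<phi> i q" if i: "i \<in> idx X" for i
    proof -
      obtain j r where j: "(((), j), r) \<in> \<rho> i" using AX_ne[OF X X \<rho> i] by blast
      obtain j' f' where j': "(j', f') \<in> \<phi> j" using ih_ne[OF X Y \<phi> AX_mem(1)[OF X X \<rho> i j]] by blast
      obtain m f where m: "(m, f) \<in> \<phi> i" using ih_ne[OF X Y \<phi> i] by blast
      obtain n s where n: "(((), n), s) \<in> \<rho>' m" using AX_ne[OF Y Y \<rho>' ih_mem(1)[OF X Y \<phi> i m]] by blast
      show ?thesis by (rule exI[of _ "(j, r, j', f', m, f, n, s)"]) (use j j' m n in \<open>simp add: Q_def\<close>)
    qed
    have m1: "((%(j, r, j', f', m, f, n, s). ((), j')) q, ?FL i q) \<in> ?L \<phi> i" if i: "i \<in> idx X" and q: "Q \<phi> i q" for i q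
    proof -
      obtain j r j' f' m f n s where q': "q = (j, r, j', f', m, f, n, s)" by (cases q) auto
      have a: "(((), j), r) \<in> \<rho> i" "(j', f') \<in> \<phi> j" using q by (auto simp: Q_def q')
      note J = AX_mem[OF X X \<rho> i a(1)]
      have "(((), j'), tens_map c C C (at_idx X j) (at_idx Y j') (ban_id C) f') \<in> ind_tensor_map c kC kC X Y (ind_id kC) \<phi> ((), j)"
        using ind_tensor_map_mem[OF kC_isind kC_isind X Y ind_id_hom[OF kC_isind] \<phi> _ J(1) idm a(2)] by simp
      from ind_comp_mem[OF X AXi AYi \<rho> t1 i a(1) this] show ?thesis by (simp add: q')
    qed
    have m2: "((%(j, r, j', f', m, f, n, s). ((), n)) q, ?FR i q) \<in> ?R \<phi> i" if i: "i \<in> idx X" and q: "Q \<phi> i q" for i q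
    proof -
      obtain j r j' f' m f n s where q': "q = (j, r, j', f', m, f, n, s)" by (cases q) auto
      have a: "(m, f) \<in> \<phi> i" "(((), n), s) \<in> \<rho>' m" using q by (auto simp: Q_def q')
      show ?thesis using ind_comp_mem[OF X Y AYi \<phi> \<rho>' i a] by (simp add: q')
    qed
    have GE: "?G i q \<longleftrightarrow> E i q" if i: "i \<in> idx X" and q: "Q \<phi> i q" for i q
    proof -
      obtain j r j' f' m f n s where q': "q = (j, r, j', f', m, f, n, s)" by (cases q) auto
      have a: "(((), j), r) \<in> \<rho> i" "(j', f') \<in> \<phi> j" "(m, f) \<in> \<phi> i" "(((), n), s) \<in> \<rho>' m" using q by (auto simp: Q_def q')
      note J = AX_mem[OF X X \<rho> i a(1)] and N = ih_mem[OF X Y \<phi> i a(3)]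
      note J' = ih_mem[OF X Y \<phi> J(1) a(2)] and S = AX_mem[OF Y Y \<rho>' N(1) a(4)]
      note B = ind_bs[OF X J(1)] ind_bs[OF Y J'(1)]
      note tm = tens_map_hom[OF bs_C B(1) bs_C B(2) bl_id[OF bs_C] J'(2)]
      let ?fl = "compose (elts X i) (tens_map c C C (at_idx X j) (at_idx Y j') (ban_id C) f') r"
      let ?fr = "compose (elts X i) s f"
      have fl: "?fl x \<in> carrier (tC (at_idx Y j'))" if "x \<in> elts X i" for x
        using bl_closed[OF tm bl_closed[OF J(2) that]] that by (simp add: compose_eq)
      have fr: "?fr x \<in> carrier (tC (at_idx Y n))" if "x \<in> elts X i" for x
        using bl_closed[OF S(2) bl_closed[OF N(2) that]] that by (simp add: compose_eq)
      have 1: "?G i q \<longleftrightarrow> geq Y (UNIV \<times> elts X i) j' (%(g, x). ev (at_idx Y j') g (?fl x)) n (%(g, x). ev (at_idx Y n) g (?fr x))"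
        unfolding q' prod.case by (rule geq_AX[OF sind_u[OF Y] J'(1) S(1) fl fr])
      have a': "(%(g, x). ev (at_idx Y j') g (?fl x)) p = (%(g, x). f' (ev (at_idx X j) g (r x))) p"
        "(%(g, x). ev (at_idx Y n) g (?fr x)) p = (%(g, x). ev (at_idx Y n) g (s (f x))) p"
        if p: "p \<in> UNIV \<times> elts X i" for p
      proof -
        obtain g x where p: "p = (g, x)" "x \<in> elts X i" using p by auto
        show "(%(g, x). ev (at_idx Y j') g (?fl x)) p = (%(g, x). f' (ev (at_idx X j) g (r x))) p"
          using ev_natural[OF B J'(2) bl_closed[OF J(2) p(2)], of g] p by (simp add: compose_eq)
        show "(%(g, x). ev (at_idx Y n) g (?fr x)) p = (%(g, x). ev (at_idx Y n) g (s (f x))) p"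
          using p by (simp add: compose_eq)
      qed
      show ?thesis unfolding 1 unfolding E_def q' prod.case
      proof
        assume g: "geq Y (UNIV \<times> elts X i) j' (%(g, x). ev (at_idx Y j') g (?fl x)) n (%(g, x). ev (at_idx Y n) g (?fr x))"
        show "geq Y (UNIV \<times> elts X i) j' (%(g, x). f' (ev (at_idx X j) g (r x))) n (%(g, x). ev (at_idx Y n) g (s (f x)))"
          by (rule geq_cong[OF g a'])
      next
        assume g: "geq Y (UNIV \<times> elts X i) j' (%(g, x). f' (ev (at_idx X j) g (r x))) n (%(g, x). ev (at_idx Y n) g (s (f x)))"
        show "geq Y (UNIV \<times> elts X i) j' (%(g, x). ev (at_idx Y j') g (?fl x)) n (%(g, x). ev (at_idx Y n) g (?fr x))"
          by (rule geq_cong[OF g a'[symmetric]])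
      qed
    qed
    note I = ih_eq_iff[OF X AYi L R ne m1 m2]
    have i1: "?L \<phi> = ?R \<phi> \<longleftrightarrow> (\<forall>i\<in>idx X. \<forall>q. Q \<phi> i q --> ?G i q)" by (rule I(1))
    have i2: "(!!i. i \<in> idx X ==> \<exists>q. Q \<phi> i q \<and> ?G i q) ==> ?L \<phi> = ?R \<phi>" by (rule I(2))
    show ?thesis using i1 i2 GE by blast
  qed
  have D: "\<phi> \<in> comodule_hom c (group_bialg v c :: ('k, 'g => 'k) bialg) (X, \<rho>) (Y, \<rho>') \<longleftrightarrow> \<phi> \<in> ind_hom X Y \<and> ?L \<phi> = ?R \<phi>" for \<phi>
    unfolding comodule_hom_def Let_def gb_simps fst_conv snd_conv by simp
  show "\<phi> \<in> comodule_hom c (group_bialg v c :: ('k, 'g => 'k) bialg) (X, \<rho>) (Y, \<rho>') \<longleftrightarrow>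
      \<phi> \<in> ind_hom X Y \<and> (\<forall>i\<in>idx X. \<forall>q. Q \<phi> i q --> E i q)"
    unfolding D using main[of \<phi>] by blast
  show "\<phi> \<in> ind_hom X Y ==> (!!i. i \<in> idx X ==> \<exists>q. Q \<phi> i q \<and> E i q) ==>
      \<phi> \<in> comodule_hom c (group_bialg v c :: ('k, 'g => 'k) bialg) (X, \<rho>) (Y, \<rho>')"
    unfolding D using main[of \<phi>] by blast
qed

end

section \<open>From modules to comodules\<close>

text \<open>F is the identity on arrows and so fully faithful; what remains is essential
  surjectivity. The inverse picks for every d an object whose image is isomorphic to d and
  conjugates arrows with the chosen isomorphisms.\<close>

lemma equivalent_categoriesI:
  fixes C :: "('o, 'm) cat" and D :: "('p, 'm) cat"
  assumes C: "is_category C" and D: "is_category D"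
    and Ob: "!!a. a \<in> Ob C ==> F a \<in> Ob D"
    and Ar: "!!a b. a \<in> Ob C ==> b \<in> Ob C ==> Ar D (F a) (F b) = Ar C a b"
    and Id: "!!a. a \<in> Ob C ==> Idm D (F a) = Idm C a"
    and Co: "!!a b c f g. a \<in> Ob C ==> b \<in> Ob C ==> c \<in> Ob C ==> Cmp D (F a) (F b) (F c) g f = Cmp C a b c g f"
    and ess: "!!d. d \<in> Ob D ==> \<exists>a\<in>Ob C. \<exists>e. is_iso D (F a) d e"
  shows "equivalent_categories C D"
proof -
  have Did: "!!a. a \<in> Ob D ==> Idm D a \<in> Ar D a a"
    and Dcl: "!!a b c f g. a \<in> Ob D ==> b \<in> Ob D ==> c \<in> Ob D ==> f \<in> Ar D a b ==> g \<in> Ar D b c ==> Cmp D a b c g f \<in> Ar D a c"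
    and Dr: "!!a b f. a \<in> Ob D ==> b \<in> Ob D ==> f \<in> Ar D a b ==> Cmp D a a b f (Idm D a) = f"
    and Dl: "!!a b f. a \<in> Ob D ==> b \<in> Ob D ==> f \<in> Ar D a b ==> Cmp D a b b (Idm D b) f = f"
    and Das: "!!a b c d f g h. a \<in> Ob D ==> b \<in> Ob D ==> c \<in> Ob D ==> d \<in> Ob D ==> f \<in> Ar D a b ==> g \<in> Ar D b c ==> h \<in> Ar D c d ==>
        Cmp D a c d h (Cmp D a b c g f) = Cmp D a b d (Cmp D b c d h g) f"
    using D unfolding is_category_def by blast+
  have "\<forall>d. \<exists>a e e'. d \<in> Ob D --> a \<in> Ob C \<and> e \<in> Ar D (F a) d \<and> e' \<in> Ar D d (F a) \<and>
      Cmp D (F a) d (F a) e' e = Idm D (F a) \<and> Cmp D d (F a) d e e' = Idm D d"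
    using ess unfolding is_iso_def by blast
  then obtain G e e' where g: "!!d. d \<in> Ob D ==> G d \<in> Ob C" "!!d. d \<in> Ob D ==> e d \<in> Ar D (F (G d)) d"
    "!!d. d \<in> Ob D ==> e' d \<in> Ar D d (F (G d))"
    "!!d. d \<in> Ob D ==> Cmp D (F (G d)) d (F (G d)) (e' d) (e d) = Idm D (F (G d))"
    "!!d. d \<in> Ob D ==> Cmp D d (F (G d)) d (e d) (e' d) = Idm D d" by metis
  define Ff :: "('o, 'm, 'p, 'm) fctor" where "Ff = \<lparr>fob = F, far = (%_ _ f. f)\<rparr>"
  define ga where "ga d d' f = Cmp D (F (G d)) d' (F (G d')) (e' d') (Cmp D (F (G d)) d d' f (e d))" for d d' f
  define Gf :: "('p, 'm, 'o, 'm) fctor" where "Gf = \<lparr>fob = G, far = ga\<rparr>"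
  have FG: "F (G d) \<in> Ob D" if "d \<in> Ob D" for d by (rule Ob[OF g(1)[OF that]])
  have fe: "Cmp D (F (G d)) d d' f (e d) \<in> Ar D (F (G d)) d'" if "d \<in> Ob D" "d' \<in> Ob D" "f \<in> Ar D d d'" for d d' f
    by (rule Dcl[OF FG[OF that(1)] that(1,2) g(2)[OF that(1)] that(3)])
  have ga: "ga d d' f \<in> Ar D (F (G d)) (F (G d'))" if "d \<in> Ob D" "d' \<in> Ob D" "f \<in> Ar D d d'" for d d' f
    unfolding ga_def by (rule Dcl[OF FG[OF that(1)] that(2) FG[OF that(2)] fe[OF that] g(3)[OF that(2)]])
  have nat: "Cmp D (F (G d)) (F (G d')) d' (e d') (ga d d' f) = Cmp D (F (G d)) d d' f (e d)"
    if d: "d \<in> Ob D" "d' \<in> Ob D" "f \<in> Ar D d d'" for d d' f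
    unfolding ga_def Das[OF FG[OF d(1)] d(2) FG[OF d(2)] d(2) fe[OF d] g(3)[OF d(2)] g(2)[OF d(2)]] g(5)[OF d(2)]
    by (rule Dl[OF FG[OF d(1)] d(2) fe[OF d]])
  have F: "is_functor C D Ff"
    unfolding is_functor_def Ff_def using Ob Ar Id Co by simp
  have Gfun: "is_functor D C Gf"
    unfolding is_functor_def
  proof (intro conjI ballI)
    fix d assume d: "d \<in> Ob D"
    show "fob Gf d \<in> Ob C" using g(1)[OF d] by (simp add: Gf_def)
    show "far Gf d d (Idm D d) = Idm C (fob Gf d)"
      using Dr[OF d d Did[OF d]] Dl[OF FG[OF d] d g(2)[OF d]] g(4)[OF d] Id[OF g(1)[OF d]] by (simp add: Gf_def ga_def)
    fix d' assume d': "d' \<in> Ob D"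
    show "far Gf d d' f \<in> Ar C (fob Gf d) (fob Gf d')" if "f \<in> Ar D d d'" for f
      using ga[OF d d' that] Ar[OF g(1)[OF d] g(1)[OF d']] by (simp add: Gf_def)
    fix d'' f h assume d'': "d'' \<in> Ob D" and f: "f \<in> Ar D d d'" and h: "h \<in> Ar D d' d''"
    let ?F = "%d. F (G d)"
    have "Cmp D (?F d) (?F d') (?F d'') (ga d' d'' h) (ga d d' f)
      = Cmp D (?F d) d'' (?F d'') (e' d'') (Cmp D (?F d) (?F d') d'' (Cmp D (?F d') d' d'' h (e d')) (ga d d' f))"
      unfolding ga_def[of d' d'' h]
      by (rule Das[OF FG[OF d] FG[OF d'] d'' FG[OF d''] ga[OF d d' f] fe[OF d' d'' h] g(3)[OF d''], symmetric])
    also have "Cmp D (?F d) (?F d') d'' (Cmp D (?F d') d' d'' h (e d')) (ga d d' f)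
        = Cmp D (?F d) d' d'' h (Cmp D (?F d) (?F d') d' (e d') (ga d d' f))"
      by (rule Das[OF FG[OF d] FG[OF d'] d' d'' ga[OF d d' f] g(2)[OF d'] h, symmetric])
    also have "\<dots> = Cmp D (?F d) d' d'' h (Cmp D (?F d) d d' f (e d))" unfolding nat[OF d d' f] ..
    also have "\<dots> = Cmp D (?F d) d d'' (Cmp D d d' d'' h f) (e d)"
      by (rule Das[OF FG[OF d] d d' d'' g(2)[OF d] f h])
    finally have "ga d d'' (Cmp D d d' d'' h f) = Cmp D (?F d) (?F d') (?F d'') (ga d' d'' h) (ga d d' f)"
      by (simp add: ga_def[of d d''])
    thus "far Gf d d'' (Cmp D d d' d'' h f) = Cmp C (fob Gf d) (fob Gf d') (fob Gf d'') (far Gf d' d'' h) (far Gf d d' f)"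
      using Co[OF g(1)[OF d] g(1)[OF d'] g(1)[OF d'']] by (simp add: Gf_def)
  qed
  have n1: "naturally_isomorphic C C (comp_functor Gf Ff) id_functor"
    unfolding naturally_isomorphic_def
  proof (intro exI[of _ "%a. e (F a)"] conjI ballI)
    fix a assume a: "a \<in> Ob C"
    note Fa = Ob[OF a] and GFa = g(1)[OF Ob[OF a]]
    have i: "e (F a) \<in> Ar C (G (F a)) a" "e' (F a) \<in> Ar C a (G (F a))"
      using g(2)[OF Fa] g(3)[OF Fa] Ar[OF GFa a] Ar[OF a GFa] by auto
    show "is_iso C (fob (comp_functor Gf Ff) a) (fob id_functor a) (e (F a))"
      unfolding is_iso_def using i g(4)[OF Fa] g(5)[OF Fa] Co[OF GFa a GFa] Co[OF a GFa a] Id[OF a] Id[OF GFa]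
      by (auto simp: comp_functor_def id_functor_def Gf_def Ff_def)
    fix b f assume b: "b \<in> Ob C" and f: "f \<in> Ar C a b"
    note Fb = Ob[OF b] and GFb = g(1)[OF Ob[OF b]]
    have "f \<in> Ar D (F a) (F b)" using f Ar[OF a b] by simp
    from nat[OF Fa Fb this]
    show "Cmp C (fob (comp_functor Gf Ff) a) (fob (comp_functor Gf Ff) b) (fob id_functor b) (e (F b)) (far (comp_functor Gf Ff) a b f)
      = Cmp C (fob (comp_functor Gf Ff) a) (fob id_functor a) (fob id_functor b) (far id_functor a b f) (e (F a))"
      using Co[OF GFa GFb b] Co[OF GFa a b] by (simp add: comp_functor_def id_functor_def Gf_def Ff_def)
  qed
  have n2: "naturally_isomorphic D D (comp_functor Ff Gf) id_functor"
    unfolding naturally_isomorphic_def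
  proof (intro exI[of _ e] conjI ballI)
    fix d assume d: "d \<in> Ob D"
    show "is_iso D (fob (comp_functor Ff Gf) d) (fob id_functor d) (e d)"
      unfolding is_iso_def using g[OF d] by (auto simp: comp_functor_def id_functor_def Gf_def Ff_def)
    fix d' f assume "d' \<in> Ob D" "f \<in> Ar D d d'"
    from nat[OF d this]
    show "Cmp D (fob (comp_functor Ff Gf) d) (fob (comp_functor Ff Gf) d') (fob id_functor d') (e d') (far (comp_functor Ff Gf) d d' f)
      = Cmp D (fob (comp_functor Ff Gf) d) (fob id_functor d) (fob id_functor d') (far id_functor d d' f) (e d)"
      by (simp add: comp_functor_def id_functor_def Gf_def Ff_def)
  qed
  show ?thesis unfolding equivalent_categories_def using C D F Gfun n1 n2 by blast
qed

text \<open>Uncurrying turns a family of maps into one map on pairs, so that agreement uniformly in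
  g is an instance of \<open>geq\<close>.\<close>

definition act :: "('g => 'a => 'b) => 'g \<times> 'a => 'b" where "act \<sigma> p = \<sigma> (fst p) (snd p)"

lemma act_simp [simp]: "act \<sigma> (g, x) = \<sigma> g x" by (simp add: act_def)

lemma fam_germ_iff: "(j', \<sigma>') \<in> fam_germ A Y j \<sigma> \<longleftrightarrow>
   j' \<in> idx Y \<and> \<sigma>' \<in> sot_maps A (at_idx Y j') \<and> geq Y (UNIV \<times> carrier A) j (act \<sigma>) j' (act \<sigma>')"
  unfolding fam_germ_def geq_def compose_eq_iff by (auto simp: act_def)

section \<open>Germs of families and the laws of a module\<close>

context universe
begin

lemma sotD: "\<sigma> \<in> sot_maps A W ==> \<sigma> g \<in> bl_hom A W" "\<sigma> \<in> sot_maps A W ==> x \<in> carrier A ==> cont_into W (%g. \<sigma> g x)"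
  by (auto simp: sot_maps_def)

lemma sot_closed: "\<sigma> \<in> sot_maps A W ==> p \<in> UNIV \<times> carrier A ==> act \<sigma> p \<in> carrier W"
  using bl_closed[OF sotD(1)] by (auto simp: act_def)

lemma fam_germ_self: "isind Y ==> j \<in> idx Y ==> \<sigma> \<in> sot_maps A (at_idx Y j) ==> (j, \<sigma>) \<in> fam_germ A Y j \<sigma>"
  by (simp add: fam_germ_iff geq_refl)

lemma fam_germ_eqI:
  assumes Y: "isind Y" and j: "j \<in> idx Y" "j' \<in> idx Y" and f: "\<sigma> \<in> sot_maps A (at_idx Y j)" "\<sigma>' \<in> sot_maps A (at_idx Y j')"
    and g: "geq Y (UNIV \<times> carrier A) j (act \<sigma>) j' (act \<sigma>')"
  shows "fam_germ A Y j \<sigma> = fam_germ A Y j' \<sigma>'"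
proof -
  have "(l, h) \<in> fam_germ A Y j \<sigma> \<longleftrightarrow> (l, h) \<in> fam_germ A Y j' \<sigma>'" for l h
  proof -
    have "geq Y (UNIV \<times> carrier A) j (act \<sigma>) l (act h) \<longleftrightarrow> geq Y (UNIV \<times> carrier A) j' (act \<sigma>') l (act h)"
      if l: "l \<in> idx Y" "h \<in> sot_maps A (at_idx Y l)"
    proof
      assume 1: "geq Y (UNIV \<times> carrier A) j (act \<sigma>) l (act h)"
      show "geq Y (UNIV \<times> carrier A) j' (act \<sigma>') l (act h)"
        by (rule geq_trans[OF Y j(2,1) l(1) sot_closed[OF f(2)] sot_closed[OF f(1)] sot_closed[OF l(2)] geq_sym[OF g] 1])
    next
      assume 1: "geq Y (UNIV \<times> carrier A) j' (act \<sigma>') l (act h)"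
      show "geq Y (UNIV \<times> carrier A) j (act \<sigma>) l (act h)"
        by (rule geq_trans[OF Y j l(1) sot_closed[OF f(1)] sot_closed[OF f(2)] sot_closed[OF l(2)] g 1])
    qed
    thus ?thesis unfolding fam_germ_iff by blast
  qed
  thus ?thesis by auto
qed

abbreviation "gm M \<equiv> is_gmod_iso v c (M :: ('k, 'g, 'u) gmod)"

lemma gm_ind: "gm M ==> isind (fst M)"
  by (simp add: is_gmod_iso_def Let_def)

lemma gm_iso:
  assumes "gm M" "i \<in> idx (fst M)"
  shows "\<exists>j\<in>idx (fst M). \<exists>\<sigma>\<in>sot_maps (at_idx (fst M) i) (at_idx (fst M) j).
      (\<forall>g. \<forall>x\<in>elts (fst M) i. nrm (at_idx (fst M) j) (\<sigma> g x) = nrm (at_idx (fst M) i) x) \<and>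
      snd M i = fam_germ (at_idx (fst M) i) (fst M) j \<sigma>"
  using assms unfolding is_gmod_iso_def Let_def by (elim conjE) (erule (1) bspec)

lemma gm_ne: assumes M: "gm M" and i: "i \<in> idx (fst M)"
  shows "\<exists>j \<sigma>. (j, \<sigma>) \<in> snd M i \<and> (\<forall>g. \<forall>x\<in>elts (fst M) i. nrm (at_idx (fst M) j) (\<sigma> g x) = nrm (at_idx (fst M) i) x)"
proof -
  obtain j \<sigma> where j: "j \<in> idx (fst M)" "\<sigma> \<in> sot_maps (at_idx (fst M) i) (at_idx (fst M) j)"
    "\<forall>g. \<forall>x\<in>elts (fst M) i. nrm (at_idx (fst M) j) (\<sigma> g x) = nrm (at_idx (fst M) i) x"
    "snd M i = fam_germ (at_idx (fst M) i) (fst M) j \<sigma>" using gm_iso[OF M i] by blast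
  have "(j, \<sigma>) \<in> snd M i" unfolding j(4) by (rule fam_germ_self[OF gm_ind[OF M] j(1,2)])
  thus ?thesis using j(3) by blast
qed

lemma gm_mem: assumes M: "gm M" and i: "i \<in> idx (fst M)" and m: "(j, \<sigma>) \<in> snd M i"
  shows "j \<in> idx (fst M)" "\<sigma> \<in> sot_maps (at_idx (fst M) i) (at_idx (fst M) j)"
    "snd M i = fam_germ (at_idx (fst M) i) (fst M) j \<sigma>"
proof -
  obtain j0 \<sigma>0 where 0: "j0 \<in> idx (fst M)" "\<sigma>0 \<in> sot_maps (at_idx (fst M) i) (at_idx (fst M) j0)"
    "snd M i = fam_germ (at_idx (fst M) i) (fst M) j0 \<sigma>0" using gm_iso[OF M i] by blast
  have 1: "(j, \<sigma>) \<in> fam_germ (at_idx (fst M) i) (fst M) j0 \<sigma>0" using m unfolding 0(3) .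
  show 2: "j \<in> idx (fst M)" "\<sigma> \<in> sot_maps (at_idx (fst M) i) (at_idx (fst M) j)" using 1 unfolding fam_germ_iff by blast+
  have 3: "geq (fst M) (UNIV \<times> elts (fst M) i) j0 (act \<sigma>0) j (act \<sigma>)" using 1 unfolding fam_germ_iff by blast
  show "snd M i = fam_germ (at_idx (fst M) i) (fst M) j \<sigma>"
    unfolding 0(3) by (rule fam_germ_eqI[OF gm_ind[OF M] 0(1) 2(1) 0(2) 2(2) 3])
qed

lemma gm_geq: assumes M: "gm M" and i: "i \<in> idx (fst M)" and m: "(j, \<sigma>) \<in> snd M i" "(j', \<sigma>') \<in> snd M i"
  shows "geq (fst M) (UNIV \<times> elts (fst M) i) j (act \<sigma>) j' (act \<sigma>')"
  using m(2) unfolding gm_mem(3)[OF M i m(1)] fam_germ_iff by blast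

lemma gm_nat: assumes M: "gm M" and i: "i \<in> idx (fst M)" "i' \<in> idx (fst M)" "a \<in> arr (fst M) i i'"
    and m: "(j, \<sigma>) \<in> snd M i" "(j', \<sigma>') \<in> snd M i'"
  shows "geq (fst M) (UNIV \<times> elts (fst M) i) j (act \<sigma>) j' (%p. \<sigma>' (fst p) (trn (fst M) i i' a (snd p)))"
proof -
  have "\<forall>(j, \<tau>)\<in>snd M i'. snd M i = fam_germ (at_idx (fst M) i) (fst M) j
                     (%g. compose (elts (fst M) i) (\<tau> g) (trn (fst M) i i' a))"
    using M i unfolding is_gmod_iso_def Let_def by blast
  hence "snd M i = fam_germ (at_idx (fst M) i) (fst M) j' (%g. compose (elts (fst M) i) (\<sigma>' g) (trn (fst M) i i' a))"
    using m(2) by blast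
  hence "(j, \<sigma>) \<in> fam_germ (at_idx (fst M) i) (fst M) j' (%g. compose (elts (fst M) i) (\<sigma>' g) (trn (fst M) i i' a))"
    using m(1) by simp
  hence "geq (fst M) (UNIV \<times> elts (fst M) i) j' (act (%g. compose (elts (fst M) i) (\<sigma>' g) (trn (fst M) i i' a))) j (act \<sigma>)"
    unfolding fam_germ_iff by blast
  from geq_sym[OF this] show ?thesis by (rule geq_cong) (auto simp: compose_eq)
qed

lemma gm_unit: assumes M: "gm M" and i: "i \<in> idx (fst M)" and m: "(j, \<sigma>) \<in> snd M i"
  shows "geq (fst M) (elts (fst M) i) j (\<sigma> 0) i (%x. x)"
proof -
  have "\<forall>(i', \<sigma>)\<in>snd M i. (i', \<sigma> 0) \<in> ind_id (fst M) i" using M i unfolding is_gmod_iso_def Let_def by blast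
  hence "(j, \<sigma> 0) \<in> germ (at_idx (fst M) i) (fst M) i (ban_id (at_idx (fst M) i))" using m i unfolding ind_id_def by auto
  hence "geq (fst M) (elts (fst M) i) i (ban_id (at_idx (fst M) i)) j (\<sigma> 0)" unfolding germ_iff by blast
  from geq_sym[OF this] show ?thesis by (rule geq_cong) auto
qed

lemma gm_mult: assumes M: "gm M" and i: "i \<in> idx (fst M)" and m: "(j, \<sigma>) \<in> snd M i" "(l, \<tau>) \<in> snd M j"
  shows "geq (fst M) (UNIV \<times> UNIV \<times> elts (fst M) i) l (%(g, h, x). \<tau> g (\<sigma> h x)) j (%(g, h, x). \<sigma> (g + h) x)"
proof -
  let ?X = "fst M"
  let ?A = "elts ?X i"
  have "\<forall>i\<in>idx ?X. \<forall>(i', \<sigma>)\<in>snd M i. \<forall>(i'', \<tau>)\<in>snd M i'. \<exists>l\<in>idx ?X. \<exists>a\<in>arr ?X i'' l. \<exists>b\<in>arr ?X i' l. \<forall>g h.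
              compose (elts ?X i) (trn ?X i'' l a) (compose (elts ?X i) (\<tau> g) (\<sigma> h))
              = compose (elts ?X i) (trn ?X i' l b) (\<sigma> (g + h))"
    using M unfolding is_gmod_iso_def Let_def by (elim conjE) assumption
  from bspec[OF bspec[OF this i] m(1), unfolded prod.case, THEN bspec, OF m(2), unfolded prod.case]
  have "\<exists>m\<in>idx ?X. \<exists>a\<in>arr ?X l m. \<exists>b\<in>arr ?X j m. \<forall>g h.
              compose ?A (trn ?X l m a) (compose ?A (\<tau> g) (\<sigma> h)) = compose ?A (trn ?X j m b) (\<sigma> (g + h))" .
  then obtain m a b where o: "m \<in> idx ?X" "a \<in> arr ?X l m" "b \<in> arr ?X j m"
    "!!g h. compose ?A (trn ?X l m a) (compose ?A (\<tau> g) (\<sigma> h)) = compose ?A (trn ?X j m b) (\<sigma> (g + h))" by blast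
  show ?thesis
  proof (rule geqI[OF o(1-3)])
    fix p assume "p \<in> (UNIV :: 'g set) \<times> (UNIV :: 'g set) \<times> ?A"
    then obtain g h x where p: "p = (g, h, x)" "x \<in> ?A" by auto
    show "trn ?X l m a (case p of (g, h, x) => \<tau> g (\<sigma> h x)) = trn ?X j m b (case p of (g, h, x) => \<sigma> (g + h) x)"
      using fun_cong[OF o(4)[of g h], of x] p by (simp add: compose_eq)
  qed
qed

text \<open>Evaluating at g and then at h amounts to evaluating at g + h, which is a right action;
  inverting the group element turns it into a left one.\<close>

definition sg :: "('k, 'a) nspace => ('k, 'b) nspace => ('a => ('g => 'k, 'b) tens) => 'g => 'a => 'b" where
  "sg V W r g = compose (carrier V) (ev W (- g)) r"

lemma sg_apply: "x \<in> carrier V ==> sg V W r g x = ev W (- g) (r x)"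
  by (simp add: sg_def compose_eq)

lemma sg_sot: assumes V: "bs V" and W: "bs W" and r: "r \<in> bl_hom V (tC W)" shows "sg V W r \<in> sot_maps V W"
  unfolding sot_maps_def
proof (intro CollectI conjI allI ballI)
  show "sg V W r g \<in> bl_hom V W" for g
    unfolding sg_def by (rule bl_comp[OF r ev_hom[OF W] V bs_tensor[OF bs_C W]])
  show "cont_into W (%g. sg V W r g x)" if x: "x \<in> carrier V" for x
    unfolding sg_apply[OF x] by (rule translate_cont(3)[OF W ev_cont[OF W bl_closed[OF r x]]])
qed

text \<open>The coaction sends x to the function g \<mapsto> \<sigma>(-g) x; by
  \<open>ev_surj\<close> it exists once the family is bounded uniformly in g.\<close>

lemma sg_ex:
  assumes V: "bs V" and W: "small W" and s: "\<sigma> \<in> sot_maps V W"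
    and b: "!!g x. x \<in> carrier V ==> nrm W (\<sigma> g x) \<le> B * nrm V x"
  shows "\<exists>r\<in>bl_hom V (tC W). sg V W r = \<sigma>"
proof -
  note bW = small_bs[OF W]
  have "\<exists>r\<in>bl_hom V (tC W). \<forall>g. \<forall>x\<in>carrier V. ev W g (r x) = (%g. \<sigma> (- g)) g x"
  proof (rule ev_surj[OF W V, where B=B])
    show "cont_into W (%g. \<sigma> (- g) x)" if "x \<in> carrier V" for x
      by (rule translate_cont(3)[OF bW sotD(2)[OF s that]])
    show "nrm W (\<sigma> (- g) x) \<le> B * nrm V x" if "x \<in> carrier V" for g x by (rule b[OF that])
  qed (use bl_closed[OF sotD(1)[OF s]] bl_add[OF sotD(1)[OF s]] bl_smult[OF sotD(1)[OF s]] in auto)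
  then obtain r where r: "r \<in> bl_hom V (tC W)" "!!g x. x \<in> carrier V ==> ev W g (r x) = \<sigma> (- g) x" by blast
  have "sg V W r g = \<sigma> g" for g
    by (rule bl_ext[OF sotD(1)[OF sg_sot[OF V bW r(1)]] sotD(1)[OF s]]) (simp add: sg_apply r(2))
  thus ?thesis using r(1) by blast
qed

text \<open>\<open>geq_AX\<close> after the substitution g \<mapsto> -g, which only permutes the
  parameters.\<close>

lemma geq_ev_sg:
  fixes X :: "('k, 'u) uind"
  assumes X: "isind X" and V: "bs V" and j: "j \<in> idx X" "j' \<in> idx X"
    and r: "r \<in> bl_hom V (tC (at_idx X j))" "r' \<in> bl_hom V (tC (at_idx X j'))"
  shows "geq (AX X) (carrier V) (u, j) r (u', j') r' \<longleftrightarrow>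
    geq X (UNIV \<times> carrier V) j (act (sg V (at_idx X j) r)) j' (act (sg V (at_idx X j') r'))"
proof -
  have 1: "geq (AX X) (carrier V) (u, j) r (u', j') r' \<longleftrightarrow>
    geq X (UNIV \<times> carrier V) j (%(g, x). ev (at_idx X j) g (r x)) j' (%(g, x). ev (at_idx X j') g (r' x))"
    by (rule geq_AX[OF sind_u[OF X] j bl_closed[OF r(1)] bl_closed[OF r(2)]])
  show ?thesis unfolding 1
  proof
    assume "geq X (UNIV \<times> carrier V) j (%(g, x). ev (at_idx X j) g (r x)) j' (%(g, x). ev (at_idx X j') g (r' x))"
    note this0 = this
    show "geq X (UNIV \<times> carrier V) j (act (sg V (at_idx X j) r)) j' (act (sg V (at_idx X j') r'))"
      by (rule geq_cong[OF geq_pre[OF this0, where Q="UNIV \<times> carrier V" and k="%p. (- fst p, snd p)"]]) (auto simp: sg_apply)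
  next
    assume "geq X (UNIV \<times> carrier V) j (act (sg V (at_idx X j) r)) j' (act (sg V (at_idx X j') r'))"
    note this0 = this
    show "geq X (UNIV \<times> carrier V) j (%(g, x). ev (at_idx X j) g (r x)) j' (%(g, x). ev (at_idx X j') g (r' x))"
      by (rule geq_cong[OF geq_pre[OF this0, where Q="UNIV \<times> carrier V" and k="%p. (- fst p, snd p)"]]) (auto simp: sg_apply)
  qed
qed

text \<open>The set of all maps whose associated family lies in the germ of the action. No
  representative has to be chosen, and \<open>rho_germ\<close> shows that the set is a germ.\<close>

definition rho :: "('k, 'g, 'u) gmod => 'u => ((unit \<times> 'u) \<times> ('u => ('g => 'k, 'u) tens)) set" where
  "rho M = (\<lambda>i\<in>idx (fst M). {((u, j), r). j \<in> idx (fst M) \<and> r \<in> bl_hom (at_idx (fst M) i) (tC (at_idx (fst M) j)) \<and>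
     (j, sg (at_idx (fst M) i) (at_idx (fst M) j) r) \<in> snd M i})"

lemma rho_iff: "i \<in> idx (fst M) ==> ((u, j), r) \<in> rho M i \<longleftrightarrow> j \<in> idx (fst M) \<and>
    r \<in> bl_hom (at_idx (fst M) i) (tC (at_idx (fst M) j)) \<and> (j, sg (at_idx (fst M) i) (at_idx (fst M) j) r) \<in> snd M i"
  by (simp add: rho_def)

lemma rho_germ:
  assumes M: "gm M" and i: "i \<in> idx (fst M)" and m: "((u, j), r) \<in> rho M i"
  shows "rho M i = germ (at_idx (fst M) i) (AX (fst M)) (u, j) r"
proof -
  note X = gm_ind[OF M]
  have j: "j \<in> idx (fst M)" "r \<in> bl_hom (at_idx (fst M) i) (tC (at_idx (fst M) j))"
    "(j, sg (at_idx (fst M) i) (at_idx (fst M) j) r) \<in> snd M i" using m unfolding rho_iff[OF i] by blast+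
  have "((u', j'), r') \<in> rho M i \<longleftrightarrow> ((u', j'), r') \<in> germ (at_idx (fst M) i) (AX (fst M)) (u, j) r" for u' j' r'
  proof -
    have "((u', j'), r') \<in> germ (at_idx (fst M) i) (AX (fst M)) (u, j) r \<longleftrightarrow>
       j' \<in> idx (fst M) \<and> r' \<in> bl_hom (at_idx (fst M) i) (tC (at_idx (fst M) j')) \<and>
       geq (AX (fst M)) (elts (fst M) i) (u, j) r (u', j') r'"
      unfolding germ_iff by simp
    also have "\<dots> \<longleftrightarrow> ((u', j'), r') \<in> rho M i"
      unfolding rho_iff[OF i] gm_mem(3)[OF M i j(3)] fam_germ_iff
      using geq_ev_sg[OF X ind_bs[OF X i] j(1) _ j(2)] sg_sot[OF ind_bs[OF X i] ind_bs[OF X]] by blast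
    finally show ?thesis by blast
  qed
  thus ?thesis by auto
qed

text \<open>Here isometry is used: a representative by isometries is bounded by 1 uniformly in g, as
  \<open>sg_ex\<close> demands.\<close>

lemma rho_ne: assumes M: "gm M" and i: "i \<in> idx (fst M)" shows "\<exists>j r. (((), j), r) \<in> rho M i"
proof -
  note X = gm_ind[OF M]
  obtain j \<sigma> where j: "(j, \<sigma>) \<in> snd M i"
    "!!g x. x \<in> elts (fst M) i ==> nrm (at_idx (fst M) j) (\<sigma> g x) = nrm (at_idx (fst M) i) x" using gm_ne[OF M i] by blast
  note J = gm_mem[OF M i j(1)]
  obtain r where "r \<in> bl_hom (at_idx (fst M) i) (tC (at_idx (fst M) j))" "sg (at_idx (fst M) i) (at_idx (fst M) j) r = \<sigma>"
    using sg_ex[OF ind_bs[OF X i] small_u[OF ind_bs[OF X J(1)]] J(2), of 1] j(2) by auto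
  thus ?thesis using J(1) j(1) unfolding rho_iff[OF i] by blast
qed

lemma rho_hom: assumes M: "gm M" shows "rho M \<in> ind_hom (fst M) (AX (fst M))"
proof -
  note X = gm_ind[OF M]
  have "\<forall>i. \<exists>j r. i \<in> idx (fst M) --> (((), j), r) \<in> rho M i" using rho_ne[OF M] by blast
  then obtain J R where m: "!!i. i \<in> idx (fst M) ==> (((), J i), R i) \<in> rho M i" by metis
  have r: "J i \<in> idx (fst M)" "R i \<in> bl_hom (at_idx (fst M) i) (tC (at_idx (fst M) (J i)))"
    "(J i, sg (at_idx (fst M) i) (at_idx (fst M) (J i)) (R i)) \<in> snd M i" if "i \<in> idx (fst M)" for i
    using m[OF that] unfolding rho_iff[OF that] by blast+
  show ?thesis
  proof (rule ih_intro[OF X AX_isind[OF X], where J="%i. ((), J i)" and F=R])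
    show "rho M \<in> extensional (idx (fst M))" unfolding rho_def by (rule restrict_extensional)
    fix i assume i: "i \<in> idx (fst M)"
    show "((), J i) \<in> idx (AX (fst M))" using r(1)[OF i] by simp
    show "R i \<in> bl_hom (at_idx (fst M) i) (at_idx (AX (fst M)) ((), J i))" using r(2)[OF i] by simp
    show "rho M i = germ (at_idx (fst M) i) (AX (fst M)) ((), J i) (R i)" by (rule rho_germ[OF M i m[OF i]])
    fix i' a assume i': "i' \<in> idx (fst M)" "a \<in> arr (fst M) i i'"
    note t = ind_trn[OF X i i'] and Bi = ind_bs[OF X i] ind_bs[OF X i'(1)]
    let ?R = "compose (elts (fst M) i) (R i') (trn (fst M) i i' a)"
    have R: "?R \<in> bl_hom (at_idx (fst M) i) (tC (at_idx (fst M) (J i')))" by (rule bl_comp[OF t r(2)[OF i'(1)] Bi])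
    have "geq (fst M) (UNIV \<times> elts (fst M) i) (J i) (act (sg (at_idx (fst M) i) (at_idx (fst M) (J i)) (R i)))
        (J i') (act (sg (at_idx (fst M) i) (at_idx (fst M) (J i')) ?R))"
      by (rule geq_cong[OF gm_nat[OF M i i' r(3)[OF i] r(3)[OF i'(1)]]])
        (use bl_closed[OF t] in \<open>auto simp: sg_apply compose_eq\<close>)
    hence "geq (AX (fst M)) (elts (fst M) i) ((), J i) (R i) ((), J i') ?R"
      unfolding geq_ev_sg[OF X Bi(1) r(1)[OF i] r(1)[OF i'(1)] r(2)[OF i] R] .
    thus "geq (AX (fst M)) (elts (fst M) i) ((), J i) (R i) ((), J i') (%x. R i' (trn (fst M) i i' a x))"
      by (rule geq_cong) (auto simp: compose_eq)
  qed
qed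

section \<open>The functor from modules to comodules\<close>

abbreviation "Bg \<equiv> (group_bialg v c :: ('k, 'g => 'k) bialg)"

lemma rho_comodule: assumes M: "gm M" shows "is_comodule v c Bg (fst M, rho M)"
proof -
  note X = gm_ind[OF M]
  have "coassociative (fst M) (rho M)"
    unfolding coassociative_def
  proof (intro ballI allI impI)
    fix i j r l s assume i: "i \<in> idx (fst M)" and j: "(((), j), r) \<in> rho M i" and l: "(((), l), s) \<in> rho M j"
    have j': "j \<in> idx (fst M)" "r \<in> bl_hom (at_idx (fst M) i) (tC (at_idx (fst M) j))"
      "(j, sg (at_idx (fst M) i) (at_idx (fst M) j) r) \<in> snd M i" using j unfolding rho_iff[OF i] by blast+
    have l': "l \<in> idx (fst M)" "s \<in> bl_hom (at_idx (fst M) j) (tC (at_idx (fst M) l))"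
      "(l, sg (at_idx (fst M) j) (at_idx (fst M) l) s) \<in> snd M j" using l unfolding rho_iff[OF j'(1)] by blast+
    have e: "ev (at_idx (fst M) j) g (r x) \<in> elts (fst M) j" if "x \<in> elts (fst M) i" for g x
      by (rule ev_closed[OF ind_bs[OF X j'(1)] bl_closed[OF j'(2) that]])
    \<comment> \<open>The multiplicative law of the action is read at the group elements -h and -g,
      where -h + -g = -(g + h).\<close>
    show "geq (fst M) (UNIV \<times> UNIV \<times> elts (fst M) i) l
        (%(h, g, x). ev (at_idx (fst M) l) h (s (ev (at_idx (fst M) j) g (r x)))) j (%(h, g, x). ev (at_idx (fst M) j) (g + h) (r x))"
      by (rule geq_cong[OF geq_pre[OF gm_mult[OF M i j'(3) l'(3)], where Q="UNIV \<times> UNIV \<times> elts (fst M) i" and k="%(h, g, x). (- h, - g, x)"]]) (auto simp: sg_apply e minus_add simp del: add_uminus_conv_diff)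
  qed
  moreover have "counital (fst M) (rho M)"
    unfolding counital_def
  proof (intro ballI allI impI)
    fix i j r assume i: "i \<in> idx (fst M)" and j: "(((), j), r) \<in> rho M i"
    have j': "(j, sg (at_idx (fst M) i) (at_idx (fst M) j) r) \<in> snd M i" using j unfolding rho_iff[OF i] by blast
    show "geq (fst M) (elts (fst M) i) j (%x. ev (at_idx (fst M) j) 0 (r x)) i (%x. x)"
      by (rule geq_cong[OF gm_unit[OF M i j']]) (auto simp: sg_apply)
  qed
  ultimately show ?thesis unfolding comodule_iff fst_conv snd_conv using X rho_hom[OF M] by blast
qed

lemma gmod_hom_iff: "\<phi> \<in> gmod_hom M N \<longleftrightarrow> \<phi> \<in> ind_hom (fst M) (fst N) \<and>
   (\<forall>i\<in>idx (fst M). \<forall>i' \<sigma> j' f' j f m \<tau>. (i', \<sigma>) \<in> snd M i --> (j', f') \<in> \<phi> i' --> (j, f) \<in> \<phi> i --> (m, \<tau>) \<in> snd N j -->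
      geq (fst N) (UNIV \<times> elts (fst M) i) j' (%p. f' (act \<sigma> p)) m (%p. \<tau> (fst p) (f (snd p))))"
proof -
  have e: "(\<exists>l\<in>idx Y. \<exists>a\<in>arr Y j' l. \<exists>b\<in>arr Y m l. \<forall>g. compose A (trn Y j' l a) (compose A f' (\<sigma> g)) = compose A (trn Y m l b) (compose A (\<tau> g) f))
     \<longleftrightarrow> geq Y (UNIV \<times> A) j' (%p. f' (act \<sigma> p)) m (%p. \<tau> (fst p) (f (snd p)))"
    for Y :: "('x, 'y, 'z, 'w) ind" and j' m f' \<tau> f and A :: "'q set" and \<sigma> :: "'p => 'q => 'r"
    unfolding geq_def compose_eq_iff by (auto simp: compose_eq act_def)
  show ?thesis unfolding gmod_hom_def Let_def mem_Collect_eq e by blast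
qed

text \<open>Both conditions are the same square up to g \<mapsto> -g, but \<open>gmod_hom\<close>
  asks for it for all representatives of the actions, the comodule side for those that come from
  tensors. Comparing representatives of the same germ closes the gap.\<close>

lemma gmod_hom_eq:
  assumes M: "gm M" and N: "gm N"
  shows "gmod_hom M N = comodule_hom c Bg (fst M, rho M) (fst N, rho N)"
proof -
  let ?X = "fst M" and ?Y = "fst N"
  note X = gm_ind[OF M] and Y = gm_ind[OF N]
  note iff = comodule_hom_iff[OF X Y rho_hom[OF M] rho_hom[OF N]]
  have rM: "j \<in> idx ?X" "r \<in> bl_hom (at_idx ?X i) (tC (at_idx ?X j))" "(j, sg (at_idx ?X i) (at_idx ?X j) r) \<in> snd M i"
    if "i \<in> idx ?X" "(((), j), r) \<in> rho M i" for i j r using that(2) unfolding rho_iff[OF that(1)] by blast+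
  have rN: "j \<in> idx ?Y" "r \<in> bl_hom (at_idx ?Y i) (tC (at_idx ?Y j))" "(j, sg (at_idx ?Y i) (at_idx ?Y j) r) \<in> snd N i"
    if "i \<in> idx ?Y" "(((), j), r) \<in> rho N i" for i j r using that(2) unfolding rho_iff[OF that(1)] by blast+
  have "\<phi> \<in> gmod_hom M N \<longleftrightarrow> \<phi> \<in> comodule_hom c Bg (?X, rho M) (?Y, rho N)" if \<phi>: "\<phi> \<in> ind_hom ?X ?Y" for \<phi>
  proof
    assume g: "\<phi> \<in> gmod_hom M N"
    show "\<phi> \<in> comodule_hom c Bg (?X, rho M) (?Y, rho N)"
      unfolding iff(1)
    proof (intro conjI \<phi> ballI allI impI)
      fix i q assume i: "i \<in> idx ?X" and q: "(case q of (j, r, j', f', m, f, n, s) =>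
        (((), j), r) \<in> rho M i \<and> (j', f') \<in> \<phi> j \<and> (m, f) \<in> \<phi> i \<and> (((), n), s) \<in> rho N m)"
      obtain j r j' f' m f n s where q': "q = (j, r, j', f', m, f, n, s)" by (cases q) auto
      have a: "(((), j), r) \<in> rho M i" "(j', f') \<in> \<phi> j" "(m, f) \<in> \<phi> i" "(((), n), s) \<in> rho N m" using q unfolding q' by auto
      note J = rM[OF i a(1)] and F = ih_mem[OF X Y \<phi> i a(3)]
      note S = rN[OF F(1) a(4)]
      have "geq ?Y (UNIV \<times> elts ?X i) j' (%p. f' (act (sg (at_idx ?X i) (at_idx ?X j) r) p))
          n (%p. sg (at_idx ?Y m) (at_idx ?Y n) s (fst p) (f (snd p)))"
        using g i J(3) a(2,3) S(3) unfolding gmod_hom_iff by blast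
      note this0 = this
      show "case q of (j, r, j', f', m, f, n, s) => geq ?Y (UNIV \<times> elts ?X i) j' (%(g, x). f' (ev (at_idx ?X j) g (r x)))
          n (%(g, x). ev (at_idx ?Y n) g (s (f x)))"
        unfolding q' prod.case by (rule geq_cong[OF geq_pre[OF this0, where Q="UNIV \<times> elts ?X i" and k="%p. (- fst p, snd p)"]]) (use bl_closed[OF F(2)] in \<open>auto simp: sg_apply\<close>)
    qed
  next
    assume h: "\<phi> \<in> comodule_hom c Bg (?X, rho M) (?Y, rho N)"
    show "\<phi> \<in> gmod_hom M N"
      unfolding gmod_hom_iff
    proof (intro conjI \<phi> ballI allI impI)
      fix i i' \<sigma> j' f' j f m \<tau> assume i: "i \<in> idx ?X" and a: "(i', \<sigma>) \<in> snd M i" "(j', f') \<in> \<phi> i'" "(j, f) \<in> \<phi> i" "(m, \<tau>) \<in> snd N j"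
      note S = gm_mem[OF M i a(1)] and F = ih_mem[OF X Y \<phi> i a(3)]
      note F' = ih_mem[OF X Y \<phi> S(1) a(2)] and T = gm_mem[OF N F(1) a(4)]
      obtain j0 r where r: "(((), j0), r) \<in> rho M i" using rho_ne[OF M i] by blast
      note R = rM[OF i r]
      obtain j1 f1 where f1: "(j1, f1) \<in> \<phi> j0" using ih_ne[OF X Y \<phi> R(1)] by blast
      note F1 = ih_mem[OF X Y \<phi> R(1) f1]
      obtain n s where s: "(((), n), s) \<in> rho N j" using rho_ne[OF N F(1)] by blast
      note Sn = rN[OF F(1) s]
      let ?P = "(UNIV :: 'g set) \<times> elts ?X i"
      have h': "geq ?Y ?P j1 (%(g, x). f1 (ev (at_idx ?X j0) g (r x))) n (%(g, x). ev (at_idx ?Y n) g (s (f x)))"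
        using h[unfolded iff(1), THEN conjunct2, rule_format, OF i, of "(j0, r, j1, f1, j, f, n, s)"] r f1 a(3) s by simp
      \<comment> \<open>An arbitrary \<sigma> is linked to the family given by r, and \<tau> to the
        one given by s. The three links are \<open>1\<close>, \<open>2\<close> and \<open>3\<close>,
        with the comodule square in the middle.\<close>
      have 2: "geq ?Y ?P j1 (%p. f1 (act (sg (at_idx ?X i) (at_idx ?X j0) r) p)) n (%p. act (sg (at_idx ?Y j) (at_idx ?Y n) s) (fst p, f (snd p)))"
        by (rule geq_cong[OF geq_pre[OF h', where Q="?P" and k="%p. (- fst p, snd p)"]]) (use bl_closed[OF F(2)] in \<open>auto simp: sg_apply\<close>)
      note sgr = sg_sot[OF ind_bs[OF X i] ind_bs[OF X R(1)] R(2)] and sgs = sg_sot[OF ind_bs[OF Y F(1)] ind_bs[OF Y Sn(1)] Sn(2)]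
      have 1: "geq ?Y ?P j' (%p. f' (act \<sigma> p)) j1 (%p. f1 (act (sg (at_idx ?X i) (at_idx ?X j0) r) p))"
        by (rule geq_hom[OF X Y \<phi> S(1) R(1) sot_closed[OF S(2)] sot_closed[OF sgr] a(2) f1 gm_geq[OF M i a(1) R(3)]])
      have fp: "(fst p, f (snd p)) \<in> UNIV \<times> elts ?Y j" if "p \<in> ?P" for p
        using that bl_closed[OF F(2)] by auto
      have 3: "geq ?Y ?P n (%p. act (sg (at_idx ?Y j) (at_idx ?Y n) s) (fst p, f (snd p))) m (%p. act \<tau> (fst p, f (snd p)))"
        by (rule geq_pre[OF gm_geq[OF N F(1) Sn(3) a(4)] fp])
      have c0: "f' (act \<sigma> p) \<in> elts ?Y j'" if "p \<in> ?P" for p by (rule bl_closed[OF F'(2) sot_closed[OF S(2) that]])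
      have c1: "f1 (act (sg (at_idx ?X i) (at_idx ?X j0) r) p) \<in> elts ?Y j1" if "p \<in> ?P" for p
        by (rule bl_closed[OF F1(2) sot_closed[OF sgr that]])
      have c2: "act (sg (at_idx ?Y j) (at_idx ?Y n) s) (fst p, f (snd p)) \<in> elts ?Y n" if "p \<in> ?P" for p
        by (rule sot_closed[OF sgs fp[OF that]])
      have c3: "act \<tau> (fst p, f (snd p)) \<in> elts ?Y m" if "p \<in> ?P" for p
        by (rule sot_closed[OF T(2) fp[OF that]])
      have 12: "geq ?Y ?P j' (%p. f' (act \<sigma> p)) n (%p. act (sg (at_idx ?Y j) (at_idx ?Y n) s) (fst p, f (snd p)))"
        by (rule geq_trans[OF Y F'(1) F1(1) Sn(1) c0 c1 c2 1 2])
      have "geq ?Y ?P j' (%p. f' (act \<sigma> p)) m (%p. act \<tau> (fst p, f (snd p)))"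
        by (rule geq_trans[OF Y F'(1) Sn(1) T(1) c0 c2 c3 12 3])
      thus "geq ?Y ?P j' (%p. f' (act \<sigma> p)) m (%p. \<tau> (fst p) (f (snd p)))" by simp
    qed
  qed
  thus ?thesis using gmod_hom_iff iff(1) by blast
qed

section \<open>The two categories\<close>

abbreviation "cm M \<equiv> is_comodule v c Bg (M :: ('k, 'g => 'k, 'u) comodule)"

lemma comodD: assumes "cm M"
  shows "isind (fst M)" "snd M \<in> ind_hom (fst M) (AX (fst M))"
  using assms unfolding comodule_iff by auto

lemma comodule_id: assumes M: "cm M" shows "ind_id (fst M) \<in> comodule_hom c Bg M M"
proof -
  obtain X \<rho> where Mx: "M = (X, \<rho>)" by force
  have X: "isind X" and \<rho>: "\<rho> \<in> ind_hom X (AX X)" using comodD[OF M] by (auto simp: Mx)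
  show ?thesis unfolding Mx fst_conv
  proof (rule comodule_hom_iff(2)[OF X X \<rho> \<rho> ind_id_hom[OF X]])
    fix i assume i: "i \<in> idx X"
    obtain j r where r: "(((), j), r) \<in> \<rho> i" using AX_ne[OF X X \<rho> i] by blast
    note J = AX_mem[OF X X \<rho> i r]
    have "geq X (UNIV \<times> elts X i) j (%(g, x). ban_id (at_idx X j) (ev (at_idx X j) g (r x)))
          j (%(g, x). ev (at_idx X j) g (r (ban_id (at_idx X i) x)))"
      by (rule geq_cong[OF geq_refl[OF X J(1), where f="%(g, x). ev (at_idx X j) g (r x)"]])
        (use ev_closed[OF ind_bs[OF X J(1)] bl_closed[OF J(2)]] in auto)
    thus "\<exists>q. (case q of (j, r, j', f', m, f, n, s) => (((), j), r) \<in> \<rho> i \<and> (j', f') \<in> ind_id X j \<and> (m, f) \<in> ind_id X i \<and> (((), n), s) \<in> \<rho> m) \<and>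
      (case q of (j, r, j', f', m, f, n, s) => geq X (UNIV \<times> elts X i) j' (%(g, x). f' (ev (at_idx X j) g (r x)))
          n (%(g, x). ev (at_idx X n) g (s (f x))))"
      using r ind_id_mem[OF X J(1)] ind_id_mem[OF X i]
      by (intro exI[of _ "(j, r, j, ban_id (at_idx X j), i, ban_id (at_idx X i), j, r)"]) simp
  qed
qed

text \<open>Pasting of squares: \<psi> is applied to the square of \<phi>, and the square of \<psi>
  is precomposed with a representative of \<phi>.\<close>

lemma comodule_comp:
  assumes M: "cm M" and N: "cm N" and P: "cm P"
    and \<phi>: "\<phi> \<in> comodule_hom c Bg M N" and \<psi>: "\<psi> \<in> comodule_hom c Bg N P"
  shows "ind_comp (fst M) (fst N) (fst P) \<psi> \<phi> \<in> comodule_hom c Bg M P"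
proof -
  obtain X \<rho> Y \<rho>' Z \<rho>'' where Mx: "M = (X, \<rho>)" "N = (Y, \<rho>')" "P = (Z, \<rho>'')" by (cases M, cases N, cases P) auto
  have X: "isind X" and \<rho>: "\<rho> \<in> ind_hom X (AX X)" using comodD[OF M] by (auto simp: Mx)
  have Y: "isind Y" and \<rho>': "\<rho>' \<in> ind_hom Y (AX Y)" using comodD[OF N] by (auto simp: Mx)
  have Z: "isind Z" and \<rho>'': "\<rho>'' \<in> ind_hom Z (AX Z)" using comodD[OF P] by (auto simp: Mx)
  note f = \<phi>[unfolded Mx comodule_hom_iff(1)[OF X Y \<rho> \<rho>']] and h = \<psi>[unfolded Mx comodule_hom_iff(1)[OF Y Z \<rho>' \<rho>'']]
  note \<phi>' = f[THEN conjunct1] and \<psi>' = h[THEN conjunct1]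
  show ?thesis unfolding Mx fst_conv
  proof (rule comodule_hom_iff(2)[OF X Z \<rho> \<rho>'' ind_comp_hom[OF X Y Z \<phi>' \<psi>']])
    fix i assume i: "i \<in> idx X"
    obtain j r where r: "(((), j), r) \<in> \<rho> i" using AX_ne[OF X X \<rho> i] by blast
    note J = AX_mem[OF X X \<rho> i r]
    obtain j1 f1 where f1: "(j1, f1) \<in> \<phi> j" using ih_ne[OF X Y \<phi>' J(1)] by blast
    note F1 = ih_mem[OF X Y \<phi>' J(1) f1]
    obtain j2 h1 where h1: "(j2, h1) \<in> \<psi> j1" using ih_ne[OF Y Z \<psi>' F1(1)] by blast
    note H1 = ih_mem[OF Y Z \<psi>' F1(1) h1]
    obtain m f0 where f0: "(m, f0) \<in> \<phi> i" using ih_ne[OF X Y \<phi>' i] by blast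
    note F0 = ih_mem[OF X Y \<phi>' i f0]
    obtain m1 h0 where h0: "(m1, h0) \<in> \<psi> m" using ih_ne[OF Y Z \<psi>' F0(1)] by blast
    note H0 = ih_mem[OF Y Z \<psi>' F0(1) h0]
    obtain n s where s: "(((), n), s) \<in> \<rho>' m" using AX_ne[OF Y Y \<rho>' F0(1)] by blast
    note S = AX_mem[OF Y Y \<rho>' F0(1) s]
    obtain n1 k where k: "(n1, k) \<in> \<psi> n" using ih_ne[OF Y Z \<psi>' S(1)] by blast
    note K = ih_mem[OF Y Z \<psi>' S(1) k]
    obtain l t where t: "(((), l), t) \<in> \<rho>'' m1" using AX_ne[OF Z Z \<rho>'' H0(1)] by blast
    note T = AX_mem[OF Z Z \<rho>'' H0(1) t]
    let ?P = "(UNIV :: 'g set) \<times> elts X i"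
    have e1: "geq Y ?P j1 (%(g, x). f1 (ev (at_idx X j) g (r x))) n (%(g, x). ev (at_idx Y n) g (s (f0 x)))"
      using f[THEN conjunct2, rule_format, OF i, of "(j, r, j1, f1, m, f0, n, s)"] r f1 f0 s by simp
    have e2: "geq Z (UNIV \<times> elts Y m) n1 (%(g, x). k (ev (at_idx Y n) g (s x))) l (%(g, x). ev (at_idx Z l) g (t (h0 x)))"
      using h[THEN conjunct2, rule_format, OF F0(1), of "(n, s, n1, k, m1, h0, l, t)"] s k h0 t by simp
    have c1: "(%(g, x). f1 (ev (at_idx X j) g (r x))) p \<in> elts Y j1" if p: "p \<in> ?P" for p
      using p bl_closed[OF F1(2) ev_closed[OF ind_bs[OF X J(1)] bl_closed[OF J(2)]]] by auto
    have c2: "(%(g, x). ev (at_idx Y n) g (s (f0 x))) p \<in> elts Y n" if p: "p \<in> ?P" for p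
      using p ev_closed[OF ind_bs[OF Y S(1)] bl_closed[OF S(2) bl_closed[OF F0(2)]]] by auto
    have c3: "(%(g, x). ev (at_idx Z l) g (t (h0 (f0 x)))) p \<in> elts Z l" if p: "p \<in> ?P" for p
      using p ev_closed[OF ind_bs[OF Z T(1)] bl_closed[OF T(2) bl_closed[OF H0(2) bl_closed[OF F0(2)]]]] by auto
    have g1: "geq Z ?P j2 (%p. h1 ((%(g, x). f1 (ev (at_idx X j) g (r x))) p)) n1 (%p. k ((%(g, x). ev (at_idx Y n) g (s (f0 x))) p))"
      by (rule geq_hom[OF Y Z \<psi>' F1(1) S(1) c1 c2 h1 k e1])
    have g2: "geq Z ?P n1 (%p. k ((%(g, x). ev (at_idx Y n) g (s (f0 x))) p)) l (%(g, x). ev (at_idx Z l) g (t (h0 (f0 x))))"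
      by (rule geq_cong[OF geq_pre[OF e2, where Q="?P" and k="%p. (fst p, f0 (snd p))"]]) (use bl_closed[OF F0(2)] in auto)
    have g3: "geq Z ?P j2 (%p. h1 ((%(g, x). f1 (ev (at_idx X j) g (r x))) p)) l (%(g, x). ev (at_idx Z l) g (t (h0 (f0 x))))"
      by (rule geq_trans[OF Z H1(1) K(1) T(1) bl_closed[OF H1(2) c1] bl_closed[OF K(2) c2] c3 g1 g2])
    let ?f' = "compose (elts X j) h1 f1" and ?f = "compose (elts X i) h0 f0"
    have "geq Z ?P j2 (%(g, x). ?f' (ev (at_idx X j) g (r x))) l (%(g, x). ev (at_idx Z l) g (t (?f x)))"
      by (rule geq_cong[OF g3]) (use ev_closed[OF ind_bs[OF X J(1)] bl_closed[OF J(2)]] in \<open>auto simp: compose_eq\<close>)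
    thus "\<exists>q. (case q of (j, r, j', f', m, f, n, s) => (((), j), r) \<in> \<rho> i \<and> (j', f') \<in> ind_comp X Y Z \<psi> \<phi> j \<and> (m, f) \<in> ind_comp X Y Z \<psi> \<phi> i \<and> (((), n), s) \<in> \<rho>'' m) \<and>
      (case q of (j, r, j', f', m, f, n, s) => geq Z (UNIV \<times> elts X i) j' (%(g, x). f' (ev (at_idx X j) g (r x)))
          n (%(g, x). ev (at_idx Z n) g (s (f x))))"
      using r t ind_comp_mem[OF X Y Z \<phi>' \<psi>' J(1) f1 h1] ind_comp_mem[OF X Y Z \<phi>' \<psi>' i f0 h0]
      by (intro exI[of _ "(j, r, j2, ?f', m1, ?f, l, t)"]) simp
  qed
qed

lemma comodule_hom_ind: "\<phi> \<in> comodule_hom c Bg M N ==> \<phi> \<in> ind_hom (fst M) (fst N)"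
  by (simp add: comodule_hom_def Let_def)

lemma comodule_category: "is_category (comodule_cat v c Bg :: (('k, 'g => 'k, 'u) comodule, 'u => ('u \<times> ('u => 'u)) set) cat)"
  unfolding is_category_def comodule_cat_def cat.simps mem_Collect_eq
proof (intro conjI ballI, goal_cases)
  case (1 a) thus ?case using comodule_id by simp
next
  case (2 a b d f g) thus ?case using comodule_comp by simp
next
  case (3 a b f) thus ?case using ind_comp_id(1)[OF comodD(1) comodD(1) comodule_hom_ind] by simp
next
  case (4 a b f) thus ?case using ind_comp_id(2)[OF comodD(1) comodD(1) comodule_hom_ind] by simp
next
  case (5 a b d e f g h)
  thus ?case using ind_comp_assoc[OF comodD(1) comodD(1) comodD(1) comodD(1) comodule_hom_ind comodule_hom_ind comodule_hom_ind] by simp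
qed

text \<open>Identities and composites are module morphisms because they are comodule morphisms and
  the hom-sets are equal.\<close>

lemma gmod_category: "is_category (gmod_iso_cat v c :: (('k, 'g, 'u) gmod, 'u => ('u \<times> ('u => 'u)) set) cat)"
  unfolding is_category_def gmod_iso_cat_def cat.simps mem_Collect_eq
proof (intro conjI ballI, goal_cases)
  case (1 a) thus ?case using comodule_id[OF rho_comodule] by (simp add: gmod_hom_eq)
next
  case (2 a b d f g)
  thus ?case using comodule_comp[OF rho_comodule rho_comodule rho_comodule] by (simp add: gmod_hom_eq)
next
  case (3 a b f)
  hence "gm a" "gm b" "f \<in> ind_hom (fst a) (fst b)" by (auto simp: gmod_hom_iff)
  thus ?case using ind_comp_id(1)[OF gm_ind gm_ind] by simp
next
  case (4 a b f)
  hence "gm a" "gm b" "f \<in> ind_hom (fst a) (fst b)" by (auto simp: gmod_hom_iff)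
  thus ?case using ind_comp_id(2)[OF gm_ind gm_ind] by simp
next
  case (5 a b d e f g h)
  hence "gm a" "gm b" "gm d" "gm e" "f \<in> ind_hom (fst a) (fst b)" "g \<in> ind_hom (fst b) (fst d)" "h \<in> ind_hom (fst d) (fst e)"
    by (auto simp: gmod_hom_iff)
  thus ?case using ind_comp_assoc[OF gm_ind gm_ind gm_ind gm_ind] by simp
qed

end

section \<open>From comodules to modules\<close>

context valued
begin

lemma bs_subspace:
  fixes V :: "('k, 'a) nspace"
  assumes V: "bs V" and S: "S \<subseteq> carrier V"
    and add: "!!x y. x \<in> S ==> y \<in> S ==> x \<oplus>\<^bsub>V\<^esub> y \<in> S" and smult: "!!a x. x \<in> S ==> a \<odot>\<^bsub>V\<^esub> x \<in> S" and zero: "\<zero>\<^bsub>V\<^esub> \<in> S"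
    and closed: "!!s l. vlim V s l ==> (!!n. s n \<in> S) ==> l \<in> S"
  shows "bs (V\<lparr>carrier := S\<rparr>)"
proof (rule bsI)
  let ?W = "V\<lparr>carrier := S\<rparr>"
  have c: "x \<in> carrier V" if "x \<in> S" for x using S that by blast
  show "\<exists>l\<in>carrier ?W. (%n. nrm ?W (s n \<oplus>\<^bsub>?W\<^esub> - 1 \<odot>\<^bsub>?W\<^esub> l)) \<longlonglongrightarrow> 0"
    if s: "\<forall>n. s n \<in> carrier ?W" "\<forall>r>0. \<exists>N. \<forall>m\<ge>N. \<forall>n\<ge>N. nrm ?W (s m \<oplus>\<^bsub>?W\<^esub> - 1 \<odot>\<^bsub>?W\<^esub> s n) < r" for s
  proof -
    have sS: "s n \<in> S" for n using s(1) by simp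
    have "vcauchy V s" unfolding vcauchy_def using s(2) c[OF sS] V by (simp add: bs_dif_conv)
    then obtain l where l: "vlim V s l" using bs_complete[OF V] by blast
    have "l \<in> S" by (rule closed[OF l sS])
    moreover have "(%n. dst V (s n) l) \<longlonglongrightarrow> 0" using l by (simp add: vlim_def)
    ultimately show ?thesis using c[OF sS] c V by (intro bexI[of _ l]) (auto simp: bs_dif_conv)
  qed
  show "x \<oplus>\<^bsub>?W\<^esub> y \<oplus>\<^bsub>?W\<^esub> z = x \<oplus>\<^bsub>?W\<^esub> (y \<oplus>\<^bsub>?W\<^esub> z)" if "x \<in> carrier ?W" "y \<in> carrier ?W" "z \<in> carrier ?W" for x y z
    using that c by (simp add: bs_ac[OF V])
  show "x \<oplus>\<^bsub>?W\<^esub> y = y \<oplus>\<^bsub>?W\<^esub> x" if "x \<in> carrier ?W" "y \<in> carrier ?W" for x y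
    using that c bs_ac(2)[OF V] by simp
  show "- 1 \<odot>\<^bsub>?W\<^esub> x \<oplus>\<^bsub>?W\<^esub> x = \<zero>\<^bsub>?W\<^esub>" if "x \<in> carrier ?W" for x
    using that c V by (simp flip: bs_neg_conv)
  show "nrm ?W (x \<oplus>\<^bsub>?W\<^esub> y) \<le> tri c (nrm ?W x) (nrm ?W y)" if "x \<in> carrier ?W" "y \<in> carrier ?W" for x y
    using that c nrm_tri[OF V] by simp
  show "x = \<zero>\<^bsub>?W\<^esub>" if "x \<in> carrier ?W" "nrm ?W x = 0" for x using that c nrm_eq_0[OF V] by simp
qed (use add smult zero S V in \<open>auto simp: bs_smult subset_iff\<close>)

lemma geq_up:
  assumes Y: "isind Y" and j: "j \<in> idx Y" "j' \<in> idx Y" "m \<in> idx Y" and w: "w \<in> arr Y j m" "w' \<in> arr Y j' m"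
    and f: "!!x. x \<in> P ==> f x \<in> elts Y j" "!!x. x \<in> P ==> f' x \<in> elts Y j'" and g: "geq Y P j f j' f'"
  shows "geq Y P m (%x. trn Y j m w (f x)) m (%x. trn Y j' m w' (f' x))"
proof -
  have t: "trn Y j m w (f x) \<in> elts Y m" "trn Y j' m w' (f' x) \<in> elts Y m" if "x \<in> P" for x
    using ind_trn_closed[OF Y j(1,3) w(1) f(1)[OF that]] ind_trn_closed[OF Y j(2,3) w(2) f(2)[OF that]] by auto
  have 1: "geq Y P m (%x. trn Y j m w (f x)) j' f'"
    by (rule geq_trans[OF Y j(3,1,2) t(1) f(1) f(2) geq_sym[OF geq_trn[OF Y j(1,3) w(1) f(1)]] g])
  show ?thesis by (rule geq_trans[OF Y j(3,2,3) t(1) f(2) t(2) 1 geq_trn[OF Y j(2,3) w(2) f(2)]])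
qed

text \<open>The two families reach their common stage along arrows that may differ; composing with
  an equalising arrow leaves one arrow for both.\<close>

lemma geq_same:
  assumes Y: "isind Y" and m: "m \<in> idx Y"
    and f: "!!x. x \<in> P ==> f x \<in> elts Y m" "!!x. x \<in> P ==> f' x \<in> elts Y m" and g: "geq Y P m f m f'"
  shows "\<exists>l\<in>idx Y. \<exists>s\<in>arr Y m l. \<forall>x\<in>P. trn Y m l s (f x) = trn Y m l s (f' x)"
proof -
  obtain k a b where k: "k \<in> idx Y" "a \<in> arr Y m k" "b \<in> arr Y m k"
    "!!x. x \<in> P ==> trn Y m k a (f x) = trn Y m k b (f' x)" by (rule geqE[OF g]) blast
  obtain l h where l: "l \<in> idx Y" "h \<in> arr Y k l" "Cmp (shape Y) m k l h a = Cmp (shape Y) m k l h b"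
    using ind_coeq[OF Y m k(1-3)] by blast
  have "trn Y m l (Cmp (shape Y) m k l h a) (f x) = trn Y m l (Cmp (shape Y) m k l h a) (f' x)" if x: "x \<in> P" for x
    using ind_trn_comp[OF Y m k(1) l(1) k(2) l(2) f(1)[OF x]] ind_trn_comp[OF Y m k(1) l(1) k(3) l(2) f(2)[OF x]] k(4)[OF x] l(3)
    by simp
  thus ?thesis using l(1) ind_comp_arr[OF Y m k(1) l(1) k(2) l(2)] by blast
qed

text \<open>Finitely many agreements are realised one after the other, each along an arrow that
  prolongs the previous one and so keeps what has been achieved.\<close>

lemma geq_same_list:
  assumes Y: "isind Y" and m: "m \<in> idx Y"
    and es: "\<forall>(P, f, f')\<in>set es. geq Y P m f m f' \<and> (\<forall>x\<in>P. f x \<in> elts Y m \<and> f' x \<in> elts Y m)"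
  shows "\<exists>l\<in>idx Y. \<exists>s\<in>arr Y m l. \<forall>(P, f, f')\<in>set es. \<forall>x\<in>P. trn Y m l s (f x) = trn Y m l s (f' x)"
  using es
proof (induction es)
  case Nil thus ?case using m ind_id_arr[OF Y m] by auto
next
  case (Cons e es)
  obtain P f f' where e: "e = (P, f, f')" by (cases e) auto
  obtain l s where l: "l \<in> idx Y" "s \<in> arr Y m l" "\<forall>(P, f, f')\<in>set es. \<forall>x\<in>P. trn Y m l s (f x) = trn Y m l s (f' x)"
    using Cons by auto
  have f: "!!x. x \<in> P ==> f x \<in> elts Y m" "!!x. x \<in> P ==> f' x \<in> elts Y m" "geq Y P m f m f'"
    using Cons.prems by (auto simp: e)
  note g = geq_up[OF Y m m l(1) l(2) l(2) f]
  obtain k t where k: "k \<in> idx Y" "t \<in> arr Y l k" "\<forall>x\<in>P. trn Y l k t (trn Y m l s (f x)) = trn Y l k t (trn Y m l s (f' x))"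
    using geq_same[OF Y l(1) ind_trn_closed[OF Y m l(1,2) f(1)] ind_trn_closed[OF Y m l(1,2) f(2)] g] by blast
  let ?u = "Cmp (shape Y) m l k t s"
  have c: "trn Y m k ?u x = trn Y l k t (trn Y m l s x)" if "x \<in> elts Y m" for x
    by (rule ind_trn_comp[OF Y m l(1) k(1) l(2) k(2) that])
  have "\<forall>(P, f, f')\<in>set (e # es). \<forall>x\<in>P. trn Y m k ?u (f x) = trn Y m k ?u (f' x)"
  proof (intro ballI, clarify)
    fix P0 f0 f0' x assume p: "(P0, f0, f0') \<in> set (e # es)" and x: "x \<in> P0"
    have "f0 x \<in> elts Y m" "f0' x \<in> elts Y m" using bspec[OF Cons.prems p] x by auto
    thus "trn Y m k ?u (f0 x) = trn Y m k ?u (f0' x)"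
      unfolding c using p x k(3) l(3) by (auto simp: e c)
  qed
  thus ?case using k(1) ind_comp_arr[OF Y m l(1) k(1) l(2) k(2)] by blast
qed

end

section \<open>Strict actions and codes in the universe\<close>

context universe
begin

text \<open>Every stage carries an honest isometric action and the transition maps are equivariant.
  The work lies in \<open>is_gmod_iso\<close> speaking of all representatives: each is compared with
  \<sigma>, for which the laws hold without passing to a later stage.\<close>

lemma strict_gmod:
  fixes Y :: "('k, 'u) uind"
  assumes Y: "isind Y"
    and sot: "!!i. i \<in> idx Y ==> \<sigma> i \<in> sot_maps (at_idx Y i) (at_idx Y i)"
    and iso: "!!i g x. i \<in> idx Y ==> x \<in> elts Y i ==> nrm (at_idx Y i) (\<sigma> i g x) = nrm (at_idx Y i) x"
    and mult: "!!i g h x. i \<in> idx Y ==> x \<in> elts Y i ==> \<sigma> i g (\<sigma> i h x) = \<sigma> i (g + h) x"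
    and unit: "!!i x. i \<in> idx Y ==> x \<in> elts Y i ==> \<sigma> i (0::'g) x = x"
    and nat: "!!i l a g x. i \<in> idx Y ==> l \<in> idx Y ==> a \<in> arr Y i l ==> x \<in> elts Y i ==>
      trn Y i l a (\<sigma> i g x) = \<sigma> l g (trn Y i l a x)"
  defines "\<alpha> \<equiv> \<lambda>i\<in>idx Y. fam_germ (at_idx Y i) Y i (\<sigma> i)"
  shows "gm (Y, \<alpha>)" "!!i. i \<in> idx Y ==> (i, \<sigma> i) \<in> \<alpha> i"
proof -
  have \<alpha>: "\<alpha> i = fam_germ (at_idx Y i) Y i (\<sigma> i)" if "i \<in> idx Y" for i using that by (simp add: \<alpha>_def)
  show self: "(i, \<sigma> i) \<in> \<alpha> i" if "i \<in> idx Y" for i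
    unfolding \<alpha>[OF that] by (rule fam_germ_self[OF Y that sot[OF that]])
  have mem: "j \<in> idx Y" "\<tau> \<in> sot_maps (at_idx Y i) (at_idx Y j)" "geq Y (UNIV \<times> elts Y i) i (act (\<sigma> i)) j (act \<tau>)"
    if "i \<in> idx Y" "(j, \<tau>) \<in> \<alpha> i" for i j \<tau>
    using that(2) unfolding \<alpha>[OF that(1)] fam_germ_iff by blast+
  have nat0: "geq Y (UNIV \<times> elts Y i) i (act (\<sigma> i)) j (%p. \<tau> (fst p) (trn Y i l a (snd p)))"
    if h: "i \<in> idx Y" "l \<in> idx Y" "a \<in> arr Y i l" "(j, \<tau>) \<in> \<alpha> l" for i l a j \<tau>
  proof -
    note m = mem[OF h(2,4)]
    note tc = ind_trn_closed[OF Y h(1-3)]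
    have 1: "geq Y (UNIV \<times> elts Y i) i (act (\<sigma> i)) l (%p. trn Y i l a (act (\<sigma> i) p))"
      by (rule geq_trn[OF Y h(1-3) sot_closed[OF sot[OF h(1)]]])
    have 2: "geq Y (UNIV \<times> elts Y i) l (%p. trn Y i l a (act (\<sigma> i) p)) j (%p. \<tau> (fst p) (trn Y i l a (snd p)))"
      by (rule geq_cong[OF geq_pre[OF m(3), where Q="UNIV \<times> elts Y i" and k="%p. (fst p, trn Y i l a (snd p))"]])
        (use tc nat[OF h(1-3)] in auto)
    have c2: "trn Y i l a (act (\<sigma> i) p) \<in> elts Y l" if "p \<in> UNIV \<times> elts Y i" for p
      by (rule tc[OF sot_closed[OF sot[OF h(1)] that]])
    have c3: "\<tau> (fst p) (trn Y i l a (snd p)) \<in> elts Y j" if "p \<in> UNIV \<times> elts Y i" for p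
      using that bl_closed[OF sotD(1)[OF m(2)] tc] by auto
    show ?thesis by (rule geq_trans[OF Y h(1,2) m(1) sot_closed[OF sot[OF h(1)]] c2 c3 1 2])
  qed
  have nat1: "geq Y (UNIV \<times> elts Y i) j0 (act \<tau>0) j (%p. \<tau> (fst p) (trn Y i l a (snd p)))"
    if h: "i \<in> idx Y" "l \<in> idx Y" "a \<in> arr Y i l" "(j0, \<tau>0) \<in> \<alpha> i" "(j, \<tau>) \<in> \<alpha> l" for i l a j \<tau> j0 \<tau>0
  proof -
    note m0 = mem[OF h(1,4)] and m = mem[OF h(2,5)]
    have c3: "\<tau> (fst p) (trn Y i l a (snd p)) \<in> elts Y j" if "p \<in> UNIV \<times> elts Y i" for p
      using that bl_closed[OF sotD(1)[OF m(2)] ind_trn_closed[OF Y h(1-3)]] by auto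
    show ?thesis
      by (rule geq_trans[OF Y m0(1) h(1) m(1) sot_closed[OF m0(2)] sot_closed[OF sot[OF h(1)]] c3 geq_sym[OF m0(3)] nat0[OF h(1-3,5)]])
  qed
  have A: "\<exists>i'\<in>idx Y. \<exists>\<tau>\<in>sot_maps (at_idx Y i) (at_idx Y i').
            (\<forall>g. \<forall>x\<in>elts Y i. nrm (at_idx Y i') (\<tau> g x) = nrm (at_idx Y i) x) \<and> \<alpha> i = fam_germ (at_idx Y i) Y i' \<tau>"
    if i: "i \<in> idx Y" for i
    by (rule bexI[OF _ i], rule bexI[OF _ sot[OF i]]) (use iso[OF i] \<alpha>[OF i] in simp)
  have B: "\<alpha> i = fam_germ (at_idx Y i) Y j (%g. compose (elts Y i) (\<tau> g) (trn Y i l a))"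
    if h: "i \<in> idx Y" "l \<in> idx Y" "a \<in> arr Y i l" "(j, \<tau>) \<in> \<alpha> l" for i l a j \<tau>
  proof -
    note m = mem[OF h(2,4)]
    note t = ind_trn[OF Y h(1-3)]
    let ?\<tau> = "%g. compose (elts Y i) (\<tau> g) (trn Y i l a)"
    have s: "?\<tau> \<in> sot_maps (at_idx Y i) (at_idx Y j)"
      unfolding sot_maps_def
    proof (intro CollectI conjI allI ballI)
      show "?\<tau> g \<in> bl_hom (at_idx Y i) (at_idx Y j)" for g
        by (rule bl_comp[OF t sotD(1)[OF m(2)] ind_bs[OF Y h(1)] ind_bs[OF Y h(2)]])
      show "cont_into (at_idx Y j) (%g. ?\<tau> g x)" if "x \<in> elts Y i" for x
        using sotD(2)[OF m(2) bl_closed[OF t that]] that by (simp add: compose_eq)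
    qed
    have g: "geq Y (UNIV \<times> elts Y i) i (act (\<sigma> i)) j (act ?\<tau>)"
      by (rule geq_cong[OF nat0[OF h]]) (auto simp: compose_eq)
    show ?thesis unfolding \<alpha>[OF h(1)] by (rule fam_germ_eqI[OF Y h(1) m(1) sot[OF h(1)] s g])
  qed
  have D: "(i', \<tau> 0) \<in> ind_id Y i" if h: "i \<in> idx Y" "(i', \<tau>) \<in> \<alpha> i" for i i' \<tau>
  proof -
    note m = mem[OF h]
    have "geq Y (elts Y i) i (ban_id (at_idx Y i)) i' (\<tau> 0)"
      by (rule geq_cong[OF geq_pre[OF m(3), where Q="elts Y i" and k="%x. (0, x)"]]) (auto simp: unit[OF h(1)])
    thus ?thesis unfolding ind_id_def restrict_apply'[OF h(1)] germ_iff using m(1) sotD(1)[OF m(2)] by blast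
  qed
  have E: "\<exists>l\<in>idx Y. \<exists>a\<in>arr Y i'' l. \<exists>b\<in>arr Y i' l. \<forall>g h.
              compose (elts Y i) (trn Y i'' l a) (compose (elts Y i) (\<tau>' g) (\<tau> h))
                = compose (elts Y i) (trn Y i' l b) (\<tau> (g + h))"
    if h: "i \<in> idx Y" "(i', \<tau>) \<in> \<alpha> i" "(i'', \<tau>') \<in> \<alpha> i'" for i i' \<tau> i'' \<tau>'
  proof -
    note m = mem[OF h(1,2)]
    note m' = mem[OF m(1) h(3)]
    let ?P = "(UNIV :: 'g set) \<times> elts Y i"
    \<comment> \<open>The composite of arbitrary representatives is compared with the strict one
      through \<open>geq_map\<close>, with the outer group element as parameter.\<close>
    have 1: "geq Y (UNIV \<times> ?P) i'' (%(q, p). \<tau>' q (act \<tau> p)) i (%(q, p). \<sigma> i q (act (\<sigma> i) p))"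
    proof (rule geq_map[OF Y Y, where \<Phi>=\<alpha>])
      show "\<exists>l h. (l, h) \<in> \<alpha> j" if "j \<in> idx Y" for j using self[OF that] by blast
      show "l \<in> idx Y" if "j \<in> idx Y" "(l, h) \<in> \<alpha> j" for j l h by (rule mem(1)[OF that])
      show "h q y \<in> elts Y l" if "j \<in> idx Y" "(l, h) \<in> \<alpha> j" "y \<in> elts Y j" for j l h q y
        by (rule bl_closed[OF sotD(1)[OF mem(2)[OF that(1,2)]] that(3)])
      show "geq Y (UNIV \<times> elts Y j) l (%(q, y). h q y) l' (%(q, y). h' q (trn Y j j' a y))"
        if "j \<in> idx Y" "j' \<in> idx Y" "a \<in> arr Y j j'" "(l, h) \<in> \<alpha> j" "(l', h') \<in> \<alpha> j'" for j j' a l h l' h'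
        by (rule geq_cong[OF nat1[OF that]]) auto
      show "geq Y ?P i' (act \<tau>) i (act (\<sigma> i))" by (rule geq_sym[OF m(3)])
    qed (use m(1) h self[OF h(1)] sot_closed[OF m(2)] sot_closed[OF sot[OF h(1)]] in auto)
    have 2: "geq Y (UNIV \<times> ?P) i (%(q, p). \<sigma> i q (act (\<sigma> i) p)) i' (%(q, p). \<tau> (q + fst p) (snd p))"
      by (rule geq_cong[OF geq_pre[OF m(3), where Q="UNIV \<times> ?P" and k="%(q, p). (q + fst p, snd p)"]]) (auto simp: mult[OF h(1)])
    have c1: "(%(q, p). \<tau>' q (act \<tau> p)) p \<in> elts Y i''" if "p \<in> UNIV \<times> ?P" for p
      using that bl_closed[OF sotD(1)[OF m'(2)] sot_closed[OF m(2)]] by auto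
    have c2: "(%(q, p). \<sigma> i q (act (\<sigma> i) p)) p \<in> elts Y i" if "p \<in> UNIV \<times> ?P" for p
      using that bl_closed[OF sotD(1)[OF sot[OF h(1)]] sot_closed[OF sot[OF h(1)]]] by auto
    have c3: "(%(q, p). \<tau> (q + fst p) (snd p)) p \<in> elts Y i'" if "p \<in> UNIV \<times> ?P" for p
      using that bl_closed[OF sotD(1)[OF m(2)]] by auto
    have "geq Y (UNIV \<times> ?P) i'' (%(q, p). \<tau>' q (act \<tau> p)) i' (%(q, p). \<tau> (q + fst p) (snd p))"
      by (rule geq_trans[OF Y m'(1) h(1) m(1) c1 c2 c3 1 2])
    then obtain l a b where l: "l \<in> idx Y" "a \<in> arr Y i'' l" "b \<in> arr Y i' l"
      "!!p. p \<in> UNIV \<times> ?P ==> trn Y i'' l a ((%(q, p). \<tau>' q (act \<tau> p)) p) = trn Y i' l b ((%(q, p). \<tau> (q + fst p) (snd p)) p)"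
      by (rule geqE) blast
    have "compose (elts Y i) (trn Y i'' l a) (compose (elts Y i) (\<tau>' g) (\<tau> h))
        = compose (elts Y i) (trn Y i' l b) (\<tau> (g + h))" for g h
      unfolding compose_eq_iff using l(4)[of "(g, h, _)"] by (auto simp: compose_eq)
    thus ?thesis using l(1-3) by blast
  qed
  show "gm (Y, \<alpha>)"
    unfolding is_gmod_iso_def Let_def fst_conv snd_conv
    using Y A B D E by (auto simp: \<alpha>_def)
qed

text \<open>Quadruples are coded by families over \<nat> \<times> G that depend on the number alone;
  the entries are recovered from the values at 0, 1, 2 and 3.\<close>

definition qc :: "'u \<times> 'u \<times> 'u \<times> 'u => 'u" where
  "qc = (%(j, l, a, b). en (%(n, x). if n = 0 then j else if n = 1 then l else if n = 2 then a else b))"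

lemma inj_qc: "inj qc"
proof (rule injI)
  fix p q :: "'u \<times> 'u \<times> 'u \<times> 'u" assume e: "qc p = qc q"
  obtain j l a b where p: "p = (j, l, a, b)" by (cases p) auto
  obtain j' l' a' b' where q: "q = (j', l', a', b')" by (cases q) auto
  have "(%(n::nat, x::'g). if n = 0 then j else if n = 1 then l else if n = 2 then a else b)
    = (%(n, x). if n = 0 then j' else if n = 1 then l' else if n = 2 then a' else b')" (is "?f = ?g")
    using e inj_en unfolding p q qc_def by (auto dest: injD)
  hence "?f (n, undefined) = ?g (n, undefined)" for n by (rule fun_cong)
  from this[of 0] this[of 1] this[of 2] this[of 3] show "p = q" unfolding p q by simp
qed

definition dq :: "'u => 'u \<times> 'u \<times> 'u \<times> 'u" where "dq = inv_into UNIV qc"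

lemma dq [simp]: "dq (qc p) = p" unfolding dq_def by (rule inv_into_f_f[OF inj_qc]) simp

definition denf :: "'u => 'g => 'u" where "denf = inv_into UNIV enf"

lemma denf [simp]: "denf (enf f) = f" unfolding denf_def by (rule inv_into_f_f[OF inj_enf]) simp

end

section \<open>A comodule and its orbit maps\<close>

locale comod = universe v c G enk en for v :: "'k::field => real" and c and G :: "'g::topological_group_add itself"
    and enk :: "'k => 'u" and en :: "(nat \<times> 'g => 'u) => 'u" +
  fixes X :: "('k, 'u) uind" and \<rho> :: "'u => ((unit \<times> 'u) \<times> ('u => ('g => 'k, 'u) tens)) set"
  assumes comod: "is_comodule v c (group_bialg v c :: ('k, 'g => 'k) bialg) (X, \<rho>)"
begin

lemma X: "isind X" and \<rho>: "\<rho> \<in> ind_hom X (AX X)" and coas: "coassociative X \<rho>" and coun: "counital X \<rho>"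
  using comod unfolding comodule_iff by auto

text \<open>\<open>R j : X\<^sub>j \<rightarrow> C \<otimes> X\<^bsub>L j\<^esub>\<close> represents the germ \<open>\<rho> j\<close>.\<close>

definition L :: "'u => 'u" where "L j = fst (SOME p. (((), fst p), snd p) \<in> \<rho> j)"
definition R :: "'u => 'u => ('g => 'k, 'u) tens" where "R j = snd (SOME p. (((), fst p), snd p) \<in> \<rho> j)"

lemma LR: assumes "j \<in> idx X" shows "(((), L j), R j) \<in> \<rho> j"
proof -
  obtain l r where "(((), l), r) \<in> \<rho> j" using AX_ne[OF X X \<rho> assms] by blast
  hence "\<exists>p. (((), fst p), snd p) \<in> \<rho> j" by (intro exI[of _ "(l, r)"]) simp
  thus ?thesis unfolding L_def R_def by (rule someI_ex)
qed

lemma L: "j \<in> idx X ==> L j \<in> idx X" and R: "j \<in> idx X ==> R j \<in> bl_hom (at_idx X j) (tC (at_idx X (L j)))"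
  using AX_mem[OF X X \<rho> _ LR] by auto

text \<open>The right translate of x by g, in a chosen representative of the coaction. It is a right
  action only after passing to later stages, by \<open>rr_mult\<close> and
  \<open>rr_unit\<close>.\<close>

definition rr :: "'u => 'g => 'u => 'u" where "rr j g x = ev (at_idx X (L j)) g (R j x)"

abbreviation "cX j \<equiv> elts X j"

lemma rr_closed: "j \<in> idx X ==> x \<in> cX j ==> rr j g x \<in> cX (L j)"
  unfolding rr_def by (rule ev_closed[OF ind_bs[OF X L] bl_closed[OF R]])

lemma rr_cont: "j \<in> idx X ==> x \<in> cX j ==> cont_into (at_idx X (L j)) (%g. rr j g x)"
  unfolding rr_def by (rule ev_cont[OF ind_bs[OF X L] bl_closed[OF R]])

lemma rr_hom: assumes j: "j \<in> idx X" shows "lin (at_idx X j) (at_idx X (L j)) (rr j g)"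
  using lin_comp[OF bl_lin[OF R[OF j]] bl_lin[OF ev_hom[OF ind_bs[OF X L[OF j]]]] ind_bs[OF X j] bs_tensor[OF bs_C ind_bs[OF X L[OF j]]]]
  unfolding rr_def .

lemma lin_bl: "lin V W f ==> restrict f (carrier V) \<in> bl_hom V W" by (simp add: lin_def)

lemma rr_nat: assumes j: "j \<in> idx X" "j' \<in> idx X" "a \<in> arr X j j'"
  shows "geq X (UNIV \<times> cX j) (L j) (%(g, x). rr j g x) (L j') (%(g, x). rr j' g (trn X j j' a x))"
proof -
  note t = ind_trn_closed[OF X j]
  have "geq (AX X) (cX j) ((), L j) (R j) ((), L j') (%x. R j' (trn X j j' a x))"
    by (rule ih_nat[OF X AX_isind[OF X] \<rho> j LR[OF j(1)] LR[OF j(2)]])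
  hence "geq X (UNIV \<times> cX j) (L j) (%(g, x). ev (at_idx X (L j)) g (R j x)) (L j') (%(g, x). ev (at_idx X (L j')) g (R j' (trn X j j' a x)))"
    by (subst (asm) geq_AX[OF sind_u[OF X] L[OF j(1)] L[OF j(2)] bl_closed[OF R[OF j(1)]] bl_closed[OF R[OF j(2)] t]])
  thus ?thesis unfolding rr_def .
qed

lemma rr_mult: assumes j: "j \<in> idx X"
  shows "geq X (UNIV \<times> UNIV \<times> cX j) (L (L j)) (%(h, g, x). rr (L j) h (rr j g x)) (L j) (%(h, g, x). rr j (g + h) x)"
  using coas j LR[OF j] LR[OF L[OF j]] unfolding coassociative_def rr_def by blast

lemma rr_unit: assumes j: "j \<in> idx X" shows "geq X (cX j) (L j) (%x. rr j 0 x) j (%x. x)"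
  using coun j LR[OF j] unfolding counital_def rr_def by blast

text \<open>\<open>E (j, l, a, b)\<close> consists of the functions into \<open>X\<^sub>j\<close> that stage \<open>l\<close> recognises as orbit
  maps of the coaction, i.e. as equal to \<open>g \<mapsto> ev\<^sub>g(\<rho>(f 0))\<close>. Unlike the image of \<open>X\<^sub>j\<close> under the
  orbit map, this set is closed and translation invariant.\<close>

definition Or :: "('u \<times> 'u \<times> 'u \<times> 'u) set" where
  "Or = {(j, l, a, b). j \<in> idx X \<and> l \<in> idx X \<and> a \<in> arr X j l \<and> b \<in> arr X (L j) l}"

definition E :: "'u \<times> 'u \<times> 'u \<times> 'u => ('g => 'u) set" where
  "E = (%(j, l, a, b). {f \<in> carrier (Cb (at_idx X j)).
     \<forall>g h. trn X j l a (f (g + h)) = trn X (L j) l b (rr j h (f g))})"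

definition Es :: "'u \<times> 'u \<times> 'u \<times> 'u => ('k, 'g => 'u) nspace" where
  "Es p = (Cb (at_idx X (fst p)))\<lparr>carrier := E p\<rparr>"

abbreviation "Eu p \<equiv> push enf (Es p)"

lemma E_iff: "f \<in> E (j, l, a, b) \<longleftrightarrow> f \<in> carrier (Cb (at_idx X j)) \<and>
     (\<forall>g h. trn X j l a (f (g + h)) = trn X (L j) l b (rr j h (f g)))"
  by (simp add: E_def)

lemma E_Cb: "f \<in> E p ==> f \<in> carrier (Cb (at_idx X (fst p)))"
  by (cases p) (auto simp: E_iff)

text \<open>For fixed g and h both sides of the equation defining \<open>E\<close> are bounded
  linear in f, so the equations cut out a closed subspace of the continuous functions.\<close>

lemma Es_bs: assumes p: "p \<in> Or" shows "bs (Es p)"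
proof -
  obtain j l a b where p': "p = (j, l, a, b)" by (cases p) auto
  have o: "j \<in> idx X" "l \<in> idx X" "a \<in> arr X j l" "b \<in> arr X (L j) l" using p by (auto simp: Or_def p')
  let ?V = "at_idx X j"
  note V = ind_bs[OF X o(1)] and Lj = L[OF o(1)]
  note W = ind_bs[OF X Lj] and U = ind_bs[OF X o(2)]
  note ta = ind_trn[OF X o(1-3)] and tb = ind_trn[OF X Lj o(2,4)]
  have fa: "lin (Cb ?V) (at_idx X l) (%f. trn X j l a (f (g + h)))" for g h
    by (rule lin_comp[OF lin_eval[OF V] bl_lin[OF ta] bs_Cb[OF V] V])
  have fb: "lin (Cb ?V) (at_idx X l) (%f. trn X (L j) l b (rr j h (f g)))" for g h
    by (rule lin_comp[OF lin_comp[OF lin_eval[OF V] rr_hom[OF o(1)] bs_Cb[OF V] V] bl_lin[OF tb] bs_Cb[OF V] W])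
  have c: "trn X j l a (f (g + h)) = restrict (%f. trn X j l a (f (g + h))) (carrier (Cb ?V)) f"
    "trn X (L j) l b (rr j h (f g)) = restrict (%f. trn X (L j) l b (rr j h (f g))) (carrier (Cb ?V)) f"
    if "f \<in> carrier (Cb ?V)" for f g h using that by auto
  note ha = lin_bl[OF fa] and hb = lin_bl[OF fb]
  show ?thesis unfolding Es_def p' fst_conv
  proof (rule bs_subspace[OF bs_Cb[OF V]])
    show "E (j, l, a, b) \<subseteq> carrier (Cb ?V)" by (auto simp: E_iff)
    show "x \<oplus>\<^bsub>Cb ?V\<^esub> y \<in> E (j, l, a, b)" if xy: "x \<in> E (j, l, a, b)" "y \<in> E (j, l, a, b)" for x y
    proof -
      have x: "x \<in> carrier (Cb ?V)" "y \<in> carrier (Cb ?V)" using xy by (auto simp: E_iff)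
      have "trn X j l a ((x \<oplus>\<^bsub>Cb ?V\<^esub> y) (g + h)) = trn X (L j) l b (rr j h ((x \<oplus>\<^bsub>Cb ?V\<^esub> y) g))" for g h
        unfolding c[OF bs_closed(2)[OF bs_Cb[OF V] x]] bl_add[OF ha x] bl_add[OF hb x]
        using xy x by (simp add: E_iff)
      thus ?thesis using bs_closed(2)[OF bs_Cb[OF V] x] by (simp add: E_iff)
    qed
    show "k \<odot>\<^bsub>Cb ?V\<^esub> x \<in> E (j, l, a, b)" if xE: "x \<in> E (j, l, a, b)" for k x
    proof -
      have x: "x \<in> carrier (Cb ?V)" using xE by (auto simp: E_iff)
      have "trn X j l a ((k \<odot>\<^bsub>Cb ?V\<^esub> x) (g + h)) = trn X (L j) l b (rr j h ((k \<odot>\<^bsub>Cb ?V\<^esub> x) g))" for g h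
        unfolding c[OF bs_closed(5)[OF bs_Cb[OF V] x]] bl_smult[OF ha x] bl_smult[OF hb x]
        using xE x by (simp add: E_iff)
      thus ?thesis using bs_closed(5)[OF bs_Cb[OF V] x] by (simp add: E_iff)
    qed
    show "\<zero>\<^bsub>Cb ?V\<^esub> \<in> E (j, l, a, b)"
    proof -
      have x: "\<zero>\<^bsub>Cb ?V\<^esub> \<in> carrier (Cb ?V)" using V by simp
      have "trn X j l a (\<zero>\<^bsub>Cb ?V\<^esub> (g + h)) = trn X (L j) l b (rr j h (\<zero>\<^bsub>Cb ?V\<^esub> g))" for g h
        unfolding c[OF x] bl_zero[OF ha bs_Cb[OF V] U] bl_zero[OF hb bs_Cb[OF V] U] ..
      thus ?thesis using x by (simp add: E_iff)
    qed
    show "f \<in> E (j, l, a, b)" if s: "vlim (Cb ?V) s f" "!!n. s n \<in> E (j, l, a, b)" for s f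
    proof -
      have f: "f \<in> carrier (Cb ?V)" "!!n. s n \<in> carrier (Cb ?V)" using s(1) by (auto simp: vlim_def)
      have "trn X j l a (f (g + h)) = trn X (L j) l b (rr j h (f g))" for g h
      proof -
        let ?A = "restrict (%f. trn X j l a (f (g + h))) (carrier (Cb ?V))"
        let ?B = "restrict (%f. trn X (L j) l b (rr j h (f g))) (carrier (Cb ?V))"
        have "vlim (at_idx X l) (%n. ?A (s n)) (?A f)" by (rule bl_vlim[OF ha bs_Cb[OF V] U s(1)])
        moreover have "?A (s n) = ?B (s n)" for n using s(2)[of n] f by (simp add: E_iff)
        ultimately have "vlim (at_idx X l) (%n. ?B (s n)) (?A f)" by simp
        from vlim_unique[OF U this bl_vlim[OF hb bs_Cb[OF V] U s(1)]] show ?thesis using f by simp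
      qed
      thus ?thesis using f by (simp add: E_iff)
    qed
  qed
qed

definition tr :: "'u => 'u => 'u => ('g => 'u) => 'g => 'u" where "tr j j' u f = (%g. trn X j j' u (f g))"

text \<open>An arrow of X counts if its transition map carries one function space into the other. It
  need not be related to l, a and b, so composition and equality of arrows are those of X.\<close>

definition okarr :: "'u \<times> 'u \<times> 'u \<times> 'u => 'u \<times> 'u \<times> 'u \<times> 'u => 'u => bool" where
  "okarr p p' u \<longleftrightarrow> u \<in> arr X (fst p) (fst p') \<and> (\<forall>f\<in>E p. tr (fst p) (fst p') u f \<in> E p')"

lemma tr_Cb: assumes "j \<in> idx X" "j' \<in> idx X" "u \<in> arr X j j'" "f \<in> carrier (Cb (at_idx X j))"
  shows "tr j j' u f \<in> carrier (Cb (at_idx X j'))"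
  using assms(4) cont_bl[OF ind_bs[OF X assms(1)] ind_bs[OF X assms(2)] ind_trn[OF X assms(1-3)]]
  unfolding tr_def Cb_carrier[OF ind_bs[OF X assms(1)]] Cb_carrier[OF ind_bs[OF X assms(2)]] by blast

text \<open>Functions in the two given spaces satisfy their equations at l and l'. Their images over
  n satisfy an equation at any stage where transition maps and coaction are compatible in four ways.
  Each compatibility holds in the colimit, so \<open>geq_same_list\<close> finds one stage k for all
  four, and the new index over n records it.\<close>

lemma amalgam:
  assumes p: "(j, l, a, b) \<in> Or" "(j', l', a', b') \<in> Or" and n: "n \<in> idx X" "u \<in> arr X j n" "u' \<in> arr X j' n"
  shows "\<exists>m s t. (n, m, s, t) \<in> Or \<and> okarr (j, l, a, b) (n, m, s, t) u \<and> okarr (j', l', a', b') (n, m, s, t) u'"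
proof -
  have o: "j \<in> idx X" "l \<in> idx X" "a \<in> arr X j l" "b \<in> arr X (L j) l"
    and o': "j' \<in> idx X" "l' \<in> idx X" "a' \<in> arr X j' l'" "b' \<in> arr X (L j') l'" using p by (auto simp: Or_def)
  note Ln = L[OF n(1)] and Lj = L[OF o(1)]
  \<comment> \<open>The stage m reached in the end receives arrows from l, l', n and
    \<open>L n\<close>.\<close>
  obtain m1 x1 x2 where m1: "m1 \<in> idx X" "x1 \<in> arr X l m1" "x2 \<in> arr X l' m1" using ind_span[OF X o(2) o'(2)] by blast
  obtain m2 x3 x4 where m2: "m2 \<in> idx X" "x3 \<in> arr X n m2" "x4 \<in> arr X (L n) m2" using ind_span[OF X n(1) Ln] by blast
  obtain m y1 y2 where m: "m \<in> idx X" "y1 \<in> arr X m1 m" "y2 \<in> arr X m2 m" using ind_span[OF X m1(1) m2(1)] by blast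
  obtain w where w: "w \<in> arr X l m" using ind_comp_arr[OF X o(2) m1(1) m(1) m1(2) m(2)] by blast
  obtain w' where w': "w' \<in> arr X l' m" using ind_comp_arr[OF X o'(2) m1(1) m(1) m1(3) m(2)] by blast
  obtain e where e: "e \<in> arr X n m" using ind_comp_arr[OF X n(1) m2(1) m(1) m2(2) m(3)] by blast
  obtain d where d: "d \<in> arr X (L n) m" using ind_comp_arr[OF X Ln m2(1) m(1) m2(3) m(3)] by blast
  note T = ind_trn_closed[OF X]
  \<comment> \<open>In the colimit the first agreement says that transition maps do not change an
    element; the second is naturality of the coaction along u, from \<open>rr_nat\<close>.\<close>
  have eqs: "geq X ((UNIV :: 'g set) \<times> cX j) m (%p. trn X l m w (trn X j l a (snd p))) m (%p. trn X n m e (trn X j n u (snd p)))"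
    "geq X (UNIV \<times> cX j) m (%p. trn X l m w (trn X (L j) l b (rr j (fst p) (snd p)))) m (%p. trn X (L n) m d (rr n (fst p) (trn X j n u (snd p))))"
    if o: "j \<in> idx X" "l \<in> idx X" "a \<in> arr X j l" "b \<in> arr X (L j) l" and w: "w \<in> arr X l m" and u: "u \<in> arr X j n" for j l a b w u
  proof -
    note Lj = L[OF o(1)]
    have c: "snd p \<in> cX j" if "p \<in> (UNIV :: 'g set) \<times> cX j" for p using that by auto
    have 1: "geq X ((UNIV :: 'g set) \<times> cX j) l (%p. trn X j l a (snd p)) j snd"
      by (rule geq_sym[OF geq_trn[OF X o(1,2,3) c]])
    have 2: "geq X ((UNIV :: 'g set) \<times> cX j) l (%p. trn X j l a (snd p)) n (%p. trn X j n u (snd p))"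
      by (rule geq_trans[OF X o(2,1) n(1) T[OF o(1,2,3) c] c T[OF o(1) n(1) u c] 1 geq_trn[OF X o(1) n(1) u c]])
    show "geq X ((UNIV :: 'g set) \<times> cX j) m (%p. trn X l m w (trn X j l a (snd p))) m (%p. trn X n m e (trn X j n u (snd p)))"
      by (rule geq_up[OF X o(2) n(1) m(1) w e T[OF o(1,2,3) c] T[OF o(1) n(1) u c] 2])
    have rc: "rr j (fst p) (snd p) \<in> cX (L j)" "rr n (fst p) (trn X j n u (snd p)) \<in> cX (L n)" if "p \<in> (UNIV :: 'g set) \<times> cX j" for p
      using rr_closed[OF o(1) c[OF that]] rr_closed[OF n(1) T[OF o(1) n(1) u c[OF that]]] by auto
    have 3: "geq X (UNIV \<times> cX j) (L j) (%p. rr j (fst p) (snd p)) (L n) (%p. rr n (fst p) (trn X j n u (snd p)))"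
      by (rule geq_cong[OF rr_nat[OF o(1) n(1) u]]) auto
    have 4: "geq X (UNIV \<times> cX j) l (%p. trn X (L j) l b (rr j (fst p) (snd p))) (L n) (%p. rr n (fst p) (trn X j n u (snd p)))"
      by (rule geq_trans[OF X o(2) Lj Ln T[OF Lj o(2,4) rc(1)] rc(1) rc(2) geq_sym[OF geq_trn[OF X Lj o(2,4) rc(1)]] 3])
    show "geq X (UNIV \<times> cX j) m (%p. trn X l m w (trn X (L j) l b (rr j (fst p) (snd p)))) m (%p. trn X (L n) m d (rr n (fst p) (trn X j n u (snd p))))"
      by (rule geq_up[OF X o(2) Ln m(1) w d T[OF Lj o(2,4) rc(1)] rc(2) 4])
  qed
  let ?es = "[(UNIV \<times> cX j, %p. trn X l m w (trn X j l a (snd p)), %p. trn X n m e (trn X j n u (snd p))),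
     (UNIV \<times> cX j, %p. trn X l m w (trn X (L j) l b (rr j (fst p) (snd p))), %p. trn X (L n) m d (rr n (fst p) (trn X j n u (snd p)))),
     (UNIV \<times> cX j', %p. trn X l' m w' (trn X j' l' a' (snd p)), %p. trn X n m e (trn X j' n u' (snd p))),
     (UNIV \<times> cX j', %p. trn X l' m w' (trn X (L j') l' b' (rr j' (fst p) (snd p))), %p. trn X (L n) m d (rr n (fst p) (trn X j' n u' (snd p))))]
     :: (('g \<times> 'u) set \<times> ('g \<times> 'u => 'u) \<times> ('g \<times> 'u => 'u)) list"
  have cl: "trn X l m w (trn X j l a x) \<in> cX m" "trn X n m e (trn X j n u x) \<in> cX m"
    "trn X l m w (trn X (L j) l b (rr j g x)) \<in> cX m" "trn X (L n) m d (rr n g (trn X j n u x)) \<in> cX m"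
    if o: "j \<in> idx X" "l \<in> idx X" "a \<in> arr X j l" "b \<in> arr X (L j) l" "w \<in> arr X l m" "u \<in> arr X j n" "x \<in> cX j" for j l a b w u x g
    using T[OF o(2) m(1) o(5) T[OF o(1,2,3,7)]] T[OF n(1) m(1) e T[OF o(1) n(1) o(6,7)]]
      T[OF o(2) m(1) o(5) T[OF L[OF o(1)] o(2,4) rr_closed[OF o(1,7)]]] T[OF Ln m(1) d rr_closed[OF n(1) T[OF o(1) n(1) o(6,7)]]] by auto
  have "\<forall>(P, f, f')\<in>set ?es. geq X P m f m f' \<and> (\<forall>x\<in>P. f x \<in> cX m \<and> f' x \<in> cX m)"
    using eqs[OF o w n(2)] eqs[OF o' w' n(3)] cl[OF o w n(2)] cl[OF o' w' n(3)] by auto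
  from geq_same_list[OF X m(1) this]
  obtain k s where k: "k \<in> idx X" "s \<in> arr X m k" and q: "\<forall>(P, f, f')\<in>set ?es. \<forall>x\<in>P. trn X m k s (f x) = trn X m k s (f' x)"
    by blast
  let ?S = "Cmp (shape X) n m k s e" and ?T = "Cmp (shape X) (L n) m k s d"
  have O3: "(n, k, ?S, ?T) \<in> Or"
    using n(1) k(1) ind_comp_arr[OF X n(1) m(1) k(1) e k(2)] ind_comp_arr[OF X Ln m(1) k(1) d k(2)] by (simp add: Or_def)
  have ok: "okarr (j, l, a, b) (n, k, ?S, ?T) u"
    if o: "j \<in> idx X" "l \<in> idx X" "a \<in> arr X j l" "b \<in> arr X (L j) l" and w: "w \<in> arr X l m" and u: "u \<in> arr X j n"
      and q1: "!!x. x \<in> cX j ==> trn X m k s (trn X l m w (trn X j l a x)) = trn X m k s (trn X n m e (trn X j n u x))"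
      and q2: "!!g x. x \<in> cX j ==> trn X m k s (trn X l m w (trn X (L j) l b (rr j g x))) = trn X m k s (trn X (L n) m d (rr n g (trn X j n u x)))"
    for j l a b w u
    unfolding okarr_def fst_conv
  proof (intro conjI u ballI)
    fix f assume f: "f \<in> E (j, l, a, b)"
    have fC: "f \<in> carrier (Cb (at_idx X j))" and fE: "!!g h. trn X j l a (f (g + h)) = trn X (L j) l b (rr j h (f g))"
      using f by (auto simp: E_iff)
    have fc: "f g \<in> cX j" for g by (rule Cb_closed[OF ind_bs[OF X o(1)] fC])
    \<comment> \<open>\<open>q1\<close> carries the left side back to stage l, where f satisfies its
      own equation, and \<open>q2\<close> carries the result over to the coaction at n.\<close>
    have "trn X n k ?S (tr j n u f (g + h)) = trn X (L n) k ?T (rr n h (tr j n u f g))" for g h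
    proof -
      have "trn X n k ?S (tr j n u f (g + h)) = trn X m k s (trn X n m e (trn X j n u (f (g + h))))"
        unfolding tr_def by (rule ind_trn_comp[OF X n(1) m(1) k(1) e k(2) T[OF o(1) n(1) u fc]])
      also have "\<dots> = trn X m k s (trn X l m w (trn X (L j) l b (rr j h (f g))))"
        unfolding q1[OF fc, symmetric] fE ..
      also have "\<dots> = trn X m k s (trn X (L n) m d (rr n h (trn X j n u (f g))))" by (rule q2[OF fc])
      also have "\<dots> = trn X (L n) k ?T (rr n h (tr j n u f g))"
        unfolding tr_def by (rule ind_trn_comp[OF X Ln m(1) k(1) d k(2) rr_closed[OF n(1) T[OF o(1) n(1) u fc]], symmetric])
      finally show ?thesis .
    qed
    thus "tr j n u f \<in> E (n, k, ?S, ?T)" using tr_Cb[OF o(1) n(1) u fC] by (simp add: E_iff)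
  qed
  have "okarr (j, l, a, b) (n, k, ?S, ?T) u"
    by (rule ok[OF o w n(2)]) (use q in auto)
  moreover have "okarr (j', l', a', b') (n, k, ?S, ?T) u'"
    by (rule ok[OF o' w' n(3)]) (use q in auto)
  ultimately show ?thesis using O3 by blast
qed

section \<open>The ind-object of orbit functions\<close>

definition YJ :: "('u, 'u) cat" where
  "YJ = \<lparr>Ob = qc ` Or, Ar = (%o1 o2. {u. okarr (dq o1) (dq o2) u}),
     Idm = (%o1. Idm (shape X) (fst (dq o1))),
     Cmp = (%o1 o2 o3 g f. Cmp (shape X) (fst (dq o1)) (fst (dq o2)) (fst (dq o3)) g f)\<rparr>"

definition Y :: "('k, 'u) uind" where
  "Y = \<lparr>shape = YJ, diag = \<lparr>fob = (%o1. Eu (dq o1)),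
     far = (%o1 o2 u. \<lambda>y\<in>carrier (Eu (dq o1)). enf (tr (fst (dq o1)) (fst (dq o2)) u (denf y)))\<rparr>\<rparr>"

lemma Y_simps: "idx Y = qc ` Or" "u \<in> arr Y o1 o2 \<longleftrightarrow> okarr (dq o1) (dq o2) u"
  "at_idx Y o1 = Eu (dq o1)"
  "trn Y o1 o2 u = (\<lambda>y\<in>carrier (Eu (dq o1)). enf (tr (fst (dq o1)) (fst (dq o2)) u (denf y)))"
  "Idm (shape Y) o1 = Idm (shape X) (fst (dq o1))"
  "Cmp (shape Y) o1 o2 o3 g f = Cmp (shape X) (fst (dq o1)) (fst (dq o2)) (fst (dq o3)) g f"
  by (simp_all add: Y_def YJ_def)

lemma inj_enf_on: "inj_on enf A" by (rule inj_on_subset[OF inj_enf]) simp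

lemma Y_bs: "p \<in> Or ==> bs (Eu p)"
  by (rule push_bs[OF Es_bs inj_enf_on])

lemma Y_carrier: assumes "p \<in> Or" shows "carrier (Eu p) = enf ` E p"
  using push_carrier[OF Es_bs[OF assms] inj_enf_on] by (simp add: Es_def)

lemma Y_nrm: assumes "p \<in> Or" "f \<in> E p" shows "nrm (Eu p) (enf f) = nrm (Cb (at_idx X (fst p))) f"
proof -
  have "f \<in> carrier (Es p)" using assms by (simp add: Es_def)
  from push_nrm[OF Es_bs[OF assms(1)] inj_enf_on this] show ?thesis by (simp add: Es_def)
qed

lemma Y_ops: assumes p: "p \<in> Or"
  shows "f \<in> E p ==> f' \<in> E p ==> enf f \<oplus>\<^bsub>Eu p\<^esub> enf f' = enf (f \<oplus>\<^bsub>Cb (at_idx X (fst p))\<^esub> f')"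
    "f \<in> E p ==> k \<odot>\<^bsub>Eu p\<^esub> enf f = enf (k \<odot>\<^bsub>Cb (at_idx X (fst p))\<^esub> f)"
    "f \<in> E p ==> f' \<in> E p ==> f \<oplus>\<^bsub>Cb (at_idx X (fst p))\<^esub> f' \<in> E p"
    "f \<in> E p ==> k \<odot>\<^bsub>Cb (at_idx X (fst p))\<^esub> f \<in> E p"
proof -
  note i = push_iso[OF Es_bs[OF p] inj_enf_on, THEN ban_iso_hom]
  have c: "carrier (Es p) = E p" by (simp add: Es_def)
  note B = Es_bs[OF p]
  show a: "f \<oplus>\<^bsub>Cb (at_idx X (fst p))\<^esub> f' \<in> E p" if "f \<in> E p" "f' \<in> E p" for f f'
    using bs_closed(2)[OF B, of f f'] that by (simp add: Es_def)
  show m: "k \<odot>\<^bsub>Cb (at_idx X (fst p))\<^esub> f \<in> E p" if "f \<in> E p" for f k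
    using bs_closed(5)[OF B, of f k] that by (simp add: Es_def)
  show "enf f \<oplus>\<^bsub>Eu p\<^esub> enf f' = enf (f \<oplus>\<^bsub>Cb (at_idx X (fst p))\<^esub> f')" if f: "f \<in> E p" "f' \<in> E p" for f f'
    using bl_add[OF i, of f f'] f a[OF f] by (simp add: c) (simp add: Es_def)
  show "k \<odot>\<^bsub>Eu p\<^esub> enf f = enf (k \<odot>\<^bsub>Cb (at_idx X (fst p))\<^esub> f)" if f: "f \<in> E p" for f k
    using bl_smult[OF i, of f k] f m[OF f] by (simp add: c) (simp add: Es_def)
qed

lemma enf_hom:
  assumes p: "p \<in> Or" and p': "p' \<in> Or" and T: "!!f. f \<in> E p ==> T f \<in> E p'"
    and add: "!!f f'. f \<in> E p ==> f' \<in> E p ==> T (f \<oplus>\<^bsub>Cb (at_idx X (fst p))\<^esub> f') = T f \<oplus>\<^bsub>Cb (at_idx X (fst p'))\<^esub> T f'"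
    and smult: "!!k f. f \<in> E p ==> T (k \<odot>\<^bsub>Cb (at_idx X (fst p))\<^esub> f) = k \<odot>\<^bsub>Cb (at_idx X (fst p'))\<^esub> T f"
    and bound: "!!f. f \<in> E p ==> nrm (Cb (at_idx X (fst p'))) (T f) \<le> B * nrm (Cb (at_idx X (fst p))) f"
  shows "(\<lambda>y\<in>carrier (Eu p). enf (T (denf y))) \<in> bl_hom (Eu p) (Eu p')"
proof (rule blI[where B=B])
  let ?f = "\<lambda>y\<in>carrier (Eu p). enf (T (denf y))"
  note C = Y_carrier[OF p] Y_carrier[OF p']
  show "?f x \<in> carrier (Eu p')" if "x \<in> carrier (Eu p)" for x
    using that T by (auto simp: C)
  have ap: "?f (enf f) = enf (T f)" if "f \<in> E p" for f using that by (simp add: C)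
  show "?f (x \<oplus>\<^bsub>Eu p\<^esub> y) = ?f x \<oplus>\<^bsub>Eu p'\<^esub> ?f y"
    if xy: "x \<in> carrier (Eu p)" "y \<in> carrier (Eu p)" for x y
  proof -
    obtain f f' where f: "x = enf f" "y = enf f'" "f \<in> E p" "f' \<in> E p" using xy unfolding C by blast
    show ?thesis unfolding f(1,2) Y_ops(1)[OF p f(3,4)] ap[OF Y_ops(3)[OF p f(3,4)]] ap[OF f(3)] ap[OF f(4)]
      Y_ops(1)[OF p' T[OF f(3)] T[OF f(4)]] add[OF f(3,4)] ..
  qed
  show "?f (k \<odot>\<^bsub>Eu p\<^esub> x) = k \<odot>\<^bsub>Eu p'\<^esub> ?f x"
    if x: "x \<in> carrier (Eu p)" for x k
  proof -
    obtain f where f: "x = enf f" "f \<in> E p" using x unfolding C by blast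
    show ?thesis unfolding f(1) Y_ops(2)[OF p f(2)] ap[OF Y_ops(4)[OF p f(2)]] ap[OF f(2)]
      Y_ops(2)[OF p' T[OF f(2)]] smult[OF f(2)] ..
  qed
  show "nrm (Eu p') (?f x) \<le> B * nrm (Eu p) x" if "x \<in> carrier (Eu p)" for x
    using that Y_nrm[OF p] Y_nrm[OF p'] T bound by (auto simp: C)
qed simp

lemma Y_obj: assumes "o1 \<in> idx Y" obtains j l a b where "o1 = qc (j, l, a, b)" "(j, l, a, b) \<in> Or" "dq o1 = (j, l, a, b)"
    "j \<in> idx X" "l \<in> idx X" "a \<in> arr X j l" "b \<in> arr X (L j) l"
  using assms unfolding Y_simps Or_def by auto

lemma Y_Or: "o1 \<in> idx Y ==> dq o1 \<in> Or" and Y_fst: "o1 \<in> idx Y ==> fst (dq o1) \<in> idx X"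
  unfolding Y_simps Or_def by auto

lemma Y_trn: assumes o: "o1 \<in> idx Y" "o2 \<in> idx Y" and u: "u \<in> arr Y o1 o2"
  shows "trn Y o1 o2 u \<in> bl_hom (at_idx Y o1) (at_idx Y o2)"
proof -
  let ?j = "fst (dq o1)" and ?j' = "fst (dq o2)"
  note j = Y_fst[OF o(1)] Y_fst[OF o(2)]
  have u': "u \<in> arr X ?j ?j'" "!!f. f \<in> E (dq o1) ==> tr ?j ?j' u f \<in> E (dq o2)" using u unfolding Y_simps okarr_def by auto
  note t = ind_trn[OF X j u'(1)]
  note V = ind_bs[OF X j(1)]
  obtain B where B: "B > 0" "!!x. x \<in> cX ?j ==> nrm (at_idx X ?j') (trn X ?j ?j' u x) \<le> B * nrm (at_idx X ?j) x"
    by (rule bl_bound[OF V t]) blast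
  have fc: "f g \<in> cX ?j" if "f \<in> E (dq o1)" for f g by (rule Cb_closed[OF V E_Cb[OF that]])
  show ?thesis unfolding Y_simps(3,4)
  proof (rule enf_hom[OF Y_Or[OF o(1)] Y_Or[OF o(2)] u'(2), where B=B])
    show "tr ?j ?j' u (f \<oplus>\<^bsub>Cb (at_idx X ?j)\<^esub> f') = tr ?j ?j' u f \<oplus>\<^bsub>Cb (at_idx X ?j')\<^esub> tr ?j ?j' u f'"
      if "f \<in> E (dq o1)" "f' \<in> E (dq o1)" for f f'
      using bl_add[OF t fc[OF that(1)] fc[OF that(2)]] by (simp add: tr_def Cb_simps)
    show "tr ?j ?j' u (k \<odot>\<^bsub>Cb (at_idx X ?j)\<^esub> f) = k \<odot>\<^bsub>Cb (at_idx X ?j')\<^esub> tr ?j ?j' u f" if "f \<in> E (dq o1)" for f k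
      using bl_smult[OF t fc[OF that]] by (simp add: tr_def Cb_simps)
    show "nrm (Cb (at_idx X ?j')) (tr ?j ?j' u f) \<le> B * nrm (Cb (at_idx X ?j)) f" if f: "f \<in> E (dq o1)" for f
    proof (rule Cb_nrm_le)
      fix g
      have "nrm (at_idx X ?j') (trn X ?j ?j' u (f g)) \<le> B * nrm (at_idx X ?j) (f g)" by (rule B(2)[OF fc[OF f]])
      also have "\<dots> \<le> B * nrm (Cb (at_idx X ?j)) f" by (rule mult_left_mono[OF Cb_nrm_ge[OF V E_Cb[OF f]]]) (use B in simp)
      finally show "nrm (at_idx X ?j') (tr ?j ?j' u f g) \<le> B * nrm (Cb (at_idx X ?j)) f" by (simp add: tr_def)
    qed
  qed
qed

lemma Y_trn_enf: assumes "o1 \<in> idx Y" "f \<in> E (dq o1)"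
  shows "trn Y o1 o2 u (enf f) = enf (tr (fst (dq o1)) (fst (dq o2)) u f)"
  using assms by (simp add: Y_simps(4) Y_carrier[OF Y_Or[OF assms(1)]])

text \<open>Cospans in X over the underlying indices lift to Y. Through this, filteredness of Y and
  equalities in its colimit are inherited from X.\<close>

lemma Y_amalg:
  assumes o: "o1 \<in> idx Y" "o2 \<in> idx Y" and n: "n \<in> idx X" "u \<in> arr X (fst (dq o1)) n" "u' \<in> arr X (fst (dq o2)) n"
  shows "\<exists>o3\<in>idx Y. fst (dq o3) = n \<and> u \<in> arr Y o1 o3 \<and> u' \<in> arr Y o2 o3"
proof -
  obtain j l a b where 1: "o1 = qc (j, l, a, b)" "(j, l, a, b) \<in> Or" "dq o1 = (j, l, a, b)" by (rule Y_obj[OF o(1)])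
  obtain j' l' a' b' where 2: "o2 = qc (j', l', a', b')" "(j', l', a', b') \<in> Or" "dq o2 = (j', l', a', b')" by (rule Y_obj[OF o(2)])
  have "\<exists>m s t. (n, m, s, t) \<in> Or \<and> okarr (j, l, a, b) (n, m, s, t) u \<and> okarr (j', l', a', b') (n, m, s, t) u'"
    by (rule amalgam[OF 1(2) 2(2) n(1)]) (use n 1(3) 2(3) in auto)
  then obtain m s t where "(n, m, s, t) \<in> Or" "okarr (j, l, a, b) (n, m, s, t) u" "okarr (j', l', a', b') (n, m, s, t) u'" by blast
  thus ?thesis by (intro bexI[of _ "qc (n, m, s, t)"]) (auto simp: Y_simps 1 2)
qed

lemma tr_id: "j \<in> idx X ==> f \<in> carrier (Cb (at_idx X j)) ==> tr j j (Idm (shape X) j) f = f"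
  using ind_trn_id[OF X] Cb_closed[OF ind_bs[OF X]] by (simp add: tr_def)

lemma tr_comp: "j \<in> idx X ==> j' \<in> idx X ==> j'' \<in> idx X ==> u \<in> arr X j j' ==> u' \<in> arr X j' j'' ==> f \<in> carrier (Cb (at_idx X j)) ==>
    tr j j'' (Cmp (shape X) j j' j'' u' u) f = tr j' j'' u' (tr j j' u f)"
  using ind_trn_comp[OF X] Cb_closed[OF ind_bs[OF X]] by (simp add: tr_def)

lemma Y_arr: "u \<in> arr Y o1 o2 ==> u \<in> arr X (fst (dq o1)) (fst (dq o2))"
  by (simp add: Y_simps okarr_def)

lemma Y_id_arr: "o1 \<in> idx Y ==> Idm (shape X) (fst (dq o1)) \<in> arr Y o1 o1"
  using ind_id_arr[OF X Y_fst] tr_id[OF Y_fst E_Cb] by (simp add: Y_simps(2) okarr_def)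

lemma Y_comp_arr:
  assumes o: "o1 \<in> idx Y" "o2 \<in> idx Y" "o3 \<in> idx Y" and u: "u \<in> arr Y o1 o2" "u' \<in> arr Y o2 o3"
  shows "Cmp (shape X) (fst (dq o1)) (fst (dq o2)) (fst (dq o3)) u' u \<in> arr Y o1 o3"
proof -
  note j = Y_fst[OF o(1)] Y_fst[OF o(2)] Y_fst[OF o(3)] and a = Y_arr[OF u(1)] Y_arr[OF u(2)]
  show ?thesis
    using ind_comp_arr[OF X j a] tr_comp[OF j a E_Cb] u by (simp add: Y_simps(2) okarr_def)
qed

lemma Y_category: "is_category (shape Y)"
proof -
  have X': "is_category (shape X)" by (rule ind_cat[OF X])
  show ?thesis
    unfolding is_category_def
  proof (intro conjI ballI)
    show "Idm (shape Y) a \<in> arr Y a a" if "a \<in> idx Y" for a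
      unfolding Y_simps(5) by (rule Y_id_arr[OF that])
    show "Cmp (shape Y) a b d g f \<in> arr Y a d"
      if "a \<in> idx Y" "b \<in> idx Y" "d \<in> idx Y" "f \<in> arr Y a b" "g \<in> arr Y b d" for a b d f g
      unfolding Y_simps(6) by (rule Y_comp_arr[OF that])
    show "Cmp (shape Y) a a b f (Idm (shape Y) a) = f" "Cmp (shape Y) a b b (Idm (shape Y) b) f = f"
      if "a \<in> idx Y" "b \<in> idx Y" "f \<in> arr Y a b" for a b f
      using X' Y_fst[OF that(1)] Y_fst[OF that(2)] Y_arr[OF that(3)] unfolding Y_simps(5,6) is_category_def by blast+
    show "Cmp (shape Y) a d e h (Cmp (shape Y) a b d g f) = Cmp (shape Y) a b e (Cmp (shape Y) b d e h g) f"
      if "a \<in> idx Y" "b \<in> idx Y" "d \<in> idx Y" "e \<in> idx Y" "f \<in> arr Y a b" "g \<in> arr Y b d" "h \<in> arr Y d e" for a b d e f g h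
      using X' Y_fst[OF that(1)] Y_fst[OF that(2)] Y_fst[OF that(3)] Y_fst[OF that(4)] Y_arr[OF that(5)] Y_arr[OF that(6)] Y_arr[OF that(7)]
      unfolding Y_simps(6) is_category_def by blast
  qed
qed

lemma Y_isind: "isind Y"
proof -
  have ne: "idx Y \<noteq> {}"
  proof -
    obtain j where j: "j \<in> idx X" using ind_ne[OF X] by blast
    \<comment> \<open>Every index j of X underlies an index of Y, since j and \<open>L j\<close>
      have a common later stage.\<close>
    obtain l a b where "l \<in> idx X" "a \<in> arr X j l" "b \<in> arr X (L j) l" using ind_span[OF X j L[OF j]] by blast
    hence "(j, l, a, b) \<in> Or" using j by (simp add: Or_def)
    thus ?thesis by (auto simp: Y_simps)
  qed
  have span: "\<exists>l\<in>idx Y. arr Y i l \<noteq> {} \<and> arr Y j l \<noteq> {}" if ij: "i \<in> idx Y" "j \<in> idx Y" for i j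
  proof -
    obtain n u u' where "n \<in> idx X" "u \<in> arr X (fst (dq i)) n" "u' \<in> arr X (fst (dq j)) n"
      using ind_span[OF X Y_fst[OF ij(1)] Y_fst[OF ij(2)]] by blast
    from Y_amalg[OF ij this] show ?thesis by blast
  qed
  have coeq: "\<exists>l\<in>idx Y. \<exists>h\<in>arr Y j l. Cmp (shape Y) i j l h f = Cmp (shape Y) i j l h g"
    if ij: "i \<in> idx Y" "j \<in> idx Y" "f \<in> arr Y i j" "g \<in> arr Y i j" for i j f g
  proof -
    obtain n h where n: "n \<in> idx X" "h \<in> arr X (fst (dq j)) n"
      "Cmp (shape X) (fst (dq i)) (fst (dq j)) n h f = Cmp (shape X) (fst (dq i)) (fst (dq j)) n h g"
      using ind_coeq[OF X Y_fst[OF ij(1)] Y_fst[OF ij(2)] Y_arr[OF ij(3)] Y_arr[OF ij(4)]] by blast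
    \<comment> \<open>Lifting the cospan whose two legs are both h makes h an arrow of Y.\<close>
    obtain l where "l \<in> idx Y" "fst (dq l) = n" "h \<in> arr Y j l" using Y_amalg[OF ij(2,2) n(1,2,2)] by blast
    thus ?thesis using n(3) unfolding Y_simps(6) by blast
  qed
  have filt: "filtered (shape Y)" unfolding filtered_def using Y_category ne span coeq by blast
  have "is_functor (shape Y) (ban_cat v c) (diag Y)"
    unfolding is_functor_def
  proof (intro conjI ballI)
    fix a assume a: "a \<in> idx Y"
    have B: "bs (at_idx Y a)" unfolding Y_simps(3) by (rule Y_bs[OF Y_Or[OF a]])
    show "at_idx Y a \<in> Ob (ban_cat v c)" using B by (simp add: ban_cat_def)
    show "trn Y a a (Idm (shape Y) a) = Idm (ban_cat v c) (at_idx Y a)"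
    proof -
      have "trn Y a a (Idm (shape Y) a) = ban_id (at_idx Y a)"
      proof (rule bl_ext[OF Y_trn[OF a a] bl_id[OF B]])
        show "Idm (shape Y) a \<in> arr Y a a" unfolding Y_simps(5) by (rule Y_id_arr[OF a])
        fix y assume y: "y \<in> elts Y a"
        then obtain f where f: "y = enf f" "f \<in> E (dq a)" unfolding Y_simps(3) Y_carrier[OF Y_Or[OF a]] by blast
        show "trn Y a a (Idm (shape Y) a) y = ban_id (at_idx Y a) y"
          unfolding ban_id_apply[OF y] unfolding f(1) Y_trn_enf[OF a f(2)] Y_simps(5) tr_id[OF Y_fst[OF a] E_Cb[OF f(2)]] ..
      qed
      thus ?thesis by (simp add: ban_cat_def)
    qed
    fix b assume b: "b \<in> idx Y"
    show "trn Y a b f \<in> Ar (ban_cat v c) (at_idx Y a) (at_idx Y b)" if "f \<in> arr Y a b" for f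
      using Y_trn[OF a b that] by (simp add: ban_cat_def)
    fix d f g assume d: "d \<in> idx Y" and f: "f \<in> arr Y a b" and g: "g \<in> arr Y b d"
    have Bb: "bs (at_idx Y b)" unfolding Y_simps(3) by (rule Y_bs[OF Y_Or[OF b]])
    have "trn Y a d (Cmp (shape Y) a b d g f) = compose (elts Y a) (trn Y b d g) (trn Y a b f)"
    proof (rule bl_ext[OF Y_trn[OF a d] bl_comp[OF Y_trn[OF a b f] Y_trn[OF b d g] B Bb]])
      show "Cmp (shape Y) a b d g f \<in> arr Y a d" unfolding Y_simps(6) by (rule Y_comp_arr[OF a b d f g])
      fix y assume y: "y \<in> elts Y a"
      then obtain x where x: "y = enf x" "x \<in> E (dq a)" unfolding Y_simps(3) Y_carrier[OF Y_Or[OF a]] by blast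
      have t: "tr (fst (dq a)) (fst (dq b)) f x \<in> E (dq b)" using f x(2) by (simp add: Y_simps(2) okarr_def)
      show "trn Y a d (Cmp (shape Y) a b d g f) y = compose (elts Y a) (trn Y b d g) (trn Y a b f) y"
        unfolding compose_eq[OF y] unfolding x(1) Y_trn_enf[OF a x(2)] Y_trn_enf[OF b t] Y_simps(6)
          tr_comp[OF Y_fst[OF a] Y_fst[OF b] Y_fst[OF d] Y_arr[OF f] Y_arr[OF g] E_Cb[OF x(2)]] ..
    qed
    thus "trn Y a d (Cmp (shape Y) a b d g f) = Cmp (ban_cat v c) (at_idx Y a) (at_idx Y b) (at_idx Y d) (trn Y b d g) (trn Y a b f)"
      by (simp add: ban_cat_def)
  qed
  thus ?thesis using filt by (simp add: is_ind_def)
qed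

section \<open>The action by translations\<close>

definition shift :: "'u => 'g => 'u => 'u" where
  "shift o1 s = (\<lambda>y\<in>carrier (Eu (dq o1)). enf (%g. denf y (- s + g)))"

lemma shift_enf: assumes "o1 \<in> idx Y" "f \<in> E (dq o1)" shows "shift o1 s (enf f) = enf (%g. f (- s + g))"
  using assms by (simp add: shift_def Y_carrier[OF Y_Or[OF assms(1)]])

text \<open>The equation defining \<open>E\<close> is imposed at every g, not only at 0, so it
  persists when g is replaced by -s + g.\<close>

lemma shift_E: assumes o: "o1 \<in> idx Y" and f: "f \<in> E (dq o1)" shows "(%g. f (- s + g)) \<in> E (dq o1)"
proof -
  obtain j l a b where q: "dq o1 = (j, l, a, b)" "j \<in> idx X" by (rule Y_obj[OF o])
  have "(%g. f (- s + g)) \<in> carrier (Cb (at_idx X j))"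
    using f translate_cont(2)[OF ind_bs[OF X q(2)], of f s] unfolding q E_iff Cb_carrier[OF ind_bs[OF X q(2)]] by blast
  moreover have "trn X j l a (f (- s + (g + h))) = trn X (L j) l b (rr j h (f (- s + g)))" for g h
    using f unfolding q E_iff by (metis add.assoc)
  ultimately show ?thesis unfolding q E_iff by blast
qed

lemma shift_nrm: "nrm (Cb V) (%g. f (- s + g)) = nrm (Cb V) (f :: 'g => 'u)"
proof -
  have "range (%g. nrm V (f (- s + g))) = range (%g. nrm V (f g))"
  proof (intro equalityI subsetI)
    fix y assume "y \<in> range (%g. nrm V (f g))"
    then obtain g where "y = nrm V (f g)" by blast
    hence "y = nrm V (f (- s + (s + g)))" by simp
    thus "y \<in> range (%g. nrm V (f (- s + g)))" by blast
  qed auto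
  thus ?thesis by (simp add: Cblu_def)
qed

text \<open>Strong continuity means that the translates of f depend continuously on s in the
  supremum norm. This is left uniform continuity of f, in the form of
  \<open>translate_cont_Cb\<close>.\<close>

lemma shift_sot: assumes o: "o1 \<in> idx Y" shows "shift o1 \<in> sot_maps (at_idx Y o1) (at_idx Y o1)"
  unfolding sot_maps_def
proof (intro CollectI conjI allI ballI)
  note p = Y_Or[OF o]
  note V = ind_bs[OF X Y_fst[OF o]]
  show "shift o1 s \<in> bl_hom (at_idx Y o1) (at_idx Y o1)" for s
    unfolding shift_def Y_simps(3)
  proof (rule enf_hom[OF p p, where B=1])
    show "(%g. f (- s + g)) \<in> E (dq o1)" if "f \<in> E (dq o1)" for f by (rule shift_E[OF o that])
  qed (auto simp: Cb_simps shift_nrm)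
  fix y assume "y \<in> elts Y o1"
  then obtain f where f: "y = enf f" "f \<in> E (dq o1)" unfolding Y_simps(3) Y_carrier[OF p] by blast
  note B = Y_bs[OF p]
  show "cont_into (at_idx Y o1) (%s. shift o1 s y)"
    unfolding cont_into_def Y_simps(3) f(1) shift_enf[OF o f(2)]
  proof (intro conjI allI impI)
    show "enf (%g. f (- s + g)) \<in> carrier (Eu (dq o1))" for s
      unfolding Y_carrier[OF p] using shift_E[OF o f(2)] by blast
    fix s :: 'g and e :: real assume e: "e > 0"
    have "cont_into (Cb (at_idx X (fst (dq o1)))) (%s g. f (s + g))"
      by (rule translate_cont_Cb[OF V]) (use E_Cb[OF f(2)] in \<open>simp add: Cb_carrier[OF V]\<close>)
    from translate_cont(3)[OF bs_Cb[OF V] this]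
    have "cont_into (Cb (at_idx X (fst (dq o1)))) (%s g. f (- s + g))" .
    from cont_intoD(2)[OF this e, of s]
    show "eventually (%t. nrm (Eu (dq o1)) (enf (%g. f (- t + g)) \<ominus>\<^bsub>Eu (dq o1)\<^esub> enf (%g. f (- s + g))) < e) (nhds s)"
    proof (rule eventually_mono)
      fix t assume t: "nrm (Cb (at_idx X (fst (dq o1)))) ((%g. f (- t + g)) \<ominus>\<^bsub>Cb (at_idx X (fst (dq o1)))\<^esub> (%g. f (- s + g))) < e"
      have m: "(%g. f (- t + g)) \<in> E (dq o1)" "(%g. f (- s + g)) \<in> E (dq o1)" using shift_E[OF o f(2)] by auto
      have mC: "enf (%g. f (- t + g)) \<in> carrier (Eu (dq o1))" "enf (%g. f (- s + g)) \<in> carrier (Eu (dq o1))"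
        using m by (auto simp: Y_carrier[OF p])
      note ops = Y_ops[OF p]
      show "nrm (Eu (dq o1)) (enf (%g. f (- t + g)) \<ominus>\<^bsub>Eu (dq o1)\<^esub> enf (%g. f (- s + g))) < e"
        using t unfolding bs_dif_conv[OF B mC] bs_dif_conv[OF bs_Cb[OF V] E_Cb[OF m(1)] E_Cb[OF m(2)]]
          ops(2)[OF m(2)] ops(1)[OF m(1) ops(4)[OF m(2)]] Y_nrm[OF p ops(3)[OF m(1) ops(4)[OF m(2)]]] .
    qed
  qed
qed

definition MY :: "('k, 'g, 'u) gmod" where
  "MY = (Y, \<lambda>i\<in>idx Y. fam_germ (at_idx Y i) Y i (shift i))"

lemma MY: "gm MY" and MY_self: "i \<in> idx Y ==> (i, shift i) \<in> snd MY i"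
proof -
  have el: "\<exists>f. y = enf f \<and> f \<in> E (dq i)" if "i \<in> idx Y" "y \<in> elts Y i" for i y
    using that(2) unfolding Y_simps(3) Y_carrier[OF Y_Or[OF that(1)]] by blast
  have 1: "nrm (at_idx Y i) (shift i g x) = nrm (at_idx Y i) x" if i: "i \<in> idx Y" "x \<in> elts Y i" for i g x
  proof -
    obtain f where f: "x = enf f" "f \<in> E (dq i)" using el[OF i] by blast
    show ?thesis unfolding f(1) shift_enf[OF i(1) f(2)] Y_simps(3) Y_nrm[OF Y_Or[OF i(1)] f(2)]
      Y_nrm[OF Y_Or[OF i(1)] shift_E[OF i(1) f(2)]] by (rule shift_nrm)
  qed
  have 2: "shift i g (shift i h x) = shift i (g + h) x" if i: "i \<in> idx Y" "x \<in> elts Y i" for i g h x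
  proof -
    obtain f where f: "x = enf f" "f \<in> E (dq i)" using el[OF i] by blast
    have "- h + (- g + k) = - (g + h) + k" for k by (simp only: minus_add add.assoc)
    thus ?thesis unfolding f(1) shift_enf[OF i(1) f(2)] shift_enf[OF i(1) shift_E[OF i(1) f(2)]] by simp
  qed
  have 3: "shift i 0 x = x" if i: "i \<in> idx Y" "x \<in> elts Y i" for i x
  proof -
    obtain f where f: "x = enf f" "f \<in> E (dq i)" using el[OF i] by blast
    show ?thesis unfolding f(1) shift_enf[OF i(1) f(2)] by simp
  qed
  have 4: "trn Y i l a (shift i g x) = shift l g (trn Y i l a x)"
    if i: "i \<in> idx Y" "l \<in> idx Y" "a \<in> arr Y i l" "x \<in> elts Y i" for i l a g x
  proof -
    obtain f where f: "x = enf f" "f \<in> E (dq i)" using el[OF i(1,4)] by blast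
    have t: "tr (fst (dq i)) (fst (dq l)) a f \<in> E (dq l)" using i(3) f(2) by (simp add: Y_simps(2) okarr_def)
    show ?thesis
      unfolding f(1) shift_enf[OF i(1) f(2)] Y_trn_enf[OF i(1) f(2)] Y_trn_enf[OF i(1) shift_E[OF i(1) f(2)]] shift_enf[OF i(2) t]
      by (simp add: tr_def)
  qed
  note S = strict_gmod[OF Y_isind, of shift, OF shift_sot 1 2 3 4]
  show "gm MY" unfolding MY_def by (rule S(1))
  show "i \<in> idx Y ==> (i, shift i) \<in> snd MY i" unfolding MY_def snd_conv by (rule S(2))
qed

section \<open>The isomorphism with the given comodule\<close>

definition oj :: "'u => 'u" where
  "oj j = (SOME q. q \<in> idx Y \<and> fst (dq q) = L j \<and> (\<forall>x\<in>cX j. (%g. rr j g x) \<in> E (dq q)))"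

text \<open>\<open>rr_mult\<close>, read at the stage m where it holds, is the equation defining
  \<open>E\<close> for the orbit maps of all x at index j; so one index over \<open>L j\<close>
  holds them all.\<close>

lemma oj: assumes j: "j \<in> idx X"
  shows "oj j \<in> idx Y" "fst (dq (oj j)) = L j" "!!x. x \<in> cX j ==> (%g. rr j g x) \<in> E (dq (oj j))"
proof -
  obtain m A B where m: "m \<in> idx X" "A \<in> arr X (L (L j)) m" "B \<in> arr X (L j) m"
    "!!p. p \<in> UNIV \<times> UNIV \<times> cX j ==> trn X (L (L j)) m A ((%(h, g, x). rr (L j) h (rr j g x)) p) = trn X (L j) m B ((%(h, g, x). rr j (g + h) x) p)"
    by (rule geqE[OF rr_mult[OF j]]) blast
  \<comment> \<open>\<open>B\<close> starts at \<open>L j\<close>, where the orbit maps take their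
    values, and \<open>A\<close> at \<open>L (L j)\<close>, where the coaction sends those values;
    hence this order of the entries.\<close>
  let ?p = "(L j, m, B, A)"
  have p: "?p \<in> Or" using L[OF j] m by (simp add: Or_def)
  have "(%g. rr j g x) \<in> E ?p" if x: "x \<in> cX j" for x
    unfolding E_iff Cb_carrier[OF ind_bs[OF X L[OF j]]]
    using rr_cont[OF j x] m(4)[of "(_, _, x)"] x by auto
  hence "\<exists>q. q \<in> idx Y \<and> fst (dq q) = L j \<and> (\<forall>x\<in>cX j. (%g. rr j g x) \<in> E (dq q))"
    using p by (intro exI[of _ "qc ?p"]) (simp add: Y_simps)
  from someI_ex[OF this] show "oj j \<in> idx Y" "fst (dq (oj j)) = L j" "!!x. x \<in> cX j ==> (%g. rr j g x) \<in> E (dq (oj j))"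
    unfolding oj_def by blast+
qed

definition S :: "'u => 'u => 'u" where "S j = (\<lambda>x\<in>cX j. enf (%g. rr j g x))"
definition e0 :: "'u => 'u => 'u" where "e0 q = (\<lambda>y\<in>elts Y q. denf y 0)"

lemma e0_enf: "q \<in> idx Y ==> f \<in> E (dq q) ==> e0 q (enf f) = f 0"
  by (simp add: e0_def Y_simps(3) Y_carrier[OF Y_Or])

lemma Y_el: assumes "q \<in> idx Y" "y \<in> elts Y q" obtains f where "y = enf f" "f \<in> E (dq q)"
  using assms(2) unfolding Y_simps(3) Y_carrier[OF Y_Or[OF assms(1)]] by blast

text \<open>The bound from \<open>ev_bound\<close> is uniform in g and hence bounds the supremum
  norm of the orbit map.\<close>

lemma S_hom: assumes j: "j \<in> idx X" shows "S j \<in> bl_hom (at_idx X j) (at_idx Y (oj j))"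
proof -
  note o = oj[OF j]
  note p = Y_Or[OF o(1)]
  note V = ind_bs[OF X j] and W = ind_bs[OF X L[OF j]]
  obtain B where B: "!!x g. x \<in> cX j ==> nrm (at_idx X (L j)) (rr j g x) \<le> B * nrm (at_idx X j) x"
    unfolding rr_def by (rule ev_bound[OF V W R[OF j]]) blast
  note rl = lin_bl[OF rr_hom[OF j]]
  show ?thesis unfolding Y_simps(3)
  proof (rule blI[where B=B])
    show "S j x \<in> carrier (push enf (Es (dq (oj j))))" if "x \<in> cX j" for x
      using o(3)[OF that] that by (simp add: S_def Y_carrier[OF p])
    show "S j x = undefined" if "x \<notin> cX j" for x using that by (simp add: S_def)
    show "S j (x \<oplus>\<^bsub>at_idx X j\<^esub> y) = S j x \<oplus>\<^bsub>push enf (Es (dq (oj j)))\<^esub> S j y" if x: "x \<in> cX j" "y \<in> cX j" for x y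
    proof -
      have "(%g. rr j g (x \<oplus>\<^bsub>at_idx X j\<^esub> y)) = (%g. rr j g x) \<oplus>\<^bsub>Cb (at_idx X (fst (dq (oj j))))\<^esub> (%g. rr j g y)"
        unfolding Cb_simps o(2) using bl_add[OF rl x] x V by simp
      thus ?thesis using x V Y_ops(1)[OF p o(3)[OF x(1)] o(3)[OF x(2)]] by (simp add: S_def)
    qed
    show "S j (k \<odot>\<^bsub>at_idx X j\<^esub> x) = k \<odot>\<^bsub>push enf (Es (dq (oj j)))\<^esub> S j x" if x: "x \<in> cX j" for x k
    proof -
      have "(%g. rr j g (k \<odot>\<^bsub>at_idx X j\<^esub> x)) = k \<odot>\<^bsub>Cb (at_idx X (fst (dq (oj j))))\<^esub> (%g. rr j g x)"
        unfolding Cb_simps o(2) using bl_smult[OF rl x] x V by simp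
      thus ?thesis using x V Y_ops(2)[OF p o(3)[OF x]] by (simp add: S_def)
    qed
    show "nrm (push enf (Es (dq (oj j)))) (S j x) \<le> B * nrm (at_idx X j) x" if x: "x \<in> cX j" for x
      using x Y_nrm[OF p o(3)[OF x]] Cb_nrm_le[of "at_idx X (L j)" "%g. rr j g x", OF B[OF x]] by (simp add: S_def o(2))
  qed
qed

lemma e0_hom: assumes q: "q \<in> idx Y" shows "e0 q \<in> bl_hom (at_idx Y q) (at_idx X (fst (dq q)))"
proof -
  note p = Y_Or[OF q]
  note V = ind_bs[OF X Y_fst[OF q]]
  show ?thesis
  proof (rule blI[where B=1])
    show "e0 q x = undefined" if "x \<notin> elts Y q" for x using that by (simp add: e0_def)
    fix x assume x: "x \<in> elts Y q"
    obtain f where f: "x = enf f" "f \<in> E (dq q)" by (rule Y_el[OF q x])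
    note fC = E_Cb[OF f(2)]
    show "e0 q x \<in> cX (fst (dq q))" unfolding f(1) e0_enf[OF q f(2)] by (rule Cb_closed[OF V fC])
    show "e0 q (k \<odot>\<^bsub>at_idx Y q\<^esub> x) = k \<odot>\<^bsub>at_idx X (fst (dq q))\<^esub> e0 q x" for k
      unfolding f(1) Y_simps(3) Y_ops(2)[OF p f(2)] e0_enf[OF q f(2)] e0_enf[OF q Y_ops(4)[OF p f(2)]] by (simp add: Cb_simps)
    show "nrm (at_idx X (fst (dq q))) (e0 q x) \<le> 1 * nrm (at_idx Y q) x"
      unfolding f(1) Y_simps(3) e0_enf[OF q f(2)] Y_nrm[OF p f(2)] using Cb_nrm_ge[OF V fC] by simp
    fix y assume y: "y \<in> elts Y q"
    obtain h where h: "y = enf h" "h \<in> E (dq q)" by (rule Y_el[OF q y])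
    show "e0 q (x \<oplus>\<^bsub>at_idx Y q\<^esub> y) = e0 q x \<oplus>\<^bsub>at_idx X (fst (dq q))\<^esub> e0 q y"
      unfolding f(1) h(1) Y_simps(3) Y_ops(1)[OF p f(2) h(2)] e0_enf[OF q f(2)] e0_enf[OF q h(2)] e0_enf[OF q Y_ops(3)[OF p f(2) h(2)]]
      by (simp add: Cb_simps)
  qed
qed

definition \<theta> where "\<theta> = (\<lambda>q\<in>idx Y. germ (at_idx Y q) X (fst (dq q)) (e0 q))"
definition \<theta>' where "\<theta>' = (\<lambda>j\<in>idx X. germ (at_idx X j) Y (oj j) (S j))"

lemma tr_closed: "q \<in> idx Y ==> u \<in> arr Y q q' ==> f \<in> E (dq q) ==> tr (fst (dq q)) (fst (dq q')) u f \<in> E (dq q')"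
  by (simp add: Y_simps(2) okarr_def)

lemma \<theta>_hom: "\<theta> \<in> ind_hom Y X"
proof (rule ih_intro[OF Y_isind X, where J="%q. fst (dq q)" and F=e0])
  fix q q' u assume q: "q \<in> idx Y" "q' \<in> idx Y" "u \<in> arr Y q q'"
  have "geq X (elts Y q) (fst (dq q)) (e0 q) (fst (dq q')) (%x. trn X (fst (dq q)) (fst (dq q')) u (e0 q x))"
    by (rule geq_trn[OF X Y_fst[OF q(1)] Y_fst[OF q(2)] Y_arr[OF q(3)] bl_closed[OF e0_hom[OF q(1)]]])
  thus "geq X (elts Y q) (fst (dq q)) (e0 q) (fst (dq q')) (%x. e0 q' (trn Y q q' u x))"
  proof (rule geq_cong)
    fix y assume y: "y \<in> elts Y q"
    obtain f where f: "y = enf f" "f \<in> E (dq q)" by (rule Y_el[OF q(1) y])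
    show "trn X (fst (dq q)) (fst (dq q')) u (e0 q y) = e0 q' (trn Y q q' u y)"
      unfolding f(1) e0_enf[OF q(1) f(2)] Y_trn_enf[OF q(1) f(2)] e0_enf[OF q(2) tr_closed[OF q(1,3) f(2)]] by (simp add: tr_def)
  qed simp
qed (auto simp: \<theta>_def Y_fst e0_hom)

text \<open>Agreement in X that is uniform in g is agreement of functions after one transition map
  on each side. The arrows of X that realise it lift to Y by \<open>Y_amalg\<close>.\<close>

lemma S_geq:
  assumes q: "q1 \<in> idx Y" "q2 \<in> idx Y" and g: "geq X P' (fst (dq q1)) F (fst (dq q2)) F'"
    and P': "!!p g. p \<in> P ==> (g, p) \<in> P'"
    and E: "!!p. p \<in> P ==> (%g. F (g, p)) \<in> E (dq q1)" "!!p. p \<in> P ==> (%g. F' (g, p)) \<in> E (dq q2)"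
  shows "geq Y P q1 (%p. enf (%g. F (g, p))) q2 (%p. enf (%g. F' (g, p)))"
proof -
  obtain n u u' where n: "n \<in> idx X" "u \<in> arr X (fst (dq q1)) n" "u' \<in> arr X (fst (dq q2)) n"
    "!!p. p \<in> P' ==> trn X (fst (dq q1)) n u (F p) = trn X (fst (dq q2)) n u' (F' p)" by (rule geqE[OF g]) blast
  obtain q3 where q3: "q3 \<in> idx Y" "fst (dq q3) = n" "u \<in> arr Y q1 q3" "u' \<in> arr Y q2 q3" using Y_amalg[OF q n(1-3)] by blast
  show ?thesis
  proof (rule geqI[OF q3(1,3,4)])
    fix p assume p: "p \<in> P"
    show "trn Y q1 q3 u (enf (%g. F (g, p))) = trn Y q2 q3 u' (enf (%g. F' (g, p)))"
      unfolding Y_trn_enf[OF q(1) E(1)[OF p]] Y_trn_enf[OF q(2) E(2)[OF p]] tr_def q3(2) using n(4)[OF P'[OF p]] by simp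
  qed
qed

lemma \<theta>'_hom: "\<theta>' \<in> ind_hom X Y"
proof (rule ih_intro[OF X Y_isind, where J=oj and F=S])
  fix j j' a assume j: "j \<in> idx X" "j' \<in> idx X" "a \<in> arr X j j'"
  note t = ind_trn_closed[OF X j]
  have "geq Y (cX j) (oj j) (%x. enf (%g. (%(g, x). rr j g x) (g, x))) (oj j') (%x. enf (%g. (%(g, x). rr j' g (trn X j j' a x)) (g, x)))"
  proof (rule S_geq[OF oj(1)[OF j(1)] oj(1)[OF j(2)]])
    show "geq X (UNIV \<times> cX j) (fst (dq (oj j))) (%(g, x). rr j g x) (fst (dq (oj j'))) (%(g, x). rr j' g (trn X j j' a x))"
      unfolding oj(2)[OF j(1)] oj(2)[OF j(2)] by (rule rr_nat[OF j])
  qed (use oj(3)[OF j(1)] oj(3)[OF j(2) t] in auto)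
  thus "geq Y (cX j) (oj j) (S j) (oj j') (%x. S j' (trn X j j' a x))"
    by (rule geq_cong) (use t in \<open>auto simp: S_def\<close>)
qed (auto simp: \<theta>'_def oj S_hom)

lemma \<theta>_mem: "q \<in> idx Y ==> (fst (dq q), e0 q) \<in> \<theta> q"
  unfolding \<theta>_def by (simp add: germ_self[OF X Y_fst e0_hom])

lemma \<theta>'_mem: "j \<in> idx X ==> (oj j, S j) \<in> \<theta>' j"
  unfolding \<theta>'_def by (simp add: germ_self[OF Y_isind oj(1) S_hom])

text \<open>An orbit map evaluated at 0 is \<open>rr j 0 x\<close>, which counitality identifies
  with x.\<close>

lemma \<theta>\<theta>': "ind_comp X Y X \<theta> \<theta>' = ind_id X"
proof (rule ih_eqI[OF X X ind_comp_hom[OF X Y_isind X \<theta>'_hom \<theta>_hom] ind_id_hom[OF X]])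
  fix j assume j: "j \<in> idx X"
  note o = oj[OF j]
  have 1: "(L j, compose (cX j) (e0 (oj j)) (S j)) \<in> ind_comp X Y X \<theta> \<theta>' j"
    using ind_comp_mem[OF X Y_isind X \<theta>'_hom \<theta>_hom j \<theta>'_mem[OF j] \<theta>_mem[OF o(1)]] unfolding o(2) .
  have "geq X (cX j) (L j) (compose (cX j) (e0 (oj j)) (S j)) j (ban_id (at_idx X j))"
    by (rule geq_cong[OF rr_unit[OF j]]) (use e0_enf[OF o(1) o(3)] in \<open>auto simp: compose_eq S_def\<close>)
  thus "\<exists>i f i' f'. (i, f) \<in> ind_comp X Y X \<theta> \<theta>' j \<and> (i', f') \<in> ind_id X j \<and> geq X (cX j) i f i' f'"
    using 1 ind_id_mem[OF X j] by blast
qed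

text \<open>The orbit map of f 0 is f itself: this is the equation defining \<open>E\<close> at g =
  0, and the stage and arrows where it holds are recorded in the index q.\<close>

lemma \<theta>'\<theta>: "ind_comp Y X Y \<theta>' \<theta> = ind_id Y"
proof (rule ih_eqI[OF Y_isind Y_isind ind_comp_hom[OF Y_isind X Y_isind \<theta>_hom \<theta>'_hom] ind_id_hom[OF Y_isind]])
  fix q assume q: "q \<in> idx Y"
  obtain j l a b where p: "dq q = (j, l, a, b)" "j \<in> idx X" "l \<in> idx X" "a \<in> arr X j l" "b \<in> arr X (L j) l" by (rule Y_obj[OF q])
  note o = oj[OF p(2)]
  have fq: "fst (dq q) = j" by (simp add: p)
  have 1: "(oj j, compose (elts Y q) (S j) (e0 q)) \<in> ind_comp Y X Y \<theta>' \<theta> q"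
    by (rule ind_comp_mem[OF Y_isind X Y_isind \<theta>_hom \<theta>'_hom q \<theta>_mem[OF q, unfolded fq] \<theta>'_mem[OF p(2)]])
  have d: "f g \<in> cX j" if "f \<in> E (dq q)" for f g
    using Cb_closed[OF ind_bs[OF X p(2)]] E_Cb[OF that] unfolding fq by blast
  have "geq Y (E (dq q)) (oj j) (%f. enf (%g. (%(g, f). rr j g (f 0)) (g, f))) q (%f. enf (%g. (%(g, f). f g) (g, f)))"
  proof (rule S_geq[OF o(1) q])
    show "geq X (UNIV \<times> E (dq q)) (fst (dq (oj j))) (%(g, f). rr j g (f 0)) (fst (dq q)) (%(g, f). f g)"
      unfolding o(2) fq
    proof (rule geqI[OF p(3,5,4)])
      fix x assume "x \<in> (UNIV :: 'g set) \<times> E (dq q)"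
      then obtain g f where x: "x = (g, f)" "f \<in> E (dq q)" by auto
      have "trn X j l a (f (0 + g)) = trn X (L j) l b (rr j g (f 0))" using x(2) unfolding p(1) E_iff by blast
      thus "trn X (L j) l b ((%(g, f). rr j g (f 0)) x) = trn X j l a ((%(g, f). f g) x)" using x(1) by simp
    qed
  qed (use o(3) d in auto)
  from geq_pre[OF this, where Q="elts Y q" and k=denf]
  have 2: "(!!y. y \<in> elts Y q ==> denf y \<in> E (dq q)) ==>
     geq Y (elts Y q) (oj j) (%y. enf (%g. rr j g (denf y 0))) q (%y. enf (denf y))" by simp
  have el: "denf y \<in> E (dq q)" "enf (denf y) = y" if y: "y \<in> elts Y q" for y
  proof -
    obtain f where "y = enf f" "f \<in> E (dq q)" by (rule Y_el[OF q y])
    thus "denf y \<in> E (dq q)" "enf (denf y) = y" by auto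
  qed
  have "geq Y (elts Y q) (oj j) (compose (elts Y q) (S j) (e0 q)) q (ban_id (at_idx Y q))"
    by (rule geq_cong[OF 2]) (use el d in \<open>auto simp: compose_eq S_def e0_def\<close>)
  thus "\<exists>i f i' f'. (i, f) \<in> ind_comp Y X Y \<theta>' \<theta> q \<and> (i', f') \<in> ind_id Y q \<and> geq Y (elts Y q) i f i' f'"
    using 1 ind_id_mem[OF Y_isind q] by blast
qed

lemma MY_fst: "fst MY = Y" by (simp add: MY_def)

text \<open>The translations at q are isometric and stay at the index q, so \<open>sg_ex\<close>
  provides a representative of the coaction that stays there too.\<close>

lemma MY_rep: assumes q: "q \<in> idx Y"
  shows "\<exists>r. (((), q), r) \<in> rho MY q \<and> (\<forall>g y. y \<in> elts Y q --> ev (at_idx Y q) g (r y) = shift q (- g) y)"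
proof -
  note B = ind_bs[OF Y_isind q]
  have n: "nrm (at_idx Y q) (shift q g x) \<le> 1 * nrm (at_idx Y q) x" if x: "x \<in> elts Y q" for g x
  proof -
    obtain f where f: "x = enf f" "f \<in> E (dq q)" by (rule Y_el[OF q x])
    show ?thesis unfolding f(1) shift_enf[OF q f(2)] Y_simps(3) Y_nrm[OF Y_Or[OF q] f(2)] Y_nrm[OF Y_Or[OF q] shift_E[OF q f(2)]]
      by (simp add: shift_nrm)
  qed
  obtain r where r: "r \<in> bl_hom (at_idx Y q) (tC (at_idx Y q))" "sg (at_idx Y q) (at_idx Y q) r = shift q"
    using sg_ex[OF B small_u[OF B] shift_sot[OF q] n] by blast
  have "(((), q), r) \<in> rho MY q"
    using q r MY_self[OF q] by (simp add: rho_def MY_fst)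
  moreover have "ev (at_idx Y q) g (r y) = shift q (- g) y" if "y \<in> elts Y q" for g y
    using sg_apply[OF that, of "at_idx Y q" r "- g"] r(2) by simp
  ultimately show ?thesis by blast
qed

lemma rho_MY: "rho MY \<in> ind_hom Y (AX Y)"
  using rho_hom[OF MY] unfolding MY_fst .

text \<open>In the coaction of Y, evaluation at g sends f to its translate x \<mapsto> f(g + x). The
  value at 0 is f g, and the equation defining \<open>E\<close> equates it with the right translate
  of f 0 by g.\<close>

lemma \<theta>_comodule: "\<theta> \<in> comodule_hom c Bg (Y, rho MY) (X, \<rho>)"
proof (rule comodule_hom_iff(2)[OF Y_isind X rho_MY \<rho> \<theta>_hom])
  fix q assume q: "q \<in> idx Y"
  obtain j l a b where p: "dq q = (j, l, a, b)" "j \<in> idx X" "l \<in> idx X" "a \<in> arr X j l" "b \<in> arr X (L j) l" by (rule Y_obj[OF q])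
  have fq: "fst (dq q) = j" by (simp add: p)
  obtain r where r: "(((), q), r) \<in> rho MY q" "!!g y. y \<in> elts Y q ==> ev (at_idx Y q) g (r y) = shift q (- g) y"
    using MY_rep[OF q] by blast
  have "geq X (UNIV \<times> elts Y q) j (%(g, x). e0 q (ev (at_idx Y q) g (r x))) (L j) (%(g, x). ev (at_idx X (L j)) g (R j (e0 q x)))"
  proof (rule geqI[OF p(3-5)])
    fix z assume "z \<in> (UNIV :: 'g set) \<times> elts Y q"
    then obtain g y where z: "z = (g, y)" and y: "y \<in> elts Y q" by auto
    obtain f where f: "y = enf f" "f \<in> E (dq q)" by (rule Y_el[OF q y])
    have "e0 q (ev (at_idx Y q) g (r y)) = f (- (- g) + 0)"
      unfolding r(2)[OF y] unfolding f(1) shift_enf[OF q f(2)] e0_enf[OF q shift_E[OF q f(2)]] ..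
    moreover have "trn X j l a (f (0 + g)) = trn X (L j) l b (rr j g (f 0))" using f(2) unfolding p(1) E_iff by blast
    moreover have "e0 q y = f 0" unfolding f(1) by (rule e0_enf[OF q f(2)])
    ultimately show "trn X j l a ((%(g, x). e0 q (ev (at_idx Y q) g (r x))) z)
      = trn X (L j) l b ((%(g, x). ev (at_idx X (L j)) g (R j (e0 q x))) z)"
      unfolding z by (simp add: rr_def)
  qed
  thus "\<exists>z. (case z of (j, r, j', f', m, f, n, s) => (((), j), r) \<in> rho MY q \<and> (j', f') \<in> \<theta> j \<and> (m, f) \<in> \<theta> q \<and> (((), n), s) \<in> \<rho> m) \<and>
      (case z of (j, r, j', f', m, f, n, s) => geq X (UNIV \<times> elts Y q) j' (%(g, x). f' (ev (at_idx Y j) g (r x)))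
          n (%(g, x). ev (at_idx X n) g (s (f x))))"
    using r(1) \<theta>_mem[OF q] LR[OF p(2)] unfolding fq
    by (intro exI[of _ "(q, r, j, e0 q, j, e0 q, L j, R j)"]) simp
qed

text \<open>The orbit map of the right translate of x by g is a left translate of the orbit map of
  x. This is coassociativity, and \<open>S_geq\<close> lifts it to Y.\<close>

lemma \<theta>'_comodule: "\<theta>' \<in> comodule_hom c Bg (X, \<rho>) (Y, rho MY)"
proof (rule comodule_hom_iff(2)[OF X Y_isind \<rho> rho_MY \<theta>'_hom])
  fix j assume j: "j \<in> idx X"
  note Lj = L[OF j]
  note o = oj[OF j] and o' = oj[OF Lj]
  obtain r where r: "(((), oj j), r) \<in> rho MY (oj j)"
    "!!g y. y \<in> elts Y (oj j) ==> ev (at_idx Y (oj j)) g (r y) = shift (oj j) (- g) y"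
    using MY_rep[OF o(1)] by blast
  have "geq Y (UNIV \<times> cX j) (oj (L j)) (%p. enf (%h. (%(h, g, x). rr (L j) h (rr j g x)) (h, p)))
      (oj j) (%p. enf (%h. (%(h, g, x). rr j (g + h) x) (h, p)))"
  proof (rule S_geq[OF o'(1) o(1)])
    show "geq X (UNIV \<times> UNIV \<times> cX j) (fst (dq (oj (L j)))) (%(h, g, x). rr (L j) h (rr j g x)) (fst (dq (oj j))) (%(h, g, x). rr j (g + h) x)"
      unfolding o(2) o'(2) by (rule rr_mult[OF j])
    show "(%h. (%(h, g, x). rr (L j) h (rr j g x)) (h, p)) \<in> E (dq (oj (L j)))" if "p \<in> UNIV \<times> cX j" for p
      using that o'(3)[OF rr_closed[OF j]] by auto
    show "(%h. (%(h, g, x). rr j (g + h) x) (h, p)) \<in> E (dq (oj j))" if pP: "p \<in> UNIV \<times> cX j" for p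
    proof -
      obtain g x where p: "p = (g, x)" "x \<in> cX j" using pP by auto
      from shift_E[OF o(1) o(3)[OF p(2)], of "- g"] show ?thesis by (simp add: p)
    qed
  qed auto
  hence "geq Y (UNIV \<times> cX j) (oj (L j)) (%(g, x). S (L j) (ev (at_idx X (L j)) g (R j x))) (oj j) (%(g, x). ev (at_idx Y (oj j)) g (r (S j x)))"
  proof (rule geq_cong)
    fix p assume "p \<in> (UNIV :: 'g set) \<times> cX j"
    then obtain g x where p: "p = (g, x)" "x \<in> cX j" by auto
    show "enf (%h. (%(h, g, x). rr (L j) h (rr j g x)) (h, p)) = (%(g, x). S (L j) (ev (at_idx X (L j)) g (R j x))) p"
      using rr_closed[OF j p(2), of g] by (simp add: p S_def rr_def)
    have "S j x = enf (%g. rr j g x)" using p by (simp add: S_def)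
    moreover have "S j x \<in> elts Y (oj j)" by (rule bl_closed[OF S_hom[OF j] p(2)])
    ultimately show "enf (%h. (%(h, g, x). rr j (g + h) x) (h, p)) = (%(g, x). ev (at_idx Y (oj j)) g (r (S j x))) p"
      using r(2)[of "S j x" g] shift_enf[OF o(1) o(3)[OF p(2)], of "- g"] by (simp add: p)
  qed
  thus "\<exists>z. (case z of (i, r, j', f', m, f, n, s) => (((), i), r) \<in> \<rho> j \<and> (j', f') \<in> \<theta>' i \<and> (m, f) \<in> \<theta>' j \<and> (((), n), s) \<in> rho MY m) \<and>
      (case z of (i, r, j', f', m, f, n, s) => geq Y (UNIV \<times> cX j) j' (%(g, x). f' (ev (at_idx X i) g (r x)))
          n (%(g, x). ev (at_idx Y n) g (s (f x))))"
    using r(1) \<theta>'_mem[OF j] \<theta>'_mem[OF Lj] LR[OF j]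
    by (intro exI[of _ "(L j, R j, oj (L j), S (L j), oj j, S j, oj j, r)"]) simp
qed

lemma ess_surj: "is_iso (comodule_cat v c Bg) (fst MY, rho MY) (X, \<rho>) \<theta>"
  unfolding is_iso_def comodule_cat_def cat.simps
  using \<theta>_comodule \<theta>'_comodule \<theta>\<theta>' \<theta>'\<theta> by (auto simp: MY_fst)

end

section \<open>The equivalence of categories\<close>

context universe
begin

lemma categories_equivalent:
  "equivalent_categories
    (gmod_iso_cat v c :: (('k, 'g, 'u) gmod, 'u => ('u \<times> ('u => 'u)) set) cat)
    (comodule_cat v c Bg :: (('k, 'g => 'k, 'u) comodule, 'u => ('u \<times> ('u => 'u)) set) cat)"
proof (rule equivalent_categoriesI[where F="%M. (fst M, rho M)", OF gmod_category comodule_category])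
  fix d :: "('k, 'g => 'k, 'u) comodule"
  assume "d \<in> Ob (comodule_cat v c Bg)"
  hence "is_comodule v c Bg (fst d, snd d)" by (simp add: comodule_cat_def)
  then interpret comod v c G enk en "fst d" "snd d" by unfold_locales
  show "\<exists>a\<in>Ob (gmod_iso_cat v c). \<exists>e. is_iso (comodule_cat v c Bg) (fst a, rho a) d e"
    by (intro bexI[of _ MY] exI) (use MY ess_surj in \<open>simp_all add: gmod_iso_cat_def\<close>)
qed (simp_all add: gmod_iso_cat_def comodule_cat_def rho_comodule gmod_hom_eq)

end

text \<open>The universe conditions are met, for instance, by the power set of any set at least as
  large as k and \<nat> \<times> G, since (2^m)^n = 2^(m n) = 2^m for cardinals n \<le> m with n
  nonzero and m infinite.\<close>

theorem corollary4p23: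
  fixes v :: "'k::field \<Rightarrow> real" and c :: convention
  assumes k: "complete_valued_field v"
    and conv: "c = Strong \<Longrightarrow> nonarchimedean v"
    and G: "compact (UNIV :: 'g::topological_group_add set)"
    and universe: "(UNIV :: 'k set) \<lesssim> (UNIV :: 'u set)"
      "(UNIV :: (nat \<times> 'g \<Rightarrow> 'u) set) \<lesssim> (UNIV :: 'u set)"
    and usual: "c = Usual \<Longrightarrow> \<forall>V :: ('k, 'u) nspace. banach_space v c V \<longrightarrow>
      ban_iso (tensor c (Cblu (base_field v)) V) (Cblu V :: ('k, 'g \<Rightarrow> 'u) nspace) (can v c V)"
  shows "let C = (Cblu (base_field v) :: ('k, 'g \<Rightarrow> 'k) nspace);
             B = (group_bialg v c :: ('k, 'g \<Rightarrow> 'k) bialg)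
         in ban_iso (tensor c C C) (Cblu C :: ('k, 'g \<Rightarrow> 'g \<Rightarrow> 'k) nspace) (can v c C) \<and>
            is_bialgebra v c B \<and>
            equivalent_categories
              (gmod_iso_cat v c :: (('k, 'g, 'u) gmod, 'u \<Rightarrow> ('u \<times> ('u \<Rightarrow> 'u)) set) cat)
              (comodule_cat v c B :: (('k, 'g \<Rightarrow> 'k, 'u) comodule, 'u \<Rightarrow> ('u \<times> ('u \<Rightarrow> 'u)) set) cat)"
proof -
  obtain enk :: "'k => 'u" and en :: "(nat \<times> 'g => 'u) => 'u" where "inj enk" "inj en"
    using universe unfolding lepoll_def by blast
  then interpret universe v c "TYPE('g)" enk en
    by unfold_locales (use k conv G usual in auto)
  show ?thesis
    unfolding Let_def using can_iso[OF small_C] group_bialgebra categories_equivalent by blast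
qed

end
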